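(* Let $(f,G)$ be the Landau-Ginzburg orbifold described in the context: $f=f_{\kappa_0}+f_{add}+x_{N+1}^2$, with $\kappa_0$ a loop with branches map having the leaf $1$ with $\kappa_0(1)=2$ and even exponent $2a_1$, and $G=\langle g\rangle\cong\mathbb{Z}/2\mathbb{Z}$, with $g$ changing the signs of $x_1$ and $x_{N+1}$. Then there is a non-degenerate quasihomogeneous polynomial $\bar f\in\mathbb{C}[x_1,\dots,x_{N+1}]$ with the following properties: (1) $\bar f$ has the reduced system of weights $(2q_1,q_2,\dots,q_N,\tfrac12-q_1)$; (2) $\bar f=f_{\bar\kappa}+\bar f_{add}$, where $f_{\bar\kappa}=\sum_{j=1}^{N+1}x_j^{\bar a_j}x_{\bar\kappa(j)}$ for some positive integers $\bar a_j$, the graph of $\bar\kappa$ is $\Gamma_{\bar\kappa}=\circ_{\Gamma_\kappa}(N+1,1)$, and $\bar f_{add}=f_{add}(t_1,\dots,t_N)$ with $t_1^2=x_1$ and $t_m=x_m$ for $m\ne1$ (that is, $\bar f_{add}$ is obtained from $f_{add}$, which is even in $x_1$, by replacing $x_1^2$ by $x_1$); and such that $(f,G)$ and $(\bar f,\{\mathrm{id}\})$ are orbifold equivalent. In particular, there is an equivalence of categories $\mathrm{MF}(\bar f)\cong\mathrm{MF}_G(f)$.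
   Context: A polynomial is non-degenerate if the common zero set of its partial derivatives is exactly $\{0\}$. It is quasihomogeneous with reduced system of weights $(q_1,\dots,q_n)$, $q_i\in\mathbb{Q}$, if every monomial $x^\alpha$ occurring in it satisfies $\sum_i\alpha_iq_i=1$. Graphs. For a map $\kappa$ of a finite set to itself, $\Gamma_\kappa$ is the oriented graph on that set with an arrow $j\to\kappa(j)$ whenever $\kappa(j)\ne j$. It is a loop with branches graph if it is connected and consists of one globally oriented cycle (the loop, possibly of length 1, i.e. a fixed point of $\kappa$) and finitely many pairwise disjoint oriented chains, each ending by an arrow into a loop vertex. A leaf is a vertex at the (outer) end of a branch, i.e. a vertex off the loop with no incoming arrow. If $N+1$ is an isolated vertex of $\Gamma_\kappa$ and $t$ is a leaf, $\circ_{\Gamma_\kappa}(N+1,t)$ is the graph obtained from $\Gamma_\kappa$ by adding an arrow $N+1\to t$. Setup. Let $I=\{1,\dots,N\}$ and $\kappa_0:I\to I$ with $\Gamma_{\kappa_0}$ a loop with branches graph, $L\subset I$ the set of its loop vertices. Assume $1$ is a leaf and $\kappa_0(1)=2$. Let $a_1\ge1$ and $a_j\ge2$ ($2\le j\le N$) be integers and $f_{\kappa_0}=x_1^{2a_1}x_2+\sum_{j=2}^Nx_j^{a_j}x_{\kappa_0(j)}$. Let $(q_1,\dots,q_N)$ be its reduced weights: $2a_1q_1+q_2=1$ and $a_jq_j+q_{\kappa_0(j)}=1$ for $j\ge2$. For $m\in L$ let $S_m$ be the set of vertices with an arrow ending in $m$, and let $A=\bigcup_{m\in L}\{J\subseteq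 S_m:|J|\ge2\}$. For each $J\in A$ let positive integers $b_{J,s}$ ($s\in J$) with $\sum_{s\in J}b_{J,s}q_s=1$ be given, and let $\varepsilon_J\in\mathbb{C}^*$ be such that, with $f_{add}=\sum_{J\in A}\varepsilon_J\prod_{s\in J}x_s^{b_{J,s}}$, the polynomial $f_0=f_{\kappa_0}+f_{add}$ is non-degenerate. Put $f_\kappa=f_{\kappa_0}+x_{N+1}^2$; its graph $\Gamma_\kappa$ is the disjoint union of $\Gamma_{\kappa_0}$ and the isolated vertex $N+1$. Put $f=f_\kappa+f_{add}=f_0+x_{N+1}^2$. Let $g$ act on $\mathbb{C}^{N+1}$ by $x_m\mapsto-x_m$ for $m\in\{1,N+1\}$ and $x_m\mapsto x_m$ otherwise, and $G=\langle g\rangle$. It is assumed that $G$ is a group of symmetries of $f$, i.e. $f(g\cdot x)=f(x)$; equivalently $b_{J,1}$ is even whenever $1\in J$. Categories. $\mathrm{MF}_G(f)$ is the (homotopy) category of $\mathbb{Z}/2$-graded $G$-equivariant matrix factorizations of $f$ over the polynomial ring, and $\mathrm{MF}(f)=\mathrm{MF}_{\{\mathrm{id}\}}(f)$. Orbifold equivalence of $(f,G)$ and $(\bar f,\{\mathrm{id}\})$ is understood as the existence of an equivalence of categories $\mathrm{MF}(\bar f)\cong\mathrm{MF}_G(f)$. *)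

theory Defs
  imports Complex_Main "HOL-Library.Poly_Mapping" "HOL-Library.FuncSet"
    "Jordan_Normal_Form.Matrix" "Graph_Theory.Graph_Theory"
begin

section \<open>Polynomials\<close>

text \<open>
  Polynomials with complex coefficients in variables indexed by natural numbers: finitely supported
  maps from exponent vectors to coefficients, with the convolution product of
  \<^theory>\<open>HOL-Library.Poly_Mapping\<close>. The ring \<open>\<complex>[x\<^sub>i | i \<in> V]\<close> is the subset \<open>poly_ring V\<close>, and
  the point set \<open>\<complex>\<^sup>V\<close> is represented by the functions vanishing outside \<open>V\<close>.
\<close>

type_synonym mpoly = "(nat \<Rightarrow>\<^sub>0 nat) \<Rightarrow>\<^sub>0 complex"

abbreviation const :: "complex \<Rightarrow> mpoly" where
  "const c \<equiv> Poly_Mapping.single 0 c"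

definition var :: "nat \<Rightarrow> mpoly" where
  "var i = Poly_Mapping.single (Poly_Mapping.single i 1) 1"

definition poly_ring :: "nat set \<Rightarrow> mpoly set" where
  "poly_ring V = {p. \<forall>m\<in>Poly_Mapping.keys p. Poly_Mapping.keys m \<subseteq> V}"

definition poly_hom :: "(complex \<Rightarrow> 'a) \<Rightarrow> (nat \<Rightarrow> 'a) \<Rightarrow> mpoly \<Rightarrow> 'a::comm_semiring_1" where
  "poly_hom c x p = (\<Sum>m\<in>Poly_Mapping.keys p. c (Poly_Mapping.lookup p m) *
     (\<Prod>i\<in>Poly_Mapping.keys m. x i ^ Poly_Mapping.lookup m i))"

definition poly_eval :: "(nat \<Rightarrow> complex) \<Rightarrow> mpoly \<Rightarrow> complex" where
  "poly_eval x p = poly_hom (\<lambda>c. c) x p"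

definition poly_subst :: "(nat \<Rightarrow> mpoly) \<Rightarrow> mpoly \<Rightarrow> mpoly" where
  "poly_subst s p = poly_hom const s p"

text \<open>
  In the derivative, the truncated subtraction of exponents is harmless: if the exponent of the
  variable is \<open>0\<close>, then so is the coefficient.
\<close>

definition partial_deriv :: "nat \<Rightarrow> mpoly \<Rightarrow> mpoly" where
  "partial_deriv i p = (\<Sum>m\<in>Poly_Mapping.keys p. Poly_Mapping.single (m - Poly_Mapping.single i 1)
     (of_nat (Poly_Mapping.lookup m i) * Poly_Mapping.lookup p m))"

definition nondegenerate :: "nat set \<Rightarrow> mpoly \<Rightarrow> bool" where
  "nondegenerate V p \<longleftrightarrow>
     {x. (\<forall>i. i \<notin> V \<longrightarrow> x i = 0) \<and> (\<forall>i\<in>V. poly_eval x (partial_deriv i p) = 0)} = {\<lambda>i. 0}"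

definition quasihomogeneous :: "nat set \<Rightarrow> (nat \<Rightarrow> rat) \<Rightarrow> mpoly \<Rightarrow> bool" where
  "quasihomogeneous V q p \<longleftrightarrow> p \<in> poly_ring V \<and>
     (\<forall>m\<in>Poly_Mapping.keys p. (\<Sum>i\<in>V. of_nat (Poly_Mapping.lookup m i) * q i) = 1)"


section \<open>Graphs of self-maps\<close>

definition map_graph :: "nat set \<Rightarrow> (nat \<Rightarrow> nat) \<Rightarrow> nat pair_pre_digraph" where
  "map_graph V k = \<lparr>pverts = V, parcs = {(j, k j) | j. j \<in> V \<and> k j \<noteq> j}\<rparr>"

text \<open>The vertices on oriented cycles; a fixed point counts as a cycle of length one, although it
  contributes no arrow to the graph.\<close>

definition loop_vertices :: "nat set \<Rightarrow> (nat \<Rightarrow> nat) \<Rightarrow> nat set" where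
  "loop_vertices V k = {v \<in> V. \<exists>n>0. (k ^^ n) v = v}"

definition is_cycle :: "(nat \<Rightarrow> nat) \<Rightarrow> nat list \<Rightarrow> bool" where
  "is_cycle k c \<longleftrightarrow> c \<noteq> [] \<and> distinct c \<and>
     (\<forall>i<length c. k (c ! i) = c ! (Suc i mod length c))"

text \<open>A branch is listed from its outer end to the vertex attached to the loop.\<close>

definition is_branch :: "nat pair_pre_digraph \<Rightarrow> nat set \<Rightarrow> nat list \<Rightarrow> bool" where
  "is_branch Gr L ch \<longleftrightarrow> ch \<noteq> [] \<and> distinct ch \<and> set ch \<subseteq> pverts Gr - L \<and>
     (\<forall>i. Suc i < length ch \<longrightarrow> (ch ! i, ch ! Suc i) \<in> parcs Gr) \<and>
     (\<exists>m\<in>L. (last ch, m) \<in> parcs Gr)"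

definition loop_with_branches :: "nat set \<Rightarrow> (nat \<Rightarrow> nat) \<Rightarrow> bool" where
  "loop_with_branches V k \<longleftrightarrow> finite V \<and> k \<in> V \<rightarrow> V \<and> connected (with_proj (map_graph V k)) \<and>
     (\<exists>c. is_cycle k c \<and> set c = loop_vertices V k) \<and>
     (\<exists>B. finite B \<and> (\<forall>ch\<in>B. is_branch (map_graph V k) (loop_vertices V k) ch) \<and>
        (\<forall>ch\<in>B. \<forall>ch'\<in>B. ch \<noteq> ch' \<longrightarrow> set ch \<inter> set ch' = {}) \<and>
        V = loop_vertices V k \<union> (\<Union>ch\<in>B. set ch))"

definition in_nbrs :: "nat pair_pre_digraph \<Rightarrow> nat \<Rightarrow> nat set" where
  "in_nbrs Gr m = {j. (j, m) \<in> parcs Gr}"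

definition is_leaf :: "nat set \<Rightarrow> (nat \<Rightarrow> nat) \<Rightarrow> nat \<Rightarrow> bool" where
  "is_leaf V k t \<longleftrightarrow> t \<in> V - loop_vertices V k \<and> in_nbrs (map_graph V k) t = {}"

definition add_arrow :: "nat pair_pre_digraph \<Rightarrow> nat \<Rightarrow> nat \<Rightarrow> nat pair_pre_digraph" where
  "add_arrow Gr s t = Gr\<lparr>parcs := insert (s, t) (parcs Gr)\<rparr>"


section \<open>Equivalence of categories\<close>

text \<open>\<open>Cmp C X Y Z v u\<close> is the composite \<open>v \<circ> u\<close> of \<open>u : X \<rightarrow> Y\<close> and \<open>v : Y \<rightarrow> Z\<close>.\<close>

record ('o, 'm) cat =
  Obj :: "'o set"
  Hom :: "'o \<Rightarrow> 'o \<Rightarrow> 'm set"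
  Ide :: "'o \<Rightarrow> 'm"
  Cmp :: "'o \<Rightarrow> 'o \<Rightarrow> 'o \<Rightarrow> 'm \<Rightarrow> 'm \<Rightarrow> 'm"

definition is_category :: "('o, 'm) cat \<Rightarrow> bool" where
  "is_category C \<longleftrightarrow>
     (\<forall>X\<in>Obj C. Ide C X \<in> Hom C X X) \<and>
     (\<forall>X\<in>Obj C. \<forall>Y\<in>Obj C. \<forall>Z\<in>Obj C. \<forall>u\<in>Hom C X Y. \<forall>v\<in>Hom C Y Z.
        Cmp C X Y Z v u \<in> Hom C X Z) \<and>
     (\<forall>X\<in>Obj C. \<forall>Y\<in>Obj C. \<forall>u\<in>Hom C X Y.
        Cmp C X X Y u (Ide C X) = u \<and> Cmp C X Y Y (Ide C Y) u = u) \<and>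
     (\<forall>W\<in>Obj C. \<forall>X\<in>Obj C. \<forall>Y\<in>Obj C. \<forall>Z\<in>Obj C.
        \<forall>u\<in>Hom C W X. \<forall>v\<in>Hom C X Y. \<forall>w\<in>Hom C Y Z.
        Cmp C W Y Z w (Cmp C W X Y v u) = Cmp C W X Z (Cmp C X Y Z w v) u)"

definition is_functor ::
  "('o, 'm) cat \<Rightarrow> ('p, 'n) cat \<Rightarrow> ('o \<Rightarrow> 'p) \<Rightarrow> ('o \<Rightarrow> 'o \<Rightarrow> 'm \<Rightarrow> 'n) \<Rightarrow> bool" where
  "is_functor C D F F' \<longleftrightarrow>
     (\<forall>X\<in>Obj C. F X \<in> Obj D) \<and>
     (\<forall>X\<in>Obj C. \<forall>Y\<in>Obj C. \<forall>u\<in>Hom C X Y. F' X Y u \<in> Hom D (F X) (F Y)) \<and>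
     (\<forall>X\<in>Obj C. F' X X (Ide C X) = Ide D (F X)) \<and>
     (\<forall>X\<in>Obj C. \<forall>Y\<in>Obj C. \<forall>Z\<in>Obj C. \<forall>u\<in>Hom C X Y. \<forall>v\<in>Hom C Y Z.
        F' X Z (Cmp C X Y Z v u) = Cmp D (F X) (F Y) (F Z) (F' Y Z v) (F' X Y u))"

definition is_iso :: "('o, 'm) cat \<Rightarrow> 'o \<Rightarrow> 'o \<Rightarrow> 'm \<Rightarrow> bool" where
  "is_iso C X Y u \<longleftrightarrow> u \<in> Hom C X Y \<and>
     (\<exists>v\<in>Hom C Y X. Cmp C X Y X v u = Ide C X \<and> Cmp C Y X Y u v = Ide C Y)"

definition naturally_isomorphic ::
  "('o, 'm) cat \<Rightarrow> ('p, 'n) cat \<Rightarrow> ('o \<Rightarrow> 'p) \<Rightarrow> ('o \<Rightarrow> 'o \<Rightarrow> 'm \<Rightarrow> 'n) \<Rightarrow>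
    ('o \<Rightarrow> 'p) \<Rightarrow> ('o \<Rightarrow> 'o \<Rightarrow> 'm \<Rightarrow> 'n) \<Rightarrow> bool" where
  "naturally_isomorphic C D F F' H H' \<longleftrightarrow>
     (\<exists>t. (\<forall>X\<in>Obj C. is_iso D (F X) (H X) (t X)) \<and>
        (\<forall>X\<in>Obj C. \<forall>Y\<in>Obj C. \<forall>u\<in>Hom C X Y.
           Cmp D (F X) (F Y) (H Y) (t Y) (F' X Y u) = Cmp D (F X) (H X) (H Y) (H' X Y u) (t X)))"

definition equivalent_categories :: "('o, 'm) cat \<Rightarrow> ('p, 'n) cat \<Rightarrow> bool" where
  "equivalent_categories C D \<longleftrightarrow> is_category C \<and> is_category D \<and>
     (\<exists>F F' H H'. is_functor C D F F' \<and> is_functor D C H H' \<and>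
        naturally_isomorphic C C (\<lambda>X. X) (\<lambda>X Y u. u)
          (\<lambda>X. H (F X)) (\<lambda>X Y u. H' (F X) (F Y) (F' X Y u)) \<and>
        naturally_isomorphic D D (\<lambda>X. F (H X)) (\<lambda>X Y u. F' (H X) (H Y) (H' X Y u))
          (\<lambda>X. X) (\<lambda>X Y u. u))"


section \<open>Diagonal symmetries\<close>

text \<open>
  A diagonal linear map \<open>x\<^sub>i \<mapsto> g\<^sub>i x\<^sub>i\<close> is given by its diagonal entries; the group operation is
  pointwise multiplication. Diagonal maps commute, so substitution of \<open>g\<close> is a left action on
  polynomials.
\<close>

definition diag_act :: "(nat \<Rightarrow> complex) \<Rightarrow> mpoly \<Rightarrow> mpoly" where
  "diag_act g p = poly_subst (\<lambda>i. const (g i) * var i) p"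

definition cyclic_group :: "(nat \<Rightarrow> complex) \<Rightarrow> (nat \<Rightarrow> complex) set" where
  "cyclic_group g = {(\<lambda>i. g i powi n) | n. True}"

abbreviation trivial_group :: "(nat \<Rightarrow> complex) set" where
  "trivial_group \<equiv> {\<lambda>i. 1}"

definition symmetry_group :: "(nat \<Rightarrow> complex) set \<Rightarrow> mpoly \<Rightarrow> bool" where
  "symmetry_group G f \<longleftrightarrow> (\<forall>g\<in>G. diag_act g f = f)"


section \<open>Equivariant matrix factorizations\<close>

definition poly_mats :: "nat set \<Rightarrow> nat \<Rightarrow> nat \<Rightarrow> mpoly mat set" where
  "poly_mats V r s = {A \<in> carrier_mat r s. elements_mat A \<subseteq> poly_ring V}"

text \<open>
  Let \<open>S = poly_ring V\<close>. An action of \<open>G\<close> on the free module \<open>S\<^sup>r\<close> compatible with the action on \<open>S\<close>,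
  that is \<open>g \<cdot> (p v) = (g \<cdot> p) (g \<cdot> v)\<close>, is determined by the matrices \<open>\<rho> g\<close> whose columns are the
  images of the standard basis: \<open>g \<cdot> v = \<rho> g *\<^sub>v map_vec (diag_act g) v\<close>. Being an action amounts to
  the cocycle condition below.
\<close>

definition equivariant_structure ::
  "nat set \<Rightarrow> (nat \<Rightarrow> complex) set \<Rightarrow> nat \<Rightarrow> ((nat \<Rightarrow> complex) \<Rightarrow> mpoly mat) \<Rightarrow> bool" where
  "equivariant_structure V G r \<rho> \<longleftrightarrow> \<rho> \<in> G \<rightarrow>\<^sub>E poly_mats V r r \<and> \<rho> (\<lambda>i. 1) = 1\<^sub>m r \<and>
     (\<forall>g\<in>G. \<forall>h\<in>G. \<rho> (\<lambda>i. g i * h i) = \<rho> g * map_mat (diag_act g) (\<rho> h))"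

text \<open>\<open>A\<close> commutes with the actions given by \<open>\<rho>\<close> on its source and \<open>\<sigma>\<close> on its target.\<close>

definition equivariant_mat ::
  "(nat \<Rightarrow> complex) set \<Rightarrow> ((nat \<Rightarrow> complex) \<Rightarrow> mpoly mat) \<Rightarrow> ((nat \<Rightarrow> complex) \<Rightarrow> mpoly mat) \<Rightarrow>
    mpoly mat \<Rightarrow> bool" where
  "equivariant_mat G \<rho> \<sigma> A \<longleftrightarrow> (\<forall>g\<in>G. A * \<rho> g = \<sigma> g * map_mat (diag_act g) A)"

text \<open>
  The free modules in even and odd degree, of ranks \<open>rk0\<close> and \<open>rk1\<close>, with their \<open>G\<close>-actions, and the
  two components of the odd differential: \<open>dif0\<close> from even to odd, \<open>dif1\<close> from odd to even.
\<close>

record matrix_fact =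
  rk0 :: nat
  rk1 :: nat
  act0 :: "(nat \<Rightarrow> complex) \<Rightarrow> mpoly mat"
  act1 :: "(nat \<Rightarrow> complex) \<Rightarrow> mpoly mat"
  dif0 :: "mpoly mat"
  dif1 :: "mpoly mat"

definition equiv_maps ::
  "nat set \<Rightarrow> (nat \<Rightarrow> complex) set \<Rightarrow> nat \<Rightarrow> ((nat \<Rightarrow> complex) \<Rightarrow> mpoly mat) \<Rightarrow>
    nat \<Rightarrow> ((nat \<Rightarrow> complex) \<Rightarrow> mpoly mat) \<Rightarrow> mpoly mat set" where
  "equiv_maps V G r \<rho> s \<sigma> = {A \<in> poly_mats V s r. equivariant_mat G \<rho> \<sigma> A}"

definition mf_objects :: "nat set \<Rightarrow> (nat \<Rightarrow> complex) set \<Rightarrow> mpoly \<Rightarrow> matrix_fact set" where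
  "mf_objects V G f = {E.
     equivariant_structure V G (rk0 E) (act0 E) \<and>
     equivariant_structure V G (rk1 E) (act1 E) \<and>
     dif0 E \<in> equiv_maps V G (rk0 E) (act0 E) (rk1 E) (act1 E) \<and>
     dif1 E \<in> equiv_maps V G (rk1 E) (act1 E) (rk0 E) (act0 E) \<and>
     dif1 E * dif0 E = f \<cdot>\<^sub>m 1\<^sub>m (rk0 E) \<and>
     dif0 E * dif1 E = f \<cdot>\<^sub>m 1\<^sub>m (rk1 E)}"

definition mf_maps ::
  "nat set \<Rightarrow> (nat \<Rightarrow> complex) set \<Rightarrow> matrix_fact \<Rightarrow> matrix_fact \<Rightarrow> (mpoly mat \<times> mpoly mat) set" where
  "mf_maps V G E E' = {(a0, a1).
     a0 \<in> equiv_maps V G (rk0 E) (act0 E) (rk0 E') (act0 E') \<and>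
     a1 \<in> equiv_maps V G (rk1 E) (act1 E) (rk1 E') (act1 E') \<and>
     a1 * dif0 E = dif0 E' * a0 \<and> a0 * dif1 E = dif1 E' * a1}"

definition mf_homotopy ::
  "nat set \<Rightarrow> (nat \<Rightarrow> complex) set \<Rightarrow> matrix_fact \<Rightarrow> matrix_fact \<Rightarrow> (mpoly mat \<times> mpoly mat) rel" where
  "mf_homotopy V G E E' = {((a0, a1), (b0, b1)).
     (a0, a1) \<in> mf_maps V G E E' \<and> (b0, b1) \<in> mf_maps V G E E' \<and>
     (\<exists>h0 \<in> equiv_maps V G (rk0 E) (act0 E) (rk1 E') (act1 E').
      \<exists>h1 \<in> equiv_maps V G (rk1 E) (act1 E) (rk0 E') (act0 E').
        a0 = b0 + (dif1 E' * h0 + h1 * dif0 E) \<and>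
        a1 = b1 + (dif0 E' * h1 + h0 * dif1 E))}"

definition MF_equiv ::
  "nat set \<Rightarrow> (nat \<Rightarrow> complex) set \<Rightarrow> mpoly \<Rightarrow> (matrix_fact, (mpoly mat \<times> mpoly mat) set) cat" where
  "MF_equiv V G f = \<lparr>
     Obj = mf_objects V G f,
     Hom = (\<lambda>E E'. mf_maps V G E E' // mf_homotopy V G E E'),
     Ide = (\<lambda>E. mf_homotopy V G E E `` {(1\<^sub>m (rk0 E), 1\<^sub>m (rk1 E))}),
     Cmp = (\<lambda>E E' E'' v u.
       \<Union>(b0, b1)\<in>v. \<Union>(a0, a1)\<in>u. mf_homotopy V G E E'' `` {(b0 * a0, b1 * a1)})\<rparr>"

abbreviation MF :: "nat set \<Rightarrow> mpoly \<Rightarrow> (matrix_fact, (mpoly mat \<times> mpoly mat) set) cat" where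
  "MF V f \<equiv> MF_equiv V trivial_group f"

definition orbifold_equivalent ::
  "nat set \<Rightarrow> mpoly \<Rightarrow> (nat \<Rightarrow> complex) set \<Rightarrow> mpoly \<Rightarrow> bool" where
  "orbifold_equivalent V f G fbar \<longleftrightarrow> equivalent_categories (MF V fbar) (MF_equiv V G f)"

end

theory Submission
  imports Defs
begin

text \<open>
  Write \<open>f = h(x\<^sub>1\<^sup>2, x\<^sub>2, \<dots>, x\<^sub>N) + z\<^sup>2\<close>, where \<open>h(x\<^sub>1\<^sup>2, x\<^sub>2, \<dots>) = f\<^sub>0\<close>. The polynomial in question is
  \<open>h(y, x\<^sub>2, \<dots>, x\<^sub>N) + y t\<^sup>2\<close>, and the equivalence is an instance of the crepant resolution of the surface
  singularity \<open>\<complex>\<^sup>2 / \<plusminus>1\<close>. In the ring of polynomials in \<open>u, y, x\<^sub>2, \<dots>, x\<^sub>N, t\<close> let \<open>u\<close>, \<open>y\<close>, \<open>t\<close> have the degrees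
  \<open>1\<close>, \<open>- 2\<close>, \<open>1\<close> and all other variables the degree \<open>0\<close>. The polynomial \<open>F = h(y u\<^sup>2, x\<^sub>2, \<dots>, x\<^sub>N) + y t\<^sup>2\<close> is
  homogeneous of degree \<open>0\<close>. Setting \<open>y = 1\<close> gives \<open>f\<close> in the variables \<open>u, x\<^sub>2, \<dots>, x\<^sub>N, t\<close>, and the degree modulo \<open>2\<close> is
  the action of \<open>g\<close>: this chart is the quotient stack. Setting \<open>u = 1\<close> gives the other polynomial: this is a chart of the
  resolution, which contains all critical points.

  Both categories are compared with the graded matrix factorizations of \<open>F\<close> whose generators have weights \<open>0\<close> and
  \<open>1\<close>. They correspond to the two line bundles that generate the derived category of the resolution.

  In each chart, every factorization comes from a graded one. Its cokernel is the restriction of a graded module, which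
  has a finite free resolution by Hilbert's syzygy theorem (\<open>resolvable_finite\<close>), and a resolution of the cokernel
  can be folded to a factorization (\<open>heq_of_resolution\<close>, \<open>graded_model\<close>). It remains to bring the weights to \<open>0\<close> and \<open>1\<close>.
  For \<open>y = 1\<close> only their parity matters (\<open>y_small\<close>). For \<open>u = 1\<close> the highest weight is lowered step by step with the
  Koszul complex of \<open>u\<close> and \<open>t\<close>, as in Beilinson's theorem (\<open>reduce_top\<close>).

  For such factorizations, maps and homotopies in the charts are graded ones. For \<open>y = 1\<close> this holds for single matrices,
  because only the degrees \<open>- 1\<close>, \<open>0\<close>, \<open>1\<close> occur (\<open>y_lift\<close>). For \<open>u = 1\<close> a map lifts to some positive degree, and the degree is
  lowered up to homotopy: modulo \<open>u\<close>, the derivative of the differential with respect to \<open>y\<close> is a homotopy for the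
  multiplication by \<open>\<partial>F/\<partial>y = t\<^sup>2\<close> (\<open>descend_half\<close>, \<open>chart_full\<close>, \<open>chart_faithful\<close>). Together this yields the
  equivalence (\<open>charts_equivalent\<close>); the remaining properties are elementary (\<open>nondegenerate_fbar\<close>, \<open>halve\<close>).
\<close>

section \<open>Polynomials by monomials\<close>

type_synonym monom = "nat \<Rightarrow>\<^sub>0 nat"

abbreviation look :: "('a \<Rightarrow>\<^sub>0 'b::zero) \<Rightarrow> 'a \<Rightarrow> 'b" where "look \<equiv> Poly_Mapping.lookup"
abbreviation mon :: "'a \<Rightarrow> 'b::zero \<Rightarrow> 'a \<Rightarrow>\<^sub>0 'b" where "mon \<equiv> Poly_Mapping.single"
abbreviation supp :: "('a \<Rightarrow>\<^sub>0 'b::zero) \<Rightarrow> 'a set" where "supp \<equiv> Poly_Mapping.keys"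

definition span_of :: "monom set \<Rightarrow> mpoly set" where
  "span_of S = {p. supp p \<subseteq> S}"

lemma span_of_0 [simp]: "0 \<in> span_of S"
  by (simp add: span_of_def)

lemma span_of_add: "p \<in> span_of S \<Longrightarrow> q \<in> span_of S \<Longrightarrow> p + q \<in> span_of S"
  using Poly_Mapping.keys_add[of p q] by (auto simp: span_of_def)

lemma span_of_uminus [simp]: "- p \<in> span_of S \<longleftrightarrow> p \<in> span_of S"
  by (simp add: span_of_def)

lemma span_of_diff: "p \<in> span_of S \<Longrightarrow> q \<in> span_of S \<Longrightarrow> p - q \<in> span_of S"
  using span_of_add[of p S "- q"] by simp

lemma span_of_sum: "(\<And>i. i \<in> A \<Longrightarrow> p i \<in> span_of S) \<Longrightarrow> sum p A \<in> span_of S"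
  by (induction A rule: infinite_finite_induct) (auto intro: span_of_add)

lemma span_of_mon: "c = 0 \<or> m \<in> S \<Longrightarrow> mon m c \<in> span_of S"
  by (auto simp: span_of_def)

lemma span_of_mult:
  assumes "p \<in> span_of S" "q \<in> span_of T" "\<And>m n. m \<in> S \<Longrightarrow> n \<in> T \<Longrightarrow> m + n \<in> U"
  shows "p * q \<in> span_of U"
  using Poly_Mapping.keys_mult[of p q] assms by (fastforce simp: span_of_def)

lemma span_of_mono: "p \<in> span_of S \<Longrightarrow> S \<subseteq> T \<Longrightarrow> p \<in> span_of T"
  by (auto simp: span_of_def)

lemma mpoly_eq_sum_mon: "p = (\<Sum>m\<in>supp p. mon m (look p m))" for p :: mpoly
  by (rule poly_mapping_eqI)
     (auto simp: lookup_sum lookup_single when_def in_keys_iff sum.delta')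

lemma span_of_induct [consumes 1, case_names zero mon add]:
  assumes "p \<in> span_of S"
    and "P 0" "\<And>m c. m \<in> S \<Longrightarrow> P (mon m c)" "\<And>p q. P p \<Longrightarrow> P q \<Longrightarrow> P (p + q)"
  shows "P p"
proof -
  have "P (\<Sum>m\<in>A. mon m (look p m))" if "finite A" "A \<subseteq> S" for A
    using that by (induction A rule: finite_induct) (auto intro: assms(2-))
  then show ?thesis
    using assms(1) by (subst mpoly_eq_sum_mon) (auto simp: span_of_def)
qed

lemma mpoly_induct [case_names zero mon add]:
  assumes "P 0" "\<And>m c. P (mon m c)" "\<And>p q. P p \<Longrightarrow> P q \<Longrightarrow> P (p + q)"
  shows "P (p :: mpoly)"
  by (rule span_of_induct[of p UNIV]) (auto simp: span_of_def assms)

text \<open>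
  Substitutions of monomials, actions of diagonal groups, derivatives and coefficient extraction are all of this
  form, so that their injectivity and surjectivity become statements about exponent vectors.
\<close>

definition mono_op :: "(monom \<Rightarrow> monom) \<Rightarrow> (monom \<Rightarrow> complex) \<Rightarrow> mpoly \<Rightarrow> mpoly" where
  "mono_op \<mu> \<chi> p = (\<Sum>m\<in>supp p. mon (\<mu> m) (\<chi> m * look p m))"

lemma mono_op_superset:
  assumes "finite A" "supp p \<subseteq> A"
  shows "mono_op \<mu> \<chi> p = (\<Sum>m\<in>A. mon (\<mu> m) (\<chi> m * look p m))"
  unfolding mono_op_def using assms
  by (intro sum.mono_neutral_left) (auto simp: in_keys_iff)

lemma mono_op_0 [simp]: "mono_op \<mu> \<chi> 0 = 0"
  by (simp add: mono_op_def)

lemma mono_op_mon [simp]: "mono_op \<mu> \<chi> (mon m c) = mon (\<mu> m) (\<chi> m * c)"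
  by (subst mono_op_superset[of "{m}"]) auto

lemma mono_op_add: "mono_op \<mu> \<chi> (p + q) = mono_op \<mu> \<chi> p + mono_op \<mu> \<chi> q"
proof -
  let ?A = "supp p \<union> supp q"
  have *: "supp (p + q) \<subseteq> ?A" using Poly_Mapping.keys_add[of p q] by auto
  show ?thesis
    by (subst (1 2 3) mono_op_superset[of ?A])
       (use * in \<open>auto simp: lookup_add ring_distribs single_add sum.distrib\<close>)
qed

lemma mono_op_uminus: "mono_op \<mu> \<chi> (- p) = - mono_op \<mu> \<chi> p"
  by (metis add.right_inverse mono_op_0 mono_op_add minus_unique)

lemma mono_op_diff: "mono_op \<mu> \<chi> (p - q) = mono_op \<mu> \<chi> p - mono_op \<mu> \<chi> q"
  by (metis diff_conv_add_uminus mono_op_add mono_op_uminus)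

lemma mono_op_sum: "mono_op \<mu> \<chi> (sum p A) = (\<Sum>i\<in>A. mono_op \<mu> \<chi> (p i))"
  by (induction A rule: infinite_finite_induct) (auto simp: mono_op_add)

lemma mono_op_mult:
  assumes "\<And>m n. \<mu> (m + n) = \<mu> m + \<mu> n" "\<And>m n. \<chi> (m + n) = \<chi> m * \<chi> n"
  shows "mono_op \<mu> \<chi> (p * q) = mono_op \<mu> \<chi> p * mono_op \<mu> \<chi> q"
proof (induction p rule: mpoly_induct)
  case (mon m c)
  show ?case
    by (induction q rule: mpoly_induct)
       (auto simp: assms mult_single mono_op_add ring_distribs mult_ac)
qed (auto simp: mono_op_add ring_distribs)

lemma mono_op_span_of:
  assumes "p \<in> span_of S" "\<And>m. m \<in> S \<Longrightarrow> \<chi> m = 0 \<or> \<mu> m \<in> T"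
  shows "mono_op \<mu> \<chi> p \<in> span_of T"
  using assms(1)
proof (induction rule: span_of_induct)
  case (mon m c)
  then show ?case using assms(2)[of m] by (auto intro!: span_of_mon)
qed (auto simp: mono_op_add intro: span_of_add)

lemma lookup_mono_op:
  assumes "p \<in> span_of S" "inj_on \<mu> S" "m \<in> S"
  shows "look (mono_op \<mu> \<chi> p) (\<mu> m) = \<chi> m * look p m"
  using assms(1)
proof (induction rule: span_of_induct)
  case (mon n c)
  then show ?case using assms(2,3)
    by (auto simp: lookup_single when_def inj_on_def)
qed (auto simp: mono_op_add lookup_add ring_distribs)

lemma mono_op_inj:
  assumes "p \<in> span_of S" "inj_on \<mu> S" "\<And>m. m \<in> S \<Longrightarrow> \<chi> m \<noteq> 0" "mono_op \<mu> \<chi> p = 0"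
  shows "p = 0"
proof (rule poly_mapping_eqI)
  fix m show "look p m = look 0 m"
    using lookup_mono_op[OF assms(1,2), of m \<chi>] assms by (cases "m \<in> S") (auto simp: span_of_def in_keys_iff)
qed

lemma mono_op_surj:
  assumes "q \<in> span_of T" "\<And>n. n \<in> T \<Longrightarrow> \<exists>m\<in>S. \<mu> m = n \<and> \<chi> m \<noteq> 0"
  shows "\<exists>p\<in>span_of S. mono_op \<mu> \<chi> p = q"
  using assms(1)
proof (induction rule: span_of_induct)
  case zero
  then show ?case by (intro bexI[of _ 0]) auto
next
  case (mon n c)
  then obtain m where "m \<in> S" "\<mu> m = n" "\<chi> m \<noteq> 0" using assms(2) by blast
  then show ?case by (intro bexI[of _ "mon m (c / \<chi> m)"]) (auto intro!: span_of_mon)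
next
  case (add p q)
  then show ?case by (metis mono_op_add span_of_add)
qed

subsection \<open>Degrees\<close>

definition mdeg :: "(nat \<Rightarrow> int) \<Rightarrow> monom \<Rightarrow> int" where
  "mdeg \<delta> m = (\<Sum>i\<in>supp m. \<delta> i * int (look m i))"

lemma mdeg_superset:
  assumes "finite A" "supp m \<subseteq> A"
  shows "mdeg \<delta> m = (\<Sum>i\<in>A. \<delta> i * int (look m i))"
  unfolding mdeg_def using assms
  by (intro sum.mono_neutral_left) (auto simp: in_keys_iff)

lemma mdeg_add: "mdeg \<delta> (m + n) = mdeg \<delta> m + mdeg \<delta> n"
proof -
  let ?A = "supp m \<union> supp n"
  have *: "supp (m + n) \<subseteq> ?A" using Poly_Mapping.keys_add[of m n] by auto
  show ?thesis
    by (subst (1 2 3) mdeg_superset[of ?A])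
       (use * in \<open>auto simp: lookup_add ring_distribs sum.distrib\<close>)
qed

lemma mdeg_0 [simp]: "mdeg \<delta> 0 = 0" by (simp add: mdeg_def)

lemma mdeg_single [simp]: "mdeg \<delta> (mon i k) = \<delta> i * int k"
  by (subst mdeg_superset[of "{i}"]) auto

lemma keys_add_nat: "supp (m + n) = supp m \<union> supp n" for m n :: monom
  by (auto simp: in_keys_iff lookup_add)

definition mons :: "nat set \<Rightarrow> monom set" where
  "mons W = {m. supp m \<subseteq> W}"

definition hmons :: "(nat \<Rightarrow> int) \<Rightarrow> nat set \<Rightarrow> int \<Rightarrow> monom set" where
  "hmons \<delta> W e = {m. supp m \<subseteq> W \<and> mdeg \<delta> m = e}"

definition hmg :: "(nat \<Rightarrow> int) \<Rightarrow> nat set \<Rightarrow> int \<Rightarrow> mpoly set" where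
  "hmg \<delta> W e = span_of (hmons \<delta> W e)"

lemma poly_ring_eq: "poly_ring W = span_of (mons W)"
  by (auto simp: poly_ring_def span_of_def mons_def)

lemma hmg_mult: "p \<in> hmg \<delta> W e \<Longrightarrow> q \<in> hmg \<delta> W e' \<Longrightarrow> p * q \<in> hmg \<delta> W (e + e')"
  unfolding hmg_def by (erule span_of_mult) (auto simp: hmons_def mdeg_add keys_add_nat)

lemma hmg_mono: "p \<in> hmg \<delta> W e \<Longrightarrow> W \<subseteq> W' \<Longrightarrow> p \<in> hmg \<delta> W' e"
  unfolding hmg_def by (erule span_of_mono) (auto simp: hmons_def)

lemma hmg_add: "p \<in> hmg \<delta> W e \<Longrightarrow> q \<in> hmg \<delta> W e \<Longrightarrow> p + q \<in> hmg \<delta> W e"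
  unfolding hmg_def by (rule span_of_add)

lemma hmg_uminus [simp]: "- p \<in> hmg \<delta> W e \<longleftrightarrow> p \<in> hmg \<delta> W e"
  unfolding hmg_def by (rule span_of_uminus)

lemma hmg_0 [simp]: "0 \<in> hmg \<delta> W e" unfolding hmg_def by simp

lemma hmg_1 [simp]: "1 \<in> hmg \<delta> W 0"
  unfolding hmg_def single_one[symmetric] by (rule span_of_mon) (auto simp: hmons_def)

lemma hmg_const [simp]: "const c \<in> hmg \<delta> W 0"
  unfolding hmg_def by (rule span_of_mon) (auto simp: hmons_def)

lemma hmg_sum: "(\<And>i. i \<in> A \<Longrightarrow> p i \<in> hmg \<delta> W e) \<Longrightarrow> sum p A \<in> hmg \<delta> W e"
  unfolding hmg_def by (rule span_of_sum)

lemma var_power: "var i ^ k = mon (mon i k) 1"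
proof (induction k)
  case 0
  show ?case unfolding single_zero single_one by simp
next
  case (Suc k)
  then show ?case by (simp add: var_def mult_single single_add[symmetric])
qed

lemma hmg_var_power: "i \<in> W \<Longrightarrow> e = \<delta> i * int k \<Longrightarrow> var i ^ k \<in> hmg \<delta> W e"
  unfolding var_power hmg_def by (rule span_of_mon) (auto simp: hmons_def)

lemma hmg_var: "i \<in> W \<Longrightarrow> e = \<delta> i \<Longrightarrow> var i \<in> hmg \<delta> W e"
  using hmg_var_power[of i W e \<delta> 1] by simp

lemma hmg_empty: "p \<in> hmg \<delta> {} e \<Longrightarrow> \<exists>c. p = const c \<and> (c = 0 \<or> e = 0)"
  unfolding hmg_def
proof (induction rule: span_of_induct)
  case zero
  then show ?case by (intro exI[of _ 0]) auto
next
  case (mon m c)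
  then show ?case by (intro exI[of _ c]) (auto simp: hmons_def)
next
  case (add p q)
  then obtain c d where "p = const c \<and> (c = 0 \<or> e = 0)" "q = const d \<and> (d = 0 \<or> e = 0)" by blast
  then show ?case by (intro exI[of _ "c + d"]) (auto simp: single_add)
qed

lemma hmg_poly_ring: "p \<in> hmg \<delta> W e \<Longrightarrow> p \<in> poly_ring W"
  unfolding hmg_def poly_ring_eq by (erule span_of_mono) (auto simp: hmons_def mons_def)

lemma poly_ring_0 [simp]: "0 \<in> poly_ring V" by (simp add: poly_ring_eq)
lemma poly_ring_1 [simp]: "1 \<in> poly_ring V" using hmg_poly_ring[OF hmg_1] .
lemma poly_ring_const [simp]: "const c \<in> poly_ring V" using hmg_poly_ring[OF hmg_const] .
lemma poly_ring_add: "p \<in> poly_ring V \<Longrightarrow> q \<in> poly_ring V \<Longrightarrow> p + q \<in> poly_ring V"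
  unfolding poly_ring_eq by (rule span_of_add)
lemma poly_ring_uminus [simp]: "- p \<in> poly_ring V \<longleftrightarrow> p \<in> poly_ring V"
  unfolding poly_ring_eq by (rule span_of_uminus)
lemma poly_ring_mult: "p \<in> poly_ring V \<Longrightarrow> q \<in> poly_ring V \<Longrightarrow> p * q \<in> poly_ring V"
  unfolding poly_ring_eq by (erule span_of_mult) (auto simp: mons_def keys_add_nat)
lemma poly_ring_sum: "(\<And>i. i \<in> A \<Longrightarrow> p i \<in> poly_ring V) \<Longrightarrow> sum p A \<in> poly_ring V"
  unfolding poly_ring_eq by (rule span_of_sum)

subsection \<open>Coefficients with respect to one variable\<close>

definition coef :: "nat \<Rightarrow> nat \<Rightarrow> mpoly \<Rightarrow> mpoly" where
  "coef t k = mono_op (\<lambda>m. m - mon t k) (\<lambda>m. if look m t = k then 1 else 0)"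

lemma coef_0 [simp]: "coef t k 0 = 0" by (simp add: coef_def)
lemma coef_add: "coef t k (p + q) = coef t k p + coef t k q" by (simp add: coef_def mono_op_add)
lemma coef_diff: "coef t k (p - q) = coef t k p - coef t k q" by (simp add: coef_def mono_op_diff)
lemma coef_sum: "coef t k (sum p A) = (\<Sum>i\<in>A. coef t k (p i))" by (simp add: coef_def mono_op_sum)

lemma coef_hmg:
  assumes "p \<in> hmg \<delta> (insert t W) e" "t \<notin> W"
  shows "coef t k p \<in> hmg \<delta> W (e - \<delta> t * int k)"
  using assms(1) unfolding coef_def hmg_def
proof (rule mono_op_span_of)
  fix m assume m: "m \<in> hmons \<delta> (insert t W) e"
  show "(if look m t = k then 1 else 0) = (0::complex) \<or> m - mon t k \<in> hmons \<delta> W (e - \<delta> t * int k)"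
  proof (cases "look m t = k")
    case True
    then have *: "m = (m - mon t k) + mon t k"
      by (intro poly_mapping_eqI) (auto simp: lookup_add lookup_minus lookup_single when_def)
    then have "mdeg \<delta> m = mdeg \<delta> (m - mon t k) + \<delta> t * int k"
      by (metis mdeg_add mdeg_single)
    moreover have "supp (m - mon t k) \<subseteq> W"
    proof
      fix i assume "i \<in> supp (m - mon t k)"
      then have "look m i - look (mon t k) i \<noteq> 0" by (simp add: in_keys_iff lookup_minus)
      then have "i \<noteq> t" "i \<in> supp m" using True by (auto simp: in_keys_iff lookup_single)
      then show "i \<in> W" using m by (auto simp: hmons_def)
    qed
    ultimately show ?thesis using m by (auto simp: hmons_def)
  qed auto
qed

lemma coef_mult_free:
  assumes "p \<in> poly_ring W" "t \<notin> W"
  shows "coef t k (p * q) = p * coef t k q"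
  using assms(1) unfolding poly_ring_eq
proof (induction p rule: span_of_induct)
  case (mon m c)
  then have m: "look m t = 0" using assms(2) by (auto simp: mons_def in_keys_iff)
  show ?case
  proof (induction q rule: mpoly_induct)
    case (mon n d)
    have "m + n - mon t k = m + (n - mon t k)" if "look n t = k"
      by (intro poly_mapping_eqI) (use that in \<open>auto simp: lookup_add lookup_minus lookup_single when_def\<close>)
    then show ?case
      by (auto simp: coef_def mult_single lookup_add m)
  qed (auto simp: coef_add ring_distribs)
qed (auto simp: coef_add ring_distribs)

lemma coef_var_mult: "coef t k (var t ^ j * q) = (if j \<le> k then coef t (k - j) q else 0)"
proof (induction q rule: mpoly_induct)
  case (mon n d)
  have "mon t j + n - mon t k = n - mon t (k - j)" if "look n t + j = k"
    by (intro poly_mapping_eqI) (use that in \<open>auto simp: lookup_add lookup_minus lookup_single when_def\<close>)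
  then show ?case
    by (auto simp: coef_def var_power mult_single lookup_add lookup_single)
qed (auto simp: coef_add ring_distribs)

lemma coef_free:
  assumes "p \<in> poly_ring W" "t \<notin> W"
  shows "coef t k p = (if k = 0 then p else 0)"
proof -
  have "coef t k 1 = (if k = 0 then 1 else 0)"
    unfolding coef_def by (subst single_one[symmetric], subst mono_op_mon) simp
  then show ?thesis using coef_mult_free[OF assms, of k 1] by auto
qed

lemma coef_expand:
  assumes "\<And>k. k > K \<Longrightarrow> coef t k p = 0"
  shows "p = (\<Sum>k\<le>K. var t ^ k * coef t k p)"
proof -
  have *: "\<exists>K. \<forall>M\<ge>K. p = (\<Sum>k\<le>M. var t ^ k * coef t k p)"
  proof (induction p rule: mpoly_induct)
    case (mon m c)
    have "mon m c = (\<Sum>k\<le>M. var t ^ k * coef t k (mon m c))" if "M \<ge> look m t" for M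
    proof -
      have "mon t (look m t) + (m - mon t (look m t)) = m"
        by (intro poly_mapping_eqI) (auto simp: lookup_add lookup_minus lookup_single when_def)
      then have "var t ^ k * coef t k (mon m c) = (if k = look m t then mon m c else 0)" for k
        by (auto simp: coef_def var_power mult_single)
      then show ?thesis using that by simp
    qed
    then show ?case by blast
  next
    case (add p q)
    then obtain K L where "\<forall>M\<ge>K. p = (\<Sum>k\<le>M. var t ^ k * coef t k p)"
      "\<forall>M\<ge>L. q = (\<Sum>k\<le>M. var t ^ k * coef t k q)" by blast
    then show ?case
      by (intro exI[of _ "max K L"]) (auto simp: coef_add ring_distribs sum.distrib)
  qed auto
  then obtain L where L: "\<forall>M\<ge>L. p = (\<Sum>k\<le>M. var t ^ k * coef t k p)" by blast
  then have "p = (\<Sum>k\<le>max K L. var t ^ k * coef t k p)" by (meson max.cobounded2)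
  also have "\<dots> = (\<Sum>k\<le>K. var t ^ k * coef t k p)"
    by (rule sum.mono_neutral_right) (use assms in auto)
  finally show ?thesis .
qed

lemma coef_bounded: "\<exists>K. \<forall>k>K. coef t k p = 0"
proof (induction p rule: mpoly_induct)
  case (mon m c)
  show ?case by (intro exI[of _ "look m t"]) (auto simp: coef_def)
next
  case (add p q)
  then obtain K L where "\<forall>k>K. coef t k p = 0" "\<forall>k>L. coef t k q = 0" by blast
  then show ?case by (intro exI[of _ "max K L"]) (auto simp: coef_add)
qed auto

section \<open>Column-finite matrices\<close>

text \<open>
  Matrices of all sizes are elements of one ring, and their shapes are recorded by separate index sets. Direct
  sums and block matrices then become computations in this ring. The product only needs columns to be finite.
\<close>

typedef (overloaded) 'a cmat = "{f :: nat \<Rightarrow> nat \<Rightarrow> 'a::comm_ring_1. \<forall>j. finite {i. f i j \<noteq> 0}}"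
  morphisms ent CMat
  by (rule exI[of _ "\<lambda>_ _. 0"]) auto

lemma finite_col: "finite {i. ent a i j \<noteq> 0}"
  using ent[of a] by auto

lemma ent_CMat: "(\<And>j. finite {i. f i j \<noteq> 0}) \<Longrightarrow> ent (CMat f) = f"
  by (simp add: CMat_inverse)

lemma ent_CMat_within:
  assumes "\<And>j. finite (S j)" "\<And>i j. f i j \<noteq> 0 \<Longrightarrow> i \<in> S j"
  shows "ent (CMat f) i j = f i j"
proof -
  have "finite {i. f i j \<noteq> 0}" for j
    by (rule finite_subset[OF _ assms(1)[of j]]) (use assms(2) in auto)
  then show ?thesis by (subst ent_CMat) auto
qed

lemma cmat_eqI: "(\<And>i j. ent a i j = ent b i j) \<Longrightarrow> a = b"
  by (simp add: ent_inject[symmetric] fun_eq_iff)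

instantiation cmat :: (comm_ring_1) ring_1
begin

definition "0 = CMat (\<lambda>_ _. 0)"
definition "1 = CMat (\<lambda>i j. if i = j then 1 else 0)"
definition "a + b = CMat (\<lambda>i j. ent a i j + ent b i j)"
definition "a - b = CMat (\<lambda>i j. ent a i j - ent b i j)"
definition "- a = CMat (\<lambda>i j. - ent a i j)"
definition "a * b = CMat (\<lambda>i j. \<Sum>k | ent b k j \<noteq> 0. ent a i k * ent b k j)"

lemma ent_0 [simp]: "ent 0 i j = 0"
  unfolding zero_cmat_def by (subst ent_CMat) auto

lemma ent_1 [simp]: "ent 1 i j = (if i = j then 1 else 0)"
  unfolding one_cmat_def by (subst ent_CMat_within[where S = "\<lambda>j. {j}"]) (auto split: if_splits)

lemma ent_add [simp]: "ent (a + b) i j = ent a i j + ent b i j"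
  unfolding plus_cmat_def
  by (rule ent_CMat_within[where S = "\<lambda>j. {i. ent a i j \<noteq> 0} \<union> {i. ent b i j \<noteq> 0}"]) (auto simp: finite_col)

lemma ent_diff [simp]: "ent (a - b) i j = ent a i j - ent b i j"
  unfolding minus_cmat_def
  by (rule ent_CMat_within[where S = "\<lambda>j. {i. ent a i j \<noteq> 0} \<union> {i. ent b i j \<noteq> 0}"]) (auto simp: finite_col)

lemma ent_uminus [simp]: "ent (- a) i j = - ent a i j"
  unfolding uminus_cmat_def
  by (rule ent_CMat_within[where S = "\<lambda>j. {i. ent a i j \<noteq> 0}"]) (auto simp: finite_col)

lemma ent_mult: "ent (a * b) i j = (\<Sum>k | ent b k j \<noteq> 0. ent a i k * ent b k j)"
proof -
  have "finite {i. (\<Sum>k | ent b k j \<noteq> 0. ent a i k * ent b k j) \<noteq> 0}" for j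
  proof (rule finite_subset)
    show "{i. (\<Sum>k | ent b k j \<noteq> 0. ent a i k * ent b k j) \<noteq> 0}
        \<subseteq> (\<Union>k\<in>{k. ent b k j \<noteq> 0}. {i. ent a i k \<noteq> 0})"
    proof
      fix i assume "i \<in> {i. (\<Sum>k | ent b k j \<noteq> 0. ent a i k * ent b k j) \<noteq> 0}"
      then obtain k where "ent b k j \<noteq> 0" "ent a i k * ent b k j \<noteq> 0"
        by (auto elim!: sum.not_neutral_contains_not_neutral)
      then show "i \<in> (\<Union>k\<in>{k. ent b k j \<noteq> 0}. {i. ent a i k \<noteq> 0})"
        by (auto intro!: exI[of _ k])
    qed
  qed (auto intro: finite_col)
  then show ?thesis unfolding times_cmat_def by (subst ent_CMat) auto
qed

lemma ent_mult_superset: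
  assumes "finite K" "\<And>k. ent b k j \<noteq> 0 \<Longrightarrow> k \<in> K"
  shows "ent (a * b) i j = (\<Sum>k\<in>K. ent a i k * ent b k j)"
  unfolding ent_mult by (rule sum.mono_neutral_left) (use assms in auto)

instance
proof
  fix a b c :: "'a cmat"
  show "a * b * c = a * (b * c)"
  proof (rule cmat_eqI)
    fix i j
    let ?L = "{l. ent c l j \<noteq> 0}"
    let ?K = "\<Union>l\<in>?L. {k. ent b k l \<noteq> 0}"
    have fin: "finite ?L" "finite ?K" by (auto intro: finite_col)
    have "ent (a * b * c) i j = (\<Sum>l\<in>?L. (\<Sum>k\<in>?K. ent a i k * ent b k l) * ent c l j)"
      unfolding ent_mult[of "a * b"]
      by (intro sum.cong refl arg_cong2[where f = "(*)"] ent_mult_superset fin) auto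
    also have "\<dots> = (\<Sum>k\<in>?K. ent a i k * (\<Sum>l\<in>?L. ent b k l * ent c l j))"
      unfolding sum_distrib_left sum_distrib_right
      by (subst sum.swap) (simp add: mult.assoc)
    also have "\<dots> = (\<Sum>k\<in>?K. ent a i k * ent (b * c) k j)"
      unfolding ent_mult[of b] ..
    also have "\<dots> = ent (a * (b * c)) i j"
      by (rule ent_mult_superset[symmetric, OF fin(2)])
         (auto simp: ent_mult elim!: sum.not_neutral_contains_not_neutral)
    finally show "ent (a * b * c) i j = ent (a * (b * c)) i j" .
  qed
  show "(a + b) * c = a * c + b * c"
    by (rule cmat_eqI) (simp add: ent_mult ring_distribs sum.distrib)
  show "a * (b + c) = a * b + a * c"
  proof (rule cmat_eqI)
    fix i j
    let ?K = "{k. ent b k j \<noteq> 0} \<union> {k. ent c k j \<noteq> 0}"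
    have "finite ?K" by (auto intro: finite_col)
    then show "ent (a * (b + c)) i j = ent (a * b + a * c) i j"
      by (simp only: ent_add, subst (1 2 3) ent_mult_superset[of ?K])
         (auto simp: ring_distribs sum.distrib)
  qed
  show "1 * a = a"
    by (rule cmat_eqI) (auto simp: ent_mult if_distrib[of "\<lambda>x. x * _"] sum.delta finite_col cong: if_cong)
  show "a * 1 = a"
  proof (rule cmat_eqI)
    show "ent (a * 1) i j = ent a i j" for i j
      by (subst ent_mult_superset[of "{j}"]) (auto split: if_splits)
  qed
  have "ent (0::'a cmat) 0 0 \<noteq> ent 1 0 0" by simp
  then show "(0::'a cmat) \<noteq> 1" by metis
qed (auto intro!: cmat_eqI simp: algebra_simps)

end

lemma ent_sum: "ent (sum f A) i j = (\<Sum>x\<in>A. ent (f x) i j)"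
  by (induction A rule: infinite_finite_induct) auto

definition cmap :: "('a::comm_ring_1 \<Rightarrow> 'b::comm_ring_1) \<Rightarrow> 'a cmat \<Rightarrow> 'b cmat" where
  "cmap h a = CMat (\<lambda>i j. h (ent a i j))"

lemma ent_cmap: "h 0 = 0 \<Longrightarrow> ent (cmap h a) i j = h (ent a i j)"
  unfolding cmap_def
  by (rule ent_CMat_within[where S = "\<lambda>j. {i. ent a i j \<noteq> 0}"]) (auto simp: finite_col intro: ccontr)

lemma cmap_free_mult:
  assumes "h 0 = 0" "\<And>p q. h (p + q) = h p + h q"
    "\<And>i j q. h (ent a i j * q) = ent a i j * h q"
  shows "cmap h (a * b) = a * cmap h b"
proof (rule cmat_eqI)
  fix i j
  have s: "h (sum f A) = (\<Sum>x\<in>A. h (f x))" for f and A :: "nat set"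
    by (induction A rule: infinite_finite_induct) (auto simp: assms(1,2))
  have "ent (a * cmap h b) i j = (\<Sum>k | ent b k j \<noteq> 0. ent a i k * ent (cmap h b) k j)"
    by (rule ent_mult_superset) (auto intro: finite_col simp: ent_cmap assms(1))
  then show "ent (cmap h (a * b)) i j = ent (a * cmap h b) i j"
    by (simp add: ent_cmap assms(1,3) ent_mult s)
qed

locale cring_hom =
  fixes h :: "'a::comm_ring_1 \<Rightarrow> 'b::comm_ring_1"
  assumes add: "h (p + q) = h p + h q" and mult: "h (p * q) = h p * h q" and one: "h 1 = 1"
begin

lemma zero [simp]: "h 0 = 0" using add[of 0 0] by simp
lemma uminus: "h (- p) = - h p" using add[of p "- p"] by (simp add: add_eq_0_iff)
lemma diff: "h (p - q) = h p - h q" using add[of p "- q"] uminus[of q] by simp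
lemma sum: "h (sum f A) = (\<Sum>x\<in>A. h (f x))"
  by (induction A rule: infinite_finite_induct) (auto simp: add)

lemma cmap_add: "cmap h (a + b) = cmap h a + cmap h b" by (rule cmat_eqI) (simp add: ent_cmap add)
lemma cmap_diff: "cmap h (a - b) = cmap h a - cmap h b" by (rule cmat_eqI) (simp add: ent_cmap diff)
lemma cmap_uminus: "cmap h (- a) = - cmap h a" by (rule cmat_eqI) (simp add: ent_cmap uminus)
lemma cmap_0 [simp]: "cmap h 0 = 0" by (rule cmat_eqI) (simp add: ent_cmap)
lemma cmap_1 [simp]: "cmap h 1 = 1" by (rule cmat_eqI) (simp add: ent_cmap one)

lemma cmap_mult: "cmap h (a * b) = cmap h a * cmap h b"
proof (rule cmat_eqI)
  fix i j
  have "ent (cmap h a * cmap h b) i j = (\<Sum>k | ent b k j \<noteq> 0. ent (cmap h a) i k * ent (cmap h b) k j)"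
    by (rule ent_mult_superset) (auto intro: finite_col simp: ent_cmap)
  then show "ent (cmap h (a * b)) i j = ent (cmap h a * cmap h b) i j"
    by (simp add: ent_cmap ent_mult sum mult)
qed

end

definition cdiag :: "(nat \<Rightarrow> 'a) \<Rightarrow> 'a::comm_ring_1 cmat" where
  "cdiag d = CMat (\<lambda>i j. if i = j then d i else 0)"

lemma ent_cdiag [simp]: "ent (cdiag d) i j = (if i = j then d i else 0)"
  unfolding cdiag_def by (rule ent_CMat_within[where S = "\<lambda>j. {j}"]) (auto split: if_splits)

lemma ent_cdiag_mult [simp]: "ent (cdiag d * a) i j = d i * ent a i j"
  by (auto simp: ent_mult if_distrib[of "\<lambda>x. x * _"] sum.delta finite_col cong: if_cong)

lemma ent_mult_cdiag [simp]: "ent (a * cdiag d) i j = ent a i j * d j"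
  by (subst ent_mult_superset[of "{j}"]) (auto split: if_splits)

definition scal :: "'a \<Rightarrow> 'a::comm_ring_1 cmat" where "scal c = cdiag (\<lambda>_. c)"

lemma ent_scal [simp]: "ent (scal c) i j = (if i = j then c else 0)" by (simp add: scal_def)
lemma ent_scal_mult [simp]: "ent (scal c * a) i j = c * ent a i j" by (simp add: scal_def)
lemma ent_mult_scal [simp]: "ent (a * scal c) i j = ent a i j * c" by (simp add: scal_def)
lemma scal_comm: "a * scal c = scal c * a" by (rule cmat_eqI) (simp add: mult.commute)
lemma scal_comm2: "a * (scal c * b) = scal c * (a * b)" by (metis mult.assoc scal_comm)
lemma scal_1 [simp]: "scal 1 = 1" by (rule cmat_eqI) simp
lemma scal_mult: "scal (c * d) = scal c * scal d" by (rule cmat_eqI) simp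
lemma scal_add: "scal (c + d) = scal c + scal d" by (rule cmat_eqI) simp

lemma scal_cancel: "scal (c::'a::idom) * a = scal c * b \<Longrightarrow> c \<noteq> 0 \<Longrightarrow> a = b"
  by (intro cmat_eqI) (metis ent_scal_mult mult_cancel_left)

definition cproj :: "nat set \<Rightarrow> 'a::comm_ring_1 cmat" where
  "cproj I = cdiag (\<lambda>i. if i \<in> I then 1 else 0)"

lemma ent_cproj [simp]: "ent (cproj I) i j = (if i = j \<and> i \<in> I then 1 else 0)" by (simp add: cproj_def)
lemma ent_cproj_mult [simp]: "ent (cproj I * a) i j = (if i \<in> I then ent a i j else 0)" by (simp add: cproj_def)
lemma ent_mult_cproj [simp]: "ent (a * cproj I) i j = (if j \<in> I then ent a i j else 0)" by (simp add: cproj_def)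

definition cunit :: "nat \<Rightarrow> nat \<Rightarrow> 'a::comm_ring_1 cmat" where
  "cunit i j = CMat (\<lambda>k l. if k = i \<and> l = j then 1 else 0)"

lemma ent_cunit [simp]: "ent (cunit i j) k l = (if k = i \<and> l = j then 1 else 0)"
  unfolding cunit_def by (rule ent_CMat_within[where S = "\<lambda>_. {i}"]) (auto split: if_splits)

lemma ent_mult_cunit [simp]: "ent (a * cunit i j) k l = (if l = j then ent a k i else 0)"
  by (subst ent_mult_superset[of "{i}"]) (auto split: if_splits)

text \<open>
  The isometries \<open>s0\<close> and \<open>s1\<close> send the \<open>i\<close>-th basis vector to the basis vectors with index \<open>2 i\<close>
  and \<open>2 i + 1\<close>. Together with their transposes \<open>r0\<close> and \<open>r1\<close> they satisfy the relations of the Leavitt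
  algebra, so that the block matrix with entries \<open>a, b, c, d\<close> is an element
  \<open>s0 a r0 + s0 b r1 + s1 c r0 + s1 d r1\<close> of the same ring.
\<close>

definition s0 :: "'a::comm_ring_1 cmat" where "s0 = CMat (\<lambda>i j. if i = 2 * j then 1 else 0)"
definition s1 :: "'a::comm_ring_1 cmat" where "s1 = CMat (\<lambda>i j. if i = Suc (2 * j) then 1 else 0)"
definition r0 :: "'a::comm_ring_1 cmat" where "r0 = CMat (\<lambda>i j. if j = 2 * i then 1 else 0)"
definition r1 :: "'a::comm_ring_1 cmat" where "r1 = CMat (\<lambda>i j. if j = Suc (2 * i) then 1 else 0)"

lemma ent_s0 [simp]: "ent s0 i j = (if i = 2 * j then 1 else 0)"
  unfolding s0_def by (rule ent_CMat_within[where S = "\<lambda>j. {2 * j}"]) (auto split: if_splits)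
lemma ent_s1 [simp]: "ent s1 i j = (if i = Suc (2 * j) then 1 else 0)"
  unfolding s1_def by (rule ent_CMat_within[where S = "\<lambda>j. {Suc (2 * j)}"]) (auto split: if_splits)
lemma ent_r0 [simp]: "ent r0 i j = (if j = 2 * i then 1 else 0)"
  unfolding r0_def by (rule ent_CMat_within[where S = "\<lambda>j. {..j}"]) (auto split: if_splits)
lemma ent_r1 [simp]: "ent r1 i j = (if j = Suc (2 * i) then 1 else 0)"
  unfolding r1_def by (rule ent_CMat_within[where S = "\<lambda>j. {..j}"]) (auto split: if_splits)

lemma ent_mult_s0 [simp]: "ent (a * s0) i j = ent a i (2 * j)"
  by (subst ent_mult_superset[of "{2 * j}"]) (auto split: if_splits)
lemma ent_mult_s1 [simp]: "ent (a * s1) i j = ent a i (Suc (2 * j))"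
  by (subst ent_mult_superset[of "{Suc (2 * j)}"]) (auto split: if_splits)
lemma ent_mult_r0 [simp]: "ent (a * r0) i j = (if even j then ent a i (j div 2) else 0)"
proof (cases "even j")
  case True
  then obtain m where "j = 2 * m" by (auto elim: evenE)
  then show ?thesis by (subst ent_mult_superset[of "{m}"]) (auto split: if_splits)
next
  case False
  then show ?thesis by (subst ent_mult_superset[of "{}"]) (auto split: if_splits)
qed
lemma ent_mult_r1 [simp]: "ent (a * r1) i j = (if odd j then ent a i (j div 2) else 0)"
proof (cases "odd j")
  case True
  then obtain m where "j = Suc (2 * m)" by (auto elim: oddE)
  then show ?thesis by (subst ent_mult_superset[of "{m}"]) (auto split: if_splits)
next
  case False
  then show ?thesis by (subst ent_mult_superset[of "{}"]) (auto split: if_splits)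
qed

lemma ent_s0_mult [simp]: "ent (s0 * a) i j = (if even i then ent a (i div 2) j else 0)"
proof -
  have "ent (s0 * a) i j = (\<Sum>k | ent a k j \<noteq> 0. if k = i div 2 then (if even i then ent a k j else 0) else 0)"
    unfolding ent_mult by (rule sum.cong) auto
  also have "\<dots> = (if even i then ent a (i div 2) j else 0)" by (auto simp: sum.delta finite_col)
  finally show ?thesis .
qed

lemma ent_s1_mult [simp]: "ent (s1 * a) i j = (if odd i then ent a (i div 2) j else 0)"
proof -
  have "ent (s1 * a) i j = (\<Sum>k | ent a k j \<noteq> 0. if k = i div 2 then (if odd i then ent a k j else 0) else 0)"
    unfolding ent_mult by (rule sum.cong) (auto elim!: oddE)
  also have "\<dots> = (if odd i then ent a (i div 2) j else 0)" by (auto simp: sum.delta finite_col)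
  finally show ?thesis .
qed

lemma ent_r0_mult [simp]: "ent (r0 * a) i j = ent a (2 * i) j"
proof -
  have "ent (r0 * a) i j = (\<Sum>k | ent a k j \<noteq> 0. if k = 2 * i then ent a k j else 0)"
    unfolding ent_mult by (rule sum.cong) auto
  then show ?thesis by (auto simp: sum.delta finite_col)
qed

lemma ent_r1_mult [simp]: "ent (r1 * a) i j = ent a (Suc (2 * i)) j"
proof -
  have "ent (r1 * a) i j = (\<Sum>k | ent a k j \<noteq> 0. if k = Suc (2 * i) then ent a k j else 0)"
    unfolding ent_mult by (rule sum.cong) auto
  then show ?thesis by (auto simp: sum.delta finite_col)
qed

lemma leavitt [simp]: "r0 * s0 = 1" "r1 * s1 = 1" "r0 * s1 = 0" "r1 * s0 = 0"
  by (rule cmat_eqI, simp; presburger)+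

lemma leavitt_sum: "s0 * r0 + s1 * r1 = 1"
  by (rule cmat_eqI) (auto elim!: evenE oddE)

lemma leavitt2 [simp]: "r0 * (s0 * a) = a" "r1 * (s1 * a) = a" "r0 * (s1 * a) = 0" "r1 * (s0 * a) = 0"
  by (simp_all only: mult.assoc[symmetric] leavitt mult_1_left mult_zero_left)

lemma leavitt_split: "s0 * (r0 * a) + s1 * (r1 * a) = a" "a * s0 * r0 + a * s1 * r1 = a"
proof -
  have "s0 * (r0 * a) + s1 * (r1 * a) = (s0 * r0 + s1 * r1) * a" by (simp add: ring_distribs mult.assoc)
  then show "s0 * (r0 * a) + s1 * (r1 * a) = a" by (simp add: leavitt_sum)
  have "a * s0 * r0 + a * s1 * r1 = a * (s0 * r0 + s1 * r1)" by (simp add: ring_distribs mult.assoc)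
  then show "a * s0 * r0 + a * s1 * r1 = a" by (simp add: leavitt_sum)
qed

lemma (in cring_hom) cmap_consts [simp]:
  "cmap h (cunit i j) = cunit i j" "cmap h (cproj I) = cproj I"
  "cmap h s0 = s0" "cmap h s1 = s1" "cmap h r0 = r0" "cmap h r1 = r1" "cmap h (scal c) = scal (h c)"
  by (rule cmat_eqI, auto simp: ent_cmap one)+

section \<open>Graded free modules\<close>

text \<open>A pair \<open>(I, w)\<close> stands for the free module with basis \<open>I\<close>, the basis vector \<open>i\<close> having weight \<open>w i\<close>.\<close>

type_synonym gmod = "nat set \<times> (nat \<Rightarrow> int)"

definition ghom :: "(nat \<Rightarrow> int) \<Rightarrow> nat set \<Rightarrow> gmod \<Rightarrow> gmod \<Rightarrow> mpoly cmat set" where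
  "ghom \<delta> W X Y = {a. \<forall>i j. (ent a i j \<noteq> 0 \<longrightarrow> i \<in> fst Y \<and> j \<in> fst X) \<and>
     ent a i j \<in> hmg \<delta> W (snd Y i - snd X j)}"

definition gline :: "int \<Rightarrow> gmod" where "gline D = ({0}, \<lambda>_. D)"

definition gsum :: "gmod \<Rightarrow> gmod \<Rightarrow> gmod" where
  "gsum X Y = ((\<lambda>i. 2 * i) ` fst X \<union> (\<lambda>i. Suc (2 * i)) ` fst Y,
     \<lambda>i. if even i then snd X (i div 2) else snd Y (i div 2))"

definition gzero :: gmod where "gzero = ({}, \<lambda>_. 0)"

lemma ghomI:
  "(\<And>i j. ent a i j \<noteq> 0 \<Longrightarrow> i \<in> fst Y \<and> j \<in> fst X \<and> ent a i j \<in> hmg \<delta> W (snd Y i - snd X j)) \<Longrightarrow>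
    a \<in> ghom \<delta> W X Y"
  unfolding ghom_def by (auto, metis hmg_0)

lemma ghomD: "a \<in> ghom \<delta> W X Y \<Longrightarrow> ent a i j \<in> hmg \<delta> W (snd Y i - snd X j)"
  and ghomD1: "a \<in> ghom \<delta> W X Y \<Longrightarrow> ent a i j \<noteq> 0 \<Longrightarrow> i \<in> fst Y"
  and ghomD2: "a \<in> ghom \<delta> W X Y \<Longrightarrow> ent a i j \<noteq> 0 \<Longrightarrow> j \<in> fst X"
  by (auto simp: ghom_def)

lemma ghom_0 [simp]: "0 \<in> ghom \<delta> W X Y" by (auto simp: ghom_def)

lemma ghom_add: "a \<in> ghom \<delta> W X Y \<Longrightarrow> b \<in> ghom \<delta> W X Y \<Longrightarrow> a + b \<in> ghom \<delta> W X Y"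
  unfolding ghom_def by (auto intro!: hmg_add) (metis add_0_right add_cancel_left_right)+

lemma ghom_uminus [simp]: "- a \<in> ghom \<delta> W X Y \<longleftrightarrow> a \<in> ghom \<delta> W X Y"
  by (auto simp: ghom_def)

lemma ghom_diff: "a \<in> ghom \<delta> W X Y \<Longrightarrow> b \<in> ghom \<delta> W X Y \<Longrightarrow> a - b \<in> ghom \<delta> W X Y"
  using ghom_add[of a \<delta> W X Y "- b"] by simp

lemma ghom_sum: "(\<And>i. i \<in> A \<Longrightarrow> f i \<in> ghom \<delta> W X Y) \<Longrightarrow> sum f A \<in> ghom \<delta> W X Y"
  by (induction A rule: infinite_finite_induct) (auto intro: ghom_add)

lemma ghom_comp:
  assumes a: "a \<in> ghom \<delta> W Y Z" and b: "b \<in> ghom \<delta> W X Y"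
  shows "a * b \<in> ghom \<delta> W X Z"
proof (rule ghomI)
  fix i j assume nz: "ent (a * b) i j \<noteq> 0"
  then obtain k where k: "ent b k j \<noteq> 0" "ent a i k \<noteq> 0"
    unfolding ent_mult by (auto elim!: sum.not_neutral_contains_not_neutral)
  have "ent (a * b) i j \<in> hmg \<delta> W (snd Z i - snd X j)"
    unfolding ent_mult
  proof (rule hmg_sum)
    fix k
    have "ent a i k * ent b k j \<in> hmg \<delta> W ((snd Z i - snd Y k) + (snd Y k - snd X j))"
      by (intro hmg_mult ghomD a b)
    then show "ent a i k * ent b k j \<in> hmg \<delta> W (snd Z i - snd X j)" by simp
  qed
  then show "i \<in> fst Z \<and> j \<in> fst X \<and> ent (a * b) i j \<in> hmg \<delta> W (snd Z i - snd X j)"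
    using k ghomD1[OF a] ghomD2[OF b] by auto
qed

lemma ghom_mono: "a \<in> ghom \<delta> W X Y \<Longrightarrow> W \<subseteq> W' \<Longrightarrow> a \<in> ghom \<delta> W' X Y"
  by (auto simp: ghom_def intro: hmg_mono)

lemma ghom_id [simp]: "cproj (fst X) \<in> ghom \<delta> W X X"
  by (rule ghomI) (auto split: if_splits)

lemma ghom_idL: "a \<in> ghom \<delta> W X Y \<Longrightarrow> cproj (fst Y) * a = a"
  by (rule cmat_eqI) (auto dest: ghomD1)

lemma ghom_idR: "a \<in> ghom \<delta> W X Y \<Longrightarrow> a * cproj (fst X) = a"
  by (rule cmat_eqI) (auto dest: ghomD2)

lemma ghom_scal:
  assumes "a \<in> ghom \<delta> W X Y" "p \<in> hmg \<delta> W e" "fst X' = fst X" "\<And>j. j \<in> fst X \<Longrightarrow> snd X' j = snd X j - e"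
  shows "scal p * a \<in> ghom \<delta> W X' Y"
proof (rule ghomI)
  fix i j assume "ent (scal p * a) i j \<noteq> 0"
  then have "ent a i j \<noteq> 0" by auto
  then have "i \<in> fst Y" "j \<in> fst X" using assms(1) by (auto dest: ghomD1 ghomD2)
  moreover have "p * ent a i j \<in> hmg \<delta> W (e + (snd Y i - snd X j))"
    by (intro hmg_mult ghomD assms)
  ultimately show "i \<in> fst Y \<and> j \<in> fst X' \<and> ent (scal p * a) i j \<in> hmg \<delta> W (snd Y i - snd X' j)"
    using assms(3,4) by (simp add: add_diff_eq diff_diff_eq2 add.commute)
qed

lemma ghom_cunit: "j \<in> fst X \<Longrightarrow> D = snd X j \<Longrightarrow> cunit j 0 \<in> ghom \<delta> W (gline D) X"
  by (rule ghomI) (auto simp: gline_def split: if_splits)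

lemma ghom_gsum [intro]:
  "a \<in> ghom \<delta> W Z X \<Longrightarrow> s0 * a \<in> ghom \<delta> W Z (gsum X Y)"
  "a \<in> ghom \<delta> W Z Y \<Longrightarrow> s1 * a \<in> ghom \<delta> W Z (gsum X Y)"
  "a \<in> ghom \<delta> W X Z \<Longrightarrow> a * r0 \<in> ghom \<delta> W (gsum X Y) Z"
  "a \<in> ghom \<delta> W Y Z \<Longrightarrow> a * r1 \<in> ghom \<delta> W (gsum X Y) Z"
  "a \<in> ghom \<delta> W Z (gsum X Y) \<Longrightarrow> r0 * a \<in> ghom \<delta> W Z X"
  "a \<in> ghom \<delta> W Z (gsum X Y) \<Longrightarrow> r1 * a \<in> ghom \<delta> W Z Y"
  "a \<in> ghom \<delta> W (gsum X Y) Z \<Longrightarrow> a * s0 \<in> ghom \<delta> W X Z"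
  "a \<in> ghom \<delta> W (gsum X Y) Z \<Longrightarrow> a * s1 \<in> ghom \<delta> W Y Z"
proof -
  have [simp]: "Suc (2 * i) \<noteq> 2 * j" "2 * j \<noteq> Suc (2 * i)" for i j :: nat by presburger+
  note D = ghomD ghomD1 ghomD2
  {
    assume a: "a \<in> ghom \<delta> W Z X"
    show "s0 * a \<in> ghom \<delta> W Z (gsum X Y)"
      by (rule ghomI) (use D[OF a] in \<open>auto simp: gsum_def image_iff elim!: evenE split: if_splits\<close>)
  next
    assume a: "a \<in> ghom \<delta> W Z Y"
    show "s1 * a \<in> ghom \<delta> W Z (gsum X Y)"
      by (rule ghomI) (use D[OF a] in \<open>auto simp: gsum_def image_iff elim!: oddE split: if_splits\<close>)
  next
    assume a: "a \<in> ghom \<delta> W X Z"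
    show "a * r0 \<in> ghom \<delta> W (gsum X Y) Z"
      by (rule ghomI) (use D[OF a] in \<open>auto simp: gsum_def image_iff elim!: evenE split: if_splits\<close>)
  next
    assume a: "a \<in> ghom \<delta> W Y Z"
    show "a * r1 \<in> ghom \<delta> W (gsum X Y) Z"
      by (rule ghomI) (use D[OF a] in \<open>auto simp: gsum_def image_iff elim!: oddE split: if_splits\<close>)
  next
    assume a: "a \<in> ghom \<delta> W Z (gsum X Y)"
    show "r0 * a \<in> ghom \<delta> W Z X"
      by (rule ghomI) (use D(1)[OF a, of "2 * _"] D(2,3)[OF a, of "2 * _"] in \<open>auto simp: gsum_def image_iff\<close>)
    show "r1 * a \<in> ghom \<delta> W Z Y"
      by (rule ghomI) (use D(1)[OF a, of "Suc (2 * _)"] D(2,3)[OF a, of "Suc (2 * _)"] in \<open>auto simp: gsum_def image_iff\<close>)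
  next
    assume a: "a \<in> ghom \<delta> W (gsum X Y) Z"
    show "a * s0 \<in> ghom \<delta> W X Z"
      by (rule ghomI) (use D(1)[OF a, of _ "2 * _"] D(2,3)[OF a, of _ "2 * _"] in \<open>auto simp: gsum_def image_iff\<close>)
    show "a * s1 \<in> ghom \<delta> W Y Z"
      by (rule ghomI) (use D(1)[OF a, of _ "Suc (2 * _)"] D(2,3)[OF a, of _ "Suc (2 * _)"] in \<open>auto simp: gsum_def image_iff\<close>)
  }
qed

lemma finite_gsum: "finite (fst X) \<Longrightarrow> finite (fst Y) \<Longrightarrow> finite (fst (gsum X Y))"
  by (simp add: gsum_def)

definition assemble :: "nat set \<Rightarrow> (nat \<Rightarrow> 'a cmat) \<Rightarrow> 'a::comm_ring_1 cmat" where
  "assemble I v = CMat (\<lambda>i j. if j \<in> I then ent (v j) i 0 else 0)"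

lemma ent_assemble [simp]: "ent (assemble I v) i j = (if j \<in> I then ent (v j) i 0 else 0)"
proof -
  have "finite {i. (if j \<in> I then ent (v j) i 0 else 0) \<noteq> 0}" for j
    by (rule finite_subset[OF _ finite_col[of "v j" 0]]) auto
  then show ?thesis unfolding assemble_def by (subst ent_CMat) auto
qed

lemma mult_assemble: "a * assemble I v = assemble I (\<lambda>j. a * v j)"
  by (rule cmat_eqI) (auto simp: ent_mult)

lemma ghom_assemble:
  assumes "\<And>j. j \<in> fst X \<Longrightarrow> v j \<in> ghom \<delta> W (gline (snd X j)) Y"
  shows "assemble (fst X) v \<in> ghom \<delta> W X Y"
  by (rule ghomI) (use assms in \<open>auto simp: ghom_def gline_def split: if_splits\<close>)

lemma ghom_gline_ent: "v \<in> ghom \<delta> W (gline D) Y \<Longrightarrow> k \<noteq> 0 \<Longrightarrow> ent v i k = 0"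
  by (auto simp: ghom_def gline_def)

lemma ghom_lift:
  assumes C: "C \<in> ghom \<delta> W X P"
    and v: "\<And>j. j \<in> fst X \<Longrightarrow> \<exists>v\<in>ghom \<delta> W (gline (snd X j)) Q. d * v = C * cunit j 0"
  shows "\<exists>D\<in>ghom \<delta> W X Q. d * D = C"
proof -
  from v obtain v where v: "\<And>j. j \<in> fst X \<Longrightarrow> v j \<in> ghom \<delta> W (gline (snd X j)) Q \<and> d * v j = C * cunit j 0"
    by metis
  then have "assemble (fst X) v \<in> ghom \<delta> W X Q" by (intro ghom_assemble) auto
  moreover have "d * assemble (fst X) v = C"
    unfolding mult_assemble
    by (rule cmat_eqI) (use v ghomD2[OF C] in \<open>auto\<close>)
  ultimately show ?thesis by blast
qed

lemma ghom_columns: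
  assumes "a \<in> ghom \<delta> W X P" "\<And>j. j \<in> fst X \<Longrightarrow> a * cunit j 0 = b * cunit j 0" "b \<in> ghom \<delta> W X P"
  shows "a = b"
proof (rule cmat_eqI)
  fix i j
  show "ent a i j = ent b i j"
  proof (cases "j \<in> fst X")
    case True
    then have "ent (a * cunit j 0) i 0 = ent (b * cunit j 0) i 0" using assms(2) by simp
    then show ?thesis by simp
  next
    case False
    then show ?thesis using ghomD2[OF assms(1)] ghomD2[OF assms(3)] by metis
  qed
qed

section \<open>Finite graded free resolutions\<close>

text \<open>
  The matrix \<open>d\<close> is continued to the left by an exact complex of \<open>n\<close> further finite graded free modules.
  Exactness is tested on homogeneous vectors; those of degree \<open>D\<close> are the maps from \<open>gline D\<close>.
\<close>

fun gres :: "(nat \<Rightarrow> int) \<Rightarrow> nat set \<Rightarrow> nat \<Rightarrow> gmod \<Rightarrow> mpoly cmat \<Rightarrow> bool" where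
  "gres \<delta> W 0 X d \<longleftrightarrow> (\<forall>D. \<forall>v\<in>ghom \<delta> W (gline D) X. d * v = 0 \<longrightarrow> v = 0)"
| "gres \<delta> W (Suc n) X d \<longleftrightarrow> (\<exists>Z d2. finite (fst Z) \<and> d2 \<in> ghom \<delta> W Z X \<and> d * d2 = 0 \<and>
     (\<forall>D. \<forall>v\<in>ghom \<delta> W (gline D) X. d * v = 0 \<longrightarrow> (\<exists>v'\<in>ghom \<delta> W (gline D) Z. v = d2 * v')) \<and>
     gres \<delta> W n Z d2)"

text \<open>A graded submodule of \<open>P\<close>, given by its homogeneous vectors in each degree.\<close>

definition gsub :: "(nat \<Rightarrow> int) \<Rightarrow> nat set \<Rightarrow> gmod \<Rightarrow> (int \<Rightarrow> mpoly cmat set) \<Rightarrow> bool" where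
  "gsub \<delta> W P L \<longleftrightarrow> (\<forall>D. L D \<subseteq> ghom \<delta> W (gline D) P \<and> 0 \<in> L D) \<and>
     (\<forall>D. \<forall>u\<in>L D. \<forall>v\<in>L D. u + v \<in> L D) \<and>
     (\<forall>D e. \<forall>p\<in>hmg \<delta> W e. \<forall>v\<in>L D. scal p * v \<in> L (D - e))"

text \<open>A finite free module mapping onto the graded submodule \<open>L\<close> of \<open>P\<close>.\<close>

definition gcover :: "(nat \<Rightarrow> int) \<Rightarrow> nat set \<Rightarrow> gmod \<Rightarrow> (int \<Rightarrow> mpoly cmat set) \<Rightarrow> gmod \<Rightarrow> mpoly cmat \<Rightarrow> bool" where
  "gcover \<delta> W P L A \<alpha> \<longleftrightarrow> finite (fst A) \<and> \<alpha> \<in> ghom \<delta> W A P \<and>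
     (\<forall>j\<in>fst A. \<alpha> * cunit j 0 \<in> L (snd A j)) \<and>
     (\<forall>D. \<forall>u\<in>L D. \<exists>v\<in>ghom \<delta> W (gline D) A. u = \<alpha> * v)"

lemma ghom_nonempty [simp]: "\<exists>v. v \<in> ghom \<delta> W X Y" by (rule exI[of _ 0]) simp

lemma finite_gzero [simp]: "fst gzero = {}" by (simp add: gzero_def)

lemma ghom_gline_zero: "v \<in> ghom \<delta> W X gzero \<Longrightarrow> v = 0"
  by (rule cmat_eqI) (auto simp: ghom_def gzero_def)

lemma gres_Suc: "gres \<delta> W n X d \<Longrightarrow> gres \<delta> W (Suc n) X d"
proof (induction n arbitrary: X d)
  case 0
  then show ?case
    by (subst gres.simps, intro exI[of _ gzero] exI[of _ 0])
       (use 0 in \<open>auto dest: ghom_gline_zero simp: finite_gzero intro: bexI[of _ 0]\<close>)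
next
  case (Suc n)
  then show ?case by (subst gres.simps) (metis gres.simps(2))
qed

lemma gres_mono: "gres \<delta> W n X d \<Longrightarrow> n \<le> m \<Longrightarrow> gres \<delta> W m X d"
  by (induction m) (auto simp del: gres.simps simp: le_Suc_eq intro: gres_Suc)

lemma column_ghom: "a \<in> ghom \<delta> W X Y \<Longrightarrow> j \<in> fst X \<Longrightarrow> a * cunit j 0 \<in> ghom \<delta> W (gline (snd X j)) Y"
  by (erule ghom_comp) (rule ghom_cunit, auto)

lemma mult_zero_columns:
  assumes "a \<in> ghom \<delta> W X Y" "\<And>j. j \<in> fst X \<Longrightarrow> d * (a * cunit j 0) = 0"
  shows "d * a = 0"
proof (rule cmat_eqI)
  fix i j
  have "ent (d * a) i j = ent (d * a * cunit j 0) i 0" by simp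
  also have "\<dots> = 0"
  proof (cases "j \<in> fst X")
    case True
    then show ?thesis using assms(2)[of j] by (simp add: mult.assoc)
  next
    case False
    then have "a * cunit j 0 = 0" by (intro cmat_eqI) (use ghomD2[OF assms(1)] in auto)
    then show ?thesis by (simp add: mult.assoc)
  qed
  finally show "ent (d * a) i j = ent 0 i j" by simp
qed

lemma gres_cong:
  assumes "gres \<delta> W n X d" "\<And>D v. v \<in> ghom \<delta> W (gline D) X \<Longrightarrow> d * v = 0 \<longleftrightarrow> d' * v = 0"
  shows "gres \<delta> W n X d'"
proof (cases n)
  case 0
  then show ?thesis using assms by auto
next
  case (Suc m)
  then obtain Z d2 where *: "finite (fst Z)" "d2 \<in> ghom \<delta> W Z X" "d * d2 = 0"
    "\<forall>D. \<forall>v\<in>ghom \<delta> W (gline D) X. d * v = 0 \<longrightarrow> (\<exists>v'\<in>ghom \<delta> W (gline D) Z. v = d2 * v')" "gres \<delta> W m Z d2"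
    using assms(1) by auto
  have "d' * d2 = 0"
  proof (rule mult_zero_columns[OF *(2)])
    fix j assume "j \<in> fst Z"
    then have "d2 * cunit j 0 \<in> ghom \<delta> W (gline (snd Z j)) X" using *(2) by (rule column_ghom[rotated])
    moreover have "d * (d2 * cunit j 0) = 0" using *(3) by (simp flip: mult.assoc)
    ultimately show "d' * (d2 * cunit j 0) = 0" using assms(2) by blast
  qed
  then show ?thesis using * assms(2) unfolding Suc by (subst gres.simps) blast
qed

text \<open>
  The mapping cone: if \<open>\<theta>\<close> sends syzygies of \<open>\<beta>\<close> into the image of \<open>\<alpha>\<close>, then a syzygy of the block triangular
  matrix is a syzygy of \<open>\<beta>\<close> together with a correction, unique up to syzygies of \<open>\<alpha>\<close>. The same argument applies
  again to the matrix of syzygies.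
\<close>

lemma gres_triangular:
  assumes "gres \<delta> W n A \<alpha>" "gres \<delta> W n B \<beta>" "\<theta> \<in> ghom \<delta> W B A0"
    and "\<And>D v. v \<in> ghom \<delta> W (gline D) B \<Longrightarrow> \<beta> * v = 0 \<Longrightarrow> \<exists>a\<in>ghom \<delta> W (gline D) A. \<theta> * v = \<alpha> * a"
  shows "gres \<delta> W n (gsum A B) (s0 * \<alpha> * r0 + s0 * \<theta> * r1 + s1 * \<beta> * r1)"
  using assms
proof (induction n arbitrary: A \<alpha> B \<beta> \<theta> A0)
  case (0 A \<alpha> B \<beta> \<theta>)
  show ?case unfolding gres.simps
  proof (intro allI ballI impI)
    fix D v assume v: "v \<in> ghom \<delta> W (gline D) (gsum A B)"
      and *: "(s0 * \<alpha> * r0 + s0 * \<theta> * r1 + s1 * \<beta> * r1) * v = 0"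
    have "r1 * ((s0 * \<alpha> * r0 + s0 * \<theta> * r1 + s1 * \<beta> * r1) * v) = \<beta> * (r1 * v)"
      "r0 * ((s0 * \<alpha> * r0 + s0 * \<theta> * r1 + s1 * \<beta> * r1) * v) = \<alpha> * (r0 * v) + \<theta> * (r1 * v)"
      by (simp_all add: ring_distribs mult.assoc)
    then have 1: "\<beta> * (r1 * v) = 0" "\<alpha> * (r0 * v) + \<theta> * (r1 * v) = 0" unfolding * by simp_all
    then have "r1 * v = 0" using 0(2) v by (auto intro: ghom_gsum)
    moreover from this have "r0 * v = 0" using 0(1) v 1 by (auto intro: ghom_gsum)
    ultimately show "v = 0" using leavitt_split(1)[of v] by simp
  qed
next
  case (Suc n A \<alpha> B \<beta> \<theta> A0)
  from Suc.prems(1) obtain A2 \<alpha>2 where A2: "finite (fst A2)" "\<alpha>2 \<in> ghom \<delta> W A2 A" "\<alpha> * \<alpha>2 = 0"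
    "\<And>D v. v \<in> ghom \<delta> W (gline D) A \<Longrightarrow> \<alpha> * v = 0 \<Longrightarrow> \<exists>v'\<in>ghom \<delta> W (gline D) A2. v = \<alpha>2 * v'"
    "gres \<delta> W n A2 \<alpha>2" by auto
  from Suc.prems(2) obtain B2 \<beta>2 where B2: "finite (fst B2)" "\<beta>2 \<in> ghom \<delta> W B2 B" "\<beta> * \<beta>2 = 0"
    "\<And>D v. v \<in> ghom \<delta> W (gline D) B \<Longrightarrow> \<beta> * v = 0 \<Longrightarrow> \<exists>v'\<in>ghom \<delta> W (gline D) B2. v = \<beta>2 * v'"
    "gres \<delta> W n B2 \<beta>2" by auto
  have "\<exists>\<theta>2\<in>ghom \<delta> W B2 A. \<alpha> * \<theta>2 = \<theta> * \<beta>2"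
  proof (rule ghom_lift[OF ghom_comp[OF Suc.prems(3) B2(2)]])
    fix j assume "j \<in> fst B2"
    then have "\<beta>2 * cunit j 0 \<in> ghom \<delta> W (gline (snd B2 j)) B" using B2(2) by (rule column_ghom[rotated])
    moreover have "\<beta> * (\<beta>2 * cunit j 0) = 0" using B2(3) by (simp flip: mult.assoc)
    ultimately obtain a where "a \<in> ghom \<delta> W (gline (snd B2 j)) A" "\<theta> * (\<beta>2 * cunit j 0) = \<alpha> * a"
      using Suc.prems(4) by blast
    then show "\<exists>v\<in>ghom \<delta> W (gline (snd B2 j)) A. \<alpha> * v = \<theta> * \<beta>2 * cunit j 0"
      by (metis mult.assoc)
  qed
  then obtain \<theta>2 where \<theta>2: "\<theta>2 \<in> ghom \<delta> W B2 A" "\<alpha> * \<theta>2 = \<theta> * \<beta>2" by blast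
  let ?\<kappa> = "s0 * \<alpha> * r0 + s0 * \<theta> * r1 + s1 * \<beta> * r1"
  let ?\<kappa>2 = "s0 * \<alpha>2 * r0 + s0 * (- \<theta>2) * r1 + s1 * \<beta>2 * r1"
  have res: "gres \<delta> W n (gsum A2 B2) ?\<kappa>2"
  proof (rule Suc.IH[OF A2(5) B2(5)])
    show "- \<theta>2 \<in> ghom \<delta> W B2 A" using \<theta>2(1) by simp
    fix D v assume v: "v \<in> ghom \<delta> W (gline D) B2" "\<beta>2 * v = 0"
    have "\<alpha> * (\<theta>2 * v) = \<theta> * (\<beta>2 * v)" using \<theta>2(2) by (simp flip: mult.assoc)
    then obtain a where "a \<in> ghom \<delta> W (gline D) A2" "\<theta>2 * v = \<alpha>2 * a"
      using A2(4)[of "\<theta>2 * v" D] v ghom_comp[OF \<theta>2(1) v(1)] by auto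
    then show "\<exists>a\<in>ghom \<delta> W (gline D) A2. - \<theta>2 * v = \<alpha>2 * a"
      by (intro bexI[of _ "- a"]) auto
  qed
  have in2: "?\<kappa>2 \<in> ghom \<delta> W (gsum A2 B2) (gsum A B)"
    unfolding mult.assoc by (intro ghom_add ghom_gsum(1,2)) (use A2(2) B2(2) \<theta>2(1) in auto)
  have "?\<kappa> * ?\<kappa>2 = s0 * (\<alpha> * \<alpha>2) * r0 + s0 * (\<theta> * \<beta>2 - \<alpha> * \<theta>2) * r1 + s1 * (\<beta> * \<beta>2) * r1"
    by (simp add: ring_distribs mult.assoc)
  then have zero: "?\<kappa> * ?\<kappa>2 = 0" using A2(3) B2(3) \<theta>2(2) by simp
  have ex: "\<exists>v'\<in>ghom \<delta> W (gline D) (gsum A2 B2). v = ?\<kappa>2 * v'"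
    if v: "v \<in> ghom \<delta> W (gline D) (gsum A B)" and *: "?\<kappa> * v = 0" for D v
  proof -
    have "r1 * (?\<kappa> * v) = \<beta> * (r1 * v)" "r0 * (?\<kappa> * v) = \<alpha> * (r0 * v) + \<theta> * (r1 * v)"
      by (simp_all add: ring_distribs mult.assoc)
    then have 1: "\<beta> * (r1 * v) = 0" "\<alpha> * (r0 * v) + \<theta> * (r1 * v) = 0" unfolding * by simp_all
    then obtain b where b: "b \<in> ghom \<delta> W (gline D) B2" "r1 * v = \<beta>2 * b"
      using B2(4)[of "r1 * v" D] v by (auto intro: ghom_gsum)
    have "\<alpha> * (r0 * v + \<theta>2 * b) = \<alpha> * (r0 * v) + \<theta> * (r1 * v)"
      using \<theta>2(2) b(2) by (simp add: ring_distribs flip: mult.assoc)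
    moreover have "r0 * v + \<theta>2 * b \<in> ghom \<delta> W (gline D) A"
      using v b(1) \<theta>2(1) by (auto intro!: ghom_add ghom_gsum ghom_comp)
    ultimately obtain a where a: "a \<in> ghom \<delta> W (gline D) A2" "r0 * v + \<theta>2 * b = \<alpha>2 * a"
      using A2(4) 1 by metis
    have "v = s0 * (r0 * v) + s1 * (r1 * v)" by (simp add: leavitt_split)
    also have "r0 * v = \<alpha>2 * a - \<theta>2 * b" using a(2) by (simp add: algebra_simps)
    also have "s0 * (\<alpha>2 * a - \<theta>2 * b) + s1 * (r1 * v) = ?\<kappa>2 * (s0 * a + s1 * b)"
      unfolding b(2) by (simp add: ring_distribs mult.assoc)
    finally have "v = ?\<kappa>2 * (s0 * a + s1 * b)" .
    moreover have "s0 * a + s1 * b \<in> ghom \<delta> W (gline D) (gsum A2 B2)"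
      using a(1) b(1) by (auto intro!: ghom_add ghom_gsum)
    ultimately show ?thesis by blast
  qed
  show ?case
    by (subst gres.simps, intro exI[of _ "gsum A2 B2"] exI[of _ ?\<kappa>2])
       (use in2 zero res ex in \<open>auto simp: finite_gsum A2(1) B2(1) simp del: gres.simps\<close>)
qed

lemma gsub_uminus: "gsub \<delta> W P L \<Longrightarrow> v \<in> L D \<Longrightarrow> - v \<in> L D"
proof -
  assume "gsub \<delta> W P L" "v \<in> L D"
  then have "scal (const (- 1)) * v \<in> L (D - 0)" unfolding gsub_def using hmg_const by blast
  moreover have "scal (const (- 1)) * v = - v" by (rule cmat_eqI) (simp add: single_uminus)
  ultimately show "- v \<in> L D" by simp
qed

lemma gsub_add: "gsub \<delta> W P L \<Longrightarrow> u \<in> L D \<Longrightarrow> v \<in> L D \<Longrightarrow> u + v \<in> L D"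
  by (auto simp: gsub_def)

lemma gsub_scal: "gsub \<delta> W P L \<Longrightarrow> p \<in> hmg \<delta> W e \<Longrightarrow> v \<in> L D \<Longrightarrow> D' = D - e \<Longrightarrow> scal p * v \<in> L D'"
  by (auto simp: gsub_def)

lemma gsub_diff: "gsub \<delta> W P L \<Longrightarrow> u \<in> L D \<Longrightarrow> v \<in> L D \<Longrightarrow> u - v \<in> L D"
  using gsub_add[of \<delta> W P L u D "- v"] gsub_uminus[of \<delta> W P L v D] by simp

lemma gsub_ghom: "gsub \<delta> W P L \<Longrightarrow> v \<in> L D \<Longrightarrow> v \<in> ghom \<delta> W (gline D) P"
  by (auto simp: gsub_def)

lemma gsub_0: "gsub \<delta> W P L \<Longrightarrow> 0 \<in> L D"
  by (auto simp: gsub_def)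

lemma gsub_comp:
  assumes L: "gsub \<delta> W P L" and fin: "finite (fst A)" and v: "v \<in> ghom \<delta> W (gline D) A"
    and col: "\<And>j. j \<in> fst A \<Longrightarrow> \<alpha> * cunit j 0 \<in> L (snd A j)"
  shows "\<alpha> * v \<in> L D"
proof -
  have "\<alpha> * v = (\<Sum>j\<in>fst A. scal (ent v j 0) * (\<alpha> * cunit j 0))"
  proof (rule cmat_eqI)
    fix i k
    have "ent (\<alpha> * v) i k = (\<Sum>j\<in>fst A. ent \<alpha> i j * ent v j k)"
      by (rule ent_mult_superset[OF fin]) (use ghomD1[OF v] in auto)
    then show "ent (\<alpha> * v) i k = ent (\<Sum>j\<in>fst A. scal (ent v j 0) * (\<alpha> * cunit j 0)) i k"
      using ghom_gline_ent[OF v] by (auto simp: ent_sum mult.commute intro!: sum.cong)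
  qed
  also have "\<dots> \<in> L D"
  proof -
    have "finite B \<Longrightarrow> B \<subseteq> fst A \<Longrightarrow> (\<Sum>j\<in>B. scal (ent v j 0) * (\<alpha> * cunit j 0)) \<in> L D" for B
    proof (induction B rule: finite_induct)
      case (insert j B)
      have "ent v j 0 \<in> hmg \<delta> W (snd A j - D)" using ghomD[OF v, of j 0] by (simp add: gline_def)
      then have "scal (ent v j 0) * (\<alpha> * cunit j 0) \<in> L D"
        by (rule gsub_scal[OF L]) (use insert col in auto)
      then show ?case using insert by (auto intro: gsub_add[OF L])
    qed (auto simp: gsub_0[OF L])
    then show ?thesis using fin by blast
  qed
  finally show ?thesis .
qed

lemma gcover_lift:
  assumes "gcover \<delta> W P L A \<alpha>" "C \<in> ghom \<delta> W X P" "\<And>j. j \<in> fst X \<Longrightarrow> C * cunit j 0 \<in> L (snd X j)"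
  shows "\<exists>D\<in>ghom \<delta> W X A. \<alpha> * D = C"
proof (rule ghom_lift[OF assms(2)])
  fix j assume "j \<in> fst X"
  then show "\<exists>v\<in>ghom \<delta> W (gline (snd X j)) A. \<alpha> * v = C * cunit j 0"
    using assms(1,3) unfolding gcover_def by metis
qed

definition resolvable :: "(nat \<Rightarrow> int) \<Rightarrow> nat set \<Rightarrow> bool" where
  "resolvable \<delta> W \<longleftrightarrow> (\<forall>P L. finite (fst P) \<longrightarrow> gsub \<delta> W P L \<longrightarrow>
     (\<exists>A \<alpha> n. gcover \<delta> W P L A \<alpha> \<and> gres \<delta> W n A \<alpha>))"

text \<open>
  Without variables this is Gaussian elimination: either the last coordinate vanishes on \<open>L\<close>, or a homogeneous
  vector with last coordinate \<open>1\<close> reduces all others to vectors whose last coordinate vanishes.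
\<close>

lemma resolvable_field_aux:
  assumes "finite I" "gsub \<delta> {} (I, w) L"
  shows "\<exists>A \<alpha>. gcover \<delta> {} (I, w) L A \<alpha> \<and> gres \<delta> {} 0 A \<alpha>"
  using assms
proof (induction I arbitrary: L rule: finite_induct)
  case empty
  have "u = 0" if "u \<in> L D" for u D
    using gsub_ghom[OF empty that] by (auto intro!: cmat_eqI simp: ghom_def)
  then show ?case
    by (intro exI[of _ gzero] exI[of _ 0])
       (auto simp: gcover_def finite_gzero dest: ghom_gline_zero intro: bexI[of _ 0])
next
  case (insert i I L)
  note L = insert.prems
  show ?case
  proof (cases "\<forall>D. \<forall>v\<in>L D. ent v i 0 = 0")
    case True
    have "v \<in> ghom \<delta> {} (gline D) (I, w)" if "v \<in> L D" for v D
      using gsub_ghom[OF L that] True that ghom_gline_ent[OF gsub_ghom[OF L that]]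
      by (auto simp: ghom_def gline_def)
    then have "gsub \<delta> {} (I, w) L" using L by (auto simp: gsub_def)
    then obtain A \<alpha> where "gcover \<delta> {} (I, w) L A \<alpha>" "gres \<delta> {} 0 A \<alpha>" using insert.IH by blast
    moreover from this(1) have "gcover \<delta> {} (insert i I, w) L A \<alpha>" by (auto simp: gcover_def ghom_def)
    ultimately show ?thesis by blast
  next
    case False
    then obtain D0 u0 where u0: "u0 \<in> L D0" "ent u0 i 0 \<noteq> 0" by blast
    have "ent u0 i 0 \<in> hmg \<delta> {} (w i - D0)" using ghomD[OF gsub_ghom[OF L u0(1)], of i 0] by (simp add: gline_def)
    then obtain c where c: "ent u0 i 0 = const c" "c \<noteq> 0" "D0 = w i" using u0(2) hmg_empty by fastforce
    define v0 where "v0 = scal (const (1 / c)) * u0"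
    have v0: "v0 \<in> L (w i)" "ent v0 i 0 = 1"
      using gsub_scal[OF L hmg_const u0(1), of D0] c by (auto simp: v0_def mult_single)
    define L' where "L' D = {v \<in> L D. ent v i 0 = 0}" for D
    have "v \<in> ghom \<delta> {} (gline D) (I, w)" if "v \<in> L' D" for v D
    proof -
      have "v \<in> L D" "ent v i 0 = 0" using that by (auto simp: L'_def)
      then show ?thesis using gsub_ghom[OF L] ghom_gline_ent[OF gsub_ghom[OF L]]
        by (auto simp: ghom_def gline_def)
    qed
    then have L': "gsub \<delta> {} (I, w) L'" using L by (auto simp: gsub_def L'_def)
    then obtain A \<alpha> where A: "gcover \<delta> {} (I, w) L' A \<alpha>" and res: "gres \<delta> {} 0 A \<alpha>" using insert.IH by blast
    have fin: "finite (fst A)" and \<alpha>: "\<alpha> \<in> ghom \<delta> {} A (I, w)" using A by (auto simp: gcover_def)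
    obtain n where n: "n \<notin> fst A" using fin by (meson ex_new_if_finite infinite_UNIV_nat)
    define A' :: gmod where "A' = (insert n (fst A), (snd A)(n := w i))"
    define \<alpha>' where "\<alpha>' = \<alpha> + v0 * cunit 0 n"
    have v0g: "v0 \<in> ghom \<delta> {} (gline (w i)) (insert i I, w)" using gsub_ghom[OF L v0(1)] .
    have \<alpha>n: "ent \<alpha> k n = 0" for k using ghomD2[OF \<alpha>] n by blast
    have col: "\<alpha>' * cunit n 0 = v0" "j \<in> fst A \<Longrightarrow> \<alpha>' * cunit j 0 = \<alpha> * cunit j 0" for j
      using n ghom_gline_ent[OF v0g] by (auto intro!: cmat_eqI simp: \<alpha>'_def \<alpha>n)
    have \<alpha>': "\<alpha>' \<in> ghom \<delta> {} A' (insert i I, w)"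
      unfolding \<alpha>'_def
    proof (rule ghom_add)
      show "\<alpha> \<in> ghom \<delta> {} A' (insert i I, w)"
        using \<alpha> n \<alpha>n by (auto simp: ghom_def A'_def)
      show "v0 * cunit 0 n \<in> ghom \<delta> {} A' (insert i I, w)"
        using v0g by (auto simp: ghom_def A'_def gline_def)
    qed
    have "gcover \<delta> {} (insert i I, w) L A' \<alpha>'"
      unfolding gcover_def
    proof (intro conjI ballI allI \<alpha>')
      show "finite (fst A')" using fin by (simp add: A'_def)
      fix j assume "j \<in> fst A'"
      then show "\<alpha>' * cunit j 0 \<in> L (snd A' j)"
        using col A v0(1) n by (auto simp: A'_def gcover_def L'_def)
    next
      fix D u assume u: "u \<in> L D"
      have ug: "u \<in> ghom \<delta> {} (gline D) (insert i I, w)" using gsub_ghom[OF L u] .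
      have "ent u i 0 \<in> hmg \<delta> {} (w i - D)" using ghomD[OF ug, of i 0] by (simp add: gline_def)
      then obtain c where c: "ent u i 0 = const c" "c = 0 \<or> w i = D" using hmg_empty by fastforce
      have "scal (const c) * v0 \<in> L D"
      proof (cases "c = 0")
        case True
        then have "scal (const c) * v0 = 0" by (intro cmat_eqI) simp
        then show ?thesis using gsub_0[OF L] by simp
      next
        case False
        then show ?thesis using c(2) gsub_scal[OF L hmg_const v0(1), of D c] by simp
      qed
      then have "u - scal (const c) * v0 \<in> L' D"
        using u c v0 by (auto simp: L'_def intro: gsub_diff[OF L])
      then obtain a where a: "a \<in> ghom \<delta> {} (gline D) A" "u - scal (const c) * v0 = \<alpha> * a"
        using A unfolding gcover_def by blast
      have an: "ent a n k = 0" for k using ghomD1[OF a(1)] n by blast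
      have "cunit 0 n * a = 0"
        by (rule cmat_eqI) (auto simp: ent_mult an intro!: sum.neutral)
      have "\<alpha>' * (a + scal (const c) * cunit n 0) = \<alpha> * a + v0 * (cunit 0 n * a) + scal (const c) * (\<alpha>' * cunit n 0)"
        by (simp add: \<alpha>'_def ring_distribs mult.assoc scal_comm2)
      also have "\<dots> = u" unfolding col \<open>cunit 0 n * a = 0\<close> a(2)[symmetric] by simp
      finally have "u = \<alpha>' * (a + scal (const c) * cunit n 0)" ..
      moreover have "a + scal (const c) * cunit n 0 \<in> ghom \<delta> {} (gline D) A'"
      proof (rule ghom_add)
        show "a \<in> ghom \<delta> {} (gline D) A'"
        proof (rule ghomI)
          fix k j assume nz: "ent a k j \<noteq> 0"
          then show "k \<in> fst A' \<and> j \<in> fst (gline D) \<and> ent a k j \<in> hmg \<delta> {} (snd A' k - snd (gline D) j)"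
            using ghomD[OF a(1), of k j] ghomD1[OF a(1) nz] ghomD2[OF a(1) nz] n by (auto simp: A'_def)
        qed
        show "scal (const c) * cunit n 0 \<in> ghom \<delta> {} (gline D) A'"
        proof (cases "c = 0")
          case True
          then have "scal (const c) * cunit n 0 = 0" by (intro cmat_eqI) simp
          then show ?thesis by simp
        next
          case False
          have "cunit n 0 \<in> ghom \<delta> {} (gline D) A'"
            by (rule ghom_cunit) (use False c(2) in \<open>auto simp: A'_def\<close>)
          then show ?thesis by (rule ghom_scal[OF _ hmg_const]) auto
        qed
      qed
      ultimately show "\<exists>v\<in>ghom \<delta> {} (gline D) A'. u = \<alpha>' * v" by blast
    qed
    moreover have "gres \<delta> {} 0 A' \<alpha>'"
      unfolding gres.simps
    proof (intro allI ballI impI)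
      fix D v assume v: "v \<in> ghom \<delta> {} (gline D) A'" "\<alpha>' * v = 0"
      have vn: "ent (v0 * cunit 0 n * v) k 0 = ent v0 k 0 * ent v n 0" for k
        by (subst ent_mult_superset[of "insert n (fst A)"])
           (use ghomD1[OF v(1)] fin n in \<open>auto simp: A'_def if_distrib[of "\<lambda>x. x * _"] sum.delta cong: if_cong\<close>)
      have "ent \<alpha> i k = 0" for k using ghomD1[OF \<alpha>, of i k] insert.hyps by auto
      then have "ent (\<alpha> * v) i 0 = 0" by (simp add: ent_mult)
      then have "ent (\<alpha>' * v) i 0 = ent v n 0" using vn[of i] v0(2) by (simp add: \<alpha>'_def ring_distribs)
      then have 0: "ent v n 0 = 0" using v(2) by simp
      have "v0 * cunit 0 n * v = 0"
      proof (rule cmat_eqI)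
        fix k l
        show "ent (v0 * cunit 0 n * v) k l = ent 0 k l"
          using vn[of k] 0 ghom_gline_ent[OF v(1)] by (cases "l = 0") (auto simp: ent_mult)
      qed
      then have "\<alpha> * v = 0" using v(2) by (simp add: \<alpha>'_def ring_distribs)
      moreover have "v \<in> ghom \<delta> {} (gline D) A"
      proof (intro ghomI)
        fix k j assume nz: "ent v k j \<noteq> 0"
        then have "k \<noteq> n" "j = 0" using 0 ghom_gline_ent[OF v(1)] by metis+
        then show "k \<in> fst A \<and> j \<in> fst (gline D) \<and> ent v k j \<in> hmg \<delta> {} (snd A k - snd (gline D) j)"
          using ghomD[OF v(1), of k j] ghomD1[OF v(1) nz] by (simp add: A'_def gline_def)
      qed
      ultimately show "v = 0" using res by simp
    qed
    ultimately show ?thesis by blast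
  qed
qed

lemma resolvable_field: "resolvable \<delta> {}"
  unfolding resolvable_def using resolvable_field_aux by (metis prod.collapse)

lemma cmap_coef_mult:
  assumes "a \<in> ghom \<delta> W X Y" "t \<notin> W"
  shows "cmap (coef t k) (a * b) = a * cmap (coef t k) b"
  by (rule cmap_free_mult)
     (auto simp: coef_add intro!: coef_mult_free[OF hmg_poly_ring[OF ghomD[OF assms(1)]] assms(2)])

lemma coef_ghom:
  assumes "v \<in> ghom \<delta> (insert t W) (gline D) X" "t \<notin> W" "D' = D + \<delta> t * int k"
  shows "cmap (coef t k) v \<in> ghom \<delta> W (gline D') X"
proof (rule ghomI)
  fix i j assume "ent (cmap (coef t k) v) i j \<noteq> 0"
  then have "ent v i j \<noteq> 0" by (auto simp: ent_cmap)
  then have "i \<in> fst X" "j = 0" using assms(1) by (auto simp: ghom_def gline_def)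
  moreover have "coef t k (ent v i j) \<in> hmg \<delta> W (snd X i - D - \<delta> t * int k)"
    by (rule coef_hmg[OF _ assms(2)]) (use ghomD[OF assms(1), of i j] in \<open>simp add: gline_def\<close>)
  ultimately show "i \<in> fst X \<and> j \<in> fst (gline D') \<and> ent (cmap (coef t k) v) i j \<in> hmg \<delta> W (snd X i - snd (gline D') j)"
    using assms(3) by (simp add: gline_def ent_cmap diff_diff_eq)
qed

definition tdeg :: "nat \<Rightarrow> nat \<Rightarrow> mpoly cmat \<Rightarrow> bool" where
  "tdeg t K v \<longleftrightarrow> (\<forall>k>K. cmap (coef t k) v = 0)"

lemma tdegD: "tdeg t K v \<Longrightarrow> k > K \<Longrightarrow> coef t k (ent v i j) = 0"
  unfolding tdeg_def by (metis coef_0 ent_0 ent_cmap)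

lemma cmap_coef_diff: "cmap (coef t k) (a - b) = cmap (coef t k) a - cmap (coef t k) b"
  by (rule cmat_eqI) (simp add: ent_cmap coef_diff)

lemma cmap_coef_add: "cmap (coef t k) (a + b) = cmap (coef t k) a + cmap (coef t k) b"
  by (rule cmat_eqI) (simp add: ent_cmap coef_add)

lemma cmap_coef_power:
  "cmap (coef t k) (scal (var t ^ j) * a) = (if j \<le> k then cmap (coef t (k - j)) a else 0)"
  by (rule cmat_eqI) (simp add: ent_cmap coef_var_mult)

lemma cmap_coef_free:
  assumes "a \<in> ghom \<delta> W X Y" "t \<notin> W"
  shows "cmap (coef t k) a = (if k = 0 then a else 0)"
  by (rule cmat_eqI) (simp add: ent_cmap coef_free[OF hmg_poly_ring[OF ghomD[OF assms(1)]] assms(2)])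

lemma tdeg_expand: "tdeg t K v \<Longrightarrow> v = (\<Sum>k\<le>K. scal (var t ^ k) * cmap (coef t k) v)"
  by (rule cmat_eqI) (simp add: ent_sum ent_cmap coef_expand[symmetric] tdegD)

lemma tdeg_bounded:
  assumes "v \<in> ghom \<delta> W (gline D) X" "finite (fst X)"
  shows "\<exists>K. tdeg t K v"
proof -
  obtain K where K: "\<And>i k. k > K i \<Longrightarrow> coef t k (ent v i 0) = 0" using coef_bounded[of t "ent v _ 0"] by metis
  show ?thesis
  proof (intro exI[of _ "Max (insert 0 (K ` fst X))"], unfold tdeg_def, intro allI impI cmat_eqI)
    fix k i j assume k: "k > Max (insert 0 (K ` fst X))"
    show "ent (cmap (coef t k) v) i j = ent 0 i j"
    proof (cases "ent v i j = 0")
      case False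
      then have "j = 0" "i \<in> fst X" using assms(1) by (auto simp: ghom_def gline_def)
      moreover from this have "k > K i" using k assms(2) by simp
      ultimately show ?thesis using K by (simp add: ent_cmap)
    qed (simp add: ent_cmap)
  qed
qed

text \<open>
  Polynomials in \<open>t\<close> form a free module over the smaller ring, so that exactness can be tested separately on the
  coefficients of the powers of \<open>t\<close>.
\<close>

lemma gres_base_change:
  assumes "gres \<delta> W n X d" "d \<in> ghom \<delta> W X Y" "t \<notin> W" "finite (fst X)"
  shows "gres \<delta> (insert t W) n X d"
  using assms
proof (induction n arbitrary: X d Y)
  case (0 X d)
  show ?case unfolding gres.simps
  proof (intro allI ballI impI)
    fix D v assume v: "v \<in> ghom \<delta> (insert t W) (gline D) X" "d * v = 0"
    have "cmap (coef t k) v = 0" for k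
    proof -
      have "d * cmap (coef t k) v = cmap (coef t k) (d * v)"
        by (rule cmap_coef_mult[symmetric, OF 0(2,3)])
      also have "\<dots> = 0" unfolding v(2) by (rule cmat_eqI) (simp add: ent_cmap)
      finally show ?thesis using 0(1) coef_ghom[OF v(1) 0(3) refl] by auto
    qed
    then show "v = 0" using tdeg_expand[of t 0 v] by (simp add: tdeg_def)
  qed
next
  case (Suc n X d)
  then obtain Z d2 where *: "finite (fst Z)" "d2 \<in> ghom \<delta> W Z X" "d * d2 = 0"
    "\<And>D v. v \<in> ghom \<delta> W (gline D) X \<Longrightarrow> d * v = 0 \<Longrightarrow> \<exists>v'\<in>ghom \<delta> W (gline D) Z. v = d2 * v'" "gres \<delta> W n Z d2"
    by auto
  have "\<exists>v'\<in>ghom \<delta> (insert t W) (gline D) Z. v = d2 * v'"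
    if v: "v \<in> ghom \<delta> (insert t W) (gline D) X" "d * v = 0" for D v
  proof -
    obtain K where K: "tdeg t K v" using tdeg_bounded[OF v(1) Suc.prems(4)] by blast
    have "\<exists>v'\<in>ghom \<delta> W (gline (D + \<delta> t * int k)) Z. cmap (coef t k) v = d2 * v'" for k
    proof (rule *(4)[OF coef_ghom[OF v(1) Suc.prems(3) refl]])
      have "d * cmap (coef t k) v = cmap (coef t k) (d * v)"
        by (rule cmap_coef_mult[symmetric, OF Suc.prems(2,3)])
      also have "\<dots> = 0" unfolding v(2) by (rule cmat_eqI) (simp add: ent_cmap)
      finally show "d * cmap (coef t k) v = 0" .
    qed
    then obtain u where u: "u k \<in> ghom \<delta> W (gline (D + \<delta> t * int k)) Z" "cmap (coef t k) v = d2 * u k" for k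
      by metis
    have "v = (\<Sum>k\<le>K. scal (var t ^ k) * cmap (coef t k) v)" by (rule tdeg_expand[OF K])
    also have "\<dots> = d2 * (\<Sum>k\<le>K. scal (var t ^ k) * u k)"
      by (simp add: u(2) sum_distrib_left scal_comm2)
    finally have "v = d2 * (\<Sum>k\<le>K. scal (var t ^ k) * u k)" .
    moreover have "(\<Sum>k\<le>K. scal (var t ^ k) * u k) \<in> ghom \<delta> (insert t W) (gline D) Z"
      by (intro ghom_sum ghom_scal[OF ghom_mono[OF u(1)] hmg_var_power[OF _ refl]]) (auto simp: gline_def)
    ultimately show ?thesis by blast
  qed
  moreover have "gres \<delta> (insert t W) n Z d2"
    by (rule Suc.IH[OF *(5) *(2) Suc.prems(3) *(1)])
  ultimately show ?case using * ghom_mono[OF *(2), of "insert t W"] by (subst gres.simps) blast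
qed

locale adjoin =
  fixes \<delta> :: "nat \<Rightarrow> int" and W :: "nat set" and t :: nat and P :: gmod and L :: "int \<Rightarrow> mpoly cmat set"
  assumes t: "t \<notin> W" and res: "resolvable \<delta> W" and finP: "finite (fst P)" and L: "gsub \<delta> (insert t W) P L"
begin

abbreviation "W' \<equiv> insert t W"
abbreviation "dt \<equiv> \<delta> t"

text \<open>Elements of \<open>P\<close> of \<open>t\<close>-degree at most \<open>p\<close> form the free module \<open>trunc p\<close> over the smaller ring.\<close>

definition trunc :: "nat \<Rightarrow> gmod" where
  "trunc p = (prod_encode ` (fst P \<times> {..p}), \<lambda>n. case prod_decode n of (i, k) \<Rightarrow> snd P i - dt * int k)"

definition unpack :: "nat \<Rightarrow> mpoly cmat" where
  "unpack p = CMat (\<lambda>i n. case prod_decode n of (i', k) \<Rightarrow> if i = i' \<and> i \<in> fst P \<and> k \<le> p then var t ^ k else 0)"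

definition pack :: "nat \<Rightarrow> mpoly cmat \<Rightarrow> mpoly cmat" where
  "pack p v = CMat (\<lambda>n j. case prod_decode n of (i, k) \<Rightarrow> if i \<in> fst P \<and> k \<le> p then coef t k (ent v i j) else 0)"

definition shift :: "nat \<Rightarrow> mpoly cmat" where
  "shift p = CMat (\<lambda>m n. case prod_decode n of (i, k) \<Rightarrow> if i \<in> fst P \<and> k < p \<and> m = prod_encode (i, Suc k) then 1 else 0)"

lemma finite_trunc: "finite (fst (trunc p))" by (simp add: trunc_def finP)

lemma in_trunc: "prod_encode (i, k) \<in> fst (trunc p) \<longleftrightarrow> i \<in> fst P \<and> k \<le> p"
  by (auto simp: trunc_def prod_encode_eq)

lemma ent_unpack: "ent (unpack p) i (prod_encode (i', k)) = (if i = i' \<and> i \<in> fst P \<and> k \<le> p then var t ^ k else 0)"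
  unfolding unpack_def
  by (subst ent_CMat_within[where S = "\<lambda>n. {fst (prod_decode n)}"]) (auto split: if_splits prod.splits)

lemma ent_pack: "ent (pack p v) (prod_encode (i, k)) j = (if i \<in> fst P \<and> k \<le> p then coef t k (ent v i j) else 0)"
  unfolding pack_def
proof (subst ent_CMat_within[where S = "\<lambda>n. prod_encode ` (fst P \<times> {..p})"])
  fix n j assume *: "(case prod_decode n of (i, k) \<Rightarrow> if i \<in> fst P \<and> k \<le> p then coef t k (ent v i j) else 0) \<noteq> 0"
  obtain i k where n: "n = prod_encode (i, k)" by (metis prod_decode_inverse surj_pair)
  show "n \<in> prod_encode ` (fst P \<times> {..p})" using * by (auto simp: n split: if_splits)
qed (auto simp: finP)

lemma ent_shift: "ent (shift p) m (prod_encode (i, k)) = (if i \<in> fst P \<and> k < p \<and> m = prod_encode (i, Suc k) then 1 else 0)"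
  unfolding shift_def
  by (subst ent_CMat_within[where S = "\<lambda>n. {prod_encode (fst (prod_decode n), Suc (snd (prod_decode n)))}"])
     (auto split: if_splits prod.splits)

lemma cmat_eqI_rows: "(\<And>i k j. ent a (prod_encode (i, k)) j = ent b (prod_encode (i, k)) j) \<Longrightarrow> a = b"
  by (rule cmat_eqI) (metis prod_decode_inverse surj_pair)

lemma ent_shift_mult:
  "ent (shift p * c) (prod_encode (i, k)) j =
    (case k of 0 \<Rightarrow> 0 | Suc k' \<Rightarrow> if i \<in> fst P \<and> k \<le> p then ent c (prod_encode (i, k')) j else 0)"
proof (cases k)
  case 0
  have "ent (shift p) (prod_encode (i, 0)) n = 0" for n
    by (metis (no_types) ent_shift prod_decode_inverse surj_pair prod_encode_eq prod.inject nat.distinct(1))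
  then show ?thesis using 0 by (simp add: ent_mult)
next
  case (Suc k')
  have *: "ent (shift p) (prod_encode (i, Suc k')) n = (if n = prod_encode (i, k') then (if i \<in> fst P \<and> k \<le> p then 1 else 0) else 0)" for n
  proof -
    obtain i'' k'' where n: "n = prod_encode (i'', k'')" by (metis prod_decode_inverse surj_pair)
    show ?thesis unfolding n by (auto simp: ent_shift prod_encode_eq Suc)
  qed
  have "ent (shift p * c) (prod_encode (i, Suc k')) j =
     (\<Sum>n | ent c n j \<noteq> 0. if n = prod_encode (i, k') then (if i \<in> fst P \<and> k \<le> p then ent c n j else 0) else 0)"
    unfolding ent_mult by (rule sum.cong) (auto simp: *)
  then show ?thesis using Suc by (auto simp: sum.delta finite_col)
qed

lemma ent_unpack_mult:
  assumes "\<And>n j. ent c n j \<noteq> 0 \<Longrightarrow> n \<in> fst (trunc p)"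
  shows "ent (unpack p * c) i j = (if i \<in> fst P then \<Sum>k\<le>p. var t ^ k * ent c (prod_encode (i, k)) j else 0)"
proof -
  have "ent (unpack p * c) i j = (\<Sum>n\<in>fst (trunc p). ent (unpack p) i n * ent c n j)"
    by (rule ent_mult_superset[OF finite_trunc assms])
  also have "\<dots> = (\<Sum>x\<in>fst P \<times> {..p}. ent (unpack p) i (prod_encode x) * ent c (prod_encode x) j)"
    by (simp add: trunc_def sum.reindex inj_on_def prod_encode_eq)
  also have "\<dots> = (\<Sum>i'\<in>fst P. if i' = i then \<Sum>k\<le>p. var t ^ k * ent c (prod_encode (i, k)) j else 0)"
    unfolding sum.cartesian_product' by (intro sum.cong refl) (auto simp: ent_unpack)
  also have "\<dots> = (if i \<in> fst P then \<Sum>k\<le>p. var t ^ k * ent c (prod_encode (i, k)) j else 0)"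
    by (simp add: sum.delta finP)
  finally show ?thesis .
qed

lemma unpack_ghom: "unpack p \<in> ghom \<delta> W' (trunc p) P"
proof (rule ghomI)
  fix i n assume nz: "ent (unpack p) i n \<noteq> 0"
  obtain i' k where n: "n = prod_encode (i', k)" by (metis prod_decode_inverse surj_pair)
  have *: "i' = i" "i \<in> fst P" "k \<le> p" using nz unfolding n ent_unpack by (auto split: if_splits)
  then show "i \<in> fst P \<and> n \<in> fst (trunc p) \<and> ent (unpack p) i n \<in> hmg \<delta> W' (snd P i - snd (trunc p) n)"
    unfolding n ent_unpack by (auto simp: trunc_def intro!: hmg_var_power)
qed

lemma coef_unpack:
  assumes "c \<in> ghom \<delta> W (gline D) (trunc p)"
  shows "coef t k (ent (unpack p * c) i 0) = (if i \<in> fst P \<and> k \<le> p then ent c (prod_encode (i, k)) 0 else 0)"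
proof -
  have "coef t k (var t ^ k' * ent c n 0) = (if k' = k then ent c n 0 else 0)" for k' n
    using coef_free[OF hmg_poly_ring[OF ghomD[OF assms]] t] by (auto simp: coef_var_mult)
  then show ?thesis
    using ghomD1[OF assms] by (subst ent_unpack_mult) (auto simp: coef_sum)
qed

lemma unpack_inj:
  assumes "c \<in> ghom \<delta> W (gline D) (trunc p)" "unpack p * c = 0"
  shows "c = 0"
proof (rule cmat_eqI_rows)
  fix i k j
  show "ent c (prod_encode (i, k)) j = ent 0 (prod_encode (i, k)) j"
  proof (cases "ent c (prod_encode (i, k)) j = 0")
    case False
    then have "i \<in> fst P" "k \<le> p" "j = 0"
      using ghomD1[OF assms(1)] ghomD2[OF assms(1)] by (force simp: in_trunc gline_def)+
    then show ?thesis using coef_unpack[OF assms(1), of k i] assms(2) by simp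
  qed simp
qed

lemma pack_ghom:
  assumes "v \<in> ghom \<delta> W' (gline D) P"
  shows "pack p v \<in> ghom \<delta> W (gline D) (trunc p)"
proof (rule ghomI)
  fix n j assume nz: "ent (pack p v) n j \<noteq> 0"
  obtain i k where n: "n = prod_encode (i, k)" by (metis prod_decode_inverse surj_pair)
  have *: "i \<in> fst P" "k \<le> p" "coef t k (ent v i j) \<noteq> 0" using nz unfolding n ent_pack by (auto split: if_splits)
  then have "ent v i j \<noteq> 0" by auto
  then have "j = 0" using assms by (auto simp: ghom_def gline_def)
  moreover have "coef t k (ent v i 0) \<in> hmg \<delta> W (snd P i - D - dt * int k)"
    by (rule coef_hmg[OF _ t]) (use ghomD[OF assms, of i 0] in \<open>simp add: gline_def\<close>)
  ultimately show "n \<in> fst (trunc p) \<and> j \<in> fst (gline D) \<and> ent (pack p v) n j \<in> hmg \<delta> W (snd (trunc p) n - snd (gline D) j)"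
    using * by (auto simp: n ent_pack trunc_def gline_def algebra_simps)
qed

lemma unpack_pack:
  assumes "v \<in> ghom \<delta> W' (gline D) P" "tdeg t p v"
  shows "unpack p * pack p v = v"
proof (rule cmat_eqI)
  fix i j
  have "ent (unpack p * pack p v) i j = (if i \<in> fst P then \<Sum>k\<le>p. var t ^ k * coef t k (ent v i j) else 0)"
    by (subst ent_unpack_mult) (use ghomD1[OF pack_ghom[OF assms(1)]] in \<open>auto simp: ent_pack intro!: sum.cong\<close>)
  then show "ent (unpack p * pack p v) i j = ent v i j"
    using coef_expand[of p t "ent v i j"] tdegD[OF assms(2)] ghomD1[OF assms(1), of i j] by auto
qed

lemma unpack_shift:
  assumes c: "c \<in> ghom \<delta> W X (trunc p)" and top: "\<And>i j. ent c (prod_encode (i, p)) j = 0"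
  shows "unpack p * (shift p * c) = scal (var t) * (unpack p * c)"
proof (rule cmat_eqI)
  fix i j
  have 1: "n \<in> fst (trunc p)" if "ent (shift p * c) n j \<noteq> 0" for n j
  proof -
    obtain i k where n: "n = prod_encode (i, k)" by (metis prod_decode_inverse surj_pair)
    show ?thesis using that unfolding n ent_shift_mult by (auto simp: trunc_def split: nat.splits if_splits)
  qed
  have "ent (unpack p * (shift p * c)) i j = (if i \<in> fst P then \<Sum>k\<le>p. var t ^ k * ent (shift p * c) (prod_encode (i, k)) j else 0)"
    by (rule ent_unpack_mult[OF 1])
  also have "\<dots> = (if i \<in> fst P then \<Sum>k<p. var t ^ Suc k * ent c (prod_encode (i, k)) j else 0)"
    by (cases p) (auto simp: ent_shift_mult lessThan_Suc_atMost sum.atMost_Suc_shift simp del: sum.atMost_Suc power_Suc intro!: sum.cong)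
  also have "\<dots> = var t * (if i \<in> fst P then \<Sum>k\<le>p. var t ^ k * ent c (prod_encode (i, k)) j else 0)"
    by (simp add: lessThan_Suc_atMost[symmetric] top sum_distrib_left mult_ac)
  also have "\<dots> = ent (scal (var t) * (unpack p * c)) i j"
    by (simp add: ent_unpack_mult[OF ghomD1[OF c]])
  finally show "ent (unpack p * (shift p * c)) i j = ent (scal (var t) * (unpack p * c)) i j" .
qed

definition "Lp p D = {c \<in> ghom \<delta> W (gline D) (trunc p). unpack p * c \<in> L D}"

lemma Lp: "gsub \<delta> W (trunc p) (Lp p)"
  unfolding gsub_def
proof (intro conjI allI ballI)
  fix D e q v assume "q \<in> hmg \<delta> W e" "v \<in> Lp p D"
  then show "scal q * v \<in> Lp p (D - e)"
    using gsub_scal[OF L, of q e "unpack p * v" D "D - e"] hmg_mono[of q \<delta> W e W']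
    by (auto simp: Lp_def scal_comm2 gline_def intro!: ghom_scal)
qed (auto simp: Lp_def ring_distribs intro: gsub_0[OF L] gsub_add[OF L] ghom_add)

definition "Lq p D = {c \<in> Lp p (D + dt). \<forall>i. ent c (prod_encode (i, p)) 0 = 0}"

definition "twist p = (fst (trunc p), \<lambda>n. snd (trunc p) n - dt)"

lemma ghom_twist: "c \<in> ghom \<delta> W (gline D) (twist p) \<longleftrightarrow> c \<in> ghom \<delta> W (gline (D + dt)) (trunc p)"
  by (auto simp: ghom_def twist_def gline_def algebra_simps)

lemma Lq: "gsub \<delta> W (twist p) (Lq p)"
  unfolding gsub_def
proof (intro conjI allI ballI subsetI)
  fix D e q v assume "q \<in> hmg \<delta> W e" "v \<in> Lq p D"
  then show "scal q * v \<in> Lq p (D - e)"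
    by (auto simp: Lq_def intro: gsub_scal[OF Lp])
qed (auto simp: Lq_def ghom_twist intro: gsub_0[OF Lp] gsub_add[OF Lp] gsub_ghom[OF Lp])

definition "lc p D = {l \<in> ghom \<delta> W (gline D) P. \<exists>v\<in>L (D - dt * int p). tdeg t p v \<and> l = cmap (coef t p) v}"

lemma lc: "gsub \<delta> W P (lc p)"
  unfolding gsub_def
proof (intro conjI allI ballI subsetI)
  fix D show "0 \<in> lc p D"
    by (auto simp: lc_def tdeg_def intro!: bexI[of _ 0] gsub_0[OF L] cmat_eqI simp: ent_cmap)
next
  fix D u v assume "u \<in> lc p D" "v \<in> lc p D"
  then obtain u' v' where *: "u' \<in> L (D - dt * int p)" "tdeg t p u'" "u = cmap (coef t p) u'"
    "v' \<in> L (D - dt * int p)" "tdeg t p v'" "v = cmap (coef t p) v'" "u + v \<in> ghom \<delta> W (gline D) P"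
    by (auto simp: lc_def intro: ghom_add)
  then show "u + v \<in> lc p D" unfolding lc_def
    by (auto simp: tdeg_def cmap_coef_add intro!: bexI[of _ "u' + v'"] gsub_add[OF L])
next
  fix D e q v assume q: "q \<in> hmg \<delta> W e" and "v \<in> lc p D"
  then obtain v' where v': "v \<in> ghom \<delta> W (gline D) P" "v' \<in> L (D - dt * int p)" "tdeg t p v'" "v = cmap (coef t p) v'"
    by (auto simp: lc_def)
  have *: "cmap (coef t k) (scal q * v') = scal q * cmap (coef t k) v'" for k
    by (rule cmat_eqI) (simp add: ent_cmap coef_mult_free[OF hmg_poly_ring[OF q] t])
  have "scal q * v' \<in> L (D - e - dt * int p)"
    by (rule gsub_scal[OF L hmg_mono[OF q]]) (use v' in auto)
  moreover have "scal q * v \<in> ghom \<delta> W (gline (D - e)) P"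
    by (rule ghom_scal[OF v'(1) q]) (auto simp: gline_def)
  ultimately show "scal q * v \<in> lc p (D - e)"
    using v'(3,4) by (auto simp: lc_def tdeg_def * intro!: bexI[of _ "scal q * v'"])
qed (auto simp: lc_def)

lemma lc_mono: "p \<le> p' \<Longrightarrow> lc p D \<subseteq> lc p' D"
proof
  fix l assume "p \<le> p'" "l \<in> lc p D"
  then obtain v where v: "l \<in> ghom \<delta> W (gline D) P" "v \<in> L (D - dt * int p)" "tdeg t p v" "l = cmap (coef t p) v"
    by (auto simp: lc_def)
  let ?v = "scal (var t ^ (p' - p)) * v"
  have "?v \<in> L (D - dt * int p')"
    by (rule gsub_scal[OF L hmg_var_power[OF _ refl] v(2)])
       (use \<open>p \<le> p'\<close> in \<open>auto simp: algebra_simps of_nat_diff\<close>)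
  then show "l \<in> lc p' D"
    using v \<open>p \<le> p'\<close> by (auto simp: lc_def tdeg_def cmap_coef_power intro!: bexI[of _ ?v])
qed

text \<open>
  The union of the increasing modules \<open>lc p\<close> is a graded submodule over the smaller ring, and its finitely many
  generators already lie in one of them.
\<close>

lemma lc_stationary: "\<exists>p0. \<forall>p D. lc p D \<subseteq> lc p0 D"
proof -
  define M where "M D = (\<Union>p. lc p D)" for D
  have M: "gsub \<delta> W P M" unfolding gsub_def
  proof (intro conjI allI ballI)
    fix D u v assume "u \<in> M D" "v \<in> M D"
    then obtain p p' where "u \<in> lc p D" "v \<in> lc p' D" by (auto simp: M_def)
    then have "u \<in> lc (max p p') D" "v \<in> lc (max p p') D" using lc_mono by (meson max.cobounded1 max.cobounded2 subsetD)+
    then have "u + v \<in> lc (max p p') D" by (rule gsub_add[OF lc])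
    then show "u + v \<in> M D" by (auto simp: M_def)
  next
    fix D e q v assume "q \<in> hmg \<delta> W e" "v \<in> M D"
    then obtain k where "v \<in> lc k D" by (auto simp: M_def)
    then have "scal q * v \<in> lc k (D - e)" by (rule gsub_scal[OF lc \<open>q \<in> hmg \<delta> W e\<close>]) simp
    then show "scal q * v \<in> M (D - e)" by (auto simp: M_def)
  qed (use gsub_ghom[OF lc] gsub_0[OF lc] in \<open>auto simp: M_def\<close>)
  obtain A m where A: "gcover \<delta> W P M A m" using res finP M unfolding resolvable_def by blast
  then have "\<And>j. j \<in> fst A \<Longrightarrow> \<exists>p. m * cunit j 0 \<in> lc p (snd A j)" unfolding gcover_def M_def by blast
  then obtain p where p: "\<And>j. j \<in> fst A \<Longrightarrow> m * cunit j 0 \<in> lc (p j) (snd A j)" by metis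
  define p0 where "p0 = Max (insert 0 (p ` fst A))"
  have fin: "finite (fst A)" using A by (simp add: gcover_def)
  have "l \<in> lc p0 D" if "l \<in> lc k D" for l k D
  proof -
    have "l \<in> M D" using that by (auto simp: M_def)
    then obtain v where v: "v \<in> ghom \<delta> W (gline D) A" "l = m * v" using A unfolding gcover_def by blast
    show ?thesis unfolding v(2)
    proof (rule gsub_comp[OF lc fin v(1)])
      fix j assume j: "j \<in> fst A"
      then have "p j \<le> p0" unfolding p0_def using fin by simp
      then show "m * cunit j 0 \<in> lc p0 (snd A j)" using p[OF j] lc_mono by blast
    qed
  qed
  then show ?thesis by blast
qed

end

context adjoin
begin

text \<open>
  Let \<open>L\<^sub>p\<close> be the part of \<open>L\<close> of \<open>t\<close>-degree at most \<open>p\<close>. If the leading coefficients are stationary from \<open>p\<close> on,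
  then \<open>0 \<rightarrow> L\<^bsub>p-1\<^esub>[t] \<rightarrow> L\<^sub>p[t] \<rightarrow> L \<rightarrow> 0\<close> is exact, where the first map is the difference of the
  multiplication by the adjoined variable and the multiplication by \<open>t\<close> inside \<open>L\<close>. Resolutions of \<open>L\<^bsub>p-1\<^esub>\<close> and \<open>L\<^sub>p\<close>
  over the smaller ring therefore give one of \<open>L\<close>, by base change and a mapping cone.
\<close>

lemma resolution: "\<exists>A \<alpha> n. gcover \<delta> W' P L A \<alpha> \<and> gres \<delta> W' n A \<alpha>"
proof -
  obtain p where p: "\<And>k D. lc k D \<subseteq> lc p D" using lc_stationary by blast
  obtain A \<alpha> n where A: "gcover \<delta> W (trunc p) (Lp p) A \<alpha>" and nA: "gres \<delta> W n A \<alpha>"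
    using res finite_trunc Lp unfolding resolvable_def by blast
  obtain B \<beta> m where B: "gcover \<delta> W (twist p) (Lq p) B \<beta>" and mB: "gres \<delta> W m B \<beta>"
    using res finite_trunc Lq unfolding resolvable_def by (metis fst_conv twist_def)
  define N where "N = max n m"
  have finA: "finite (fst A)" and \<alpha>: "\<alpha> \<in> ghom \<delta> W A (trunc p)"
    and Acol: "\<And>j. j \<in> fst A \<Longrightarrow> \<alpha> * cunit j 0 \<in> Lp p (snd A j)"
    and Aex: "\<And>D u. u \<in> Lp p D \<Longrightarrow> \<exists>v\<in>ghom \<delta> W (gline D) A. u = \<alpha> * v"
    using A unfolding gcover_def by blast+
  have finB: "finite (fst B)" and \<beta>: "\<beta> \<in> ghom \<delta> W B (twist p)"
    and Bcol: "\<And>j. j \<in> fst B \<Longrightarrow> \<beta> * cunit j 0 \<in> Lq p (snd B j)"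
    and Bex: "\<And>D u. u \<in> Lq p D \<Longrightarrow> \<exists>v\<in>ghom \<delta> W (gline D) B. u = \<beta> * v"
    using B unfolding gcover_def by blast+
  have "gres \<delta> W (Suc N) A \<alpha>" using gres_mono[OF nA] by (simp add: N_def del: gres.simps)
  then obtain A2 \<alpha>2 where A2: "finite (fst A2)" "\<alpha>2 \<in> ghom \<delta> W A2 A" "\<alpha> * \<alpha>2 = 0"
    "\<And>D v. v \<in> ghom \<delta> W (gline D) A \<Longrightarrow> \<alpha> * v = 0 \<Longrightarrow> \<exists>v'\<in>ghom \<delta> W (gline D) A2. v = \<alpha>2 * v'"
    "gres \<delta> W N A2 \<alpha>2" by auto
  have resB: "gres \<delta> W N B \<beta>" using gres_mono[OF mB] by (simp add: N_def)
  have W: "a \<in> ghom \<delta> W X Y \<Longrightarrow> a \<in> ghom \<delta> W' X Y" for a X Y by (rule ghom_mono) auto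

  \<comment> \<open>The inclusion of degree less than \<open>p\<close> and the multiplication by \<open>t\<close>, lifted to the covers.\<close>
  define B1 where "B1 = (fst B, \<lambda>j. snd B j + dt)"
  have \<beta>1: "\<beta> \<in> ghom \<delta> W B1 (trunc p)"
    using \<beta> by (auto simp: ghom_def B1_def twist_def algebra_simps)
  have "\<exists>J\<in>ghom \<delta> W B1 A. \<alpha> * J = \<beta>"
    by (rule gcover_lift[OF A \<beta>1]) (use Bcol in \<open>auto simp: B1_def Lq_def\<close>)
  then obtain J where J: "J \<in> ghom \<delta> W B1 A" "\<alpha> * J = \<beta>" by blast
  have \<beta>top: "ent \<beta> (prod_encode (i, p)) j = 0" for i j
  proof (cases "j \<in> fst B")
    case True
    then have "ent (\<beta> * cunit j 0) (prod_encode (i, p)) 0 = 0" using Bcol by (auto simp: Lq_def)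
    then show ?thesis by simp
  qed (use ghomD2[OF \<beta>] in auto)
  have unshift: "unpack p * (shift p * \<beta>) = scal (var t) * (unpack p * \<beta>)"
    by (rule unpack_shift[OF \<beta>1 \<beta>top])
  have "shift p * \<beta> \<in> ghom \<delta> W B (trunc p)"
  proof (rule ghomI)
    fix i j assume nz: "ent (shift p * \<beta>) i j \<noteq> 0"
    obtain i' k where i: "i = prod_encode (i', k)" by (metis prod_decode_inverse surj_pair)
    from nz obtain k' where k: "k = Suc k'" "i' \<in> fst P" "k \<le> p" "ent \<beta> (prod_encode (i', k')) j \<noteq> 0"
      unfolding i ent_shift_mult by (auto split: nat.splits if_splits)
    have "ent \<beta> (prod_encode (i', k')) j \<in> hmg \<delta> W (snd P i' - dt * int k' - dt - snd B j)"
      using ghomD[OF \<beta>, of "prod_encode (i', k')" j] by (simp add: trunc_def twist_def)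
    moreover have "ent (shift p * \<beta>) i j = ent \<beta> (prod_encode (i', k')) j"
      using k by (simp add: i ent_shift_mult)
    moreover have "snd (trunc p) i = snd P i' - dt * int k' - dt"
      by (simp add: i k trunc_def ring_distribs)
    moreover have "j \<in> fst B" using ghomD2[OF \<beta> k(4)] .
    moreover have "i \<in> fst (trunc p)" using k by (simp add: i in_trunc)
    ultimately show "i \<in> fst (trunc p) \<and> j \<in> fst B \<and> ent (shift p * \<beta>) i j \<in> hmg \<delta> W (snd (trunc p) i - snd B j)"
      by simp
  qed
  then have "\<exists>T\<in>ghom \<delta> W B A. \<alpha> * T = shift p * \<beta>"
  proof (rule gcover_lift[OF A])
    fix j assume j: "j \<in> fst B"
    then have "\<beta> * cunit j 0 \<in> Lp p (snd B j + dt)" using Bcol by (auto simp: Lq_def)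
    then have "unpack p * (\<beta> * cunit j 0) \<in> L (snd B j + dt)" by (simp add: Lp_def)
    then have "scal (var t) * (unpack p * (\<beta> * cunit j 0)) \<in> L (snd B j)"
      by (rule gsub_scal[OF L hmg_var[OF _ refl], rotated]) auto
    then have "unpack p * (shift p * \<beta> * cunit j 0) \<in> L (snd B j)"
      using arg_cong[OF unshift, of "\<lambda>x. x * cunit j 0"] by (simp add: mult.assoc)
    then show "shift p * \<beta> * cunit j 0 \<in> Lp p (snd B j)"
      using column_ghom[OF \<open>shift p * \<beta> \<in> ghom \<delta> W B (trunc p)\<close> j] by (simp add: Lp_def)
  qed
  then obtain T where T: "T \<in> ghom \<delta> W B A" "\<alpha> * T = shift p * \<beta>" by blast
  define \<theta> where "\<theta> = scal (var t) * J - T"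
  have tJ: "scal (var t) * J \<in> ghom \<delta> W' B A"
    by (rule ghom_scal[OF W[OF J(1)] hmg_var[OF _ refl]]) (auto simp: B1_def)
  then have \<theta>: "\<theta> \<in> ghom \<delta> W' B A" unfolding \<theta>_def by (rule ghom_diff[OF _ W[OF T(1)]])
  define \<gamma> where "\<gamma> = unpack p * \<alpha>"
  have \<gamma>: "\<gamma> \<in> ghom \<delta> W' A P" unfolding \<gamma>_def by (rule ghom_comp[OF unpack_ghom W[OF \<alpha>]])
  have \<alpha>\<theta>: "\<alpha> * \<theta> = scal (var t) * \<beta> - shift p * \<beta>"
    by (simp add: \<theta>_def ring_distribs scal_comm2 J T)
  have "\<gamma> * \<theta> = scal (var t) * (unpack p * \<beta>) - unpack p * (shift p * \<beta>)"
    by (simp add: \<gamma>_def mult.assoc \<alpha>\<theta> ring_distribs scal_comm2)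
  then have \<gamma>\<theta>: "\<gamma> * \<theta> = 0" by (simp add: unshift)
  have \<gamma>\<alpha>2: "\<gamma> * \<alpha>2 = 0" by (simp add: \<gamma>_def mult.assoc A2)
  have cm: "cmap (coef t k) (a * v) = a * cmap (coef t k) v" if "a \<in> ghom \<delta> W X Y" for k a v X Y
    by (rule cmap_coef_mult[OF that t])

  have surj: "\<exists>a\<in>ghom \<delta> W' (gline D) A. v = \<gamma> * a" if "v \<in> L D" "tdeg t K v" for v K D
    using that
  proof (induction K arbitrary: v D rule: less_induct)
    case (less K v D)
    have vg: "v \<in> ghom \<delta> W' (gline D) P" by (rule gsub_ghom[OF L less.prems(1)])
    have low: "\<exists>a\<in>ghom \<delta> W' (gline D) A. v = \<gamma> * a" if v: "v \<in> L D" "tdeg t p v" for v D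
    proof -
      have vg: "v \<in> ghom \<delta> W' (gline D) P" by (rule gsub_ghom[OF L v(1)])
      then have "pack p v \<in> Lp p D" using v pack_ghom unpack_pack by (simp add: Lp_def)
      then obtain b where "b \<in> ghom \<delta> W (gline D) A" "pack p v = \<alpha> * b" using Aex by blast
      then show ?thesis using unpack_pack[OF vg v(2)] W[of b]
        by (intro bexI[of _ b]) (auto simp: \<gamma>_def mult.assoc)
    qed
    show ?case
    proof (cases "K \<le> p")
      case True
      then show ?thesis using low[of v D] less.prems by (auto simp: tdeg_def)
    next
      case False
      then obtain K' where K': "K = Suc K'" by (cases K) auto
      have "cmap (coef t K) v \<in> lc K (D + dt * int K)"
        unfolding lc_def using less.prems coef_ghom[OF vg t refl] by (auto intro!: bexI[of _ v])
      then have "cmap (coef t K) v \<in> lc p (D + dt * int K)" using p by blast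
      then obtain v' where v': "v' \<in> L (D + dt * int K - dt * int p)" "tdeg t p v'"
        "cmap (coef t K) v = cmap (coef t p) v'" by (auto simp: lc_def)
      obtain a2 where a2: "a2 \<in> ghom \<delta> W' (gline (D + dt * int K - dt * int p)) A" "v' = \<gamma> * a2"
        using low[OF v'(1,2)] by blast
      let ?s = "scal (var t ^ (K - p))"
      have sv: "?s * v' \<in> L D"
        by (rule gsub_scal[OF L hmg_var_power[OF _ refl] v'(1)]) (use False in \<open>auto simp: of_nat_diff algebra_simps\<close>)
      have sa: "?s * a2 \<in> ghom \<delta> W' (gline D) A"
        by (rule ghom_scal[OF a2(1) hmg_var_power[OF _ refl]])
           (use False in \<open>auto simp: of_nat_diff algebra_simps gline_def\<close>)
      have "tdeg t K' (v - ?s * v')"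
        unfolding tdeg_def
      proof (intro allI impI)
        fix k assume "k > K'"
        then consider "k = K" | "k > K" using K' by linarith
        then show "cmap (coef t k) (v - ?s * v') = 0"
        proof cases
          case 1
          have "K - (K - p) = p" using False by simp
          then show ?thesis using 1 v'(3) by (simp add: cmap_coef_diff cmap_coef_power)
        next
          case 2
          then have "cmap (coef t k) v = 0" "k - (K - p) > p" using less.prems(2) False by (auto simp: tdeg_def)
          then show ?thesis using v'(2) 2 by (simp add: cmap_coef_diff cmap_coef_power tdeg_def)
        qed
      qed
      then obtain a1 where a1: "a1 \<in> ghom \<delta> W' (gline D) A" "v - ?s * v' = \<gamma> * a1"
        using less.IH[of K' "v - ?s * v'" D] gsub_diff[OF L less.prems(1) sv] K' by auto
      have "v = \<gamma> * (a1 + ?s * a2)" using a1(2) a2(2) by (simp add: ring_distribs scal_comm2 algebra_simps)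
      then show ?thesis using ghom_add[OF a1(1) sa] by blast
    qed
  qed

  have ker: "\<exists>a2\<in>ghom \<delta> W' (gline D) A2. \<exists>b\<in>ghom \<delta> W' (gline D) B. a = \<alpha>2 * a2 + \<theta> * b"
    if "a \<in> ghom \<delta> W' (gline D) A" "tdeg t K a" "\<gamma> * a = 0" for a K D
    using that
  proof (induction K arbitrary: a)
    case (0 a)
    have "a = cmap (coef t 0) a" using tdeg_expand[OF 0(2)] by simp
    then have a: "a \<in> ghom \<delta> W (gline D) A" using coef_ghom[OF 0(1) t, of D 0] by simp
    have "\<alpha> * a = 0"
      by (rule unpack_inj[OF ghom_comp[OF \<alpha> a]]) (use 0(3) in \<open>simp add: \<gamma>_def mult.assoc\<close>)
    then obtain a2 where "a2 \<in> ghom \<delta> W (gline D) A2" "a = \<alpha>2 * a2" using A2(4)[OF a] by blast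
    then show ?case using W by (intro bexI[of _ a2] bexI[of _ 0]) auto
  next
    case (Suc K a)
    define l where "l = cmap (coef t (Suc K)) a"
    let ?D = "D + dt * int K"
    have D: "?D + dt = D + dt * int (Suc K)" by (simp add: algebra_simps)
    have l: "l \<in> ghom \<delta> W (gline (?D + dt)) A" unfolding l_def D by (rule coef_ghom[OF Suc.prems(1) t refl])
    have \<alpha>a: "\<alpha> * a \<in> ghom \<delta> W' (gline D) (trunc p)" by (rule ghom_comp[OF W[OF \<alpha>] Suc.prems(1)])
    have "ent (\<alpha> * l) (prod_encode (i, p)) 0 = 0" for i
    proof (cases "i \<in> fst P")
      case True
      have *: "coef t k (ent (\<alpha> * a) n 0) = ent (\<alpha> * cmap (coef t k) a) n 0" for k n
        by (simp add: cm[OF \<alpha>, symmetric] ent_cmap)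
      have "0 = coef t (Suc K + p) (ent (unpack p * (\<alpha> * a)) i 0)"
        using Suc.prems(3) by (simp add: \<gamma>_def mult.assoc)
      also have "\<dots> = (\<Sum>k\<le>p. ent (\<alpha> * cmap (coef t (Suc K + p - k)) a) (prod_encode (i, k)) 0)"
        using True by (subst ent_unpack_mult[OF ghomD1[OF \<alpha>a]]) (auto simp: coef_sum coef_var_mult *)
      also have "\<dots> = (\<Sum>k\<le>p. if k = p then ent (\<alpha> * l) (prod_encode (i, p)) 0 else 0)"
        using Suc.prems(2) by (intro sum.cong) (auto simp: l_def tdeg_def)
      finally show ?thesis by simp
    next
      case False
      then show ?thesis using ghomD1[OF ghom_comp[OF \<alpha> l]] in_trunc by blast
    qed
    moreover have "\<alpha> * l \<in> Lp p (?D + dt)" by (rule gsub_comp[OF Lp finA l Acol])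
    ultimately have "\<alpha> * l \<in> Lq p ?D" by (simp add: Lq_def)
    then obtain b where b: "b \<in> ghom \<delta> W (gline ?D) B" "\<alpha> * l = \<beta> * b" using Bex by blast
    have Jb: "J * b \<in> ghom \<delta> W (gline (?D + dt)) A"
    proof (rule ghom_comp[OF J(1)])
      show "b \<in> ghom \<delta> W (gline (?D + dt)) B1" using b(1) by (simp add: ghom_def B1_def gline_def algebra_simps)
    qed
    have "\<alpha> * (l - J * b) = 0" using b(2) J(2) by (simp add: ring_distribs flip: mult.assoc)
    then obtain a3 where a3: "a3 \<in> ghom \<delta> W (gline (?D + dt)) A2" "l - J * b = \<alpha>2 * a3"
      using A2(4)[OF ghom_diff[OF l Jb]] by blast
    let ?u = "scal (var t ^ Suc K)" and ?s = "scal (var t ^ K)"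
    have sb: "?s * b \<in> ghom \<delta> W' (gline D) B"
      by (rule ghom_scal[OF W[OF b(1)] hmg_var_power[OF _ refl]]) (auto simp: gline_def)
    have ua3: "?u * a3 \<in> ghom \<delta> W' (gline D) A2"
      by (rule ghom_scal[OF W[OF a3(1)] hmg_var_power[OF _ refl]]) (auto simp: gline_def D)
    define a' where "a' = a - ?u * (l - J * b) - \<theta> * (?s * b)"
    have a'g: "a' \<in> ghom \<delta> W' (gline D) A"
      unfolding a'_def a3(2) scal_comm2[symmetric]
      by (intro ghom_diff Suc.prems(1) ghom_comp[OF W[OF A2(2)] ua3] ghom_comp[OF \<theta> sb])
    have "\<theta> * (?s * b) = ?u * (J * b) - ?s * (T * b)"
      by (simp add: \<theta>_def ring_distribs scal_mult mult.assoc scal_comm2[of J] scal_comm2[of T])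
    then have a'eq: "a' = a - ?u * l + ?s * (T * b)" by (simp add: a'_def ring_distribs)
    have "tdeg t K a'"
      unfolding tdeg_def
    proof (intro allI impI)
      fix k assume k: "k > K"
      have "cmap (coef t (k - K)) (T * b) = 0"
        using k by (subst cmap_coef_free[OF ghom_comp[OF T(1) b(1)] t]) auto
      moreover have "cmap (coef t k) (?u * l) = (if k = Suc K then l else 0)"
        using k by (simp only: cmap_coef_power cmap_coef_free[OF l t]) auto
      moreover have "k \<noteq> Suc K \<Longrightarrow> cmap (coef t k) a = 0" using Suc.prems(2) k by (auto simp: tdeg_def)
      ultimately show "cmap (coef t k) a' = 0"
        using k by (auto simp: a'eq cmap_coef_diff cmap_coef_add cmap_coef_power l_def)
    qed
    moreover have "\<gamma> * a' = 0"
    proof -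
      have "\<gamma> * a' = \<gamma> * a - ?u * (\<gamma> * \<alpha>2 * a3) - \<gamma> * \<theta> * (?s * b)"
        by (simp add: a'_def a3(2) ring_distribs scal_comm2[of \<gamma>] mult.assoc del: power_Suc)
      then show ?thesis by (simp add: \<gamma>\<alpha>2 \<gamma>\<theta> Suc.prems(3))
    qed
    ultimately obtain a2 b' where IH: "a2 \<in> ghom \<delta> W' (gline D) A2" "b' \<in> ghom \<delta> W' (gline D) B"
      "a' = \<alpha>2 * a2 + \<theta> * b'" using Suc.IH[OF a'g] by blast
    have "a = a' + \<alpha>2 * (?u * a3) + \<theta> * (?s * b)"
      by (simp add: a'_def a3(2) scal_comm2[of \<alpha>2] del: power_Suc)
    also have "\<dots> = \<alpha>2 * (a2 + ?u * a3) + \<theta> * (b' + ?s * b)" by (simp add: IH(3) ring_distribs)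
    finally have "a = \<alpha>2 * (a2 + ?u * a3) + \<theta> * (b' + ?s * b)" .
    then show ?case using ghom_add[OF IH(1) ua3] ghom_add[OF IH(2) sb] by blast
  qed

  have shift_inj: "c = 0" if c: "c \<in> ghom \<delta> W' (gline D) (trunc p)" "scal (var t) * c = shift p * c" for c D
  proof (rule cmat_eqI_rows)
    fix i k j
    have *: "var t * ent c (prod_encode (i, k)) j = ent (shift p * c) (prod_encode (i, k)) j" for k
      using c(2) by (metis ent_scal_mult)
    have "look (var t) (mon t 1) = 1" by (simp add: var_def)
    then have v: "var t \<noteq> (0 :: mpoly)" by auto
    have "ent c (prod_encode (i, k)) j = 0" for k
    proof (induction k)
      case 0
      then show ?case using *[of 0] v by (simp add: ent_shift_mult)
    next
      case (Suc k)
      then show ?case using *[of "Suc k"] v by (simp add: ent_shift_mult split: if_splits)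
    qed
    then show "ent c (prod_encode (i, k)) j = ent 0 (prod_encode (i, k)) j" by simp
  qed

  define d2 where "d2 = \<alpha>2 * r0 + \<theta> * r1"
  have d2: "d2 \<in> ghom \<delta> W' (gsum A2 B) A"
    unfolding d2_def by (intro ghom_add ghom_gsum W A2 \<theta>)
  have resA2: "gres \<delta> W' N A2 \<alpha>2" by (rule gres_base_change[OF A2(5,2) t A2(1)])
  have resA: "gres \<delta> W' (Suc N) A \<alpha>"
    by (rule gres_base_change[OF \<open>gres \<delta> W (Suc N) A \<alpha>\<close> \<alpha> t finA])
  have resB': "gres \<delta> W' N B \<beta>" by (rule gres_base_change[OF resB \<beta> t finB])
  have kerA: "\<exists>v'\<in>ghom \<delta> W' (gline D) A2. v = \<alpha>2 * v'" if v: "v \<in> ghom \<delta> W' (gline D) A" "\<alpha> * v = 0" for v D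
  proof -
    obtain K where K: "tdeg t K v" using tdeg_bounded[OF v(1) finA] by blast
    have "\<exists>v'\<in>ghom \<delta> W (gline (D + dt * int k)) A2. cmap (coef t k) v = \<alpha>2 * v'" for k
    proof (rule A2(4)[OF coef_ghom[OF v(1) t refl]])
      show "\<alpha> * cmap (coef t k) v = 0" unfolding cm[OF \<alpha>, symmetric] v(2)
        by (rule cmat_eqI) (simp add: ent_cmap)
    qed
    then obtain u where u: "u k \<in> ghom \<delta> W (gline (D + dt * int k)) A2" "cmap (coef t k) v = \<alpha>2 * u k" for k
      by metis
    have "v = \<alpha>2 * (\<Sum>k\<le>K. scal (var t ^ k) * u k)"
      by (subst tdeg_expand[OF K]) (simp add: u(2) sum_distrib_left scal_comm2)
    moreover have "(\<Sum>k\<le>K. scal (var t ^ k) * u k) \<in> ghom \<delta> W' (gline D) A2"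
      by (intro ghom_sum ghom_scal[OF W[OF u(1)] hmg_var_power[OF _ refl]]) (auto simp: gline_def)
    ultimately show ?thesis by blast
  qed
  have "gres \<delta> W' N (gsum A2 B) (s0 * \<alpha>2 * r0 + s0 * \<theta> * r1 + s1 * \<beta> * r1)"
  proof (rule gres_triangular[OF resA2 resB' \<theta>])
    fix D v assume v: "v \<in> ghom \<delta> W' (gline D) B" "\<beta> * v = 0"
    have "\<alpha> * (\<theta> * v) = scal (var t) * (\<beta> * v) - shift p * (\<beta> * v)"
      using arg_cong[OF \<alpha>\<theta>, of "\<lambda>x. x * v"] by (simp only: left_diff_distrib mult.assoc)
    then show "\<exists>a\<in>ghom \<delta> W' (gline D) A2. \<theta> * v = \<alpha>2 * a"
      using kerA[OF ghom_comp[OF \<theta> v(1)]] v(2) by simp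
  qed
  then have resd2: "gres \<delta> W' N (gsum A2 B) d2"
  proof (rule gres_cong)
    fix D v assume v: "v \<in> ghom \<delta> W' (gline D) (gsum A2 B)"
    let ?\<kappa> = "s0 * \<alpha>2 * r0 + s0 * \<theta> * r1 + s1 * \<beta> * r1"
    have \<kappa>: "?\<kappa> * v = s0 * (d2 * v) + s1 * (\<beta> * (r1 * v))"
      by (simp add: d2_def ring_distribs mult.assoc)
    show "?\<kappa> * v = 0 \<longleftrightarrow> d2 * v = 0"
    proof
      assume "?\<kappa> * v = 0"
      then have "r0 * (s0 * (d2 * v) + s1 * (\<beta> * (r1 * v))) = 0" by (simp only: \<kappa> mult_zero_right)
      then show "d2 * v = 0" by (simp add: ring_distribs)
    next
      assume 0: "d2 * v = 0"
      have r1v: "r1 * v \<in> ghom \<delta> W' (gline D) B" using v by auto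
      have "0 = \<alpha> * (d2 * v)" using 0 by simp
      also have "\<dots> = \<alpha> * \<alpha>2 * (r0 * v) + \<alpha> * \<theta> * (r1 * v)" by (simp add: d2_def ring_distribs mult.assoc)
      also have "\<dots> = scal (var t) * (\<beta> * (r1 * v)) - shift p * (\<beta> * (r1 * v))"
        by (simp only: A2(3) \<alpha>\<theta> left_diff_distrib mult.assoc mult_zero_left add_0_left)
      finally have "scal (var t) * (\<beta> * (r1 * v)) = shift p * (\<beta> * (r1 * v))" by simp
      moreover have "\<beta> * (r1 * v) \<in> ghom \<delta> W' (gline (D + dt)) (trunc p)"
        using ghom_comp[OF W[OF \<beta>] r1v] by (auto simp: ghom_def twist_def gline_def algebra_simps)
      ultimately have "\<beta> * (r1 * v) = 0" by (rule shift_inj[rotated])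
      then show "?\<kappa> * v = 0" unfolding \<kappa> using 0 by simp
    qed
  qed
  have "gres \<delta> W' (Suc N) A \<gamma>"
  proof (subst gres.simps, intro exI conjI allI ballI impI)
    show "finite (fst (gsum A2 B))" by (intro finite_gsum A2 finB)
    show "\<gamma> * d2 = 0" by (simp add: d2_def ring_distribs \<gamma>\<alpha>2 \<gamma>\<theta> flip: mult.assoc)
    fix D v assume v: "v \<in> ghom \<delta> W' (gline D) A" "\<gamma> * v = 0"
    obtain K where "tdeg t K v" using tdeg_bounded[OF v(1) finA] by blast
    then obtain a2 b where *: "a2 \<in> ghom \<delta> W' (gline D) A2" "b \<in> ghom \<delta> W' (gline D) B" "v = \<alpha>2 * a2 + \<theta> * b"
      using ker[OF v(1) _ v(2)] by blast
    have "v = d2 * (s0 * a2 + s1 * b)" by (simp add: d2_def ring_distribs mult.assoc *(3))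
    moreover have "s0 * a2 + s1 * b \<in> ghom \<delta> W' (gline D) (gsum A2 B)" using * by (auto intro!: ghom_add)
    ultimately show "\<exists>v'\<in>ghom \<delta> W' (gline D) (gsum A2 B). v = d2 * v'" by blast
  qed (rule d2 resd2)+
  moreover have "gcover \<delta> W' P L A \<gamma>"
    unfolding gcover_def
  proof (intro conjI ballI allI finA \<gamma>)
    fix j assume "j \<in> fst A"
    then show "\<gamma> * cunit j 0 \<in> L (snd A j)" using Acol by (auto simp: Lp_def \<gamma>_def mult.assoc)
  next
    fix D u assume u: "u \<in> L D"
    obtain K where "tdeg t K u" using tdeg_bounded[OF gsub_ghom[OF L u] finP] by blast
    then show "\<exists>v\<in>ghom \<delta> W' (gline D) A. u = \<gamma> * v" using surj[OF u] by blast
  qed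
  ultimately show ?thesis by blast
qed

end

text \<open>Hilbert's syzygy theorem, in graded form.\<close>

theorem resolvable_finite: "finite W \<Longrightarrow> resolvable \<delta> W"
proof (induction W rule: finite_induct)
  case (insert t W)
  show ?case unfolding resolvable_def
  proof (intro allI impI)
    fix P L assume "finite (fst P)" "gsub \<delta> (insert t W) P L"
    then interpret adjoin \<delta> W t P L using insert by unfold_locales
    show "\<exists>A \<alpha> n. gcover \<delta> (insert t W) P L A \<alpha> \<and> gres \<delta> (insert t W) n A \<alpha>" by (rule resolution)
  qed
qed (rule resolvable_field)

section \<open>Matrix factorizations with a twisted involution\<close>

text \<open>A pair \<open>(I, T)\<close> is the free module with basis \<open>I\<close> on which the involution acts by \<open>T\<close>,
  semilinearly with respect to the involution \<open>\<gamma>\<close> of the base ring.\<close>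

type_synonym tmod = "nat set \<times> mpoly cmat"

record tmf =
  X0 :: tmod
  X1 :: tmod
  phi :: "mpoly cmat"
  psi :: "mpoly cmat"

lemma assoc_rule: "a * b = c \<Longrightarrow> a * (b * x) = c * x" for a b c x :: "'a::semigroup_mult"
  by (simp flip: mult.assoc)

locale involution =
  fixes V :: "nat set" and \<gamma> :: "mpoly \<Rightarrow> mpoly" and f :: mpoly
  assumes gam: "cring_hom \<gamma>" and gam2: "\<gamma> (\<gamma> p) = p"
    and gam_V: "p \<in> poly_ring V \<Longrightarrow> \<gamma> p \<in> poly_ring V" and gam_const [simp]: "\<gamma> (const c) = const c"
    and gam_f: "\<gamma> f = f" and f_V: "f \<in> poly_ring V" and f_nz: "f \<noteq> 0"
begin

sublocale gam: cring_hom \<gamma> by (rule gam)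

abbreviation "G \<equiv> cmap \<gamma>"

lemma G2 [simp]: "G (G a) = a" by (rule cmat_eqI) (simp add: ent_cmap gam2)

definition vhom :: "nat set \<Rightarrow> nat set \<Rightarrow> mpoly cmat set" where
  "vhom I J = {a. \<forall>i j. (ent a i j \<noteq> 0 \<longrightarrow> i \<in> J \<and> j \<in> I) \<and> ent a i j \<in> poly_ring V}"

definition thom :: "tmod \<Rightarrow> tmod \<Rightarrow> mpoly cmat set" where
  "thom X Y = {a \<in> vhom (fst X) (fst Y). a * snd X = snd Y * G a}"

definition tmod :: "tmod \<Rightarrow> bool" where
  "tmod X \<longleftrightarrow> finite (fst X) \<and> snd X \<in> vhom (fst X) (fst X) \<and> snd X * G (snd X) = cproj (fst X)"

lemma vhom_0 [simp]: "0 \<in> vhom I J" by (simp add: vhom_def)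
lemma vhom_add: "a \<in> vhom I J \<Longrightarrow> b \<in> vhom I J \<Longrightarrow> a + b \<in> vhom I J"
  unfolding vhom_def by (auto intro!: poly_ring_add) (metis add_0_right add_cancel_left_right)+
lemma vhom_uminus [simp]: "- a \<in> vhom I J \<longleftrightarrow> a \<in> vhom I J" by (simp add: vhom_def)
lemma vhom_diff: "a \<in> vhom I J \<Longrightarrow> b \<in> vhom I J \<Longrightarrow> a - b \<in> vhom I J"
  using vhom_add[of a I J "- b"] by simp
lemma vhom_comp: "a \<in> vhom J K \<Longrightarrow> b \<in> vhom I J \<Longrightarrow> a * b \<in> vhom I K"
proof -
  assume *: "a \<in> vhom J K" "b \<in> vhom I J"
  have "i \<in> K \<and> j \<in> I" if nz: "ent (a * b) i j \<noteq> 0" for i j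
  proof -
    obtain k where "ent b k j \<noteq> 0" "ent a i k \<noteq> 0"
      using nz unfolding ent_mult by (metis (mono_tags, lifting) mem_Collect_eq mult_zero_left sum.neutral)
    then show ?thesis using * by (auto simp: vhom_def)
  qed
  moreover have "ent (a * b) i j \<in> poly_ring V" for i j
    unfolding ent_mult using * by (intro poly_ring_sum poly_ring_mult) (auto simp: vhom_def)
  ultimately show ?thesis by (simp add: vhom_def)
qed
lemma vhom_scal: "p \<in> poly_ring V \<Longrightarrow> a \<in> vhom I J \<Longrightarrow> scal p * a \<in> vhom I J"
  by (auto simp: vhom_def intro!: poly_ring_mult)
lemma vhom_G: "a \<in> vhom I J \<Longrightarrow> G a \<in> vhom I J"
  by (auto simp: vhom_def ent_cmap intro!: gam_V) (metis gam.zero)+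
lemma vhom_id: "cproj I \<in> vhom I I" by (auto simp: vhom_def)
lemma vhom_idL: "a \<in> vhom I J \<Longrightarrow> cproj J * a = a" by (rule cmat_eqI) (auto simp: vhom_def)
lemma vhom_idR: "a \<in> vhom I J \<Longrightarrow> a * cproj I = a" by (rule cmat_eqI) (auto simp: vhom_def)

lemma thom_vhom: "a \<in> thom X Y \<Longrightarrow> a \<in> vhom (fst X) (fst Y)" by (simp add: thom_def)
lemma thom_idL: "a \<in> thom X Y \<Longrightarrow> cproj (fst Y) * a = a" by (rule vhom_idL[OF thom_vhom])
lemma thom_idR: "a \<in> thom X Y \<Longrightarrow> a * cproj (fst X) = a" by (rule vhom_idR[OF thom_vhom])
lemma thom_0 [simp]: "0 \<in> thom X Y" by (simp add: thom_def)
lemma thom_add: "a \<in> thom X Y \<Longrightarrow> b \<in> thom X Y \<Longrightarrow> a + b \<in> thom X Y"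
  by (simp add: thom_def vhom_add ring_distribs gam.cmap_add)
lemma thom_uminus [simp]: "- a \<in> thom X Y \<longleftrightarrow> a \<in> thom X Y"
  by (simp add: thom_def gam.cmap_uminus)
lemma thom_diff: "a \<in> thom X Y \<Longrightarrow> b \<in> thom X Y \<Longrightarrow> a - b \<in> thom X Y"
  using thom_add[of a X Y "- b"] by simp
lemma thom_comp: "a \<in> thom Y Z \<Longrightarrow> b \<in> thom X Y \<Longrightarrow> a * b \<in> thom X Z"
proof -
  assume a: "a \<in> thom Y Z" and b: "b \<in> thom X Y"
  have "a * b * snd X = a * snd Y * G b" using b by (simp add: thom_def mult.assoc)
  also have "\<dots> = snd Z * G (a * b)" using a by (simp add: thom_def gam.cmap_mult mult.assoc)
  finally show ?thesis using a b vhom_comp by (auto simp: thom_def)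
qed
lemma thom_scal: "p \<in> poly_ring V \<Longrightarrow> \<gamma> p = p \<Longrightarrow> a \<in> thom X Y \<Longrightarrow> scal p * a \<in> thom X Y"
  by (simp add: thom_def vhom_scal gam.cmap_mult mult.assoc scal_comm2[of "snd Y"])
lemma thom_id: "tmod X \<Longrightarrow> cproj (fst X) \<in> thom X X"
  using vhom_idL[of "snd X" "fst X" "fst X"] vhom_idR[of "snd X" "fst X" "fst X"]
  by (simp add: thom_def vhom_id tmod_def)

definition is_mf :: "tmf \<Rightarrow> bool" where
  "is_mf E \<longleftrightarrow> tmod (X0 E) \<and> tmod (X1 E) \<and> phi E \<in> thom (X0 E) (X1 E) \<and> psi E \<in> thom (X1 E) (X0 E) \<and>
     psi E * phi E = scal f * cproj (fst (X0 E)) \<and> phi E * psi E = scal f * cproj (fst (X1 E))"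

definition tmaps :: "tmf \<Rightarrow> tmf \<Rightarrow> (mpoly cmat \<times> mpoly cmat) set" where
  "tmaps E E' = {(a0, a1). a0 \<in> thom (X0 E) (X0 E') \<and> a1 \<in> thom (X1 E) (X1 E') \<and>
     a1 * phi E = phi E' * a0 \<and> a0 * psi E = psi E' * a1}"

definition thtp :: "tmf \<Rightarrow> tmf \<Rightarrow> mpoly cmat \<times> mpoly cmat \<Rightarrow> mpoly cmat \<times> mpoly cmat \<Rightarrow> bool" where
  "thtp E E' a b \<longleftrightarrow> (\<exists>h0\<in>thom (X0 E) (X1 E'). \<exists>h1\<in>thom (X1 E) (X0 E').
     fst a = fst b + (psi E' * h0 + h1 * phi E) \<and> snd a = snd b + (phi E' * h1 + h0 * psi E))"

abbreviation pmul :: "mpoly cmat \<times> mpoly cmat \<Rightarrow> mpoly cmat \<times> mpoly cmat \<Rightarrow> mpoly cmat \<times> mpoly cmat" where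
  "pmul a b \<equiv> (fst a * fst b, snd a * snd b)"

definition tid :: "tmf \<Rightarrow> mpoly cmat \<times> mpoly cmat" where
  "tid E = (cproj (fst (X0 E)), cproj (fst (X1 E)))"

definition heq :: "tmf \<Rightarrow> tmf \<Rightarrow> bool" where
  "heq E E' \<longleftrightarrow> (\<exists>a\<in>tmaps E E'. \<exists>b\<in>tmaps E' E. thtp E E (pmul b a) (tid E) \<and> thtp E' E' (pmul a b) (tid E'))"

lemma tmaps_comp: "b \<in> tmaps E' E'' \<Longrightarrow> a \<in> tmaps E E' \<Longrightarrow> pmul b a \<in> tmaps E E''"
  by (auto simp: tmaps_def thom_comp) (simp_all add: mult.assoc, simp_all flip: mult.assoc)

lemma tid_tmaps: "is_mf E \<Longrightarrow> tid E \<in> tmaps E E"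
  by (auto simp: tmaps_def tid_def is_mf_def thom_id thom_idL thom_idR)

lemma pmul_tid: "a \<in> tmaps E E' \<Longrightarrow> pmul (tid E') a = a" "a \<in> tmaps E E' \<Longrightarrow> pmul a (tid E) = a"
  by (auto simp: tmaps_def tid_def thom_idL thom_idR)

lemma thtp_refl: "thtp E E' a a"
  unfolding thtp_def by (intro bexI[of _ 0]) auto

lemma thtp_sym: "thtp E E' a b \<Longrightarrow> thtp E E' b a"
proof -
  assume "thtp E E' a b"
  then obtain h0 h1 where "h0 \<in> thom (X0 E) (X1 E')" "h1 \<in> thom (X1 E) (X0 E')"
    "fst a = fst b + (psi E' * h0 + h1 * phi E)" "snd a = snd b + (phi E' * h1 + h0 * psi E)"
    by (auto simp: thtp_def)
  then show ?thesis unfolding thtp_def by (intro bexI[of _ "- h0"] bexI[of _ "- h1"]) auto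
qed

lemma thtp_trans: "thtp E E' a b \<Longrightarrow> thtp E E' b c \<Longrightarrow> thtp E E' a c"
proof -
  assume "thtp E E' a b" "thtp E E' b c"
  then obtain h0 h1 k0 k1 where "h0 \<in> thom (X0 E) (X1 E')" "h1 \<in> thom (X1 E) (X0 E')"
    "fst a = fst b + (psi E' * h0 + h1 * phi E)" "snd a = snd b + (phi E' * h1 + h0 * psi E)"
    "k0 \<in> thom (X0 E) (X1 E')" "k1 \<in> thom (X1 E) (X0 E')"
    "fst b = fst c + (psi E' * k0 + k1 * phi E)" "snd b = snd c + (phi E' * k1 + k0 * psi E)"
    by (auto simp: thtp_def)
  then show ?thesis unfolding thtp_def
    by (intro bexI[of _ "h0 + k0"] bexI[of _ "h1 + k1"]) (auto simp: ring_distribs thom_add)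
qed

lemma thtp_left: "thtp E E' a b \<Longrightarrow> c \<in> tmaps E' E'' \<Longrightarrow> thtp E E'' (pmul c a) (pmul c b)"
proof -
  assume "thtp E E' a b" and c: "c \<in> tmaps E' E''"
  then obtain h0 h1 where h: "h0 \<in> thom (X0 E) (X1 E')" "h1 \<in> thom (X1 E) (X0 E')"
    "fst a = fst b + (psi E' * h0 + h1 * phi E)" "snd a = snd b + (phi E' * h1 + h0 * psi E)"
    by (auto simp: thtp_def)
  have c': "fst c \<in> thom (X0 E') (X0 E'')" "snd c \<in> thom (X1 E') (X1 E'')"
    "snd c * phi E' = phi E'' * fst c" "fst c * psi E' = psi E'' * snd c"
    using c by (auto simp: tmaps_def)
  note r = c'(3,4) c'(3)[THEN assoc_rule] c'(4)[THEN assoc_rule]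
  show ?thesis unfolding thtp_def
    by (intro bexI[of _ "snd c * h0"] bexI[of _ "fst c * h1"])
       (use h c' in \<open>auto simp: ring_distribs thom_comp r mult.assoc\<close>)
qed

lemma thtp_right: "thtp E' E'' a b \<Longrightarrow> c \<in> tmaps E E' \<Longrightarrow> thtp E E'' (pmul a c) (pmul b c)"
proof -
  assume "thtp E' E'' a b" and c: "c \<in> tmaps E E'"
  then obtain h0 h1 where h: "h0 \<in> thom (X0 E') (X1 E'')" "h1 \<in> thom (X1 E') (X0 E'')"
    "fst a = fst b + (psi E'' * h0 + h1 * phi E')" "snd a = snd b + (phi E'' * h1 + h0 * psi E')"
    by (auto simp: thtp_def)
  have c': "fst c \<in> thom (X0 E) (X0 E')" "snd c \<in> thom (X1 E) (X1 E')"
    "phi E' * fst c = snd c * phi E" "psi E' * snd c = fst c * psi E"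
    using c by (auto simp: tmaps_def)
  show ?thesis unfolding thtp_def
    by (intro bexI[of _ "h0 * fst c"] bexI[of _ "h1 * snd c"])
       (use h c' in \<open>auto simp: ring_distribs thom_comp mult.assoc\<close>)
qed

lemma heq_refl: "is_mf E \<Longrightarrow> heq E E"
  unfolding heq_def using tid_tmaps[of E] pmul_tid[of "tid E" E E] thtp_refl by metis

lemma heq_sym: "heq E E' \<Longrightarrow> heq E' E"
  unfolding heq_def by blast

lemma heq_trans:
  assumes "heq E E'" "heq E' E''"
  shows "heq E E''"
proof -
  obtain a b where a: "a \<in> tmaps E E'" "b \<in> tmaps E' E" "thtp E E (pmul b a) (tid E)" "thtp E' E' (pmul a b) (tid E')"
    using assms(1) by (auto simp: heq_def)
  obtain c d where c: "c \<in> tmaps E' E''" "d \<in> tmaps E'' E'" "thtp E' E' (pmul d c) (tid E')" "thtp E'' E'' (pmul c d) (tid E'')"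
    using assms(2) by (auto simp: heq_def)
  have 1: "thtp E E (pmul b (pmul (pmul d c) a)) (pmul b a)"
    using thtp_left[OF thtp_right[OF c(3) a(1)] a(2)] pmul_tid(1)[OF a(1)] by simp
  have 2: "thtp E'' E'' (pmul c (pmul (pmul a b) d)) (pmul c d)"
    using thtp_left[OF thtp_right[OF a(4) c(2)] c(1)] pmul_tid(1)[OF c(2)] by simp
  have "thtp E E (pmul (pmul b d) (pmul c a)) (tid E)" "thtp E'' E'' (pmul (pmul c a) (pmul b d)) (tid E'')"
    using thtp_trans[OF 1 a(3)] thtp_trans[OF 2 c(4)] by (simp_all add: mult.assoc)
  then show ?thesis unfolding heq_def using tmaps_comp[OF c(1) a(1)] tmaps_comp[OF a(2) c(2)] by metis
qed

definition sh :: "tmf \<Rightarrow> tmf" where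
  "sh E = \<lparr>X0 = X1 E, X1 = X0 E, phi = psi E, psi = phi E\<rparr>"

lemma sh_simps [simp]: "X0 (sh E) = X1 E" "X1 (sh E) = X0 E" "phi (sh E) = psi E" "psi (sh E) = phi E" "sh (sh E) = E"
  by (simp_all add: sh_def)

lemma is_mf_sh: "is_mf E \<Longrightarrow> is_mf (sh E)" by (auto simp: is_mf_def)

lemma heq_sh: "heq E E' \<Longrightarrow> heq (sh E) (sh E')"
proof -
  have m: "(a0, a1) \<in> tmaps E E' \<Longrightarrow> (a1, a0) \<in> tmaps (sh E) (sh E')" for a0 a1 E E' by (auto simp: tmaps_def)
  have h: "thtp E E' (a0, a1) (b0, b1) \<Longrightarrow> thtp (sh E) (sh E') (a1, a0) (b1, b0)" for a0 a1 b0 b1 E E'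
    unfolding thtp_def by (auto simp: add_ac)
  assume "heq E E'"
  then obtain a0 a1 b0 b1 where "(a0, a1) \<in> tmaps E E'" "(b0, b1) \<in> tmaps E' E"
    "thtp E E (b0 * a0, b1 * a1) (tid E)" "thtp E' E' (a0 * b0, a1 * b1) (tid E')"
    unfolding heq_def by (metis prod.collapse fst_conv snd_conv)
  then show ?thesis unfolding heq_def
    by (intro bexI[of _ "(a1, a0)"] bexI[of _ "(b1, b0)"]) (auto simp: m tid_def intro!: h)
qed

lemma phi_cancel:
  assumes "is_mf E" "x \<in> vhom I (fst (X0 E))" "y \<in> vhom I (fst (X0 E))" "phi E * x = phi E * y"
  shows "x = y"
proof -
  have *: "psi E * (phi E * z) = scal f * z" if "z \<in> vhom I (fst (X0 E))" for z
  proof -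
    have "psi E * (phi E * z) = scal f * (cproj (fst (X0 E)) * z)"
      using assms(1) by (simp add: is_mf_def flip: mult.assoc)
    then show ?thesis by (simp add: vhom_idL[OF that])
  qed
  show ?thesis using assms(4) *[OF assms(2)] *[OF assms(3)] scal_cancel[OF _ f_nz] by metis
qed

end

section \<open>Dehomogenization\<close>

text \<open>
  The homomorphism \<open>\<Delta>\<close> passes from a graded ring to a chart. What is left of the degree is the eigenvalue
  \<open>eps\<^sup>e\<close> of the involution: \<open>eps = - 1\<close> for a chart divided by a group of order two, \<open>eps = 1\<close> for a chart without
  a group. An eigenvector in the chart has homogeneous lifts in all degrees far enough in the direction \<open>step\<close>,
  because the degree can be moved by powers of the variable that \<open>\<Delta>\<close> sets to \<open>1\<close>.
\<close>

locale dehom = involution V \<gamma> f for V \<gamma> f +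
  fixes \<delta> :: "nat \<Rightarrow> int" and W :: "nat set" and \<Delta> :: "mpoly \<Rightarrow> mpoly" and eps :: complex
    and step :: int and F :: mpoly
  assumes del: "cring_hom \<Delta>" and finW: "finite W" and eps: "eps = 1 \<or> eps = - 1"
    and eps1: "eps = 1 \<Longrightarrow> \<gamma> p = p"
    and del_V: "p \<in> hmg \<delta> W e \<Longrightarrow> \<Delta> p \<in> poly_ring V"
    and del_gam: "p \<in> hmg \<delta> W e \<Longrightarrow> \<gamma> (\<Delta> p) = const (if even e then 1 else eps) * \<Delta> p"
    and del_inj: "p \<in> hmg \<delta> W e \<Longrightarrow> \<Delta> p = 0 \<Longrightarrow> p = 0"
    and del_surj: "q \<in> poly_ring V \<Longrightarrow> \<gamma> q = const (if even c then 1 else eps) * q \<Longrightarrow>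
      \<exists>n0::nat. \<forall>n\<ge>n0. \<exists>p\<in>hmg \<delta> W (c + int n * step). \<Delta> p = q"
    and F: "F \<in> hmg \<delta> W 0" and del_F: "\<Delta> F = f"
begin

sublocale del: cring_hom \<Delta> by (rule del)

abbreviation "DD \<equiv> cmap \<Delta>"
abbreviation "gh \<equiv> ghom \<delta> W"

definition sg :: "int \<Rightarrow> complex" where "sg e = (if even e then 1 else eps)"

lemma sg_mult: "sg (a - b) * sg a = sg b" "sg a * sg (a - b) = sg b" "sg a * sg a = 1"
  using eps by (auto simp: sg_def)

lemma const_mult: "const (a * b) = const a * const b" by (simp add: mult_single)

definition TD :: "gmod \<Rightarrow> mpoly cmat" where
  "TD X = cdiag (\<lambda>i. if i \<in> fst X then const (sg (snd X i)) else 0)"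

definition de :: "gmod \<Rightarrow> tmod" where "de X = (fst X, TD X)"

lemma de_simps [simp]: "fst (de X) = fst X" "snd (de X) = TD X" by (simp_all add: de_def)

lemma G_TD [simp]: "G (TD X) = TD X"
  by (rule cmat_eqI) (simp add: ent_cmap TD_def)

lemma TD_TD [simp]: "TD X * TD X = cproj (fst X)"
  by (rule cmat_eqI) (simp add: TD_def const_mult[symmetric] sg_mult)

lemma tmod_de: "finite (fst X) \<Longrightarrow> tmod (de X)"
  by (auto simp: tmod_def vhom_def) (auto simp: TD_def split: if_splits)

lemma hom_de: "a \<in> gh X Y \<Longrightarrow> DD a \<in> thom (de X) (de Y)"
proof -
  assume a: "a \<in> gh X Y"
  have "DD a \<in> vhom (fst X) (fst Y)"
    using a by (auto simp: vhom_def ent_cmap ghom_def intro: del_V) (metis del.zero)+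
  moreover have "DD a * TD X = TD Y * G (DD a)"
  proof (rule cmat_eqI)
    fix i j
    show "ent (DD a * TD X) i j = ent (TD Y * G (DD a)) i j"
    proof (cases "ent a i j = 0")
      case False
      then have "i \<in> fst Y" "j \<in> fst X" using ghomD1[OF a] ghomD2[OF a] by auto
      moreover have "\<gamma> (\<Delta> (ent a i j)) = const (sg (snd Y i - snd X j)) * \<Delta> (ent a i j)"
        unfolding sg_def by (rule del_gam[OF ghomD[OF a]])
      ultimately show ?thesis
        by (simp add: TD_def ent_cmap const_mult[symmetric] sg_mult mult_ac flip: mult.assoc)
    qed (simp add: TD_def ent_cmap)
  qed
  ultimately show ?thesis by (simp add: thom_def)
qed

lemma hom_inj: "a \<in> gh X Y \<Longrightarrow> DD a = 0 \<Longrightarrow> a = 0"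
  by (rule cmat_eqI) (metis ghomD del_inj ent_0 ent_cmap del.zero)

lemma hom_inj_eq: "a \<in> gh X Y \<Longrightarrow> b \<in> gh X Y \<Longrightarrow> DD a = DD b \<Longrightarrow> a = b"
  using hom_inj[OF ghom_diff, of a X Y b] by (simp add: del.cmap_diff)

lemma TD_gsum:
  "TD (gsum X Y) * s0 = s0 * TD X" "TD (gsum X Y) * s1 = s1 * TD Y"
  "r0 * TD (gsum X Y) = TD X * r0" "r1 * TD (gsum X Y) = TD Y * r1"
  by (rule cmat_eqI; auto simp: TD_def gsum_def image_iff; presburger)+

lemma vhom_gsum:
  "a \<in> vhom I (fst X) \<Longrightarrow> s0 * a \<in> vhom I (fst (gsum X Y))"
  "a \<in> vhom I (fst Y) \<Longrightarrow> s1 * a \<in> vhom I (fst (gsum X Y))"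
  "a \<in> vhom (fst X) I \<Longrightarrow> a * r0 \<in> vhom (fst (gsum X Y)) I"
  "a \<in> vhom (fst Y) I \<Longrightarrow> a * r1 \<in> vhom (fst (gsum X Y)) I"
  by (auto simp: vhom_def gsum_def image_iff elim!: evenE oddE split: if_splits)

lemma thom_gsum [intro]:
  "a \<in> thom Z (de X) \<Longrightarrow> s0 * a \<in> thom Z (de (gsum X Y))"
  "a \<in> thom Z (de Y) \<Longrightarrow> s1 * a \<in> thom Z (de (gsum X Y))"
  "a \<in> thom (de X) Z \<Longrightarrow> a * r0 \<in> thom (de (gsum X Y)) Z"
  "a \<in> thom (de Y) Z \<Longrightarrow> a * r1 \<in> thom (de (gsum X Y)) Z"
  using TD_gsum(1,2)[THEN assoc_rule, of X Y] TD_gsum(3,4)[of X Y]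
  by (auto simp: thom_def gam.cmap_mult mult.assoc intro: vhom_gsum) (simp_all flip: mult.assoc)

text \<open>The finitely many entries of an eigenvector have homogeneous lifts in a common degree.\<close>

lemma eigen_lift:
  assumes P: "finite (fst P)" and c: "c \<in> vhom {0} (fst P)" "TD P * G c = scal (const (sg D0)) * c"
  shows "\<exists>D. \<exists>p\<in>gh (gline D) P. DD p = c"
proof -
  have "\<exists>n0. \<forall>n\<ge>n0. \<exists>p\<in>hmg \<delta> W (snd P i - D0 + int n * step). \<Delta> p = ent c i 0" if i: "i \<in> fst P" for i
  proof (rule del_surj)
    show "ent c i 0 \<in> poly_ring V" using c(1) by (simp add: vhom_def)
    have "const (sg (snd P i)) * \<gamma> (ent c i 0) = const (sg D0) * ent c i 0"
      using arg_cong[OF c(2), of "\<lambda>a. ent a i 0"] i by (simp add: TD_def ent_cmap)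
    then have "const (sg (snd P i)) * (const (sg (snd P i)) * \<gamma> (ent c i 0)) = const (sg (snd P i)) * (const (sg D0) * ent c i 0)"
      by simp
    moreover have "sg (snd P i) * sg D0 = sg (snd P i - D0)" using eps by (auto simp: sg_def)
    ultimately show "\<gamma> (ent c i 0) = const (if even (snd P i - D0) then 1 else eps) * ent c i 0"
      unfolding sg_def[symmetric] by (simp add: const_mult[symmetric] sg_mult flip: mult.assoc)
  qed
  then obtain n0 where n0: "\<And>i n. i \<in> fst P \<Longrightarrow> n \<ge> n0 i \<Longrightarrow> \<exists>p\<in>hmg \<delta> W (snd P i - D0 + int n * step). \<Delta> p = ent c i 0"
    by metis
  define n where "n = Max (insert 0 (n0 ` fst P))"
  have "\<exists>p\<in>hmg \<delta> W (snd P i - D0 + int n * step). \<Delta> p = ent c i 0" if "i \<in> fst P" for i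
    by (rule n0[OF that]) (use that P in \<open>simp add: n_def\<close>)
  then obtain p where p: "\<And>i. i \<in> fst P \<Longrightarrow> p i \<in> hmg \<delta> W (snd P i - D0 + int n * step) \<and> \<Delta> (p i) = ent c i 0"
    by metis
  define v where "v = CMat (\<lambda>i j. if i \<in> fst P \<and> j = 0 then p i else 0)"
  have v: "ent v i j = (if i \<in> fst P \<and> j = 0 then p i else 0)" for i j
    unfolding v_def by (rule ent_CMat_within[where S = "\<lambda>_. fst P"]) (auto simp: P split: if_splits)
  show ?thesis
  proof (intro exI bexI)
    show "v \<in> gh (gline (D0 - int n * step)) P"
      by (rule ghomI) (use p in \<open>auto simp: v gline_def algebra_simps split: if_splits\<close>)
    show "DD v = c"
      by (rule cmat_eqI) (use p c(1) in \<open>auto simp: ent_cmap v vhom_def\<close>)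
  qed
qed

text \<open>
  Every vector is half the sum of two eigenvectors of the twisted involution, and eigenvectors lift to homogeneous
  vectors. So what can be divided by \<open>d\<close> in the graded ring can be divided by it in the chart, and averaging over
  the involution makes the quotient equivariant.
\<close>

lemma exact_lift:
  assumes P: "finite (fst P)" "finite (fst P')" and d: "d \<in> gh P' P" and X: "tmod X" and C: "C \<in> thom X (de P)"
    and Q0: "\<And>c. c \<in> Q \<Longrightarrow> TD P * G c \<in> Q" and Q1: "\<And>c c'. c \<in> Q \<Longrightarrow> c' \<in> Q \<Longrightarrow> c + c' \<in> Q"
    and Q2: "\<And>c k. c \<in> Q \<Longrightarrow> scal (const k) * c \<in> Q"
    and lift: "\<And>D p. p \<in> gh (gline D) P \<Longrightarrow> DD p \<in> Q \<Longrightarrow> \<exists>v\<in>gh (gline D) P'. p = d * v"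
    and col: "\<And>j. j \<in> fst X \<Longrightarrow> C * cunit j 0 \<in> Q"
  shows "\<exists>D\<in>thom X (de P'). DD d * D = C"
proof -
  have half: "scal (const (1/2)) + scal (const (1/2)) = (1 :: mpoly cmat)"
    by (simp flip: scal_add single_add)
  have eig: "\<exists>x\<in>vhom {0} (fst P'). c = DD d * x"
    if c: "c \<in> vhom {0} (fst P)" "c \<in> Q" "TD P * G c = scal (const (sg D0)) * c" for c D0
  proof -
    obtain D p where p: "p \<in> gh (gline D) P" "DD p = c" using eigen_lift[OF P(1) c(1,3)] by blast
    then obtain v where v: "v \<in> gh (gline D) P'" "p = d * v" using lift c(2) by blast
    have "DD v \<in> vhom {0} (fst P')" using thom_vhom[OF hom_de[OF v(1)]] by (simp add: gline_def)
    then show ?thesis using p v by (intro bexI[of _ "DD v"]) (auto simp: del.cmap_mult)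
  qed
  have "\<exists>x\<in>vhom {0} (fst P'). C * cunit j 0 = DD d * x" if j: "j \<in> fst X" for j
  proof -
    define c where "c = C * cunit j 0"
    have cV: "c \<in> vhom {0} (fst P)" using thom_vhom[OF C] by (auto simp: c_def vhom_def)
    define c' where "c' = TD P * G c"
    have TDV: "TD P \<in> vhom (fst P) (fst P)" using tmod_de[OF P(1)] by (simp add: tmod_def)
    have c'V: "c' \<in> vhom {0} (fst P)" unfolding c'_def by (rule vhom_comp[OF TDV vhom_G[OF cV]])
    have cQ: "c \<in> Q" "c' \<in> Q" using col[OF j] Q0 by (auto simp: c_def c'_def)
    have \<tau>: "TD P * G c = c'" "TD P * G c' = c"
      by (simp_all add: c'_def gam.cmap_mult vhom_idL[OF cV] flip: mult.assoc)
    let ?h = "scal (const (1/2)) :: mpoly cmat" and ?m = "scal (const (-1)) :: mpoly cmat"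
    have m: "?m * a = - a" for a by (rule cmat_eqI) (simp add: single_uminus)
    have Gs: "TD P * G (?h * a) = ?h * (TD P * G a)" for a
      by (simp add: gam.cmap_mult scal_comm2[of "TD P"])
    have "\<exists>x\<in>vhom {0} (fst P'). ?h * (c + c') = DD d * x"
    proof (rule eig)
      show "TD P * G (?h * (c + c')) = scal (const (sg 0)) * (?h * (c + c'))"
        by (simp add: Gs gam.cmap_add ring_distribs \<tau> sg_def add.commute)
    qed (auto intro!: vhom_scal vhom_add cV c'V Q2 Q1 cQ)
    moreover have "\<exists>x\<in>vhom {0} (fst P'). ?h * (c - c') = DD d * x"
    proof (cases "eps = 1")
      case True
      then have "G c = c" using eps1 by (intro cmat_eqI) (simp add: ent_cmap)
      moreover have "sg k = 1" for k unfolding sg_def using True by auto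
      then have "TD P = cproj (fst P)" by (intro cmat_eqI) (simp add: TD_def)
      ultimately have "c' = c" by (simp add: c'_def vhom_idL[OF cV])
      then show ?thesis by (intro bexI[of _ 0]) auto
    next
      case False
      then have e: "eps = -1" using eps by simp
      show ?thesis
      proof (rule eig)
        have "TD P * G (?h * (c - c')) = ?h * (c' - c)"
          by (simp add: Gs gam.cmap_diff right_diff_distrib \<tau>)
        also have "\<dots> = scal (const (sg 1)) * (?h * (c - c'))"
        proof -
          have "sg 1 = - 1" unfolding sg_def using e by simp
          then show ?thesis by (simp only: m) (simp add: right_diff_distrib)
        qed
        finally show "TD P * G (?h * (c - c')) = scal (const (sg 1)) * (?h * (c - c'))" .
        have "c - c' = c + ?m * c'" by (simp add: m)
        then show "?h * (c - c') \<in> Q" using Q2 Q1 cQ by metis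
      qed (auto intro!: vhom_scal vhom_diff cV c'V)
    qed
    ultimately obtain x y where xy: "x \<in> vhom {0} (fst P')" "y \<in> vhom {0} (fst P')"
      "?h * (c + c') = DD d * x" "?h * (c - c') = DD d * y" by blast
    have "c = (?h + ?h) * c" by (simp add: half)
    also have "\<dots> = ?h * (c + c') + ?h * (c - c')" by (simp add: ring_distribs right_diff_distrib)
    also have "\<dots> = DD d * (x + y)" by (subst xy(3), subst xy(4), rule distrib_left[symmetric])
    finally show ?thesis using vhom_add[OF xy(1,2)] unfolding c_def by blast
  qed
  then obtain x where x: "\<And>j. j \<in> fst X \<Longrightarrow> x j \<in> vhom {0} (fst P') \<and> C * cunit j 0 = DD d * x j" by metis
  define D0 where "D0 = assemble (fst X) x"
  have D0: "D0 \<in> vhom (fst X) (fst P')"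
    using x by (auto simp: D0_def vhom_def)
  have dD0: "DD d * D0 = C"
  proof (rule cmat_eqI)
    fix i j
    show "ent (DD d * D0) i j = ent C i j"
    proof (cases "j \<in> fst X")
      case True
      then have "ent (DD d * x j) i 0 = ent (C * cunit j 0) i 0" using x by simp
      then show ?thesis using True by (simp add: D0_def mult_assemble)
    next
      case False
      then show ?thesis using thom_vhom[OF C] by (auto simp: D0_def mult_assemble vhom_def)
    qed
  qed
  let ?T = "snd X" and ?h = "scal (const (1/2)) :: mpoly cmat"
  define D1 where "D1 = ?h * (D0 + TD P' * G D0 * G ?T)"
  have T: "?T * G ?T = cproj (fst X)" "?T \<in> vhom (fst X) (fst X)" using X by (auto simp: tmod_def)
  have T': "G ?T * ?T = cproj (fst X)" using arg_cong[OF T(1), of G] by (simp add: gam.cmap_mult)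
  have TDV: "TD P' \<in> vhom (fst P') (fst P')" using tmod_de[OF P(2)] by (simp add: tmod_def)
  have "D1 \<in> vhom (fst X) (fst P')"
    unfolding D1_def by (intro vhom_scal vhom_add D0 vhom_comp[OF vhom_comp[OF TDV vhom_G[OF D0]] vhom_G[OF T(2)]]) simp
  moreover have "D1 * ?T = TD P' * G D1"
  proof -
    have "D1 * ?T = ?h * (D0 * ?T + TD P' * (G D0 * cproj (fst X)))"
      by (simp add: D1_def ring_distribs mult.assoc T')
    also have "G D0 * cproj (fst X) = G D0" by (rule vhom_idR[OF vhom_G[OF D0]])
    finally have 1: "D1 * ?T = ?h * (D0 * ?T + TD P' * G D0)" .
    have "TD P' * G D1 = ?h * (TD P' * G D0 + TD P' * TD P' * (D0 * ?T))"
      by (simp add: D1_def gam.cmap_mult gam.cmap_add ring_distribs mult.assoc scal_comm2[of "TD P'"] assoc_rule[OF TD_TD])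
    also have "TD P' * TD P' * (D0 * ?T) = D0 * ?T"
      using vhom_idL[OF D0] by (simp flip: mult.assoc)
    finally show ?thesis using 1 by (simp add: add.commute)
  qed
  moreover have "DD d * D1 = C"
  proof -
    have "DD d * TD P' = TD P * G (DD d)" using hom_de[OF d] by (simp add: thom_def)
    then have "DD d * (TD P' * G D0 * G ?T) = TD P * G (DD d * D0) * G ?T"
      by (simp add: gam.cmap_mult flip: mult.assoc)
    also have "\<dots> = C * (?T * G ?T)" using C by (simp add: dD0 thom_def flip: mult.assoc)
    also have "\<dots> = C" by (simp add: T thom_idR[OF C])
    finally have "DD d * D1 = (?h + ?h) * C"
      by (simp add: D1_def scal_comm2[of "DD d"] ring_distribs dD0)
    then show ?thesis by (simp add: half)
  qed
  ultimately show ?thesis by (auto simp: thom_def)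
qed

lemma exact_lift_kernel:
  assumes P: "finite (fst P1)" "finite (fst P2)" and d: "d \<in> gh P1 P0" and d2: "d2 \<in> gh P2 P1" and X: "tmod X"
    and C: "C \<in> thom X (de P1)" "DD d * C = 0"
    and ex: "\<And>D v. v \<in> gh (gline D) P1 \<Longrightarrow> d * v = 0 \<Longrightarrow> \<exists>v'\<in>gh (gline D) P2. v = d2 * v'"
  shows "\<exists>D\<in>thom X (de P2). DD d2 * D = C"
proof (rule exact_lift[OF P d2 X C(1), where Q = "{c. DD d * c = 0}"])
  fix c assume "c \<in> {c. DD d * c = 0}"
  then have "TD P0 * G (DD d * c) = 0" by simp
  moreover have "DD d * (TD P1 * G c) = TD P0 * G (DD d * c)"
    using hom_de[OF d] by (simp add: thom_def gam.cmap_mult flip: mult.assoc)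
  ultimately show "TD P1 * G c \<in> {c. DD d * c = 0}" by simp
next
  fix D p assume "p \<in> gh (gline D) P1" "DD p \<in> {c. DD d * c = 0}"
  then show "\<exists>v\<in>gh (gline D) P2. p = d2 * v"
    using hom_inj[OF ghom_comp[OF d]] ex by (auto simp: del.cmap_mult)
next
  fix j show "C * cunit j 0 \<in> {c. DD d * c = 0}" using C(2) by (simp flip: mult.assoc)
qed (auto simp: ring_distribs scal_comm2[of "DD d"])

end

context dehom
begin

definition gmf :: "gmod \<Rightarrow> gmod \<Rightarrow> mpoly cmat \<Rightarrow> mpoly cmat \<Rightarrow> bool" where
  "gmf P Q a b \<longleftrightarrow> finite (fst P) \<and> finite (fst Q) \<and> a \<in> gh P Q \<and> b \<in> gh Q P \<and>
     b * a = scal F * cproj (fst P) \<and> a * b = scal F * cproj (fst Q)"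

definition demf :: "gmod \<Rightarrow> gmod \<Rightarrow> mpoly cmat \<Rightarrow> mpoly cmat \<Rightarrow> tmf" where
  "demf P Q a b = \<lparr>X0 = de P, X1 = de Q, phi = DD a, psi = DD b\<rparr>"

lemma demf_simps [simp]: "X0 (demf P Q a b) = de P" "X1 (demf P Q a b) = de Q"
  "phi (demf P Q a b) = DD a" "psi (demf P Q a b) = DD b" "sh (demf P Q a b) = demf Q P b a"
  by (simp_all add: demf_def sh_def)

lemma gmf_sh: "gmf P Q a b \<Longrightarrow> gmf Q P b a" by (auto simp: gmf_def)

lemma is_mf_demf: "gmf P Q a b \<Longrightarrow> is_mf (demf P Q a b)"
proof -
  assume *: "gmf P Q a b"
  then have "DD b * DD a = scal f * cproj (fst P)" "DD a * DD b = scal f * cproj (fst Q)"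
    by (simp_all add: gmf_def del_F flip: del.cmap_mult) (simp_all add: del.cmap_mult del_F)
  then show ?thesis using * by (auto simp: is_mf_def gmf_def intro: tmod_de hom_de)
qed

text \<open>
  A factorization is determined up to homotopy by its cokernel as an object of the stable category. The maps
  \<open>\<alpha>\<close> and \<open>\<beta>\<close> of cokernels are inverse to each other up to maps factoring through free modules; for the composite
  \<open>\<beta> \<alpha>\<close> such a map is \<open>l' m'\<close>, and it descends to the cokernels because \<open>m' d\<close> is divisible by \<open>f\<close>.
\<close>

lemma heq_of_coker:
  assumes E: "is_mf E" and gm: "gmf P1 P0 d h"
    and \<alpha>: "\<alpha> \<in> thom (de P0) (X1 E)" and \<sigma>: "\<sigma> \<in> thom (de P1) (X0 E)"
    and \<beta>: "\<beta> \<in> thom (X1 E) (de P0)" and \<tau>: "\<tau> \<in> thom (X0 E) (de P1)"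
    and \<alpha>\<sigma>: "\<alpha> * DD d = phi E * \<sigma>" and \<beta>\<tau>: "\<beta> * phi E = DD d * \<tau>"
    and k: "k \<in> thom (X1 E) (X0 E)" and l: "l \<in> thom (X0 E) (X1 E)"
    and \<alpha>\<beta>: "\<alpha> * \<beta> = cproj (fst (X1 E)) + phi E * k + l * psi E"
    and k': "k' \<in> thom (de P0) (de P1)" and l': "l' \<in> thom (de Q) (de P0)" and m': "m' \<in> thom (de P0) (de Q)"
    and n': "n' \<in> thom (de P1) (de Q)" and m'n': "m' * DD d = scal f * n'"
    and \<beta>\<alpha>: "\<beta> * \<alpha> = cproj (fst P0) + DD d * k' + l' * m'"
  shows "heq E (demf P1 P0 d h)"
proof -
  let ?E = "demf P1 P0 d h"
  let ?d = "DD d" and ?h = "DD h" and ?\<phi> = "phi E" and ?\<psi> = "psi E"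
  have E': "is_mf ?E" by (rule is_mf_demf[OF gm])
  have e: "?\<phi> \<in> thom (X0 E) (X1 E)" "?\<psi> \<in> thom (X1 E) (X0 E)" "?\<psi> * ?\<phi> = scal f * cproj (fst (X0 E))"
    "?\<phi> * ?\<psi> = scal f * cproj (fst (X1 E))" using E by (auto simp: is_mf_def)
  have e': "?d \<in> thom (de P1) (de P0)" "?h \<in> thom (de P0) (de P1)" "?h * ?d = scal f * cproj (fst P1)"
    "?d * ?h = scal f * cproj (fst P0)" using E' by (auto simp: is_mf_def)
  note v = thom_vhom thom_comp thom_add thom_scal[OF f_V gam_f]
  have f1: "?\<phi> * (?\<psi> * x) = scal f * x" if "x \<in> thom Z (X1 E)" for x Z
    using thom_idL[OF that] by (simp add: assoc_rule[OF e(4)] mult.assoc)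
  have f0: "?d * (?h * x) = scal f * x" if "x \<in> thom Z (de P0)" for x Z
    using thom_idL[OF that] by (simp add: assoc_rule[OF e'(4)] mult.assoc)
  have m: "m' = n' * ?h"
  proof (rule scal_cancel[OF _ f_nz])
    have "scal f * m' = m' * (?d * ?h)" using thom_idR[OF m'] by (simp add: e' scal_comm2[of m'])
    also have "\<dots> = scal f * (n' * ?h)" using m'n' by (simp flip: mult.assoc)
    finally show "scal f * m' = scal f * (n' * ?h)" .
  qed
  have closed1: "\<sigma> * ?h = ?\<psi> * \<alpha>"
  proof (rule phi_cancel[OF E])
    show "?\<phi> * (\<sigma> * ?h) = ?\<phi> * (?\<psi> * \<alpha>)"
      using \<alpha>\<sigma>[symmetric] thom_idR[OF \<alpha>]
      by (simp add: f1[OF \<alpha>] assoc_rule[OF \<alpha>\<sigma>[symmetric]] e'(4) mult.assoc scal_comm2[of \<alpha>])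
  qed (use \<sigma> e' e \<alpha> in \<open>auto intro!: v(1) thom_comp\<close>)
  have closed2: "\<tau> * ?\<psi> = ?h * \<beta>"
  proof -
    have "?d * (\<tau> * ?\<psi>) = ?d * (?h * \<beta>)"
      using thom_idR[OF \<beta>]
      by (simp add: f0[OF \<beta>] assoc_rule[OF \<beta>\<tau>[symmetric]] e(4) mult.assoc scal_comm2[of \<beta>])
    then show ?thesis
      using phi_cancel[OF E', of "\<tau> * ?\<psi>" "fst (X1 E)" "?h * \<beta>"]
        thom_vhom[OF thom_comp[OF \<tau> e(2)]] thom_vhom[OF thom_comp[OF e'(2) \<beta>]] by simp
  qed
  have ma: "(\<sigma>, \<alpha>) \<in> tmaps ?E E" and mb: "(\<tau>, \<beta>) \<in> tmaps E ?E"
    using \<alpha> \<beta> \<sigma> \<tau> \<alpha>\<sigma> \<beta>\<tau> closed1 closed2 by (auto simp: tmaps_def)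
  have \<sigma>\<tau>: "\<sigma> * \<tau> = cproj (fst (X0 E)) + (k * ?\<phi> + ?\<psi> * l)"
  proof (rule phi_cancel[OF E])
    have "?\<phi> * (\<sigma> * \<tau>) = \<alpha> * \<beta> * ?\<phi>" by (simp add: assoc_rule[OF \<alpha>\<sigma>[symmetric]] \<beta>\<tau> mult.assoc)
    also have "\<dots> = ?\<phi> + ?\<phi> * (k * ?\<phi>) + l * (?\<psi> * ?\<phi>)"
      using thom_idL[OF e(1)] by (simp add: \<alpha>\<beta> ring_distribs mult.assoc)
    also have "l * (?\<psi> * ?\<phi>) = ?\<phi> * (?\<psi> * l)"
      using f1[OF l] thom_idR[OF l] by (simp add: e(3) scal_comm2[of l])
    finally show "?\<phi> * (\<sigma> * \<tau>) = ?\<phi> * (cproj (fst (X0 E)) + (k * ?\<phi> + ?\<psi> * l))"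
      using thom_idR[OF e(1)] by (simp add: ring_distribs)
    show "cproj (fst (X0 E)) + (k * ?\<phi> + ?\<psi> * l) \<in> vhom (fst (X0 E)) (fst (X0 E))"
      using E e k l by (intro v(1) thom_add thom_comp thom_id) (auto simp: is_mf_def)
  qed (use \<sigma> \<tau> thom_vhom[OF thom_comp] in auto)
  have \<tau>\<sigma>: "\<tau> * \<sigma> = cproj (fst P1) + (k' * ?d + ?h * (l' * n'))"
  proof -
    have "?d * (\<tau> * \<sigma>) = \<beta> * \<alpha> * ?d" by (simp add: assoc_rule[OF \<beta>\<tau>[symmetric]] \<alpha>\<sigma> mult.assoc)
    also have "\<dots> = ?d + ?d * (k' * ?d) + l' * (m' * ?d)"
      using thom_idL[OF e'(1)] by (simp add: \<beta>\<alpha> ring_distribs mult.assoc)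
    also have "l' * (m' * ?d) = ?d * (?h * (l' * n'))"
      by (simp add: f0[OF thom_comp[OF l' n']] m'n' scal_comm2[of l'])
    finally have eq: "?d * (\<tau> * \<sigma>) = ?d * (cproj (fst P1) + (k' * ?d + ?h * (l' * n')))"
      using thom_idR[OF e'(1)] by (simp add: ring_distribs)
    have in1: "cproj (fst P1) + (k' * ?d + ?h * (l' * n')) \<in> thom (de P1) (de P1)"
      using gm e' k' l' n' thom_id[OF tmod_de[of P1]]
      by (intro thom_add) (auto simp: gmf_def intro!: thom_comp)
    then show ?thesis
      using phi_cancel[OF E', of "\<tau> * \<sigma>" "fst P1" "cproj (fst P1) + (k' * ?d + ?h * (l' * n'))"] eq
        thom_vhom[OF thom_comp[OF \<tau> \<sigma>]] thom_vhom[OF in1] by simp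
  qed
  have h1: "thtp E E (pmul (\<sigma>, \<alpha>) (\<tau>, \<beta>)) (tid E)"
    unfolding thtp_def by (intro bexI[of _ l] bexI[of _ k]) (auto simp: tid_def \<sigma>\<tau> \<alpha>\<beta> k l)
  have h2: "thtp ?E ?E (pmul (\<tau>, \<beta>) (\<sigma>, \<alpha>)) (tid ?E)"
    unfolding thtp_def
    by (intro bexI[of _ "l' * n'"] bexI[of _ k'])
       (auto simp: tid_def \<tau>\<sigma> \<beta>\<alpha> m mult.assoc k' intro!: thom_comp l' n')
  show ?thesis unfolding heq_def using ma mb h1 h2 by blast
qed

lemma gh_exact_lift:
  assumes "C \<in> gh X P1" "d * C = 0"
    and ex: "\<And>D v. v \<in> gh (gline D) P1 \<Longrightarrow> d * v = 0 \<Longrightarrow> \<exists>v'\<in>gh (gline D) P2. v = d2 * v'"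
  shows "\<exists>D\<in>gh X P2. d2 * D = C"
proof (rule ghom_lift[OF assms(1)])
  fix j assume j: "j \<in> fst X"
  have "d * (C * cunit j 0) = 0" using assms(2) by (simp flip: mult.assoc)
  then show "\<exists>v\<in>gh (gline (snd X j)) P2. d2 * v = C * cunit j 0"
    using ex[OF column_ghom[OF assms(1) j]] by metis
qed

text \<open>
  Induction on the length of a resolution \<open>\<dots> \<rightarrow> P\<^sub>2 \<rightarrow> P\<^sub>1 \<rightarrow> P\<^sub>0\<close> of the cokernel of a matrix
  factorization \<open>E\<close>, up to stable equivalence. As \<open>f\<close> annihilates the cokernel \<open>N\<close>, there is a null homotopy
  \<open>h\<close> of \<open>f\<close>, and the syzygy of \<open>N\<close> over the hypersurface \<open>f = 0\<close>, which is stably the cokernel of the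
  shifted factorization, is resolved by \<open>\<dots> \<rightarrow> P\<^sub>3 \<rightarrow> P\<^sub>2 \<oplus> P\<^sub>0 \<rightarrow> P\<^sub>1\<close>. This shortens
  the resolution, until a single matrix \<open>d\<close> remains; then \<open>(d, h)\<close> is a graded matrix factorization.
\<close>

lemma heq_of_resolution:
  assumes "gres \<delta> W n P1 d" "finite (fst P1)" "finite (fst P0)" "d \<in> gh P1 P0" "h \<in> gh P0 P1"
    "d * h = scal F * cproj (fst P0)" "is_mf E"
    "\<alpha> \<in> thom (de P0) (X1 E)" "\<sigma> \<in> thom (de P1) (X0 E)" "\<beta> \<in> thom (X1 E) (de P0)" "\<tau> \<in> thom (X0 E) (de P1)"
    "\<alpha> * DD d = phi E * \<sigma>" "\<beta> * phi E = DD d * \<tau>"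
    "k \<in> thom (X1 E) (X0 E)" "l \<in> thom (X0 E) (X1 E)"
    "\<alpha> * \<beta> = cproj (fst (X1 E)) + phi E * k + l * psi E"
    "k' \<in> thom (de P0) (de P1)" "l' \<in> thom (de Q) (de P0)" "m' \<in> thom (de P0) (de Q)"
    "n' \<in> thom (de P1) (de Q)" "m' * DD d = scal f * n'"
    "\<beta> * \<alpha> = cproj (fst P0) + DD d * k' + l' * m'"
  shows "\<exists>Q0 Q1 a b. gmf Q0 Q1 a b \<and> heq E (demf Q0 Q1 a b)"
  using assms
proof (induction n arbitrary: P1 P0 d h E \<alpha> \<sigma> \<beta> \<tau> k l Q k' l' m' n')
  case (0 P1 P0 d h E \<alpha> \<sigma> \<beta> \<tau> k l Q k' l' m' n')
  have "h * d = scal F * cproj (fst P1)"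
  proof (rule ghom_columns)
    show hd: "h * d \<in> gh P1 P1" by (rule ghom_comp[OF 0(5,4)])
    show Fi: "scal F * cproj (fst P1) \<in> gh P1 P1" by (rule ghom_scal[OF ghom_id F]) auto
    fix j assume j: "j \<in> fst P1"
    have "d * (h * d) = d * (scal F * cproj (fst P1))"
      using ghom_idL[OF 0(4)] ghom_idR[OF 0(4)] by (simp add: assoc_rule[OF 0(6)] mult.assoc scal_comm2[of d])
    then have "d * ((h * d - scal F * cproj (fst P1)) * cunit j 0) = 0"
      by (simp add: right_diff_distrib flip: mult.assoc)
    moreover have "(h * d - scal F * cproj (fst P1)) * cunit j 0 \<in> gh (gline (snd P1 j)) P1"
      by (rule column_ghom[OF ghom_diff[OF hd Fi] j])
    ultimately have "(h * d - scal F * cproj (fst P1)) * cunit j 0 = 0" using 0(1) by auto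
    then show "h * d * cunit j 0 = scal F * cproj (fst P1) * cunit j 0" by (simp add: left_diff_distrib)
  qed
  then have gm: "gmf P1 P0 d h" using 0 by (auto simp: gmf_def)
  have "heq E (demf P1 P0 d h)"
    by (rule heq_of_coker[OF 0(7) gm 0(8-22)])
  then show ?case using gm by blast
next
  case (Suc n P1 P0 d h E \<alpha> \<sigma> \<beta> \<tau> k l Q k' l' m' n')
  note P = Suc.prems(2-6) and E = Suc.prems(7) and A = Suc.prems(8-22)
  let ?d = "DD d" and ?h = "DD h" and ?\<phi> = "phi E" and ?\<psi> = "psi E"
  from Suc.prems(1) obtain P2 d2 where P2: "finite (fst P2)" "d2 \<in> gh P2 P1" "d * d2 = 0"
    "\<And>D v. v \<in> gh (gline D) P1 \<Longrightarrow> d * v = 0 \<Longrightarrow> \<exists>v'\<in>gh (gline D) P2. v = d2 * v'" "gres \<delta> W n P2 d2"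
    by auto
  have e: "?\<phi> \<in> thom (X0 E) (X1 E)" "?\<psi> \<in> thom (X1 E) (X0 E)" "?\<psi> * ?\<phi> = scal f * cproj (fst (X0 E))"
    "?\<phi> * ?\<psi> = scal f * cproj (fst (X1 E))" "tmod (X0 E)" "tmod (X1 E)" using E by (auto simp: is_mf_def)
  have dg: "?d \<in> thom (de P1) (de P0)" "?h \<in> thom (de P0) (de P1)" "DD d2 \<in> thom (de P2) (de P1)"
    using P P2 by (auto intro: hom_de)
  have dh: "?d * ?h = scal f * cproj (fst P0)"
    using arg_cong[OF P(5), of DD] by (simp add: del.cmap_mult del_F)
  have dd2: "?d * DD d2 = 0" using arg_cong[OF P2(3), of DD] by (simp add: del.cmap_mult)
  have f1: "?\<phi> * (?\<psi> * x) = scal f * x" if "x \<in> thom Z (X1 E)" for x Z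
    using thom_idL[OF that] by (simp add: assoc_rule[OF e(4)] mult.assoc)
  have f0: "?d * (?h * x) = scal f * x" if "x \<in> thom Z (de P0)" for x Z
    using thom_idL[OF that] by (simp add: assoc_rule[OF dh] mult.assoc)
  have lift: "\<exists>D\<in>thom X (de P2). DD d2 * D = C" if "tmod X" "C \<in> thom X (de P1)" "?d * C = 0" for X C
    by (rule exact_lift_kernel[OF P(1) P2(1) P(3) P2(2) that P2(4)])
  define d' where "d' = d2 * r0 + h * r1"
  have d': "d' \<in> gh (gsum P2 P0) P1" unfolding d'_def by (intro ghom_add ghom_gsum P2 P)
  have DDd': "DD d' = DD d2 * r0 + ?h * r1" by (simp add: d'_def del.cmap_add del.cmap_mult)
  \<comment> \<open>The new resolution is shorter: an element of the kernel of \<open>d'\<close> has no component in \<open>P\<^sub>0\<close>.\<close>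
  have ker: "r1 * v = 0 \<and> d2 * (r0 * v) = 0" if v: "v \<in> gh (gline D) (gsum P2 P0)" "d' * v = 0" for v D
  proof -
    have r1v: "r1 * v \<in> gh (gline D) P0" using v by auto
    have "0 = d * (d' * v)" using v by simp
    also have "\<dots> = d * d2 * (r0 * v) + d * h * (r1 * v)" by (simp add: d'_def ring_distribs mult.assoc)
    also have "\<dots> = scal F * (r1 * v)" using ghom_idL[OF r1v] by (simp add: P2(3) P(5) mult.assoc)
    finally have "scal F * (r1 * v) = scal F * 0" by simp
    moreover have "F \<noteq> 0" using f_nz del_F by auto
    ultimately have "r1 * v = 0" by (rule scal_cancel)
    then show ?thesis using v(2) by (simp add: d'_def ring_distribs mult.assoc)
  qed
  have res': "gres \<delta> W n (gsum P2 P0) d'"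
  proof (cases n)
    case 0
    have "v = 0" if v: "v \<in> gh (gline D) (gsum P2 P0)" "d' * v = 0" for v D
    proof -
      have "r0 * v \<in> gh (gline D) P2" using v by auto
      then have "r0 * v = 0" using ker[OF v] P2(5) 0 by auto
      then show ?thesis using ker[OF v] leavitt_split(1)[of v] by simp
    qed
    then show ?thesis using 0 by auto
  next
    case (Suc m)
    then obtain P3 d3 where P3: "finite (fst P3)" "d3 \<in> gh P3 P2" "d2 * d3 = 0"
      "\<And>D v. v \<in> gh (gline D) P2 \<Longrightarrow> d2 * v = 0 \<Longrightarrow> \<exists>v'\<in>gh (gline D) P3. v = d3 * v'" "gres \<delta> W m P3 d3"
      using P2(5) by auto
    have "gres \<delta> W m P3 (s0 * d3)"
    proof (rule gres_cong[OF P3(5)])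
      fix D v show "d3 * v = 0 \<longleftrightarrow> s0 * d3 * v = 0"
        using leavitt2(1)[of "d3 * v"] by (auto simp: mult.assoc simp del: leavitt2)
    qed
    moreover have "\<exists>v'\<in>gh (gline D) P3. v = s0 * d3 * v'" if v: "v \<in> gh (gline D) (gsum P2 P0)" "d' * v = 0" for v D
    proof -
      have "r0 * v \<in> gh (gline D) P2" using v by auto
      then obtain v' where v': "v' \<in> gh (gline D) P3" "r0 * v = d3 * v'" using ker[OF v] P3(4) by blast
      have "v = s0 * (d3 * v')" using leavitt_split(1)[of v] ker[OF v] v'(2) by simp
      then show ?thesis using v'(1) by (auto simp: mult.assoc)
    qed
    moreover have "d' * (s0 * d3) = 0" using P3(3) by (simp add: d'_def ring_distribs mult.assoc)
    moreover have "s0 * d3 \<in> gh P3 (gsum P2 P0)" using P3(2) by auto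
    ultimately show ?thesis unfolding Suc using P3(1) by (subst gres.simps) blast
  qed
  have Fi: "scal F * cproj (fst P1) \<in> gh P1 P1" by (rule ghom_scal[OF ghom_id F]) auto
  have "\<exists>D\<in>gh P1 P2. d2 * D = scal F * cproj (fst P1) - h * d"
  proof (rule gh_exact_lift[OF ghom_diff[OF Fi ghom_comp[OF P(4,3)]] _ P2(4)])
    have "d * (h * d) = scal F * d" using ghom_idL[OF P(3)] by (simp add: assoc_rule[OF P(5)] mult.assoc)
    then show "d * (scal F * cproj (fst P1) - h * d) = 0"
      using ghom_idR[OF P(3)] by (simp add: right_diff_distrib scal_comm2[of d])
  qed
  then obtain e0 where e0: "e0 \<in> gh P1 P2" "d2 * e0 = scal F * cproj (fst P1) - h * d" by blast
  define h' where "h' = s0 * e0 + s1 * d"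
  have h': "h' \<in> gh P1 (gsum P2 P0)" unfolding h'_def by (intro ghom_add ghom_gsum e0 P)
  have d'h': "d' * h' = scal F * cproj (fst P1)"
    by (simp add: d'_def h'_def ring_distribs mult.assoc e0)
  define \<sigma>' where "\<sigma>' = \<alpha> * r1"
  have \<sigma>': "\<sigma>' \<in> thom (de (gsum P2 P0)) (X1 E)" unfolding \<sigma>'_def using A(1) by auto
  have \<sigma>d2: "\<sigma> * DD d2 = 0"
  proof (rule phi_cancel[OF E])
    show "?\<phi> * (\<sigma> * DD d2) = ?\<phi> * 0"
      using dd2 by (simp add: assoc_rule[OF A(5)[symmetric]] mult.assoc)
  qed (use thom_vhom[OF thom_comp[OF A(2) dg(3)]] in auto)
  have \<sigma>h: "\<sigma> * ?h = ?\<psi> * \<alpha>"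
  proof (rule phi_cancel[OF E])
    show "?\<phi> * (\<sigma> * ?h) = ?\<phi> * (?\<psi> * \<alpha>)"
      using thom_idR[OF A(1)]
      by (simp add: f1[OF A(1)] assoc_rule[OF A(5)[symmetric]] dh mult.assoc scal_comm2[of \<alpha>])
  qed (use thom_vhom[OF thom_comp[OF A(2) dg(2)]] thom_vhom[OF thom_comp[OF e(2) A(1)]] in auto)
  have eq1: "\<sigma> * DD d' = ?\<psi> * \<sigma>'"
    by (simp add: DDd' \<sigma>'_def ring_distribs \<sigma>d2 \<sigma>h flip: mult.assoc)
  have "\<exists>D\<in>thom (X1 E) (de P2). DD d2 * D = \<tau> * ?\<psi> - ?h * \<beta>"
  proof (rule lift[OF e(6) thom_diff[OF thom_comp[OF A(4) e(2)] thom_comp[OF dg(2) A(3)]]])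
    have "?d * (\<tau> * ?\<psi>) = scal f * \<beta>"
      using thom_idR[OF A(3)] by (simp add: assoc_rule[OF A(6)[symmetric]] mult.assoc e(4) scal_comm2[of \<beta>])
    then show "?d * (\<tau> * ?\<psi> - ?h * \<beta>) = 0" by (simp add: right_diff_distrib f0[OF A(3)])
  qed
  then obtain e1 where e1: "e1 \<in> thom (X1 E) (de P2)" "DD d2 * e1 = \<tau> * ?\<psi> - ?h * \<beta>" by blast
  define \<tau>' where "\<tau>' = s0 * e1 + s1 * \<beta>"
  have \<tau>': "\<tau>' \<in> thom (X1 E) (de (gsum P2 P0))" unfolding \<tau>'_def by (intro thom_add thom_gsum e1 A)
  have eq2: "\<tau> * ?\<psi> = DD d' * \<tau>'"
    by (simp add: DDd' \<tau>'_def ring_distribs mult.assoc e1)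
  have \<sigma>\<tau>: "\<sigma> * \<tau> = cproj (fst (X0 E)) + ?\<psi> * l + k * ?\<phi>"
  proof (rule phi_cancel[OF E])
    have "?\<phi> * (\<sigma> * \<tau>) = \<alpha> * \<beta> * ?\<phi>" by (simp add: assoc_rule[OF A(5)[symmetric]] A(6) mult.assoc)
    also have "\<dots> = ?\<phi> + ?\<phi> * (k * ?\<phi>) + l * (?\<psi> * ?\<phi>)"
      using thom_idL[OF e(1)] by (simp add: A(9) ring_distribs mult.assoc)
    also have "l * (?\<psi> * ?\<phi>) = ?\<phi> * (?\<psi> * l)"
      using f1[OF A(8)] thom_idR[OF A(8)] by (simp add: e(3) scal_comm2[of l])
    finally show "?\<phi> * (\<sigma> * \<tau>) = ?\<phi> * (cproj (fst (X0 E)) + ?\<psi> * l + k * ?\<phi>)"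
      using thom_idR[OF e(1)] by (simp add: ring_distribs)
    show "cproj (fst (X0 E)) + ?\<psi> * l + k * ?\<phi> \<in> vhom (fst (X0 E)) (fst (X0 E))"
      using e A(7,8) by (intro thom_vhom thom_add thom_comp thom_id) auto
  qed (use thom_vhom[OF thom_comp[OF A(2,4)]] in auto)
  have "\<exists>D\<in>thom (de P1) (de P2). DD d2 * D = \<tau> * \<sigma> - cproj (fst P1) - k' * ?d - ?h * (l' * n')"
  proof (rule lift[OF tmod_de[OF P(1)]])
    show "\<tau> * \<sigma> - cproj (fst P1) - k' * ?d - ?h * (l' * n') \<in> thom (de P1) (de P1)"
      using thom_id[OF tmod_de[OF P(1)]] A dg by (intro thom_diff thom_comp) auto
    have "?d * (\<tau> * \<sigma>) = \<beta> * \<alpha> * ?d" by (simp add: assoc_rule[OF A(6)[symmetric]] A(5) mult.assoc)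
    also have "\<dots> = ?d + ?d * (k' * ?d) + l' * (m' * ?d)"
      using thom_idL[OF dg(1)] by (simp add: A(15) ring_distribs mult.assoc)
    also have "l' * (m' * ?d) = ?d * (?h * (l' * n'))"
      by (simp add: f0[OF thom_comp[OF A(11,13)]] A(14) scal_comm2[of l'])
    finally show "?d * (\<tau> * \<sigma> - cproj (fst P1) - k' * ?d - ?h * (l' * n')) = 0"
      using thom_idR[OF dg(1)] by (simp add: right_diff_distrib)
  qed
  then obtain e2 where e2: "e2 \<in> thom (de P1) (de P2)"
    "DD d2 * e2 = \<tau> * \<sigma> - cproj (fst P1) - k' * ?d - ?h * (l' * n')" by blast
  have \<tau>\<sigma>: "\<tau> * \<sigma> = cproj (fst P1) + DD d' * (s0 * e2 + s1 * (l' * n')) + k' * ?d"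
    by (simp add: DDd' ring_distribs mult.assoc e2)
  have "cproj (fst P0) \<in> thom (de P0) (de P0)" using thom_id[OF tmod_de[OF P(2)]] by simp
  then have n1: "cproj (fst P0) * r1 \<in> thom (de (gsum P2 P0)) (de P0)" by auto
  have mn: "?d * DD d' = scal f * (cproj (fst P0) * r1)"
    using dd2 dh by (simp add: DDd' ring_distribs flip: mult.assoc)
  have "\<exists>Q0 Q1 a b. gmf Q0 Q1 a b \<and> heq (sh E) (demf Q0 Q1 a b)"
  proof (rule Suc.IH[where ?P1.0 = "gsum P2 P0" and ?P0.0 = P1 and d = d' and h = h' and \<alpha> = \<sigma> and \<sigma> = \<sigma>' and \<beta> = \<tau> and \<tau> = \<tau>'
        and k = l and l = k and Q = P0 and k' = "s0 * e2 + s1 * (l' * n')" and l' = k' and m' = ?d and n' = "cproj (fst P0) * r1"])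
    show "s0 * e2 + s1 * (l' * n') \<in> thom (de P1) (de (gsum P2 P0))"
      by (intro thom_add thom_gsum e2 thom_comp[OF A(11,13)])
  qed (use res' P P2 d' h' d'h' is_mf_sh[OF E] A \<sigma>' \<tau>' eq1 eq2 \<sigma>\<tau> \<tau>\<sigma> dg n1 mn in \<open>auto simp: finite_gsum\<close>)
  then show ?case using heq_sh[of "sh E"] gmf_sh by (metis sh_simps(5) demf_simps(5))
qed

end

context dehom
begin

text \<open>
  Cover the odd part of \<open>E\<close> by a graded free module \<open>P\<^sub>0\<close> with one generator of each parity for every basis vector.
  The homogeneous vectors of \<open>P\<^sub>0\<close> whose image in the chart lies in the image of \<open>phi E\<close> form a graded submodule.
  It has a finite free resolution by the syzygy theorem, which in the chart resolves the cokernel of \<open>E\<close>.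
\<close>

theorem graded_model:
  assumes E: "is_mf E" and triv: "eps = 1 \<Longrightarrow> snd (X1 E) = cproj (fst (X1 E))"
  shows "\<exists>Q0 Q1 a b. gmf Q0 Q1 a b \<and> heq E (demf Q0 Q1 a b)"
proof -
  let ?\<phi> = "phi E" and ?\<psi> = "psi E"
  define I T where "I = fst (X1 E)" and "T = snd (X1 E)"
  have e: "?\<phi> \<in> thom (X0 E) (X1 E)" "?\<psi> \<in> thom (X1 E) (X0 E)" "?\<psi> * ?\<phi> = scal f * cproj (fst (X0 E))"
    "?\<phi> * ?\<psi> = scal f * cproj (fst (X1 E))" "tmod (X0 E)" "tmod (X1 E)" using E by (auto simp: is_mf_def)
  have T: "finite I" "T \<in> vhom I I" "T * G T = cproj I" using e(6) by (auto simp: tmod_def I_def T_def)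
  have T': "G T * T = cproj I" using arg_cong[OF T(3), of G] by (simp add: gam.cmap_mult)
  have id: "cproj I * T = T" "T * cproj I = T" "cproj I * G T = G T" "G T * cproj I = G T" "cproj I * cproj I = (cproj I :: mpoly cmat)"
    using vhom_idL[OF T(2)] vhom_idR[OF T(2)] vhom_idL[OF vhom_G[OF T(2)]] vhom_idR[OF vhom_G[OF T(2)]] vhom_idL[OF vhom_id[of I]] by auto
  let ?h = "scal (const (1/2)) :: mpoly cmat"
  have half: "?h + ?h = (1 :: mpoly cmat)" by (simp flip: scal_add single_add)

  \<comment> \<open>A graded free cover of the odd part: \<open>v \<plusminus> T v\<close> are eigenvectors of the involution.\<close>
  define Pe Po :: gmod where "Pe = (I, \<lambda>_. 0)" and "Po = (I, \<lambda>_. 1)"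
  define P0 where "P0 = gsum Pe Po"
  have [simp]: "fst Pe = I" "fst Po = I" by (simp_all add: Pe_def Po_def)
  have finP0: "finite (fst P0)" by (simp add: P0_def Pe_def Po_def finite_gsum T(1))
  have TDe: "TD Pe = cproj I" by (rule cmat_eqI) (simp add: TD_def Pe_def sg_def)
  have TDo: "TD Po = scal (const eps) * cproj I" by (rule cmat_eqI) (simp add: TD_def Po_def sg_def)
  have epsT: "(cproj I - T) * (scal (const eps) * cproj I) = T - cproj I"
    using eps triv
    by (auto simp: T_def[symmetric] I_def[symmetric] left_diff_distrib id scal_comm2[of T] single_uminus intro!: cmat_eqI)
  have epsT2: "scal (const eps) * (cproj I - T) = T - cproj I"
    using eps triv by (auto simp: T_def[symmetric] I_def[symmetric] intro!: cmat_eqI simp: single_uminus)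
  have epsT3: "scal (const eps) * (cproj I - G T) = G T - cproj I"
    using arg_cong[OF epsT2, of G] by (simp add: gam.cmap_mult gam.cmap_diff)
  define \<pi> where "\<pi> = ?h * (cproj I + T) * r0 + ?h * (cproj I - T) * r1"
  define \<beta> where "\<beta> = s0 * (?h * (cproj I + G T)) + s1 * (?h * (cproj I - G T))"
  have x1: "X1 E = (I, T)" by (simp add: I_def T_def)
  have "?h * (cproj I + T) \<in> thom (de Pe) (X1 E)"
    using T vhom_id[of I]
    by (auto simp: thom_def x1 TDe gam.cmap_mult gam.cmap_add ring_distribs scal_comm2[of T] id mult.assoc
        intro!: vhom_scal vhom_add)
  moreover have "?h * (cproj I - T) \<in> thom (de Po) (X1 E)"
  proof -
    have "?h * (cproj I - T) * TD Po = ?h * (T - cproj I)" by (simp add: TDo mult.assoc epsT)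
    also have "\<dots> = T * G (?h * (cproj I - T))"
      by (simp add: gam.cmap_mult gam.cmap_diff right_diff_distrib scal_comm2[of T] id T)
    finally show ?thesis using T vhom_id[of I] by (auto simp: thom_def x1 intro!: vhom_scal vhom_diff)
  qed
  ultimately have \<pi>: "\<pi> \<in> thom (de P0) (X1 E)" unfolding \<pi>_def P0_def by (intro thom_add thom_gsum)
  have "?h * (cproj I + G T) \<in> thom (X1 E) (de Pe)"
    using T vhom_id[of I] vhom_G[OF T(2)]
    by (auto simp: thom_def x1 TDe gam.cmap_mult gam.cmap_add ring_distribs id T' mult.assoc scal_comm2[of "cproj I"]
        add.commute intro!: vhom_scal vhom_add)
  moreover have "?h * (cproj I - G T) \<in> thom (X1 E) (de Po)"
  proof -
    have "TD Po * G (?h * (cproj I - G T)) = ?h * (scal (const eps) * (cproj I - T))"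
      by (simp add: TDo gam.cmap_mult gam.cmap_diff mult.assoc scal_comm2[of "cproj I"] right_diff_distrib id
          scal_comm2[of "scal (const eps)" "const (1/2)"])
    also have "\<dots> = ?h * (cproj I - G T) * T"
      unfolding epsT2 by (simp add: mult.assoc left_diff_distrib id T')
    finally show ?thesis using T vhom_id[of I] vhom_G[OF T(2)]
      by (auto simp: thom_def x1 intro!: vhom_scal vhom_diff)
  qed
  ultimately have \<beta>: "\<beta> \<in> thom (X1 E) (de P0)" unfolding \<beta>_def P0_def by (intro thom_add thom_gsum)
  have \<pi>\<beta>: "\<pi> * \<beta> = cproj I"
  proof -
    have "\<pi> * \<beta> = ?h * (?h * ((cproj I + T) * (cproj I + G T) + (cproj I - T) * (cproj I - G T)))"
      by (simp add: \<pi>_def \<beta>_def ring_distribs mult.assoc scal_comm2[of "cproj I"] scal_comm2[of T] left_diff_distrib right_diff_distrib)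
    also have "(cproj I + T) * (cproj I + G T) + (cproj I - T) * (cproj I - G T) = (cproj I + cproj I) + (cproj I + cproj I)"
      by (simp add: ring_distribs left_diff_distrib right_diff_distrib id T)
    also have "?h * (?h * ((cproj I + cproj I) + (cproj I + cproj I))) = (?h + ?h) * ((?h + ?h) * cproj I)"
      by (simp add: ring_distribs)
    finally show ?thesis by (simp add: half)
  qed

  define L where "L D = {p \<in> gh (gline D) P0. \<exists>x\<in>vhom {0} (fst (X0 E)). \<pi> * DD p = ?\<phi> * x}" for D
  have L: "gsub \<delta> W P0 L"
    unfolding gsub_def
  proof (intro conjI allI ballI subsetI)
    fix D show "0 \<in> L D" by (auto simp: L_def intro!: bexI[of _ 0])
  next
    fix D u v assume "u \<in> L D" "v \<in> L D"
    then obtain x y where "u \<in> gh (gline D) P0" "v \<in> gh (gline D) P0" "x \<in> vhom {0} (fst (X0 E))" "y \<in> vhom {0} (fst (X0 E))"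
      "\<pi> * DD u = ?\<phi> * x" "\<pi> * DD v = ?\<phi> * y" by (auto simp: L_def)
    then show "u + v \<in> L D"
      by (auto simp: L_def ghom_add del.cmap_add ring_distribs intro!: bexI[of _ "x + y"] vhom_add)
  next
    fix D e' p v assume p: "p \<in> hmg \<delta> W e'" and "v \<in> L D"
    then obtain x where x: "v \<in> gh (gline D) P0" "x \<in> vhom {0} (fst (X0 E))" "\<pi> * DD v = ?\<phi> * x" by (auto simp: L_def)
    have "scal p * v \<in> gh (gline (D - e')) P0" by (rule ghom_scal[OF x(1) p]) (auto simp: gline_def)
    moreover have "\<pi> * DD (scal p * v) = ?\<phi> * (scal (\<Delta> p) * x)"
      by (simp add: del.cmap_mult scal_comm2[of \<pi>] scal_comm2[of ?\<phi>] x(3))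
    ultimately show "scal p * v \<in> L (D - e')" using vhom_scal[OF del_V[OF p] x(2)] by (auto simp: L_def)
  qed (auto simp: L_def)
  obtain P1 d n where cov: "gcover \<delta> W P0 L P1 d" and res: "gres \<delta> W n P1 d"
    using resolvable_finite[OF finW] finP0 L unfolding resolvable_def by blast
  have P1: "finite (fst P1)" "d \<in> gh P1 P0" and dcol: "\<And>j. j \<in> fst P1 \<Longrightarrow> d * cunit j 0 \<in> L (snd P1 j)"
    and dex: "\<And>D u. u \<in> L D \<Longrightarrow> \<exists>v\<in>gh (gline D) P1. u = d * v" using cov unfolding gcover_def by blast+
  have dg: "DD d \<in> thom (de P1) (de P0)" by (rule hom_de[OF P1(2)])
  have f1: "?\<phi> * (?\<psi> * x) = scal f * x" if "x \<in> vhom Z I" for x Z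
    using vhom_idL[OF that] by (simp add: assoc_rule[OF e(4)] I_def[symmetric] mult.assoc)
  have Fi: "scal F * cproj (fst P0) \<in> gh P0 P0" by (rule ghom_scal[OF ghom_id F]) auto
  have "\<exists>D\<in>gh P0 P1. d * D = scal F * cproj (fst P0)"
  proof (rule gcover_lift[OF cov Fi])
    fix j assume j: "j \<in> fst P0"
    have c: "cunit j 0 \<in> vhom {0} (fst P0)" using j by (auto simp: vhom_def)
    have \<pi>c: "\<pi> * cunit j 0 \<in> vhom {0} I" using vhom_comp[OF thom_vhom[OF \<pi>]] c by (simp add: I_def)
    have "\<pi> * DD (scal F * cproj (fst P0) * cunit j 0) = scal f * (\<pi> * cunit j 0)"
      using assoc_rule[OF thom_idR[OF \<pi>]] by (simp add: del.cmap_mult del_F mult.assoc scal_comm2[of \<pi>])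
    also have "\<dots> = ?\<phi> * (?\<psi> * (\<pi> * cunit j 0))" by (simp add: f1[OF \<pi>c])
    finally show "scal F * cproj (fst P0) * cunit j 0 \<in> L (snd P0 j)"
      using column_ghom[OF Fi j] vhom_comp[OF thom_vhom[OF e(2)]] \<pi>c by (auto simp: L_def I_def)
  qed
  then obtain h where h: "h \<in> gh P0 P1" "d * h = scal F * cproj (fst P0)" by blast
  have "\<forall>j\<in>fst P1. \<exists>x\<in>vhom {0} (fst (X0 E)). \<pi> * DD (d * cunit j 0) = ?\<phi> * x" using dcol by (auto simp: L_def)
  then obtain x where x: "\<And>j. j \<in> fst P1 \<Longrightarrow> x j \<in> vhom {0} (fst (X0 E))" "\<And>j. j \<in> fst P1 \<Longrightarrow> \<pi> * DD (d * cunit j 0) = ?\<phi> * x j"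
    by metis
  define \<sigma> where "\<sigma> = assemble (fst P1) x"
  have \<sigma>V: "\<sigma> \<in> vhom (fst P1) (fst (X0 E))" using x(1) by (auto simp: \<sigma>_def vhom_def)
  have \<pi>d: "\<pi> * DD d = ?\<phi> * \<sigma>"
  proof (rule cmat_eqI)
    fix i j
    show "ent (\<pi> * DD d) i j = ent (?\<phi> * \<sigma>) i j"
    proof (cases "j \<in> fst P1")
      case True
      have "ent (\<pi> * DD d) i j = ent (\<pi> * DD (d * cunit j 0)) i 0" by (simp add: del.cmap_mult flip: mult.assoc)
      then show ?thesis using True by (simp add: x(2) \<sigma>_def mult_assemble)
    next
      case False
      then show ?thesis using thom_vhom[OF thom_comp[OF \<pi> dg]] by (auto simp: \<sigma>_def mult_assemble vhom_def)
    qed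
  qed
  have \<sigma>: "\<sigma> \<in> thom (de P1) (X0 E)"
  proof -
    have "\<sigma> * TD P1 = snd (X0 E) * G \<sigma>"
    proof (rule phi_cancel[OF E])
      have "?\<phi> * (\<sigma> * TD P1) = T * G (?\<phi> * \<sigma>)"
        using thom_comp[OF \<pi> dg] by (simp add: thom_def x1 \<pi>d flip: mult.assoc)
      also have "\<dots> = ?\<phi> * (snd (X0 E) * G \<sigma>)"
        using e(1) by (simp add: thom_def x1 gam.cmap_mult flip: mult.assoc)
      finally show "?\<phi> * (\<sigma> * TD P1) = ?\<phi> * (snd (X0 E) * G \<sigma>)" .
      show "\<sigma> * TD P1 \<in> vhom (fst P1) (fst (X0 E))"
        using vhom_comp[OF \<sigma>V] tmod_de[OF P1(1)] by (simp add: tmod_def)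
      show "snd (X0 E) * G \<sigma> \<in> vhom (fst P1) (fst (X0 E))"
        using vhom_comp[OF _ vhom_G[OF \<sigma>V]] e(5) by (simp add: tmod_def)
    qed
    then show ?thesis using \<sigma>V by (simp add: thom_def)
  qed

  define Q where "Q = {c \<in> vhom {0} (fst P0). \<exists>x\<in>vhom {0} (fst (X0 E)). \<pi> * c = ?\<phi> * x}"
  have lift: "\<exists>D\<in>thom X (de P1). DD d * D = C"
    if X: "tmod X" and C: "C \<in> thom X (de P0)" and col: "\<And>j. j \<in> fst X \<Longrightarrow> C * cunit j 0 \<in> Q" for X C
  proof (rule exact_lift[OF finP0 P1 X C, where Q = Q])
    fix c assume "c \<in> Q"
    then obtain x where x: "c \<in> vhom {0} (fst P0)" "x \<in> vhom {0} (fst (X0 E))" "\<pi> * c = ?\<phi> * x" by (auto simp: Q_def)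
    have "\<pi> * (TD P0 * G c) = T * G (\<pi> * c)"
      using \<pi> by (simp add: thom_def x1 gam.cmap_mult flip: mult.assoc)
    also have "\<dots> = ?\<phi> * (snd (X0 E) * G x)"
      using e(1) unfolding x(3) by (simp add: thom_def x1 gam.cmap_mult flip: mult.assoc)
    finally have "\<pi> * (TD P0 * G c) = ?\<phi> * (snd (X0 E) * G x)" .
    moreover have "snd (X0 E) * G x \<in> vhom {0} (fst (X0 E))"
      using vhom_comp[OF _ vhom_G[OF x(2)]] e(5) by (simp add: tmod_def)
    moreover have "TD P0 * G c \<in> vhom {0} (fst P0)"
      using vhom_comp[OF _ vhom_G[OF x(1)]] tmod_de[OF finP0] by (simp add: tmod_def)
    ultimately show "TD P0 * G c \<in> Q" by (auto simp: Q_def)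
  next
    fix c c' assume "c \<in> Q" "c' \<in> Q"
    then obtain x y where "c \<in> vhom {0} (fst P0)" "c' \<in> vhom {0} (fst P0)" "x \<in> vhom {0} (fst (X0 E))" "y \<in> vhom {0} (fst (X0 E))"
      "\<pi> * c = ?\<phi> * x" "\<pi> * c' = ?\<phi> * y" by (auto simp: Q_def)
    then show "c + c' \<in> Q" by (auto simp: Q_def vhom_add ring_distribs intro!: bexI[of _ "x + y"])
  next
    fix c k assume "c \<in> Q"
    then obtain x where "c \<in> vhom {0} (fst P0)" "x \<in> vhom {0} (fst (X0 E))" "\<pi> * c = ?\<phi> * x" by (auto simp: Q_def)
    then show "scal (const k) * c \<in> Q"
      by (auto simp: Q_def vhom_scal scal_comm2[of \<pi>] scal_comm2[of ?\<phi>] intro!: bexI[of _ "scal (const k) * x"])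
  next
    fix D p assume "p \<in> gh (gline D) P0" "DD p \<in> Q"
    then have "p \<in> L D" by (auto simp: L_def Q_def)
    then show "\<exists>v\<in>gh (gline D) P1. p = d * v" by (rule dex)
  qed (rule col)
  have Qcol: "C * cunit j 0 \<in> Q" if C: "C \<in> thom X (de P0)" "\<pi> * C = ?\<phi> * x" "x \<in> vhom (fst X) (fst (X0 E))" and j: "j \<in> fst X" for C X x j
  proof -
    have c: "cunit j 0 \<in> vhom {0} (fst X)" using j by (auto simp: vhom_def)
    show ?thesis
      using vhom_comp[OF thom_vhom[OF C(1)], of "cunit j 0" "{0}"] vhom_comp[OF C(3) c] c
      by (auto simp: Q_def assoc_rule[OF C(2)] mult.assoc intro!: bexI[of _ "x * cunit j 0"])
  qed
  have "\<exists>D\<in>thom (X0 E) (de P1). DD d * D = \<beta> * ?\<phi>"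
  proof (rule lift[OF e(5) thom_comp[OF \<beta> e(1)]], rule Qcol[OF thom_comp[OF \<beta> e(1)]])
    show "\<pi> * (\<beta> * ?\<phi>) = ?\<phi> * cproj (fst (X0 E))"
      using thom_idL[OF e(1)] thom_idR[OF e(1)] by (simp add: assoc_rule[OF \<pi>\<beta>] I_def)
  qed (auto simp: vhom_id)
  then obtain \<tau> where \<tau>: "\<tau> \<in> thom (X0 E) (de P1)" "\<beta> * ?\<phi> = DD d * \<tau>" by metis
  have idP0: "cproj (fst P0) \<in> thom (de P0) (de P0)" using thom_id[OF tmod_de[OF finP0]] by simp
  have B: "\<beta> * \<pi> - cproj (fst P0) \<in> thom (de P0) (de P0)" by (rule thom_diff[OF thom_comp[OF \<beta> \<pi>] idP0])
  have "\<exists>D\<in>thom (de P0) (de P1). DD d * D = \<beta> * \<pi> - cproj (fst P0)"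
  proof (rule lift[OF tmod_de[OF finP0] B], rule Qcol[OF B])
    show "\<pi> * (\<beta> * \<pi> - cproj (fst P0)) = ?\<phi> * 0"
      using thom_idL[OF \<pi>] thom_idR[OF \<pi>] by (simp add: right_diff_distrib assoc_rule[OF \<pi>\<beta>] I_def)
  qed auto
  then obtain k' where k': "k' \<in> thom (de P0) (de P1)" "\<beta> * \<pi> - cproj (fst P0) = DD d * k'" by metis
  show ?thesis
    by (rule heq_of_resolution[OF res P1(1) finP0 P1(2) h E \<pi> \<sigma> \<beta> \<tau>(1) \<pi>d \<tau>(2) thom_0 thom_0,
          where k' = k' and l' = 0 and m' = 0 and n' = 0])
       (use k' \<pi>\<beta> in \<open>auto simp: I_def algebra_simps\<close>)
qed

end

section \<open>The Cox ring\<close>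

text \<open>
  The variables \<open>u\<close>, \<open>y\<close>, \<open>t\<close> of the graded ring have the indices \<open>0\<close>, \<open>1\<close> and \<open>N + 1\<close> and the degrees \<open>1\<close>, \<open>- 2\<close> and
  \<open>1\<close>. For \<open>h = hp\<close>, the polynomial \<open>FF = h(y u\<^sup>2, x\<^sub>2, \<dots>) + y t\<^sup>2\<close> has degree \<open>0\<close>. At \<open>u = 1\<close> it becomes
  \<open>fbar = h(y, x\<^sub>2, \<dots>) + y t\<^sup>2\<close>. At \<open>y = 1\<close> it becomes \<open>ff = h(u\<^sup>2, x\<^sub>2, \<dots>) + t\<^sup>2\<close>, and there the degree survives
  modulo \<open>2\<close> as the involution changing the signs of \<open>u\<close> and \<open>t\<close>. In \<open>del_y\<close> the variable \<open>u\<close> is renamed to the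
  first variable.
\<close>

locale cox =
  fixes N :: nat and hp :: mpoly
  assumes N: "N \<ge> 1" and hp: "hp \<in> poly_ring {1..N}"
begin

abbreviation "VV \<equiv> {1..N+1}"
abbreviation "WW \<equiv> {0..N+1}"

definition cdeg :: "nat \<Rightarrow> int" where
  "cdeg i = (if i = 0 \<or> i = N + 1 then 1 else if i = 1 then - 2 else 0)"

definition ff :: mpoly where "ff = mono_op (\<lambda>m. m + mon 1 (look m 1)) (\<lambda>_. 1) hp + var (N + 1) ^ 2"
definition fbar :: mpoly where "fbar = hp + var 1 * var (N + 1) ^ 2"
definition FF :: mpoly where "FF = mono_op (\<lambda>m. m + mon 0 (2 * look m 1)) (\<lambda>_. 1) hp + var 1 * var (N + 1) ^ 2"

definition del_u :: "mpoly \<Rightarrow> mpoly" where "del_u = mono_op (\<lambda>m. m - mon 0 (look m 0)) (\<lambda>_. 1)"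
definition del_y :: "mpoly \<Rightarrow> mpoly" where
  "del_y = mono_op (\<lambda>m. m - mon 0 (look m 0) - mon 1 (look m 1) + mon 1 (look m 0)) (\<lambda>_. 1)"
definition flip :: "mpoly \<Rightarrow> mpoly" where
  "flip = mono_op (\<lambda>m. m) (\<lambda>m. (- 1) ^ (look m 1 + look m (N + 1)))"

lemma N1: "N + 1 \<noteq> 1" "N + 1 \<noteq> 0" "Suc N \<noteq> Suc 0" using N by auto

lemma lookup_eqI: "(\<And>i. look m i = look n i) \<Longrightarrow> m = n" by (rule poly_mapping_eqI)

lemma look_u: "look (m - mon 0 (look m 0)) i = (if i = 0 then 0 else look m i)" for m :: monom
  by (auto simp: lookup_minus lookup_single when_def)

lemma look_y: "look (m - mon 0 (look m 0) - mon 1 (look m 1) + mon 1 (look m 0)) i =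
    (if i = 0 then 0 else if i = 1 then look m 0 else look m i)" for m :: monom
  by (auto simp: lookup_minus lookup_add lookup_single when_def)

definition ident :: "mpoly \<Rightarrow> mpoly" where "ident p = p"

lemma single_1: "mon 0 (1::complex) = (1 :: mpoly)" by (rule single_one)

lemma hom_u: "cring_hom del_u"
proof
  show "del_u (p + q) = del_u p + del_u q" for p q by (simp add: del_u_def mono_op_add)
  show "del_u (p * q) = del_u p * del_u q" for p q
    unfolding del_u_def
  proof (rule mono_op_mult)
    fix m n :: monom
    show "m + n - mon 0 (look (m + n) 0) = m - mon 0 (look m 0) + (n - mon 0 (look n 0))"
    proof (rule lookup_eqI)
      fix i
      have "look (m + n - mon 0 (look (m + n) 0)) i = (if i = 0 then 0 else look (m + n) i)" by (rule look_u)
      moreover have "look (m - mon 0 (look m 0) + (n - mon 0 (look n 0))) i =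
          (if i = 0 then 0 else look m i) + (if i = 0 then 0 else look n i)"
        by (subst lookup_add) (simp only: look_u)
      ultimately show "look (m + n - mon 0 (look (m + n) 0)) i = look (m - mon 0 (look m 0) + (n - mon 0 (look n 0))) i"
        by (simp add: lookup_add)
    qed
  qed simp
  show "del_u 1 = 1" unfolding del_u_def by (subst single_1[symmetric], subst mono_op_mon) simp
qed

lemma hom_y: "cring_hom del_y"
proof
  show "del_y (p + q) = del_y p + del_y q" for p q by (simp add: del_y_def mono_op_add)
  show "del_y (p * q) = del_y p * del_y q" for p q
    unfolding del_y_def
  proof (rule mono_op_mult)
    fix m n :: monom
    let ?s = "\<lambda>m::monom. m - mon 0 (look m 0) - mon 1 (look m 1) + mon 1 (look m 0)"
    show "?s (m + n) = ?s m + ?s n"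
    proof (rule lookup_eqI)
      fix i
      have "look (?s (m + n)) i = (if i = 0 then 0 else if i = 1 then look (m + n) 0 else look (m + n) i)" by (rule look_y)
      moreover have "look (?s m + ?s n) i =
          (if i = 0 then 0 else if i = 1 then look m 0 else look m i) + (if i = 0 then 0 else if i = 1 then look n 0 else look n i)"
        by (subst lookup_add) (simp only: look_y)
      ultimately show "look (?s (m + n)) i = look (?s m + ?s n) i"
        by (simp add: lookup_add)
    qed
  qed simp
  show "del_y 1 = 1" unfolding del_y_def by (subst single_1[symmetric], subst mono_op_mon) simp
qed

lemma hom_flip: "cring_hom flip"
proof
  show "flip (p + q) = flip p + flip q" for p q by (simp add: flip_def mono_op_add)
  show "flip (p * q) = flip p * flip q" for p q
    unfolding flip_def by (rule mono_op_mult) (auto simp: lookup_add power_add)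
  show "flip 1 = 1" unfolding flip_def by (subst single_1[symmetric], subst mono_op_mon) simp
qed

lemma look_flip: "look (flip p) m = (- 1) ^ (look m 1 + look m (N + 1)) * look p m"
  using lookup_mono_op[of p UNIV "\<lambda>m. m" m] by (simp add: flip_def span_of_def)

lemma flip_flip: "flip (flip p) = p"
  by (rule poly_mapping_eqI) (simp add: look_flip flip: power_mult_distrib mult.assoc)

lemma flip_V: "p \<in> poly_ring V \<Longrightarrow> flip p \<in> poly_ring V"
  unfolding poly_ring_eq flip_def by (erule mono_op_span_of) auto

lemma mdeg_cox: "supp m \<subseteq> WW \<Longrightarrow> mdeg cdeg m = int (look m 0) - 2 * int (look m 1) + int (look m (N + 1))"
proof -
  assume "supp m \<subseteq> WW"
  then have "mdeg cdeg m = (\<Sum>i\<in>WW. cdeg i * int (look m i))" by (intro mdeg_superset) auto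
  also have "\<dots> = (\<Sum>i\<in>{0, 1, N+1}. cdeg i * int (look m i))"
    by (rule sum.mono_neutral_right) (use N in \<open>auto simp: cdeg_def\<close>)
  also have "\<dots> = int (look m 0) - 2 * int (look m 1) + int (look m (N + 1))"
    using N by (simp add: cdeg_def)
  finally show ?thesis .
qed

lemma var_sq: "var 1 * var (N + 1) ^ 2 = mon (mon 1 1 + mon (N + 1) 2) (1::complex)"
  by (simp add: var_power) (simp add: var_def mult_single)

lemma supp_single_sub: "supp (mon i k :: monom) \<subseteq> {i}" by auto

lemma FF: "FF \<in> hmg cdeg WW 0"
proof -
  have "mono_op (\<lambda>m. m + mon 0 (2 * look m 1)) (\<lambda>_. 1) hp \<in> span_of (hmons cdeg WW 0)"
  proof (rule mono_op_span_of[OF hp[unfolded poly_ring_eq]])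
    fix m assume "m \<in> mons {1..N}"
    then have m: "supp m \<subseteq> {1..N}" by (simp add: mons_def)
    then have z: "look m 0 = 0" "look m (N + 1) = 0" by (auto simp: in_keys_iff)
    have s: "supp (m + mon 0 (2 * look m 1)) \<subseteq> WW"
      using m supp_single_sub[of 0] by (fastforce simp: keys_add_nat)
    show "(1::complex) = 0 \<or> m + mon 0 (2 * look m 1) \<in> hmons cdeg WW 0"
      using mdeg_cox[OF s] s z N by (simp add: hmons_def lookup_add lookup_single)
  qed
  moreover have "var 1 * var (N + 1) ^ 2 \<in> span_of (hmons cdeg WW 0)"
    unfolding var_sq using N by (intro span_of_mon) (auto simp: hmons_def keys_add_nat mdeg_add cdeg_def)
  ultimately show ?thesis unfolding FF_def hmg_def by (rule span_of_add)
qed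

lemma mono_op_comp:
  assumes "p \<in> span_of S" "\<And>m. m \<in> S \<Longrightarrow> \<mu> (\<nu> m) = \<rho> m"
  shows "mono_op \<mu> (\<lambda>_. 1) (mono_op \<nu> (\<lambda>_. 1) p) = mono_op \<rho> (\<lambda>_. 1) p"
  using assms(1) by (induction rule: span_of_induct) (auto simp: mono_op_add assms(2))

lemma del_u_FF: "del_u FF = fbar"
proof -
  have "del_u (mono_op (\<lambda>m. m + mon 0 (2 * look m 1)) (\<lambda>_. 1) hp) = mono_op (\<lambda>m. m) (\<lambda>_. 1) hp"
    unfolding del_u_def
  proof (rule mono_op_comp[OF hp[unfolded poly_ring_eq]])
    fix m assume "m \<in> mons {1..N}"
    then have "look m 0 = 0" by (auto simp: mons_def in_keys_iff)
    then show "m + mon 0 (2 * look m 1) - mon 0 (look (m + mon 0 (2 * look m 1)) 0) = m"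
      by (simp add: lookup_add)
  qed
  also have "mono_op (\<lambda>m. m) (\<lambda>_. 1) hp = hp"
    using mpoly_eq_sum_mon[of hp] by (simp add: mono_op_def)
  finally have 1: "del_u (mono_op (\<lambda>m. m + mon 0 (2 * look m 1)) (\<lambda>_. 1) hp) = hp" .
  have 2: "del_u (mon (mon 1 1 + mon (N + 1) 2) 1) = mon (mon 1 1 + mon (N + 1) 2) 1"
    unfolding del_u_def by (simp add: lookup_add lookup_single)
  show ?thesis unfolding FF_def fbar_def var_sq cring_hom.add[OF hom_u] 1 2 ..
qed

lemma del_y_FF: "del_y FF = ff"
proof -
  have 1: "del_y (mono_op (\<lambda>m. m + mon 0 (2 * look m 1)) (\<lambda>_. 1) hp) = mono_op (\<lambda>m. m + mon 1 (look m 1)) (\<lambda>_. 1) hp"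
    unfolding del_y_def
  proof (rule mono_op_comp[OF hp[unfolded poly_ring_eq]])
    fix m assume "m \<in> mons {1..N}"
    then have z: "look m 0 = 0" by (auto simp: mons_def in_keys_iff)
    let ?m = "m + mon 0 (2 * look m 1)"
    show "?m - mon 0 (look ?m 0) - mon 1 (look ?m 1) + mon 1 (look ?m 0) = m + mon 1 (look m 1)"
      by (rule lookup_eqI, subst look_y) (use z in \<open>auto simp: lookup_add lookup_single when_def\<close>)
  qed
  have 2: "del_y (mon (mon 1 1 + mon (N + 1) 2) 1) = var (N + 1) ^ 2"
  proof -
    let ?m = "mon 1 1 + mon (N + 1) 2 :: monom"
    have "?m - mon 0 (look ?m 0) - mon 1 (look ?m 1) + mon 1 (look ?m 0) = mon (N + 1) 2"
      by (rule lookup_eqI, subst look_y) (use N in \<open>auto simp: lookup_add lookup_single when_def\<close>)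
    then show ?thesis unfolding del_y_def var_power by simp
  qed
  show ?thesis unfolding FF_def ff_def var_sq cring_hom.add[OF hom_y] 1 2 ..
qed

lemma FF_nz: "FF \<noteq> 0"
proof
  assume "FF = 0"
  have "look (mono_op (\<lambda>m. m + mon 0 (2 * look m 1)) (\<lambda>_. 1) hp) (mon 1 1 + mon (N + 1) 2) = 0"
  proof -
    have "mono_op (\<lambda>m. m + mon 0 (2 * look m 1)) (\<lambda>_. 1) hp \<in> span_of {m. look m (N + 1) = 0}"
    proof (rule mono_op_span_of[OF hp[unfolded poly_ring_eq]])
      fix m assume "m \<in> mons {1..N}"
      then have "look m (N + 1) = 0" by (auto simp: mons_def in_keys_iff)
      then show "(1::complex) = 0 \<or> m + mon 0 (2 * look m 1) \<in> {m. look m (N + 1) = 0}"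
        by (simp add: lookup_add lookup_single)
    qed
    then show ?thesis using N by (auto simp: span_of_def in_keys_iff lookup_add lookup_single)
  qed
  then have "look FF (mon 1 1 + mon (N + 1) 2) = 1" unfolding FF_def var_sq by (simp add: lookup_add)
  then show False using \<open>FF = 0\<close> by simp
qed

lemma del_u_inj: "p \<in> hmg cdeg WW e \<Longrightarrow> del_u p = 0 \<Longrightarrow> p = 0"
  unfolding hmg_def del_u_def
proof (erule mono_op_inj)
  show "inj_on (\<lambda>m. m - mon 0 (look m 0)) (hmons cdeg WW e)"
  proof (rule inj_onI)
    fix m n assume m: "m \<in> hmons cdeg WW e" and n: "n \<in> hmons cdeg WW e"
      and eq: "m - mon 0 (look m 0) = n - mon 0 (look n 0)"
    have *: "look m i = look n i" if "i \<noteq> 0" for i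
      using arg_cong[OF eq, of "\<lambda>m. look m i"] that by (simp only: look_u if_False)
    have "mdeg cdeg m = mdeg cdeg n" using m n by (simp add: hmons_def)
    then have "look m 0 = look n 0"
      using m n N *[of 1] *[of "N + 1"] by (simp add: hmons_def mdeg_cox)
    then show "m = n" using * by (intro lookup_eqI) metis
  qed
qed auto

lemma del_y_inj: "p \<in> hmg cdeg WW e \<Longrightarrow> del_y p = 0 \<Longrightarrow> p = 0"
  unfolding hmg_def del_y_def
proof (erule mono_op_inj)
  show "inj_on (\<lambda>m. m - mon 0 (look m 0) - mon 1 (look m 1) + mon 1 (look m 0)) (hmons cdeg WW e)"
  proof (rule inj_onI)
    fix m n assume m: "m \<in> hmons cdeg WW e" and n: "n \<in> hmons cdeg WW e"
      and eq: "m - mon 0 (look m 0) - mon 1 (look m 1) + mon 1 (look m 0) = n - mon 0 (look n 0) - mon 1 (look n 1) + mon 1 (look n 0)"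
    have *: "look m i = look n i" if "i \<noteq> 1" for i
    proof (cases "i = 0")
      case True
      then show ?thesis using arg_cong[OF eq, of "\<lambda>m. look m 1"] by (simp only: look_y) simp
    next
      case False
      then show ?thesis using arg_cong[OF eq, of "\<lambda>m. look m i"] that by (simp only: look_y if_False)
    qed
    have "mdeg cdeg m = mdeg cdeg n" using m n by (simp add: hmons_def)
    then have "look m 1 = look n 1"
      using m n N1 *[of 0] *[of "N + 1"] by (simp add: hmons_def mdeg_cox)
    then show "m = n" using * by (intro lookup_eqI) metis
  qed
qed auto

lemma lift_monomials:
  assumes "q \<in> span_of T" and "\<And>m. m \<in> T \<Longrightarrow> \<exists>n0::nat. \<forall>n\<ge>n0. \<exists>m'\<in>S n. \<mu> m' = m"
  shows "\<exists>n0::nat. \<forall>n\<ge>n0. \<exists>p\<in>span_of (S n). mono_op \<mu> (\<lambda>_. 1) p = q"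
  using assms(1)
proof (induction rule: span_of_induct)
  case zero
  then show ?case by (intro exI[of _ 0] allI impI bexI[of _ 0]) auto
next
  case (mon m c)
  then obtain n0 where n0: "\<And>n. n \<ge> n0 \<Longrightarrow> \<exists>m'\<in>S n. \<mu> m' = m" using assms(2) by blast
  show ?case
  proof (intro exI[of _ n0] allI impI)
    fix n assume "n \<ge> n0"
    then obtain m' where "m' \<in> S n" "\<mu> m' = m" using n0 by blast
    then show "\<exists>p\<in>span_of (S n). mono_op \<mu> (\<lambda>_. 1) p = mon m c"
      by (intro bexI[of _ "mon m' c"]) (auto intro!: span_of_mon)
  qed
next
  case (add p q)
  then obtain n0 n1 where n: "\<And>n. n \<ge> n0 \<Longrightarrow> \<exists>x\<in>span_of (S n). mono_op \<mu> (\<lambda>_. 1) x = p"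
    "\<And>n. n \<ge> n1 \<Longrightarrow> \<exists>x\<in>span_of (S n). mono_op \<mu> (\<lambda>_. 1) x = q" by blast
  show ?case
  proof (intro exI[of _ "max n0 n1"] allI impI)
    fix n assume "n \<ge> max n0 n1"
    then obtain x y where "x \<in> span_of (S n)" "mono_op \<mu> (\<lambda>_. 1) x = p" "y \<in> span_of (S n)" "mono_op \<mu> (\<lambda>_. 1) y = q"
      using n by (metis max.bounded_iff)
    then show "\<exists>x\<in>span_of (S n). mono_op \<mu> (\<lambda>_. 1) x = p + q"
      by (intro bexI[of _ "x + y"]) (auto simp: mono_op_add intro: span_of_add)
  qed
qed

lemma del_u_surj:
  assumes "q \<in> poly_ring VV"
  shows "\<exists>n0::nat. \<forall>n\<ge>n0. \<exists>p\<in>hmg cdeg WW (c + int n * 1). del_u p = q"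
  unfolding hmg_def del_u_def
proof (rule lift_monomials[OF assms[unfolded poly_ring_eq]])
  fix m assume "m \<in> mons VV"
  then have m: "supp m \<subseteq> VV" by (simp add: mons_def)
  then have z: "look m 0 = 0" by (auto simp: in_keys_iff)
  define k where "k n = nat (c + int n - mdeg cdeg m)" for n :: nat
  show "\<exists>n0. \<forall>n\<ge>n0. \<exists>m'\<in>hmons cdeg WW (c + int n * 1). m' - mon 0 (look m' 0) = m"
  proof (intro exI[of _ "nat (mdeg cdeg m - c)"] allI impI bexI)
    fix n assume n: "n \<ge> nat (mdeg cdeg m - c)"
    show "m + mon 0 (k n) - mon 0 (look (m + mon 0 (k n)) 0) = m" using z by (simp add: lookup_add)
    have "supp (m + mon 0 (k n)) \<subseteq> WW" using m supp_single_sub[of 0] by (fastforce simp: keys_add_nat)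
    then show "m + mon 0 (k n) \<in> hmons cdeg WW (c + int n * 1)"
      using n by (auto simp: hmons_def mdeg_add cdeg_def k_def)
  qed
qed

lemma even_span:
  fixes c :: int
  assumes q: "q \<in> poly_ring VV" "flip q = const (if even c then 1 else - 1) * q"
  shows "q \<in> span_of {m. supp m \<subseteq> VV \<and> (even c \<longleftrightarrow> even (look m 1 + look m (N + 1)))}"
proof -
  have "even c \<longleftrightarrow> even (look m 1 + look m (N + 1))" if "m \<in> supp q" for m
  proof -
    have "look (const (if even c then 1 else - 1) * q) m = (if even c then 1 else - 1) * look q m"
    proof -
      have "const (- 1) * q = - q" by (simp add: single_uminus single_1)
      then show ?thesis by (simp add: single_1)
    qed
    then have "(- 1) ^ (look m 1 + look m (N + 1)) * look q m = (if even c then 1 else - 1) * look q m"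
      using arg_cong[OF q(2), of "\<lambda>q. look q m"] by (simp add: look_flip)
    then show ?thesis using that by (auto simp: in_keys_iff minus_one_power_iff split: if_splits)
  qed
  then show ?thesis using q(1) by (auto simp: span_of_def poly_ring_eq mons_def)
qed

lemma del_y_surj:
  assumes "q \<in> poly_ring VV" "flip q = const (if even c then 1 else - 1) * q"
  shows "\<exists>n0::nat. \<forall>n\<ge>n0. \<exists>p\<in>hmg cdeg WW (c + int n * (- 2)). del_y p = q"
  unfolding hmg_def del_y_def
proof (rule lift_monomials[OF even_span[OF assms]])
  fix m :: monom assume "m \<in> {m. supp m \<subseteq> VV \<and> (even c \<longleftrightarrow> even (look m 1 + look m (N + 1)))}"
  then have m: "supp m \<subseteq> VV" "even (int (look m 1) + int (look m (N + 1)) - c)" by auto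
  have z: "look m 0 = 0" using m(1) by (auto simp: in_keys_iff)
  define b where "b = (int (look m 1) + int (look m (N + 1)) - c) div 2"
  have b: "2 * b = int (look m 1) + int (look m (N + 1)) - c" using m(2) by (simp add: b_def)
  define m' where "m' n = m - mon 1 (look m 1) + mon 0 (look m 1) + mon 1 (nat (b + int n))" for n :: nat
  have lm': "look (m' n) i = (if i = 0 then look m 1 else if i = 1 then nat (b + int n) else look m i)" for n i
    using z by (auto simp: m'_def lookup_add lookup_minus lookup_single when_def)
  show "\<exists>n0. \<forall>n\<ge>n0. \<exists>m'\<in>hmons cdeg WW (c + int n * (- 2)). m' - mon 0 (look m' 0) - mon 1 (look m' 1) + mon 1 (look m' 0) = m"
  proof (intro exI[of _ "nat (- b)"] allI impI bexI)
    fix n assume n: "n \<ge> nat (- b)"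
    show "m' n - mon 0 (look (m' n) 0) - mon 1 (look (m' n) 1) + mon 1 (look (m' n) 0) = m"
      by (rule lookup_eqI, subst look_y) (auto simp: lm' z)
    have s: "supp (m' n) \<subseteq> WW"
    proof
      fix i assume "i \<in> supp (m' n)"
      then have "i = 0 \<or> i = 1 \<or> i \<in> supp m" by (auto simp: in_keys_iff lm' split: if_splits)
      then show "i \<in> WW" using m(1) by auto
    qed
    show "m' n \<in> hmons cdeg WW (c + int n * (- 2))"
      using s n N b by (simp add: hmons_def mdeg_cox lm')
  qed
qed

lemma del_u_V: "p \<in> hmg cdeg WW e \<Longrightarrow> del_u p \<in> poly_ring VV"
  unfolding hmg_def del_u_def poly_ring_eq
proof (erule mono_op_span_of)
  fix m assume m: "m \<in> hmons cdeg WW e"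
  have "i \<in> VV" if "i \<in> supp (m - mon 0 (look m 0))" for i
  proof -
    have "look (m - mon 0 (look m 0)) i \<noteq> 0" using that by (simp only: in_keys_iff not_False_eq_True)
    then have "i \<noteq> 0" "i \<in> supp m" unfolding look_u by (auto simp: in_keys_iff split: if_splits)
    then show ?thesis using m by (fastforce simp: hmons_def)
  qed
  then show "(1::complex) = 0 \<or> m - mon 0 (look m 0) \<in> mons VV" by (auto simp: mons_def)
qed

lemma del_y_V: "p \<in> hmg cdeg WW e \<Longrightarrow> del_y p \<in> span_of {m. supp m \<subseteq> VV \<and> (even e \<longleftrightarrow> even (look m 1 + look m (N + 1)))}"
  unfolding hmg_def del_y_def
proof (erule mono_op_span_of)
  fix m assume m: "m \<in> hmons cdeg WW e"
  let ?m = "m - mon 0 (look m 0) - mon 1 (look m 1) + mon 1 (look m 0)"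
  have "i \<in> VV" if "i \<in> supp ?m" for i
  proof -
    have "look ?m i \<noteq> 0" using that by (simp only: in_keys_iff not_False_eq_True)
    then have "i \<noteq> 0" "i = 1 \<or> i \<in> supp m" unfolding look_y by (auto simp: in_keys_iff split: if_splits)
    then show ?thesis using m N by (fastforce simp: hmons_def)
  qed
  moreover have "int (look m 0) - 2 * int (look m 1) + int (look m (N + 1)) = e"
    using m mdeg_cox[of m] by (auto simp: hmons_def)
  then have "even e \<longleftrightarrow> even (look ?m 1 + look ?m (N + 1))"
    using N unfolding look_y by (auto simp flip: of_nat_add)
  ultimately show "(1::complex) = 0 \<or> ?m \<in> {m. supp m \<subseteq> VV \<and> (even e \<longleftrightarrow> even (look m 1 + look m (N + 1)))}" by auto
qed

lemma flip_del_y: "p \<in> hmg cdeg WW e \<Longrightarrow> flip (del_y p) = const (if even e then 1 else - 1) * del_y p"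
proof -
  assume "p \<in> hmg cdeg WW e"
  from del_y_V[OF this] show ?thesis
    by (induction rule: span_of_induct)
       (auto simp: flip_def mono_op_add ring_distribs mult_single)
qed

sublocale u: dehom VV ident fbar cdeg WW del_u 1 1 FF
proof (intro dehom.intro involution.intro dehom_axioms.intro)
  show "fbar \<in> poly_ring VV" using del_u_V[OF FF] by (simp add: del_u_FF)
  show "fbar \<noteq> 0" using del_u_inj[OF FF] FF_nz by (auto simp: del_u_FF)
qed (use hom_u del_u_V del_u_inj del_u_surj FF del_u_FF in \<open>auto simp: single_1 cring_hom_def ident_def\<close>)

sublocale y: dehom VV flip ff cdeg WW del_y "- 1" "- 2" FF
proof (intro dehom.intro involution.intro dehom_axioms.intro)
  have 1: "ff \<in> span_of {m. supp m \<subseteq> VV \<and> (even (0::int) \<longleftrightarrow> even (look m 1 + look m (N + 1)))}"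
    using del_y_V[OF FF] by (simp only: del_y_FF)
  show "ff \<in> poly_ring VV" unfolding poly_ring_eq by (rule span_of_mono[OF 1]) (auto simp: mons_def)
  have c1: "const (if even (0::int) then 1 else - 1) = (1 :: mpoly)" using single_1 by simp
  show "flip ff = ff" using flip_del_y[OF FF] unfolding del_y_FF c1 by simp
  show "ff \<noteq> 0" using del_y_inj[OF FF] FF_nz by (auto simp: del_y_FF)
  show "del_y p \<in> poly_ring VV" if "p \<in> hmg cdeg WW e" for p e
    unfolding poly_ring_eq by (rule span_of_mono[OF del_y_V[OF that]]) (auto simp: mons_def)
  show "flip (const c) = const c" for c by (simp add: flip_def)
qed (use hom_y hom_flip flip_flip flip_V flip_del_y del_y_inj del_y_surj FF del_y_FF in auto)

end

section \<open>Reducing the weights\<close>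

lemma scal_scal: "scal p * (scal q * x) = scal (p * q) * x"
  by (simp add: scal_mult mult.assoc)

text \<open>The algebra behind Beilinson's resolution, for one composite of the two new maps.\<close>

lemma beilinson_product:
  fixes P Q A B C A' B' C' H K I0 :: "'a::comm_ring_1 cmat" and \<tau> F :: 'a
  assumes QP: "Q * P = scal F * I0" and I0: "I0 * H = H" "B * I0 = B" "H * I0 = H"
    and PQ: "K * P * Q = scal F * K"
    and KP: "K * P = C + A + scal \<tau> * B" and HQ: "H * Q = C' + A' + scal \<tau> * B'"
    and H: "H * H = H" "K * K = K"
    and A: "K * A = A" "K * B = B" "K * C = C" "A * H = 0" "B * H = 0" "C * H = C"
    and A': "H * A' = A'" "H * B' = B'" "H * C' = C'" "A' * K = 0" "B' * K = 0" "C' * K = C'"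
    and HQP: "H * Q * P = scal F * H"
  shows "(Q - scal \<tau> * B') * (P - scal \<tau> * B) + scal \<tau> * (Q * K - C') * B + scal \<tau> * H * (B' * P + C' * B) = scal F * I0"
    and "B' * (P - scal \<tau> * B) + C' * B - H * (B' * P + C' * B) = 0"
    and "- (B * Q + C * B') * (P - scal \<tau> * B) + A * Q * K * B + C * (B' * P + C' * B) = 0"
    and "(Q - scal \<tau> * B') * (scal \<tau> * (P * H - C)) + scal \<tau> * (Q * K - C') * C - scal \<tau> * H * (A' * P * H) = 0"
    and "B' * (scal \<tau> * (P * H - C)) + C' * C + H * (A' * P * H) = scal F * H"
    and "- (B * Q + C * B') * (scal \<tau> * (P * H - C)) + A * Q * K * C - C * (A' * P * H) = 0"
    and "- (Q - scal \<tau> * B') * (scal \<tau> * K) + scal \<tau> * (Q * K - C') * K + scal \<tau> * H * C' = 0"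
    and "- B' * (scal \<tau> * K) + C' * K - H * C' = 0"
    and "(B * Q + C * B') * (scal \<tau> * K) + A * Q * K * K + C * C' = scal F * K"
proof -
  have z: "B' * B = 0" "B' * A = 0" "B' * C = 0" "A' * B = 0" "A' * A = 0" "A' * C = 0"
    by (metis A A' mult.assoc mult_zero_left)+
  have z': "B * B' = 0" "B * A' = 0" "B * C' = 0" "A * B' = 0" "A * A' = 0" "A * C' = 0"
    by (metis A A' mult.assoc mult_zero_left)+
  have CQ: "C * Q = C * C' + C * A' + scal \<tau> * (C * B')"
  proof -
    have "C * Q = C * (H * Q)" using A by (simp flip: mult.assoc)
    then show ?thesis by (simp add: HQ distrib_left scal_comm2[of C])
  qed
  have CP: "C' * P = C' * C + C' * A + scal \<tau> * (C' * B)"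
  proof -
    have "C' * P = C' * (K * P)" using A' by (simp flip: mult.assoc)
    then show ?thesis by (simp add: KP distrib_left scal_comm2[of C'])
  qed
  have AQ: "A * Q = scal F * K - (C * C' + C * A' + scal \<tau> * (C * B')) - scal \<tau> * (B * Q)"
  proof -
    have "scal F * K = C * Q + A * Q + scal \<tau> * (B * Q)" using PQ KP by (simp add: distrib_right mult.assoc)
    then show ?thesis using CQ by (simp add: algebra_simps)
  qed
  have AP: "A' * P = scal F * H - (C' * C + C' * A + scal \<tau> * (C' * B)) - scal \<tau> * (B' * P)"
  proof -
    have "scal F * H = C' * P + A' * P + scal \<tau> * (B' * P)" using HQP HQ by (simp add: distrib_right mult.assoc)
    then show ?thesis using CP by (simp add: algebra_simps)
  qed
  note sc = scal_comm2[of P] scal_comm2[of Q] scal_comm2[of A] scal_comm2[of B] scal_comm2[of C]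
    scal_comm2[of A'] scal_comm2[of B'] scal_comm2[of C'] scal_comm2[of H] scal_comm2[of K] scal_scal
  note rules = QP I0 H A A' z z' AQ AP
  note all = rules rules[THEN assoc_rule] mult.assoc sc distrib_left distrib_right left_diff_distrib right_diff_distrib mult.commute[of \<tau> F]
  show "(Q - scal \<tau> * B') * (P - scal \<tau> * B) + scal \<tau> * (Q * K - C') * B + scal \<tau> * H * (B' * P + C' * B) = scal F * I0"
    "B' * (P - scal \<tau> * B) + C' * B - H * (B' * P + C' * B) = 0"
    "- (B * Q + C * B') * (P - scal \<tau> * B) + A * Q * K * B + C * (B' * P + C' * B) = 0"
    "(Q - scal \<tau> * B') * (scal \<tau> * (P * H - C)) + scal \<tau> * (Q * K - C') * C - scal \<tau> * H * (A' * P * H) = 0"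
    "B' * (scal \<tau> * (P * H - C)) + C' * C + H * (A' * P * H) = scal F * H"
    "- (B * Q + C * B') * (scal \<tau> * (P * H - C)) + A * Q * K * C - C * (A' * P * H) = 0"
    "- (Q - scal \<tau> * B') * (scal \<tau> * K) + scal \<tau> * (Q * K - C') * K + scal \<tau> * H * C' = 0"
    "- B' * (scal \<tau> * K) + C' * K - H * C' = 0"
    "(B * Q + C * B') * (scal \<tau> * K) + A * Q * K * K + C * C' = scal F * K"
    by (simp_all add: all)
qed

text \<open>
  The matrix with rows
  \<open>(P - \<tau> B, \<tau> (P H - C), - \<tau> K)\<close>, \<open>(B, C, K)\<close> and \<open>(- (B' P + C' B), A' P H, - C')\<close>
  in the notation of the two splittings \<open>K P = C + A + \<tau> B\<close> and \<open>H Q = C' + A' + \<tau> B'\<close>.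
\<close>

definition bmap :: "'a::comm_ring_1 \<Rightarrow> 'a cmat \<Rightarrow> 'a cmat \<Rightarrow> 'a cmat \<Rightarrow> 'a cmat \<Rightarrow> 'a cmat \<Rightarrow> 'a cmat \<Rightarrow> 'a cmat \<Rightarrow> 'a cmat \<Rightarrow> 'a cmat" where
  "bmap \<tau> H K P B C A' B' C' =
     s0 * (P - scal \<tau> * B) * r0 + s1 * s0 * B * r0 - s1 * s1 * (B' * P + C' * B) * r0 +
     s0 * (scal \<tau> * (P * H - C)) * r0 * r1 + s1 * s0 * C * r0 * r1 + s1 * s1 * (A' * P * H) * r0 * r1 -
     s0 * (scal \<tau> * K) * r1 * r1 + s1 * s0 * K * r1 * r1 - s1 * s1 * C' * r1 * r1"

lemma bmap_product:
  fixes P Q A B C A' B' C' H K I0 :: "'a::comm_ring_1 cmat" and \<tau> F :: 'a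
  assumes QP: "Q * P = scal F * I0" and I0: "I0 * H = H" "B * I0 = B" "H * I0 = H"
    and PQ: "K * P * Q = scal F * K"
    and KP: "K * P = C + A + scal \<tau> * B" and HQ: "H * Q = C' + A' + scal \<tau> * B'"
    and H: "H * H = H" "K * K = K"
    and A: "K * A = A" "K * B = B" "K * C = C" "A * H = 0" "B * H = 0" "C * H = C"
    and A': "H * A' = A'" "H * B' = B'" "H * C' = C'" "A' * K = 0" "B' * K = 0" "C' * K = C'"
    and HQP: "H * Q * P = scal F * H"
  shows "bmap \<tau> K H Q B' C' A B C * bmap \<tau> H K P B C A' B' C' =
    scal F * (s0 * I0 * r0 + s1 * (s0 * H * r0 + s1 * K * r1) * r1)"
proof -
  note b = beilinson_product[OF assms]
  have "bmap \<tau> K H Q B' C' A B C * bmap \<tau> H K P B C A' B' C' =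
    s0 * ((Q - scal \<tau> * B') * (P - scal \<tau> * B) + scal \<tau> * (Q * K - C') * B + scal \<tau> * H * (B' * P + C' * B)) * r0 +
    s1 * s0 * (B' * (P - scal \<tau> * B) + C' * B - H * (B' * P + C' * B)) * r0 +
    s1 * s1 * (- (B * Q + C * B') * (P - scal \<tau> * B) + A * Q * K * B + C * (B' * P + C' * B)) * r0 +
    s0 * ((Q - scal \<tau> * B') * (scal \<tau> * (P * H - C)) + scal \<tau> * (Q * K - C') * C - scal \<tau> * H * (A' * P * H)) * r0 * r1 +
    s1 * s0 * (B' * (scal \<tau> * (P * H - C)) + C' * C + H * (A' * P * H)) * r0 * r1 +
    s1 * s1 * (- (B * Q + C * B') * (scal \<tau> * (P * H - C)) + A * Q * K * C - C * (A' * P * H)) * r0 * r1 +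
    s0 * (- (Q - scal \<tau> * B') * (scal \<tau> * K) + scal \<tau> * (Q * K - C') * K + scal \<tau> * H * C') * r1 * r1 +
    s1 * s0 * (- B' * (scal \<tau> * K) + C' * K - H * C') * r1 * r1 +
    s1 * s1 * ((B * Q + C * B') * (scal \<tau> * K) + A * Q * K * K + C * C') * r1 * r1"
    by (simp add: bmap_def mult.assoc distrib_left distrib_right left_diff_distrib right_diff_distrib)
  also have "\<dots> = scal F * (s0 * I0 * r0 + s1 * (s0 * H * r0 + s1 * K * r1) * r1)"
    unfolding b by (simp add: mult.assoc distrib_left distrib_right scal_comm2[of s0] scal_comm2[of s1])
  finally show ?thesis .
qed

context cox
begin

text \<open>The image of the homogeneous polynomials of degree \<open>e\<close> in the chart \<open>u = 1\<close>.\<close>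

definition fil :: "int \<Rightarrow> mpoly set" where
  "fil e = span_of {m. supp m \<subseteq> VV \<and> int (look m (N + 1)) - 2 * int (look m 1) \<le> e}"

lemma fil_u: "p \<in> hmg cdeg WW e \<Longrightarrow> del_u p \<in> fil e"
  unfolding hmg_def del_u_def fil_def
proof (erule mono_op_span_of)
  fix m assume m: "m \<in> hmons cdeg WW e"
  have l: "look (m - mon 0 (look m 0)) i = (if i = 0 then 0 else look m i)" for i by (rule look_u)
  have "supp (m - mon 0 (look m 0)) \<subseteq> VV"
  proof
    fix i assume "i \<in> supp (m - mon 0 (look m 0))"
    then have "i \<noteq> 0" "i \<in> supp m" using l[of i] by (auto simp: in_keys_iff split: if_splits)
    then show "i \<in> VV" using m by (fastforce simp: hmons_def)
  qed
  then show "(1::complex) = 0 \<or> m - mon 0 (look m 0) \<in> {m. supp m \<subseteq> VV \<and> int (look m (N + 1)) - 2 * int (look m 1) \<le> e}"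
    using m mdeg_cox[of m] l[of 1] l[of "N + 1"] by (auto simp: hmons_def)
qed

lemma fil_lift: "q \<in> fil e \<Longrightarrow> \<exists>p\<in>hmg cdeg WW e. del_u p = q"
  unfolding hmg_def del_u_def fil_def
proof (erule mono_op_surj)
  fix m assume "m \<in> {m. supp m \<subseteq> VV \<and> int (look m (N + 1)) - 2 * int (look m 1) \<le> e}"
  then have m: "supp m \<subseteq> VV" "int (look m (N + 1)) - 2 * int (look m 1) \<le> e" by auto
  have z: "look m 0 = 0" using m(1) by (auto simp: in_keys_iff)
  define k where "k = nat (e - (int (look m (N + 1)) - 2 * int (look m 1)))"
  show "\<exists>n\<in>hmons cdeg WW e. n - mon 0 (look n 0) = m \<and> (1::complex) \<noteq> 0"
  proof (intro bexI conjI)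
    show "m + mon 0 k - mon 0 (look (m + mon 0 k) 0) = m" using z by (simp add: lookup_add)
    have s: "supp (m + mon 0 k) \<subseteq> WW" using m(1) supp_single_sub[of 0] by (fastforce simp: keys_add_nat)
    show "m + mon 0 k \<in> hmons cdeg WW e"
      using s m(2) z N1 mdeg_cox[OF s] by (simp add: hmons_def k_def lookup_add lookup_single)
  qed simp
qed

lemma fil_mono: "p \<in> fil e \<Longrightarrow> e \<le> e' \<Longrightarrow> p \<in> fil e'"
  unfolding fil_def by (erule span_of_mono) auto

lemma fil_0 [simp]: "0 \<in> fil e" by (simp add: fil_def)
lemma fil_add: "p \<in> fil e \<Longrightarrow> q \<in> fil e \<Longrightarrow> p + q \<in> fil e" unfolding fil_def by (rule span_of_add)
lemma fil_diff: "p \<in> fil e \<Longrightarrow> q \<in> fil e \<Longrightarrow> p - q \<in> fil e" unfolding fil_def by (rule span_of_diff)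
lemma fil_uminus [simp]: "- p \<in> fil e \<longleftrightarrow> p \<in> fil e" unfolding fil_def by simp
lemma fil_sum: "(\<And>i. i \<in> A \<Longrightarrow> p i \<in> fil e) \<Longrightarrow> sum p A \<in> fil e" unfolding fil_def by (rule span_of_sum)

lemma fil_mult: "p \<in> fil e \<Longrightarrow> q \<in> fil e' \<Longrightarrow> p * q \<in> fil (e + e')"
  unfolding fil_def by (erule span_of_mult) (auto simp: keys_add_nat lookup_add)

lemma fil_1: "e \<ge> 0 \<Longrightarrow> 1 \<in> fil e"
  unfolding fil_def single_1[symmetric] by (rule span_of_mon) auto

abbreviation tt :: mpoly where "tt \<equiv> var (N + 1)"

lemma fil_t: "tt \<in> fil 1"
  unfolding fil_def var_def using N1 by (intro span_of_mon) (auto simp: lookup_single)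

lemma fil_t_mult: "p \<in> fil (e - 1) \<Longrightarrow> tt * p \<in> fil e"
  using fil_mult[OF fil_t, of p "e - 1"] by simp

lemma t_mult: "tt * q = mono_op (\<lambda>m. m + mon (N + 1) 1) (\<lambda>_. 1) q"
  by (induction q rule: mpoly_induct) (auto simp: mono_op_add var_def mult_single ring_distribs add.commute)

lemma fil_div: "tt * q \<in> fil e \<Longrightarrow> q \<in> fil (e - 1)"
proof -
  assume q: "tt * q \<in> fil e"
  have "m \<in> {m. supp m \<subseteq> VV \<and> int (look m (N + 1)) - 2 * int (look m 1) \<le> e - 1}" if m: "m \<in> supp q" for m
  proof -
    have "look (tt * q) (m + mon (N + 1) 1) = look q m"
      unfolding t_mult using lookup_mono_op[of q UNIV "\<lambda>m. m + mon (N + 1) 1" m]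
      by (simp add: span_of_def inj_on_def)
    then have "m + mon (N + 1) 1 \<in> supp (tt * q)" using m by (simp add: in_keys_iff)
    then have "m + mon (N + 1) 1 \<in> {m. supp m \<subseteq> VV \<and> int (look m (N + 1)) - 2 * int (look m 1) \<le> e}"
      using q by (auto simp: fil_def span_of_def)
    then show ?thesis using N1 by (auto simp: keys_add_nat lookup_add lookup_single)
  qed
  then show ?thesis by (auto simp: fil_def span_of_def)
qed

lemma fil_split: "p \<in> fil e \<Longrightarrow> e \<ge> 1 \<Longrightarrow> \<exists>a b. a \<in> fil (e - 1) \<and> b \<in> fil (e - 1) \<and> p = a + tt * b"
  unfolding fil_def[of e]
proof (induction rule: span_of_induct)
  case zero
  then show ?case by (intro exI[of _ 0]) auto
next
  case (mon m c)
  show ?case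
  proof (cases "int (look m (N + 1)) - 2 * int (look m 1) \<le> e - 1")
    case True
    then have "mon m c \<in> fil (e - 1)" using mon(1) unfolding fil_def by (intro span_of_mon) auto
    then show ?thesis by (intro exI[of _ "mon m c"] exI[of _ 0]) auto
  next
    case False
    then have pos: "look m (N + 1) \<ge> 1" using mon by auto
    define m' where "m' = m - mon (N + 1) 1"
    have m': "m = m' + mon (N + 1) 1"
      using pos by (intro lookup_eqI) (auto simp: m'_def lookup_add lookup_minus lookup_single when_def)
    have "mon m' c \<in> fil (e - 1)"
      using mon(1) N1 unfolding fil_def m' by (intro span_of_mon) (auto simp: keys_add_nat lookup_add lookup_single)
    moreover have "mon m c = tt * mon m' c" by (simp add: m' var_def mult_single add.commute)
    ultimately show ?thesis by (intro exI[of _ 0] exI[of _ "mon m' c"]) auto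
  qed
next
  case (add p q)
  then obtain a b a' b' where "a \<in> fil (e - 1)" "b \<in> fil (e - 1)" "p = a + tt * b"
    "a' \<in> fil (e - 1)" "b' \<in> fil (e - 1)" "q = a' + tt * b'" by blast
  then show ?case by (intro exI[of _ "a + a'"] exI[of _ "b + b'"]) (auto simp: fil_add ring_distribs)
qed

definition fhom :: "gmod \<Rightarrow> gmod \<Rightarrow> mpoly cmat set" where
  "fhom X Y = {a. \<forall>i j. (ent a i j \<noteq> 0 \<longrightarrow> i \<in> fst Y \<and> j \<in> fst X) \<and> ent a i j \<in> fil (snd Y i - snd X j)}"

lemma fhomI:
  "(\<And>i j. ent a i j \<noteq> 0 \<Longrightarrow> i \<in> fst Y \<and> j \<in> fst X \<and> ent a i j \<in> fil (snd Y i - snd X j)) \<Longrightarrow> a \<in> fhom X Y"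
  unfolding fhom_def
proof (intro CollectI allI conjI)
  fix i j assume *: "\<And>i j. ent a i j \<noteq> 0 \<Longrightarrow> i \<in> fst Y \<and> j \<in> fst X \<and> ent a i j \<in> fil (snd Y i - snd X j)"
  show "ent a i j \<noteq> 0 \<longrightarrow> i \<in> fst Y \<and> j \<in> fst X" using * by blast
  show "ent a i j \<in> fil (snd Y i - snd X j)" using * by (cases "ent a i j = 0") auto
qed

lemma fhomD: "a \<in> fhom X Y \<Longrightarrow> ent a i j \<in> fil (snd Y i - snd X j)"
  and fhomD1: "a \<in> fhom X Y \<Longrightarrow> ent a i j \<noteq> 0 \<Longrightarrow> i \<in> fst Y"
  and fhomD2: "a \<in> fhom X Y \<Longrightarrow> ent a i j \<noteq> 0 \<Longrightarrow> j \<in> fst X"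
  by (auto simp: fhom_def)

lemma fhom_DD: "a \<in> u.gh X Y \<Longrightarrow> u.DD a \<in> fhom X Y"
proof (rule fhomI)
  fix i j assume a: "a \<in> u.gh X Y" and nz: "ent (u.DD a) i j \<noteq> 0"
  then have "ent a i j \<noteq> 0" by (auto simp: ent_cmap)
  then show "i \<in> fst Y \<and> j \<in> fst X \<and> ent (u.DD a) i j \<in> fil (snd Y i - snd X j)"
    using ghomD1[OF a] ghomD2[OF a] fil_u[OF ghomD[OF a, of i j]] by (auto simp: ent_cmap)
qed

lemma fhom_lift: "a \<in> fhom X Y \<Longrightarrow> \<exists>b\<in>u.gh X Y. u.DD b = a"
proof -
  assume a: "a \<in> fhom X Y"
  have "\<exists>p\<in>hmg cdeg WW (snd Y i - snd X j). del_u p = ent a i j" for i j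
    by (rule fil_lift[OF fhomD[OF a]])
  then obtain p where p: "\<And>i j. p i j \<in> hmg cdeg WW (snd Y i - snd X j) \<and> del_u (p i j) = ent a i j" by metis
  define b where "b = CMat (\<lambda>i j. if ent a i j = 0 then 0 else p i j)"
  have b: "ent b i j = (if ent a i j = 0 then 0 else p i j)" for i j
    unfolding b_def by (rule ent_CMat_within[where S = "\<lambda>j. {i. ent a i j \<noteq> 0}"]) (auto simp: finite_col)
  have "b \<in> u.gh X Y"
    by (rule ghomI) (use p a in \<open>auto simp: b dest: fhomD1 fhomD2 split: if_splits\<close>)
  moreover have "u.DD b = a" by (rule cmat_eqI) (use p in \<open>auto simp: ent_cmap b\<close>)
  ultimately show ?thesis by blast
qed

lemma fhom_iff: "a \<in> fhom X Y \<longleftrightarrow> (\<exists>b. b \<in> u.gh X Y \<and> a = u.DD b)"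
  using fhom_lift fhom_DD by blast

lemma fhom_comp: "a \<in> fhom Y Z \<Longrightarrow> b \<in> fhom X Y \<Longrightarrow> a * b \<in> fhom X Z"
  unfolding fhom_iff by (elim exE conjE) (rule exI, rule conjI, erule (1) ghom_comp, simp add: u.del.cmap_mult)
lemma fhom_add: "a \<in> fhom X Y \<Longrightarrow> b \<in> fhom X Y \<Longrightarrow> a + b \<in> fhom X Y"
  unfolding fhom_iff by (elim exE conjE) (rule exI, rule conjI, erule (1) ghom_add, simp add: u.del.cmap_add)
lemma fhom_diff: "a \<in> fhom X Y \<Longrightarrow> b \<in> fhom X Y \<Longrightarrow> a - b \<in> fhom X Y"
  unfolding fhom_iff by (elim exE conjE) (rule exI, rule conjI, erule (1) ghom_diff, simp add: u.del.cmap_diff)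
lemma fhom_gsum:
  "a \<in> fhom Z X \<Longrightarrow> s0 * a \<in> fhom Z (gsum X Y)"
  "a \<in> fhom Z Y \<Longrightarrow> s1 * a \<in> fhom Z (gsum X Y)"
  "a \<in> fhom X Z \<Longrightarrow> a * r0 \<in> fhom (gsum X Y) Z"
  "a \<in> fhom Y Z \<Longrightarrow> a * r1 \<in> fhom (gsum X Y) Z"
  unfolding fhom_iff
  by (elim exE conjE, rule exI, rule conjI, erule ghom_gsum, simp add: u.del.cmap_mult)+

definition lower :: "gmod \<Rightarrow> gmod" where "lower X = (fst X, \<lambda>i. snd X i - 1)"
definition top_part :: "int \<Rightarrow> gmod \<Rightarrow> nat set" where "top_part hi X = {i \<in> fst X. snd X i = hi}"
definition drop_top :: "int \<Rightarrow> gmod \<Rightarrow> gmod" where "drop_top hi X = (fst X, \<lambda>i. if snd X i = hi then hi - 1 else snd X i)"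

text \<open>
  In the chart \<open>u = 1\<close>, a polynomial of positive degree is \<open>a + t b\<close> with \<open>a\<close> and \<open>b\<close> of lower degree, where \<open>a\<close> comes from a
  multiple of \<open>u\<close>. This applies to the entries between a generator of lower weight and one of highest weight.
\<close>

lemma split_top:
  assumes P: "P \<in> fhom X Y" and fin: "finite (fst Y)" and hi: "\<And>j. j \<in> fst X \<Longrightarrow> snd X j \<le> hi"
  shows "\<exists>A B. cproj (top_part hi Y) * P = cproj (top_part hi Y) * P * cproj (top_part hi X) + A + scal tt * B \<and>
    A \<in> fhom X (lower Y) \<and> B \<in> fhom X (lower Y) \<and>
    cproj (top_part hi Y) * A = A \<and> cproj (top_part hi Y) * B = B \<and> A * cproj (top_part hi X) = 0 \<and> B * cproj (top_part hi X) = 0"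
proof -
  define S where "S i j \<longleftrightarrow> i \<in> top_part hi Y \<and> j \<in> fst X \<and> j \<notin> top_part hi X" for i j
  have "\<exists>a b. a \<in> fil (hi - snd X j - 1) \<and> b \<in> fil (hi - snd X j - 1) \<and> ent P i j = a + tt * b" if "S i j" for i j
  proof (rule fil_split)
    show "ent P i j \<in> fil (hi - snd X j)" using fhomD[OF P, of i j] that by (simp add: S_def top_part_def)
    show "hi - snd X j \<ge> 1" using that hi[of j] by (force simp: S_def top_part_def)
  qed
  then obtain a b where ab: "\<And>i j. S i j \<Longrightarrow> a i j \<in> fil (hi - snd X j - 1) \<and> b i j \<in> fil (hi - snd X j - 1) \<and> ent P i j = a i j + tt * b i j"
    by metis
  define A where "A = CMat (\<lambda>i j. if S i j then a i j else 0)"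
  define B where "B = CMat (\<lambda>i j. if S i j then b i j else 0)"
  have A: "ent A i j = (if S i j then a i j else 0)" for i j
    unfolding A_def by (rule ent_CMat_within[where S = "\<lambda>_. fst Y"]) (auto simp: fin S_def top_part_def split: if_splits)
  have B: "ent B i j = (if S i j then b i j else 0)" for i j
    unfolding B_def by (rule ent_CMat_within[where S = "\<lambda>_. fst Y"]) (auto simp: fin S_def top_part_def split: if_splits)
  show ?thesis
  proof (intro exI conjI)
    show "cproj (top_part hi Y) * P = cproj (top_part hi Y) * P * cproj (top_part hi X) + A + scal tt * B"
      by (rule cmat_eqI) (use ab fhomD2[OF P] in \<open>auto simp: A B S_def\<close>)
    show "A \<in> fhom X (lower Y)" "B \<in> fhom X (lower Y)"
      by (rule fhomI; use ab in \<open>force simp: A B S_def lower_def top_part_def algebra_simps split: if_splits\<close>)+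
  qed (rule cmat_eqI; auto simp: A B S_def)+
qed

end

text \<open>
  The index \<open>1\<close> of the variable \<open>y\<close> occurs in the parameters of the interpreted locales and must keep its form.
\<close>

declare One_nat_def [simp del]

lemma cproj_gsum: "cproj (fst (gsum X Y)) = s0 * cproj (fst X) * r0 + s1 * cproj (fst Y) * r1"
proof (rule cmat_eqI)
  fix i j :: nat
  have in_gsum: "2 * k \<in> fst (gsum X Y) \<longleftrightarrow> k \<in> fst X" "Suc (2 * k) \<in> fst (gsum X Y) \<longleftrightarrow> k \<in> fst Y" for k
    by (auto simp: gsum_def) presburger+
  obtain k where k: "i = 2 * k \<or> i = Suc (2 * k)" by (metis evenE oddE Suc_eq_plus1)
  obtain l where l: "j = 2 * l \<or> j = Suc (2 * l)" by (metis evenE oddE Suc_eq_plus1)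
  have ne: "2 * a \<noteq> Suc (2 * b)" "Suc (2 * a) \<noteq> 2 * b" for a b :: nat by presburger+
  show "ent (cproj (fst (gsum X Y))) i j = ent (s0 * cproj (fst X) * r0 + s1 * cproj (fst Y) * r1) i j"
    using k l by (elim disjE) (simp_all add: mult.assoc in_gsum ne)
qed

context cox
begin

lemma u_thom: "a \<in> u.thom (u.de X) (u.de Y) \<longleftrightarrow> a \<in> u.vhom (fst X) (fst Y)"
proof -
  have TD: "u.TD Z = cproj (fst Z)" for Z
    by (rule cmat_eqI) (simp add: u.TD_def u.sg_def single_1)
  have G: "u.G a = a" for a by (rule cmat_eqI) (simp add: ent_cmap ident_def)
  show ?thesis by (auto simp: u.thom_def TD G u.vhom_idL u.vhom_idR)
qed

lemma fhom_vhom: "a \<in> fhom X Y \<Longrightarrow> a \<in> u.vhom (fst X) (fst Y)"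
proof -
  assume a: "a \<in> fhom X Y"
  have "p \<in> poly_ring VV" if "p \<in> fil e" for p e
    using that unfolding fil_def poly_ring_eq by (rule span_of_mono) (auto simp: mons_def)
  then show ?thesis using a unfolding fhom_def u.vhom_def by blast
qed

text \<open>
  The entries have the degrees required by the lowered weights, so that the corrected differential lifts to the
  graded ring.
\<close>

lemma bmap_fhom:
  assumes P: "P \<in> fhom X Y" and Q: "Q \<in> fhom Y X"
    and A: "A \<in> fhom X (lower Y)" "B \<in> fhom X (lower Y)"
    and A': "A' \<in> fhom Y (lower X)" "B' \<in> fhom Y (lower X)"
    and hi: "\<And>j. j \<in> fst X \<Longrightarrow> snd X j \<le> hi"
    and H: "H = cproj (top_part hi X)" and K: "K = cproj (top_part hi Y)"
    and C: "C = K * P * H" and C': "C' = H * Q * K"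
    and KP: "K * P = C + A + scal tt * B" and HQ: "H * Q = C' + A' + scal tt * B'"
    and z: "K * A = A" "K * B = B" "A * H = 0" "B * H = 0" "H * A' = A'" "H * B' = B'"
    and QP: "Q * P = scal fbar * cproj (fst X)"
  shows "bmap tt H K P B C A' B' C' \<in>
    fhom (gsum (drop_top hi X) (gsum (top_part hi X, \<lambda>_. hi - 1) (top_part hi Y, \<lambda>_. hi - 2)))
         (gsum (drop_top hi Y) (gsum (top_part hi Y, \<lambda>_. hi - 1) (top_part hi X, \<lambda>_. hi - 2)))"
proof -
  let ?X1 = "(top_part hi X, \<lambda>_. hi - 1)" and ?X2 = "(top_part hi X, \<lambda>_. hi - 2)"
  let ?Y1 = "(top_part hi Y, \<lambda>_. hi - 1)" and ?Y2 = "(top_part hi Y, \<lambda>_. hi - 2)"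
  have tpX: "j \<in> top_part hi X \<longleftrightarrow> j \<in> fst X \<and> snd X j = hi" for j by (auto simp: top_part_def)
  have tpY: "j \<in> top_part hi Y \<longleftrightarrow> j \<in> fst Y \<and> snd Y j = hi" for j by (auto simp: top_part_def)
  have Cent: "ent C i j = (if i \<in> top_part hi Y \<and> j \<in> top_part hi X then ent P i j else 0)" for i j by (simp add: C K H)
  have C'ent: "ent C' i j = (if i \<in> top_part hi X \<and> j \<in> top_part hi Y then ent Q i j else 0)" for i j by (simp add: C' K H)
  have rowK: "a = K * a \<Longrightarrow> ent a i j \<noteq> 0 \<Longrightarrow> i \<in> top_part hi Y" for a i j by (metis K ent_cproj_mult)
  have rowH: "a = H * a \<Longrightarrow> ent a i j \<noteq> 0 \<Longrightarrow> i \<in> top_part hi X" for a i j by (metis H ent_cproj_mult)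
  have colH: "a * H = 0 \<Longrightarrow> ent a i j \<noteq> 0 \<Longrightarrow> j \<notin> top_part hi X" for a i j
    by (metis H ent_mult_cproj ent_0)
  have colB: "ent B i j \<noteq> 0 \<Longrightarrow> j \<notin> top_part hi X" for i j by (rule colH[OF z(4)])
  have colA: "ent A i j \<noteq> 0 \<Longrightarrow> j \<notin> top_part hi X" for i j by (rule colH[OF z(3)])
  have B: "B \<in> fhom (drop_top hi X) ?Y1"
  proof (rule fhomI)
    fix i j assume nz: "ent B i j \<noteq> 0"
    then show "i \<in> fst ?Y1 \<and> j \<in> fst (drop_top hi X) \<and> ent B i j \<in> fil (snd ?Y1 i - snd (drop_top hi X) j)"
      using rowK[OF z(2)[symmetric] nz] colB[OF nz] fhomD[OF A(2), of i j] fhomD2[OF A(2) nz]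
      by (auto simp: drop_top_def lower_def tpX tpY)
  qed
  have C1: "C \<in> fhom ?X1 ?Y1"
  proof (rule fhomI)
    fix i j assume "ent C i j \<noteq> 0"
    then show "i \<in> fst ?Y1 \<and> j \<in> fst ?X1 \<and> ent C i j \<in> fil (snd ?Y1 i - snd ?X1 j)"
      using fhomD[OF P, of i j] by (auto simp: Cent tpX tpY split: if_splits)
  qed
  have C2: "C' \<in> fhom ?Y2 ?X2"
  proof (rule fhomI)
    fix i j assume "ent C' i j \<noteq> 0"
    then show "i \<in> fst ?X2 \<and> j \<in> fst ?Y2 \<and> ent C' i j \<in> fil (snd ?X2 i - snd ?Y2 j)"
      using fhomD[OF Q, of i j] by (auto simp: C'ent tpX tpY split: if_splits)
  qed
  have PB: "P - scal tt * B \<in> fhom (drop_top hi X) (drop_top hi Y)"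
  proof (rule fhomI)
    fix i j assume nz: "ent (P - scal tt * B) i j \<noteq> 0"
    show "i \<in> fst (drop_top hi Y) \<and> j \<in> fst (drop_top hi X) \<and> ent (P - scal tt * B) i j \<in> fil (snd (drop_top hi Y) i - snd (drop_top hi X) j)"
    proof (cases "i \<in> top_part hi Y")
      case True
      then have "ent P i j = ent (K * P) i j" by (simp add: K)
      then have eq: "ent (P - scal tt * B) i j = ent C i j + ent A i j" by (simp add: KP)
      show ?thesis
      proof (cases "j \<in> top_part hi X")
        case jt: True
        then have "ent A i j = 0" using colA by blast
        then show ?thesis using eq nz True jt fhomD[OF P, of i j] by (auto simp: Cent drop_top_def tpX tpY)
      next
        case False
        then have "ent C i j = 0" by (simp add: Cent)
        then show ?thesis using eq nz True False fhomD[OF A(1), of i j] fhomD2[OF A(1), of i j]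
          by (auto simp: drop_top_def tpX tpY lower_def)
      qed
    next
      case False
      then have "ent B i j = 0" using rowK[OF z(2)[symmetric]] by blast
      then have eq: "ent (P - scal tt * B) i j = ent P i j" by simp
      then have "i \<in> fst Y" "j \<in> fst X" using nz fhomD1[OF P] fhomD2[OF P] by auto
      then show ?thesis using eq False fhomD[OF P, of i j] by (auto simp: drop_top_def tpY intro: fil_mono)
    qed
  qed
  have PH: "scal tt * (P * H - C) \<in> fhom ?X1 (drop_top hi Y)"
  proof (rule fhomI)
    fix i j assume nz: "ent (scal tt * (P * H - C)) i j \<noteq> 0"
    then have *: "j \<in> top_part hi X" "i \<notin> top_part hi Y" "ent P i j \<noteq> 0" by (auto simp: Cent H split: if_splits)
    moreover have "tt * ent P i j \<in> fil (snd Y i - hi + 1)"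
      by (rule fil_t_mult) (use fhomD[OF P, of i j] * in \<open>auto simp: tpX\<close>)
    ultimately show "i \<in> fst (drop_top hi Y) \<and> j \<in> fst ?X1 \<and> ent (scal tt * (P * H - C)) i j \<in> fil (snd (drop_top hi Y) i - snd ?X1 j)"
      using fhomD1[OF P *(3)] by (auto simp: Cent H drop_top_def tpY algebra_simps)
  qed
  have tK: "scal tt * K \<in> fhom ?Y2 (drop_top hi Y)"
    by (rule fhomI) (use fil_t in \<open>auto simp: K drop_top_def tpY split: if_splits\<close>)
  have K1: "K \<in> fhom ?Y2 ?Y1"
    by (rule fhomI) (auto simp: K intro: fil_1 split: if_splits)
  have APf: "A' * P \<in> fhom X (lower X)" by (rule fhom_comp[OF A'(1) P])
  have BPf: "B' * P \<in> fhom X (lower X)" by (rule fhom_comp[OF A'(2) P])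
  have AP: "A' * P * H \<in> fhom ?X1 ?X2"
  proof (rule fhomI)
    fix i j assume nz: "ent (A' * P * H) i j \<noteq> 0"
    have "A' * P * H = H * (A' * P * H)" using z(5) by (simp flip: mult.assoc)
    then have "i \<in> top_part hi X" using rowH nz by blast
    moreover have "j \<in> top_part hi X" "ent (A' * P * H) i j = ent (A' * P) i j" using nz by (auto simp: H split: if_splits)
    ultimately show "i \<in> fst ?X2 \<and> j \<in> fst ?X1 \<and> ent (A' * P * H) i j \<in> fil (snd ?X2 i - snd ?X1 j)"
      using fhomD[OF APf, of i j] by (auto simp: lower_def tpX)
  qed
  define \<xi> where "\<xi> = B' * P + C' * B"
  have CP: "C' * P = C' * C + C' * A + scal tt * (C' * B)"
  proof -
    have "C' * K = C'" by (rule cmat_eqI) (simp add: C' K H)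
    then have "C' * P = C' * (K * P)" by (simp flip: mult.assoc)
    then show ?thesis by (simp add: KP distrib_left scal_comm2[of C'])
  qed
  have key: "A' * P + C' * A + scal tt * \<xi> = scal fbar * H - C' * C"
  proof -
    have "H * Q * P = scal fbar * (H * cproj (fst X))" by (simp add: mult.assoc QP scal_comm2[of H])
    also have "H * cproj (fst X) = H" by (rule cmat_eqI) (auto simp: H tpX)
    finally have "scal fbar * H = C' * P + A' * P + scal tt * (B' * P)" by (simp add: HQ distrib_right mult.assoc)
    then show ?thesis by (simp add: CP \<xi>_def distrib_left algebra_simps)
  qed
  have C'f: "C' \<in> fhom Y X"
  proof (rule fhomI)
    fix i j assume "ent C' i j \<noteq> 0"
    then show "i \<in> fst X \<and> j \<in> fst Y \<and> ent C' i j \<in> fil (snd X i - snd Y j)"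
      using fhomD[OF Q, of i j] by (auto simp: C'ent tpX tpY split: if_splits)
  qed
  have \<xi>: "\<xi> \<in> fhom (drop_top hi X) ?X2"
  proof (rule fhomI)
    fix i j assume nz: "ent \<xi> i j \<noteq> 0"
    have C'H: "H * C' = C'" by (rule cmat_eqI) (simp add: C' K H)
    have "\<xi> = H * \<xi>" by (simp add: \<xi>_def distrib_left z(6) C'H flip: mult.assoc)
    then have i: "i \<in> top_part hi X" using rowH nz by blast
    have "B' * P \<in> u.vhom (fst X) (fst X)" using fhom_vhom[OF BPf] by (simp add: lower_def)
    moreover have "C' * B \<in> u.vhom (fst X) (fst X)"
      using u.vhom_comp[OF fhom_vhom[OF C'f]] fhom_vhom[OF A(2)] by (simp add: lower_def)
    ultimately have "\<xi> \<in> u.vhom (fst X) (fst X)" unfolding \<xi>_def by (rule u.vhom_add)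
    then have j: "j \<in> fst X" using nz unfolding u.vhom_def by blast
    show "i \<in> fst ?X2 \<and> j \<in> fst (drop_top hi X) \<and> ent \<xi> i j \<in> fil (snd ?X2 i - snd (drop_top hi X) j)"
    proof (cases "j \<in> top_part hi X")
      case True
      have "ent (C' * B) i j = 0" unfolding ent_mult using True colB by (intro sum.neutral) auto
      then have "ent \<xi> i j = ent (B' * P) i j" by (simp add: \<xi>_def)
      then show ?thesis using i True fhomD[OF BPf, of i j] by (auto simp: drop_top_def lower_def tpX)
    next
      case False
      have "ent (C' * C) i j = 0" unfolding ent_mult using False by (intro sum.neutral) (auto simp: Cent)
      then have "ent (A' * P + C' * A + scal tt * \<xi>) i j = 0" using False unfolding key by (simp add: H)
      then have "tt * ent \<xi> i j = - (ent (A' * P) i j + ent (C' * A) i j)"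
        by (simp only: ent_add ent_scal_mult add_eq_0_iff)
      moreover have "ent (A' * P) i j \<in> fil (hi - 1 - snd X j)"
        using fhomD[OF APf, of i j] i by (simp add: lower_def tpX)
      moreover have "ent (C' * A) i j \<in> fil (hi - 1 - snd X j)"
        unfolding ent_mult
      proof (rule fil_sum)
        fix l
        show "ent C' i l * ent A l j \<in> fil (hi - 1 - snd X j)"
        proof (cases "ent C' i l = 0")
          case False
          then have l: "l \<in> top_part hi Y" by (auto simp: C'ent split: if_splits)
          have "ent C' i l \<in> fil 0" using fhomD[OF C'f, of i l] i l by (simp add: tpX tpY)
          moreover have "ent A l j \<in> fil (hi - 1 - snd X j)" using fhomD[OF A(1), of l j] l by (simp add: lower_def tpY)
          ultimately show ?thesis using fil_mult[of "ent C' i l" 0] by fastforce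
        qed simp
      qed
      ultimately have "tt * ent \<xi> i j \<in> fil (hi - 1 - snd X j)" by (simp add: fil_diff)
      from fil_div[OF this] have "ent \<xi> i j \<in> fil (hi - 2 - snd X j)" by (simp add: algebra_simps)
      then show ?thesis using i j False by (auto simp: drop_top_def tpX)
    qed
  qed
  define M1 M2 M3 M4 where "M1 = P - scal tt * B" and "M2 = scal tt * (P * H - C)" and "M3 = scal tt * K" and "M4 = A' * P * H"
  have eq: "bmap tt H K P B C A' B' C' =
     s0 * (M1 * r0) + s1 * (s0 * (B * r0)) - s1 * (s1 * (\<xi> * r0)) +
     s0 * (M2 * r0 * r1) + s1 * (s0 * (C * r0 * r1)) + s1 * (s1 * (M4 * r0 * r1)) -
     s0 * (M3 * r1 * r1) + s1 * (s0 * (K * r1 * r1)) - s1 * (s1 * (C' * r1 * r1))"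
    by (simp add: bmap_def \<xi>_def mult.assoc M1_def M2_def M3_def M4_def)
  show ?thesis
    unfolding eq
    by (intro fhom_add fhom_diff fhom_gsum PB[folded M1_def] B \<xi> PH[folded M2_def] C1 AP[folded M4_def] tK[folded M3_def] K1 C2)
qed

text \<open>
  A generator of the highest weight \<open>hi\<close> is replaced by the rest of the Koszul complex of \<open>u\<close> and \<open>t\<close>, that is, by
  two generators of weight \<open>hi - 1\<close> and one of weight \<open>hi - 2\<close> in the other parity. This is Beilinson's
  argument: in the chart \<open>u = 1\<close> the Koszul complex is contractible, so that the factorization does not change up to
  homotopy, but the differential has to be corrected so that it respects the lower weights.
\<close>

theorem reduce_top:
  assumes gm: "u.gmf X Y p q" and hi: "\<And>j. j \<in> fst X \<Longrightarrow> snd X j \<le> hi" "\<And>j. j \<in> fst Y \<Longrightarrow> snd Y j \<le> hi"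
    and lo: "\<And>j. j \<in> fst X \<Longrightarrow> lo \<le> snd X j" "\<And>j. j \<in> fst Y \<Longrightarrow> lo \<le> snd Y j" and "lo + 2 \<le> hi"
  shows "\<exists>X' Y' p' q'. u.gmf X' Y' p' q' \<and> u.heq (u.demf X Y p q) (u.demf X' Y' p' q') \<and>
    (\<forall>j\<in>fst X'. lo \<le> snd X' j \<and> snd X' j \<le> hi - 1) \<and> (\<forall>j\<in>fst Y'. lo \<le> snd Y' j \<and> snd Y' j \<le> hi - 1)"
proof -
  define P Q where "P = u.DD p" and "Q = u.DD q"
  have fin: "finite (fst X)" "finite (fst Y)" using gm by (auto simp: u.gmf_def)
  have mf: "u.is_mf (u.demf X Y p q)" by (rule u.is_mf_demf[OF gm])
  then have QP: "Q * P = scal fbar * cproj (fst X)" "P * Q = scal fbar * cproj (fst Y)"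
    by (auto simp: u.is_mf_def P_def Q_def)
  have P: "P \<in> fhom X Y" and Q: "Q \<in> fhom Y X"
    unfolding P_def Q_def using gm by (auto simp: u.gmf_def intro: fhom_DD)
  define H K where "H = (cproj (top_part hi X) :: mpoly cmat)" and "K = (cproj (top_part hi Y) :: mpoly cmat)"
  obtain A B where AB: "K * P = K * P * H + A + scal tt * B" "A \<in> fhom X (lower Y)" "B \<in> fhom X (lower Y)"
    "K * A = A" "K * B = B" "A * H = 0" "B * H = 0"
    using split_top[OF P fin(2) hi(1)] unfolding H_def K_def by blast
  obtain A' B' where AB': "H * Q = H * Q * K + A' + scal tt * B'" "A' \<in> fhom Y (lower X)" "B' \<in> fhom Y (lower X)"
    "H * A' = A'" "H * B' = B'" "A' * K = 0" "B' * K = 0"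
    using split_top[OF Q fin(1) hi(2)] unfolding H_def K_def by blast
  define C C' where "C = K * P * H" and "C' = H * Q * K"
  let ?I = "cproj (fst X) :: mpoly cmat" and ?J = "cproj (fst Y) :: mpoly cmat"
  have HH: "H * H = H" "K * K = K" "?I * H = H" "H * ?I = H" "?J * K = K" "K * ?J = K"
    by (rule cmat_eqI; auto simp: H_def K_def top_part_def)+
  have PI: "P * ?I = P" "?J * P = P" "Q * ?J = Q" "?I * Q = Q"
    using u.vhom_idR[OF fhom_vhom[OF P]] u.vhom_idL[OF fhom_vhom[OF P]] u.vhom_idR[OF fhom_vhom[OF Q]] u.vhom_idL[OF fhom_vhom[OF Q]] by auto
  have BI: "B * ?I = B" "B' * ?J = B'" "?J * B = B" "?I * B' = B'"
    using u.vhom_idR[OF fhom_vhom[OF AB(3)]] u.vhom_idR[OF fhom_vhom[OF AB'(3)]]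
      u.vhom_idL[OF fhom_vhom[OF AB(3)]] u.vhom_idL[OF fhom_vhom[OF AB'(3)]] by (auto simp: lower_def)
  have Ck: "K * C = C" "C * H = C" "H * C' = C'" "C' * K = C'"
    by (simp_all add: C_def C'_def HH mult.assoc assoc_rule[OF HH(1)] assoc_rule[OF HH(2)])
  have KPQ: "K * P * Q = scal fbar * K" "H * Q * P = scal fbar * H"
    by (simp_all add: mult.assoc QP scal_comm2[of K] scal_comm2[of H] HH)
  note KP = AB(1)[folded C_def] and HQ = AB'(1)[folded C'_def]
  define Ph where "Ph = bmap tt H K P B C A' B' C'"
  define Qh where "Qh = bmap tt K H Q B' C' A B C"
  define X' where "X' = gsum (drop_top hi X) (gsum (top_part hi X, \<lambda>_. hi - 1) (top_part hi Y, \<lambda>_. hi - 2))"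
  define Y' where "Y' = gsum (drop_top hi Y) (gsum (top_part hi Y, \<lambda>_. hi - 1) (top_part hi X, \<lambda>_. hi - 2))"
  have Ph: "Ph \<in> fhom X' Y'" unfolding Ph_def X'_def Y'_def
    by (rule bmap_fhom[OF P Q AB(2,3) AB'(2,3) hi(1) H_def K_def C_def C'_def KP HQ AB(4-7) AB'(4,5) QP(1)])
  have Qh: "Qh \<in> fhom Y' X'" unfolding Qh_def X'_def Y'_def
    by (rule bmap_fhom[OF Q P AB'(2,3) AB(2,3) hi(2) K_def H_def C'_def C_def HQ KP AB'(4-7) AB(4,5) QP(2)])
  have idX': "cproj (fst X') = s0 * ?I * r0 + s1 * (s0 * H * r0 + s1 * K * r1) * r1"
    and idY': "cproj (fst Y') = s0 * ?J * r0 + s1 * (s0 * K * r0 + s1 * H * r1) * r1"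
    by (simp_all add: X'_def Y'_def cproj_gsum drop_top_def H_def K_def)
  have QPh: "Qh * Ph = scal fbar * cproj (fst X')" unfolding Qh_def Ph_def idX'
    by (rule bmap_product[where A = A and A' = A' and H = H and K = K and P = P and Q = Q])
       (use QP HH BI KPQ KP HQ AB AB' Ck in auto)
  have PQh: "Ph * Qh = scal fbar * cproj (fst Y')" unfolding Qh_def Ph_def idY'
    by (rule bmap_product[where A = A' and A' = A and H = K and K = H and P = Q and Q = P])
       (use QP HH BI KPQ KP HQ AB AB' Ck in auto)
  obtain p' where p': "p' \<in> u.gh X' Y'" "u.DD p' = Ph" using fhom_lift[OF Ph] by blast
  obtain q' where q': "q' \<in> u.gh Y' X'" "u.DD q' = Qh" using fhom_lift[OF Qh] by blast
  have finX': "finite (fst X')" "finite (fst Y')"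
    using fin by (auto simp: X'_def Y'_def drop_top_def top_part_def intro!: finite_gsum)
  have gm': "u.gmf X' Y' p' q'"
    unfolding u.gmf_def
  proof (intro conjI finX' p'(1) q'(1))
    show "q' * p' = scal FF * cproj (fst X')"
      by (rule u.hom_inj_eq[OF ghom_comp[OF q'(1) p'(1)] ghom_scal[OF ghom_id FF]])
         (auto simp: u.del.cmap_mult p' q' QPh del_u_FF)
    show "p' * q' = scal FF * cproj (fst Y')"
      by (rule u.hom_inj_eq[OF ghom_comp[OF p'(1) q'(1)] ghom_scal[OF ghom_id FF]])
         (auto simp: u.del.cmap_mult p' q' PQh del_u_FF)
  qed
  \<comment> \<open>The projection \<open>\<pi>\<close>, its section \<open>\<iota>\<close> and the null homotopy \<open>\<sigma>\<close> of \<open>\<iota> \<pi> - 1\<close>.\<close>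
  have V: "P \<in> u.vhom (fst X) (fst Y)" "Q \<in> u.vhom (fst Y) (fst X)" using fhom_vhom P Q by auto
  have top: "top_part hi Z \<subseteq> fst Z" for Z by (auto simp: top_part_def)
  have VH: "H \<in> u.vhom (top_part hi X) (fst X)" "K \<in> u.vhom (top_part hi Y) (fst Y)"
    "H \<in> u.vhom (top_part hi X) (top_part hi X)" "K \<in> u.vhom (top_part hi Y) (top_part hi Y)"
    using top[of X] top[of Y] by (auto simp: u.vhom_def H_def K_def)
  have VB: "B \<in> u.vhom (fst X) (top_part hi Y)" "B' \<in> u.vhom (fst Y) (top_part hi X)"
    using u.vhom_comp[OF VH(4), of B "fst X"] u.vhom_comp[OF VH(3), of B' "fst Y"] AB AB' fhom_vhom[OF AB(3)] fhom_vhom[OF AB'(3)]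
    by (auto simp: u.vhom_def lower_def K_def H_def) (metis ent_cproj_mult)+
  have tV: "tt \<in> poly_ring VV"
    unfolding poly_ring_eq var_def by (rule span_of_mon) (use N in \<open>auto simp: mons_def\<close>)
  have mm: "a0 \<in> u.vhom (fst A0) (fst B0) \<Longrightarrow> a1 \<in> u.vhom (fst A1) (fst B1) \<Longrightarrow>
      a1 * u.DD d = u.DD d' * a0 \<Longrightarrow> a0 * u.DD e = u.DD e' * a1 \<Longrightarrow>
      (a0, a1) \<in> u.tmaps (u.demf A0 A1 d e) (u.demf B0 B1 d' e')" for a0 a1 A0 A1 B0 B1 d e d' e'
    by (simp add: u.tmaps_def u_thom)
  define \<pi>0 where "\<pi>0 = ?I * r0 + scal tt * H * r0 * r1"
  define \<pi>1 where "\<pi>1 = ?J * r0 + scal tt * K * r0 * r1"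
  define \<iota>0 where "\<iota>0 = s0 * ?I - s1 * (s1 * B)"
  define \<iota>1 where "\<iota>1 = s0 * ?J - s1 * (s1 * B')"
  define \<sigma>0 where "\<sigma>0 = - (s1 * (s1 * H * r0 * r1))"
  define \<sigma>1 where "\<sigma>1 = - (s1 * (s1 * K * r0 * r1))"
  have cutf: "fst (drop_top hi Z) = fst Z" for Z by (simp add: drop_top_def)
  note vg = u.vhom_gsum
  have pV: "\<pi>0 \<in> u.vhom (fst X') (fst X)" "\<pi>1 \<in> u.vhom (fst Y') (fst Y)"
    unfolding \<pi>0_def \<pi>1_def X'_def Y'_def
    by (intro u.vhom_add vg; use u.vhom_id u.vhom_scal[OF tV VH(1)] u.vhom_scal[OF tV VH(2)] in \<open>simp add: cutf\<close>)+
  have iV: "\<iota>0 \<in> u.vhom (fst X) (fst X')" "\<iota>1 \<in> u.vhom (fst Y) (fst Y')"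
    unfolding \<iota>0_def \<iota>1_def X'_def Y'_def
    by (intro u.vhom_diff vg; use u.vhom_id VB in \<open>simp add: cutf\<close>)+
  have sV: "\<sigma>0 \<in> u.vhom (fst X') (fst Y')" "\<sigma>1 \<in> u.vhom (fst Y') (fst X')"
    unfolding \<sigma>0_def \<sigma>1_def X'_def Y'_def u.vhom_uminus
    by (intro vg; use VH in simp)+
  have PHK: "K * P = C + A + scal tt * B" "H * Q = C' + A' + scal tt * B'" by (rule KP, rule HQ)
  note expand = mult.assoc distrib_left distrib_right left_diff_distrib right_diff_distrib
    scal_comm2[of P] scal_comm2[of Q] scal_comm2[of H] scal_comm2[of K] scal_comm2[of s0] scal_comm2[of s1]
    scal_comm2[of ?I] scal_comm2[of ?J] scal_comm2[of B] scal_comm2[of B'] scal_comm2[of C] scal_comm2[of C'] scal_comm2[of r0] scal_comm2[of r1]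
  have JC: "?J * C = C" "?I * C' = C'"
    using HH(3,5) Ck by (metis mult.assoc)+
  note idr = PI BI HH Ck AB(4-7) AB'(4-7) JC
  note idr' = idr idr[THEN assoc_rule]
  have II: "?I * ?I = ?I" "?J * ?J = ?J" by (rule u.vhom_idL[OF u.vhom_id])+
  have e1: "\<pi>1 * Ph = P * \<pi>0" "\<pi>0 * Qh = Q * \<pi>1"
    by (simp_all add: \<pi>0_def \<pi>1_def Ph_def Qh_def bmap_def expand idr')
  have e2: "Ph * \<iota>0 = \<iota>1 * P" "Qh * \<iota>1 = \<iota>0 * Q"
    by (simp_all add: \<iota>0_def \<iota>1_def Ph_def Qh_def bmap_def expand idr')
  have e3: "\<pi>0 * \<iota>0 = ?I" "\<pi>1 * \<iota>1 = ?J"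
    by (simp_all add: \<iota>0_def \<iota>1_def \<pi>0_def \<pi>1_def expand idr' u.vhom_idL[OF u.vhom_id])
  have e4: "\<iota>0 * \<pi>0 = cproj (fst X') + (Qh * \<sigma>0 + \<sigma>1 * Ph)" "\<iota>1 * \<pi>1 = cproj (fst Y') + (Ph * \<sigma>1 + \<sigma>0 * Qh)"
    by (simp_all add: idX' idY' \<iota>0_def \<iota>1_def \<pi>0_def \<pi>1_def \<sigma>0_def \<sigma>1_def Ph_def Qh_def bmap_def expand idr' II II[THEN assoc_rule])
  have "u.heq (u.demf X Y p q) (u.demf X' Y' p' q')"
    unfolding u.heq_def
  proof (intro bexI conjI)
    show "(\<iota>0, \<iota>1) \<in> u.tmaps (u.demf X Y p q) (u.demf X' Y' p' q')"
      by (rule mm) (use iV e2 in \<open>auto simp: P_def Q_def p' q'\<close>)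
    show "(\<pi>0, \<pi>1) \<in> u.tmaps (u.demf X' Y' p' q') (u.demf X Y p q)"
      by (rule mm) (use pV e1 in \<open>auto simp: P_def Q_def p' q'\<close>)
    show "u.thtp (u.demf X Y p q) (u.demf X Y p q) (u.pmul (\<pi>0, \<pi>1) (\<iota>0, \<iota>1)) (u.tid (u.demf X Y p q))"
      using u.thtp_refl by (simp add: u.tid_def e3)
    show "u.thtp (u.demf X' Y' p' q') (u.demf X' Y' p' q') (u.pmul (\<iota>0, \<iota>1) (\<pi>0, \<pi>1)) (u.tid (u.demf X' Y' p' q'))"
      unfolding u.thtp_def
      by (rule bexI[of _ \<sigma>0], rule bexI[of _ \<sigma>1]) (use sV e4 in \<open>auto simp: u.tid_def p' q' u_thom\<close>)
  qed
  moreover have "(\<forall>j\<in>fst X'. lo \<le> snd X' j \<and> snd X' j \<le> hi - 1) \<and> (\<forall>j\<in>fst Y'. lo \<le> snd Y' j \<and> snd Y' j \<le> hi - 1)"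
    using hi lo \<open>lo + 2 \<le> hi\<close> unfolding X'_def Y'_def gsum_def drop_top_def top_part_def
    by (fastforce split: if_splits)
  ultimately show ?thesis using gm' by blast
qed

end

section \<open>Full faithfulness on the chart\<close>

context cox
begin

abbreviation uu :: mpoly where "uu \<equiv> var 0"

definition dy :: "mpoly \<Rightarrow> mpoly" where "dy = mono_op (\<lambda>m. m - mon 1 1) (\<lambda>m. of_nat (look m 1))"

lemma dy_add: "dy (p + q) = dy p + dy q" by (simp add: dy_def mono_op_add)
lemma dy_0 [simp]: "dy 0 = 0" by (simp add: dy_def)
lemma dy_sum: "dy (sum p A) = (\<Sum>i\<in>A. dy (p i))" by (simp add: dy_def mono_op_sum)
lemma dy_mon: "dy (mon m c) = mon (m - mon 1 1) (of_nat (look m 1) * c)" by (simp add: dy_def)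

lemma dy_mult: "dy (p * q) = dy p * q + p * dy q"
proof (induction p rule: mpoly_induct)
  case (mon m c)
  show ?case
  proof (induction q rule: mpoly_induct)
    case (mon n d)
    have 1: "mon (m + n - mon 1 1) (of_nat (look m 1) * (c * d)) = mon (m - mon 1 1 + n) (of_nat (look m 1) * (c * d))"
    proof (cases "look m 1 = 0")
      case False
      then have "m + n - mon 1 1 = m - mon 1 1 + n"
        by (intro lookup_eqI) (auto simp: lookup_add lookup_minus lookup_single lookup_one when_def)
      then show ?thesis by simp
    qed simp
    have 2: "mon (m + n - mon 1 1) (of_nat (look n 1) * (c * d)) = mon (m + (n - mon 1 1)) (of_nat (look n 1) * (c * d))"
    proof (cases "look n 1 = 0")
      case False
      then have "m + n - mon 1 1 = m + (n - mon 1 1)"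
        by (intro lookup_eqI) (auto simp: lookup_add lookup_minus lookup_single lookup_one when_def)
      then show ?thesis by simp
    qed simp
    have "dy (mon m c * mon n d) = mon (m + n - mon 1 1) (of_nat (look m 1) * (c * d)) + mon (m + n - mon 1 1) (of_nat (look n 1) * (c * d))"
      by (simp only: mult_single dy_mon lookup_add of_nat_add distrib_right single_add)
    then show ?case unfolding 1 2 by (simp add: dy_mon mult_single mult_ac add_ac)
  qed (auto simp: dy_add ring_distribs)
qed (auto simp: dy_add ring_distribs)

abbreviation "Dy \<equiv> cmap dy"

lemma Dy_mult: "Dy (a * b) = Dy a * b + a * Dy b"
proof (rule cmat_eqI)
  fix i j
  have "ent (a * Dy b) i j = (\<Sum>k | ent b k j \<noteq> 0. ent a i k * ent (Dy b) k j)"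
    by (rule ent_mult_superset) (auto intro: finite_col simp: ent_cmap)
  then show "ent (Dy (a * b)) i j = ent (Dy a * b + a * Dy b) i j"
    by (simp add: ent_cmap ent_mult dy_sum dy_mult sum.distrib)
qed

lemma dy_hmg: "p \<in> hmg cdeg WW e \<Longrightarrow> dy p \<in> hmg cdeg WW (e + 2)"
  unfolding hmg_def dy_def
proof (erule mono_op_span_of)
  fix m assume m: "m \<in> hmons cdeg WW e"
  show "of_nat (look m 1) = (0::complex) \<or> m - mon 1 1 \<in> hmons cdeg WW (e + 2)"
  proof (cases "look m 1 = 0")
    case False
    define n where "n = m - mon 1 1"
    have mn: "m = n + mon 1 1"
      using False by (intro lookup_eqI) (auto simp: n_def lookup_add lookup_minus lookup_single lookup_one when_def)
    have "mdeg cdeg m = mdeg cdeg n - 2" using N1 by (simp add: mn mdeg_add cdeg_def)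
    moreover have "supp n \<subseteq> WW" using m by (auto simp: mn hmons_def keys_add_nat)
    ultimately show ?thesis using m by (auto simp: hmons_def n_def)
  qed simp
qed

definition up :: "int \<Rightarrow> gmod \<Rightarrow> gmod" where "up p Y = (fst Y, \<lambda>i. snd Y i + p)"

lemma Dy_gh: "a \<in> u.gh X Y \<Longrightarrow> Dy a \<in> u.gh X (up 2 Y)"
proof (rule ghomI)
  fix i j assume a: "a \<in> u.gh X Y" and nz: "ent (Dy a) i j \<noteq> 0"
  then have "ent a i j \<noteq> 0" by (auto simp: ent_cmap)
  then show "i \<in> fst (up 2 Y) \<and> j \<in> fst X \<and> ent (Dy a) i j \<in> hmg cdeg WW (snd (up 2 Y) i - snd X j)"
    using ghomD1[OF a] ghomD2[OF a] dy_hmg[OF ghomD[OF a, of i j]] by (simp add: up_def ent_cmap algebra_simps)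
qed

lemma up_gh: "a \<in> u.gh (up p X) (up p Y) \<longleftrightarrow> a \<in> u.gh X Y"
  by (simp add: ghom_def up_def)

lemma up_up: "up p (up q X) = up (p + q) X" by (simp add: up_def add_ac)

lemma mdeg_one: "mdeg cdeg (1::monom) = 1"
  using mdeg_cox[of 1] N1 by (simp add: keys_one lookup_one)

lemma u_divisible: "p \<in> span_of {m. look m 0 \<ge> 1} \<Longrightarrow> \<exists>g. p = uu * g"
proof (induction rule: span_of_induct)
  case zero
  show ?case by (intro exI[of _ 0]) simp
next
  case (mon m c)
  then have "m = mon 0 1 + (m - mon 0 1)"
    by (intro lookup_eqI) (auto simp: lookup_add lookup_minus lookup_single lookup_one when_def)
  then have "mon m c = uu * mon (m - mon 0 1) c" by (simp add: var_def mult_single)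
  then show ?case ..
next
  case (add p q)
  then show ?case by (metis distrib_left)
qed

lemma dy_FF: "\<exists>g. dy FF = tt ^ 2 + uu * g"
proof -
  have "mono_op (\<lambda>m. m + mon 0 (2 * look m 1)) (\<lambda>_. 1) hp \<in> span_of {m. look m 1 = 0 \<or> look m 0 \<ge> 1}"
  proof (rule mono_op_span_of[OF hp[unfolded poly_ring_eq]])
    fix m :: monom show "(1::complex) = 0 \<or> m + mon 0 (2 * look m 1) \<in> {m. look m 1 = 0 \<or> look m 0 \<ge> 1}"
      by (auto simp: lookup_add lookup_single)
  qed
  then have "dy (mono_op (\<lambda>m. m + mon 0 (2 * look m 1)) (\<lambda>_. 1) hp) \<in> span_of {m. look m 0 \<ge> 1}"
    unfolding dy_def by (rule mono_op_span_of) (auto simp: lookup_minus lookup_single)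
  then obtain g where g: "dy (mono_op (\<lambda>m. m + mon 0 (2 * look m 1)) (\<lambda>_. 1) hp) = uu * g" using u_divisible by blast
  have "dy (var 1 * tt ^ 2) = tt ^ 2"
  proof -
    have "mon 1 1 + mon (N + 1) 2 - mon 1 1 = (mon (N + 1) 2 :: monom)"
      by (intro lookup_eqI) (auto simp: lookup_add lookup_minus lookup_single lookup_one when_def)
    moreover have "look (mon 1 1 + mon (N + 1) 2 :: monom) 1 = 1" using N1 by (simp add: lookup_add lookup_single)
    ultimately show ?thesis unfolding var_sq dy_mon by (simp only: var_power) simp
  qed
  then have "dy FF = tt ^ 2 + uu * g" unfolding FF_def dy_add g by (simp add: add.commute)
  then show ?thesis ..
qed

lemma hmg_split: "p \<in> hmg cdeg WW e \<Longrightarrow> e \<ge> 2 \<Longrightarrow> \<exists>m r. m \<in> hmg cdeg WW (e - 2) \<and> r \<in> hmg cdeg WW (e - 1) \<and> p = tt ^ 2 * m + uu * r"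
  unfolding hmg_def[of _ _ e]
proof (induction rule: span_of_induct)
  case zero
  show ?case by (intro exI[of _ 0]) auto
next
  case (mon m c)
  have md: "supp m \<subseteq> WW" "int (look m 0) - 2 * int (look m 1) + int (look m (N + 1)) = e"
    using mon(1) mdeg_cox[of m] by (auto simp: hmons_def)
  show ?case
  proof (cases "look m 0 \<ge> 1")
    case True
    define n where "n = m - mon 0 1"
    have mn: "m = mon 0 1 + n"
      using True by (intro lookup_eqI) (auto simp: n_def lookup_add lookup_minus lookup_single lookup_one when_def)
    have "mon n c \<in> hmg cdeg WW (e - 1)"
      using mon(1) unfolding hmg_def by (intro span_of_mon) (auto simp: hmons_def mn keys_add_nat mdeg_add mdeg_one cdeg_def)
    moreover have "mon m c = uu * mon n c" by (simp add: mn var_def mult_single)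
    ultimately show ?thesis by (intro exI[of _ 0] exI[of _ "mon n c"]) auto
  next
    case False
    then have t2: "look m (N + 1) \<ge> 2" using md mon(2) by auto
    define n where "n = m - mon (N + 1) 2"
    have mn: "m = mon (N + 1) 2 + n"
      using t2 by (intro lookup_eqI) (auto simp: n_def lookup_add lookup_minus lookup_single lookup_one when_def)
    have "mon n c \<in> hmg cdeg WW (e - 2)"
      using mon(1) unfolding hmg_def by (intro span_of_mon) (auto simp: hmons_def mn keys_add_nat mdeg_add mdeg_one cdeg_def)
    moreover have "mon m c = tt ^ 2 * mon n c" by (simp add: mn var_power mult_single)
    ultimately show ?thesis by (intro exI[of _ "mon n c"] exI[of _ 0]) auto
  qed
next
  case (add p q)
  then obtain m r m' r' where "m \<in> hmg cdeg WW (e - 2)" "r \<in> hmg cdeg WW (e - 1)" "p = tt ^ 2 * m + uu * r"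
    "m' \<in> hmg cdeg WW (e - 2)" "r' \<in> hmg cdeg WW (e - 1)" "q = tt ^ 2 * m' + uu * r'" by blast
  then show ?case by (intro exI[of _ "m + m'"] exI[of _ "r + r'"]) (auto simp: hmg_add ring_distribs)
qed

lemma gh_split:
  assumes q: "q \<in> u.gh X (up (p + 2) Y)" and fin: "finite (fst Y)"
    and pos: "\<And>i j. i \<in> fst Y \<Longrightarrow> j \<in> fst X \<Longrightarrow> snd Y i - snd X j + p \<ge> 0"
  shows "\<exists>m r. m \<in> u.gh X (up p Y) \<and> r \<in> u.gh X (up (p + 1) Y) \<and> q = scal (tt ^ 2) * m + scal uu * r"
proof -
  have "\<exists>m r. m \<in> hmg cdeg WW (snd Y i + p - snd X j) \<and> r \<in> hmg cdeg WW (snd Y i + p + 1 - snd X j) \<and> ent q i j = tt ^ 2 * m + uu * r"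
    if "i \<in> fst Y" "j \<in> fst X" for i j
    using hmg_split[of "ent q i j" "snd Y i + p + 2 - snd X j"] ghomD[OF q, of i j] pos[OF that]
    by (simp add: up_def algebra_simps)
  then obtain m r where mr: "\<And>i j. i \<in> fst Y \<Longrightarrow> j \<in> fst X \<Longrightarrow> m i j \<in> hmg cdeg WW (snd Y i + p - snd X j) \<and>
      r i j \<in> hmg cdeg WW (snd Y i + p + 1 - snd X j) \<and> ent q i j = tt ^ 2 * m i j + uu * r i j" by metis
  define M where "M = CMat (\<lambda>i j. if i \<in> fst Y \<and> j \<in> fst X then m i j else 0)"
  define R where "R = CMat (\<lambda>i j. if i \<in> fst Y \<and> j \<in> fst X then r i j else 0)"
  have M: "ent M i j = (if i \<in> fst Y \<and> j \<in> fst X then m i j else 0)" for i j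
    unfolding M_def by (rule ent_CMat_within[where S = "\<lambda>_. fst Y"]) (auto simp: fin split: if_splits)
  have R: "ent R i j = (if i \<in> fst Y \<and> j \<in> fst X then r i j else 0)" for i j
    unfolding R_def by (rule ent_CMat_within[where S = "\<lambda>_. fst Y"]) (auto simp: fin split: if_splits)
  show ?thesis
  proof (intro exI conjI)
    show "M \<in> u.gh X (up p Y)" by (rule ghomI) (use mr in \<open>auto simp: M up_def split: if_splits\<close>)
    show "R \<in> u.gh X (up (p + 1) Y)" by (rule ghomI) (use mr in \<open>auto simp: R up_def add_ac split: if_splits\<close>)
    show "q = scal (tt ^ 2) * M + scal uu * R"
    proof (rule cmat_eqI)
      fix i j
      show "ent q i j = ent (scal (tt ^ 2) * M + scal uu * R) i j"
        using mr ghomD1[OF q, of i j] ghomD2[OF q, of i j] by (cases "ent q i j = 0") (auto simp: M R up_def)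
    qed
  qed
qed

lemma u_div:
  assumes a: "a \<in> hmg cdeg WW e" and eq: "tt ^ 2 * a = uu * x"
  shows "\<exists>a'\<in>hmg cdeg WW (e - 1). a = uu * a'"
proof -
  have "look m 0 \<ge> 1" if "m \<in> supp a" for m
  proof -
    have "tt ^ 2 * a = mono_op (\<lambda>m. m + mon (N + 1) 2) (\<lambda>_. 1) a"
      by (induction a rule: mpoly_induct) (auto simp: mono_op_add var_power mult_single ring_distribs add.commute)
    then have "look (tt ^ 2 * a) (m + mon (N + 1) 2) = look a m"
      using lookup_mono_op[of a UNIV "\<lambda>m. m + mon (N + 1) 2" m] by (simp add: span_of_def inj_on_def)
    then have "m + mon (N + 1) 2 \<in> supp (uu * x)" using that by (simp add: in_keys_iff eq)
    moreover have "uu * x \<in> span_of {m. look m 0 \<ge> 1}"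
    proof (rule span_of_mult)
      show "uu \<in> span_of {m. look m 0 \<ge> 1}" unfolding var_def by (rule span_of_mon) simp
      show "x \<in> span_of UNIV" by (simp add: span_of_def)
    qed (simp add: lookup_add)
    ultimately have "look (m + mon (N + 1) 2) 0 \<ge> 1" by (auto simp: span_of_def)
    then show ?thesis by (simp add: lookup_add lookup_single)
  qed
  then have "a \<in> span_of (hmons cdeg WW e \<inter> {m. look m 0 \<ge> 1})" using a by (auto simp: hmg_def span_of_def)
  then show ?thesis
  proof (induction rule: span_of_induct)
    case zero
    show ?case by (intro bexI[of _ 0]) auto
  next
    case (mon m c)
    define n where "n = m - mon 0 1"
    have mn: "m = mon 0 1 + n"
      using mon by (intro lookup_eqI) (auto simp: n_def lookup_add lookup_minus lookup_single lookup_one when_def)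
    have "mon n c \<in> hmg cdeg WW (e - 1)"
      using mon unfolding hmg_def by (intro span_of_mon) (auto simp: hmons_def mn keys_add_nat mdeg_add mdeg_one cdeg_def)
    moreover have "mon m c = uu * mon n c" by (simp add: mn var_def mult_single)
    ultimately show ?case by blast
  next
    case (add p q)
    then show ?case by (metis distrib_left hmg_add)
  qed
qed

lemma u_nz: "uu \<noteq> 0"
proof -
  have "look uu (mon 0 1) = 1" by (simp add: var_def)
  then show ?thesis by auto
qed

lemma gh_u_div:
  assumes a: "a \<in> u.gh X (up p Y)" and eq: "scal (tt ^ 2) * a = scal uu * x"
  shows "\<exists>a'\<in>u.gh X (up (p - 1) Y). a = scal uu * a'"
proof -
  have "\<exists>b\<in>hmg cdeg WW (snd Y i + (p - 1) - snd X j). ent a i j = uu * b" for i j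
    using u_div[of "ent a i j" "snd Y i + p - snd X j" "ent x i j"] ghomD[OF a, of i j] arg_cong[OF eq, of "\<lambda>a. ent a i j"]
    by (simp add: up_def algebra_simps)
  then obtain b where b: "\<And>i j. b i j \<in> hmg cdeg WW (snd Y i + (p - 1) - snd X j) \<and> ent a i j = uu * b i j" by metis
  define B where "B = CMat (\<lambda>i j. if ent a i j = 0 then 0 else b i j)"
  have B: "ent B i j = (if ent a i j = 0 then 0 else b i j)" for i j
    unfolding B_def by (rule ent_CMat_within[where S = "\<lambda>j. {i. ent a i j \<noteq> 0}"]) (auto simp: finite_col)
  have "B \<in> u.gh X (up (p - 1) Y)"
  proof (rule ghomI)
    fix i j assume "ent B i j \<noteq> 0"
    then have "ent a i j \<noteq> 0" by (auto simp: B)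
    then show "i \<in> fst (up (p - 1) Y) \<and> j \<in> fst X \<and> ent B i j \<in> hmg cdeg WW (snd (up (p - 1) Y) i - snd X j)"
      using ghomD1[OF a, of i j] ghomD2[OF a, of i j] b by (auto simp: B up_def)
  qed
  moreover have "a = scal uu * B" by (rule cmat_eqI) (use b in \<open>auto simp: B\<close>)
  ultimately show ?thesis by blast
qed

definition small :: "gmod \<Rightarrow> bool" where
  "small X \<longleftrightarrow> finite (fst X) \<and> (\<forall>i\<in>fst X. snd X i \<in> {0, 1})"

text \<open>
  A map of degree \<open>p \<ge> 1\<close> whose boundary is divisible by \<open>u\<close> is, modulo \<open>u\<close>, itself a boundary: on \<open>u = 0\<close>
  the derivative of the factorization with respect to \<open>y\<close> is a contraction up to the factor
  \<open>\<partial>F/\<partial>y = t\<^sup>2\<close>, and this factor can be cancelled, because every monomial of degree at least \<open>2\<close> is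
  divisible by \<open>u\<close> or by \<open>t\<^sup>2\<close>.
\<close>

lemma descend_half:
  fixes X0 X1 Y0 Y1 :: gmod
  assumes E: "u.gmf X0 X1 \<phi> \<psi>" and E': "u.gmf Y0 Y1 \<phi>' \<psi>'"
    and sm: "small X0" "small X1" "small Y0" "small Y1" and p: "p \<ge> 1"
    and k: "k0 \<in> u.gh X0 (up p Y0)" "k1 \<in> u.gh X1 (up p Y1)"
    and c: "\<phi>' * k0 - k1 * \<phi> = scal uu * c1" "\<psi>' * k1 - k0 * \<psi> = scal uu * c0"
  shows "\<exists>m0 m1 l0 l1. m0 \<in> u.gh X0 (up p Y1) \<and> m1 \<in> u.gh X1 (up p Y0) \<and>
    l0 \<in> u.gh X0 (up (p - 1) Y0) \<and> l1 \<in> u.gh X1 (up (p - 1) Y1) \<and>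
    k0 = \<psi>' * m0 + m1 * \<phi> + scal uu * l0 \<and> k1 = \<phi>' * m1 + m0 * \<psi> + scal uu * l1"
proof -
  have e: "\<phi> \<in> u.gh X0 X1" "\<psi> \<in> u.gh X1 X0" using E by (auto simp: u.gmf_def)
  have e': "\<phi>' \<in> u.gh Y0 Y1" "\<psi>' \<in> u.gh Y1 Y0" "\<psi>' * \<phi>' = scal FF * cproj (fst Y0)" "\<phi>' * \<psi>' = scal FF * cproj (fst Y1)"
    using E' by (auto simp: u.gmf_def)
  have eu: "\<phi>' \<in> u.gh (up p Y0) (up p Y1)" "\<psi>' \<in> u.gh (up p Y1) (up p Y0)" using e' by (simp_all add: up_gh)
  define q0 q1 where "q0 = Dy \<phi>' * k0" and "q1 = Dy \<psi>' * k1"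
  have "Dy \<phi>' \<in> u.gh (up p Y0) (up (p + 2) Y1)" "Dy \<psi>' \<in> u.gh (up p Y1) (up (p + 2) Y0)"
    using Dy_gh[OF e'(1)] Dy_gh[OF e'(2)] up_gh[of _ p _ "up 2 _"] by (auto simp: up_up)
  then have q: "q0 \<in> u.gh X0 (up (p + 2) Y1)" "q1 \<in> u.gh X1 (up (p + 2) Y0)"
    unfolding q0_def q1_def using k ghom_comp by blast+
  have pos: "snd Y i - snd X j + p \<ge> 0" if "small X" "small Y" "i \<in> fst Y" "j \<in> fst X" for X Y i j
    using that p by (fastforce simp: small_def)
  obtain m0 r0 where m0: "m0 \<in> u.gh X0 (up p Y1)" "q0 = scal (tt ^ 2) * m0 + scal uu * r0"
    using gh_split[OF q(1)] sm pos[OF sm(1,4)] by (auto simp: small_def)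
  obtain m1 r1 where m1: "m1 \<in> u.gh X1 (up p Y0)" "q1 = scal (tt ^ 2) * m1 + scal uu * r1"
    using gh_split[OF q(2)] sm pos[OF sm(2,3)] by (auto simp: small_def)
  obtain g where g: "dy FF = tt ^ 2 + uu * g" using dy_FF by blast
  have DF: "Dy (scal FF * cproj I) = scal (dy FF) * cproj I" for I
    by (rule cmat_eqI) (auto simp: ent_cmap)
  have D0: "Dy \<psi>' * \<phi>' + \<psi>' * Dy \<phi>' = scal (dy FF) * cproj (fst Y0)" "Dy \<phi>' * \<psi>' + \<phi>' * Dy \<psi>' = scal (dy FF) * cproj (fst Y1)"
    by (simp_all flip: Dy_mult add: e' DF)
  have idk: "cproj (fst Y0) * k0 = k0" "cproj (fst Y1) * k1 = k1"
    using ghom_idL[OF k(1)] ghom_idL[OF k(2)] by (simp_all add: up_def)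
  \<comment> \<open>modulo \<open>u\<close>, both equations say that \<open>t\<^sup>2 k\<close> is the boundary of \<open>q = t\<^sup>2 m\<close>\<close>
  have "\<psi>' * q0 + q1 * \<phi> = (Dy \<psi>' * \<phi>' + \<psi>' * Dy \<phi>') * k0 - Dy \<psi>' * (\<phi>' * k0 - k1 * \<phi>)"
    by (simp add: q0_def q1_def ring_distribs right_diff_distrib mult.assoc)
  also have "\<dots> = scal (dy FF) * k0 - scal uu * (Dy \<psi>' * c1)"
    by (simp add: D0 c idk mult.assoc scal_comm2[of "Dy \<psi>'"])
  finally have b0: "\<psi>' * q0 + q1 * \<phi> = scal (tt ^ 2) * k0 + scal uu * (scal g * k0 - Dy \<psi>' * c1)"
    by (simp add: g scal_add scal_mult ring_distribs right_diff_distrib mult.assoc)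
  have "\<phi>' * q1 + q0 * \<psi> = (Dy \<phi>' * \<psi>' + \<phi>' * Dy \<psi>') * k1 - Dy \<phi>' * (\<psi>' * k1 - k0 * \<psi>)"
    by (simp add: q0_def q1_def ring_distribs right_diff_distrib mult.assoc)
  also have "\<dots> = scal (dy FF) * k1 - scal uu * (Dy \<phi>' * c0)"
    by (simp add: D0 c idk mult.assoc scal_comm2[of "Dy \<phi>'"])
  finally have b1: "\<phi>' * q1 + q0 * \<psi> = scal (tt ^ 2) * k1 + scal uu * (scal g * k1 - Dy \<phi>' * c0)"
    by (simp add: g scal_add scal_mult ring_distribs right_diff_distrib mult.assoc)
  define a0 a1 where "a0 = k0 - (\<psi>' * m0 + m1 * \<phi>)" and "a1 = k1 - (\<phi>' * m1 + m0 * \<psi>)"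
  have a: "a0 \<in> u.gh X0 (up p Y0)" "a1 \<in> u.gh X1 (up p Y1)"
    unfolding a0_def a1_def by (intro ghom_diff ghom_add k ghom_comp[OF eu(2) m0(1)] ghom_comp[OF m1(1) e(1)]
        ghom_comp[OF eu(1) m1(1)] ghom_comp[OF m0(1) e(2)])+
  have x0: "scal (tt ^ 2) * a0 = scal uu * (\<psi>' * r0 + r1 * \<phi> - (scal g * k0 - Dy \<psi>' * c1))"
  proof -
    have "scal (tt ^ 2) * (\<psi>' * m0 + m1 * \<phi>) + scal uu * (\<psi>' * r0 + r1 * \<phi>) = \<psi>' * q0 + q1 * \<phi>"
      unfolding m0(2) m1(2) by (simp add: ring_distribs mult.assoc scal_comm2[of \<psi>'])
    then show ?thesis unfolding b0 a0_def by (simp add: right_diff_distrib algebra_simps)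
  qed
  have x1: "scal (tt ^ 2) * a1 = scal uu * (\<phi>' * r1 + r0 * \<psi> - (scal g * k1 - Dy \<phi>' * c0))"
  proof -
    have "scal (tt ^ 2) * (\<phi>' * m1 + m0 * \<psi>) + scal uu * (\<phi>' * r1 + r0 * \<psi>) = \<phi>' * q1 + q0 * \<psi>"
      unfolding m0(2) m1(2) by (simp add: ring_distribs mult.assoc scal_comm2[of \<phi>'])
    then show ?thesis unfolding b1 a1_def by (simp add: right_diff_distrib algebra_simps)
  qed
  obtain l0 where l0: "l0 \<in> u.gh X0 (up (p - 1) Y0)" "a0 = scal uu * l0" using gh_u_div[OF a(1) x0] by blast
  obtain l1 where l1: "l1 \<in> u.gh X1 (up (p - 1) Y1)" "a1 = scal uu * l1" using gh_u_div[OF a(2) x1] by blast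
  have "k0 = \<psi>' * m0 + m1 * \<phi> + scal uu * l0" "k1 = \<phi>' * m1 + m0 * \<psi> + scal uu * l1"
    using l0(2) l1(2) by (simp_all add: a0_def a1_def algebra_simps)
  then show ?thesis using m0(1) m1(1) l0(1) l1(1) by blast
qed

lemma DD_u: "u.DD (scal uu) = 1"
proof -
  have "del_u uu = 1" by (simp add: del_u_def var_def single_1)
  then show ?thesis by simp
qed

text \<open>The finitely many entries of a matrix have homogeneous lifts in a common degree.\<close>

lemma homogenize:
  assumes a: "a \<in> u.vhom (fst X) (fst Y)" and fin: "finite (fst X)" "finite (fst Y)"
  shows "\<exists>p0::nat. \<forall>p\<ge>p0. \<exists>b\<in>u.gh X (up (int p) Y). u.DD b = a"
proof -
  have "\<exists>n0::nat. \<forall>n\<ge>n0. \<exists>q\<in>hmg cdeg WW (snd Y i - snd X j + int n * 1). del_u q = ent a i j" for i j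
    by (rule del_u_surj) (use a in \<open>auto simp: u.vhom_def\<close>)
  then obtain n0 where n0: "\<And>i j n. n \<ge> n0 i j \<Longrightarrow> \<exists>q\<in>hmg cdeg WW (snd Y i - snd X j + int n). del_u q = ent a i j"
    by (metis mult.right_neutral)
  define p0 where "p0 = Max (insert 0 (case_prod n0 ` (fst Y \<times> fst X)))"
  have "\<exists>b\<in>u.gh X (up (int p) Y). u.DD b = a" if p: "p \<ge> p0" for p
  proof -
    have "\<exists>q\<in>hmg cdeg WW (snd Y i - snd X j + int p). del_u q = ent a i j" if "i \<in> fst Y" "j \<in> fst X" for i j
    proof (rule n0)
      have "n0 i j \<le> p0" unfolding p0_def using that fin by (intro Max_ge) auto
      then show "n0 i j \<le> p" using p by simp
    qed
    then have "\<forall>i\<in>fst Y. \<forall>j\<in>fst X. ent a i j \<in> fil (snd Y i + int p - snd X j)"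
      using fil_u by (metis add_diff_eq add.commute diff_add_eq)
    then have "a \<in> fhom X (up (int p) Y)"
      by (intro fhomI) (use a in \<open>auto simp: up_def u.vhom_def\<close>)
    then show ?thesis by (rule fhom_lift)
  qed
  then show ?thesis by blast
qed

text \<open>
  A map in the chart lifts to a closed map of some degree \<open>p \<ge> 0\<close>. As long as \<open>p > 0\<close>, it is \<open>u\<close> times a closed
  map of degree \<open>p - 1\<close> up to homotopy, and \<open>u\<close> becomes \<open>1\<close> in the chart.
\<close>

theorem chart_full:
  fixes X0 X1 Y0 Y1 :: gmod
  assumes E: "u.gmf X0 X1 \<phi> \<psi>" and E': "u.gmf Y0 Y1 \<phi>' \<psi>'"
    and sm: "small X0" "small X1" "small Y0" "small Y1"
    and a: "a \<in> u.tmaps (u.demf X0 X1 \<phi> \<psi>) (u.demf Y0 Y1 \<phi>' \<psi>')"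
  shows "\<exists>b0 b1. b0 \<in> u.gh X0 Y0 \<and> b1 \<in> u.gh X1 Y1 \<and> b1 * \<phi> = \<phi>' * b0 \<and> b0 * \<psi> = \<psi>' * b1 \<and>
    u.thtp (u.demf X0 X1 \<phi> \<psi>) (u.demf Y0 Y1 \<phi>' \<psi>') a (u.DD b0, u.DD b1)"
proof -
  let ?E = "u.demf X0 X1 \<phi> \<psi>" and ?E' = "u.demf Y0 Y1 \<phi>' \<psi>'"
  have e: "\<phi> \<in> u.gh X0 X1" "\<psi> \<in> u.gh X1 X0" "\<psi> * \<phi> = scal FF * cproj (fst X0)" "\<phi> * \<psi> = scal FF * cproj (fst X1)"
    using E by (auto simp: u.gmf_def)
  have e': "\<phi>' \<in> u.gh Y0 Y1" "\<psi>' \<in> u.gh Y1 Y0" "\<psi>' * \<phi>' = scal FF * cproj (fst Y0)" "\<phi>' * \<psi>' = scal FF * cproj (fst Y1)"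
    using E' by (auto simp: u.gmf_def)
  have up0: "up 0 Z = Z" for Z by (simp add: up_def)
  have "\<exists>b0 b1. b0 \<in> u.gh X0 Y0 \<and> b1 \<in> u.gh X1 Y1 \<and> b1 * \<phi> = \<phi>' * b0 \<and> b0 * \<psi> = \<psi>' * b1 \<and>
    u.thtp ?E ?E' (u.DD k0, u.DD k1) (u.DD b0, u.DD b1)"
    if "k0 \<in> u.gh X0 (up (int p) Y0)" "k1 \<in> u.gh X1 (up (int p) Y1)" "k1 * \<phi> = \<phi>' * k0" "k0 * \<psi> = \<psi>' * k1" for p k0 k1
    using that
  proof (induction p arbitrary: k0 k1)
    case 0
    then show ?case using u.thtp_refl by (intro exI[of _ k0] exI[of _ k1]) (simp add: up0)
  next
    case (Suc p k0 k1)
    obtain m0 m1 l0 l1 where m: "m0 \<in> u.gh X0 (up (int (Suc p)) Y1)" "m1 \<in> u.gh X1 (up (int (Suc p)) Y0)"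
      and l: "l0 \<in> u.gh X0 (up (int p) Y0)" "l1 \<in> u.gh X1 (up (int p) Y1)"
      and eq: "k0 = \<psi>' * m0 + m1 * \<phi> + scal uu * l0" "k1 = \<phi>' * m1 + m0 * \<psi> + scal uu * l1"
      using descend_half[OF E E' sm _ Suc.prems(1,2), of 0 0] Suc.prems(3,4) by auto
    have idm: "cproj (fst Y1) * m0 = m0" "cproj (fst Y0) * m1 = m1" "m0 * cproj (fst X0) = m0" "m1 * cproj (fst X1) = m1"
      using ghom_idL[OF m(1)] ghom_idL[OF m(2)] ghom_idR[OF m(1)] ghom_idR[OF m(2)] by (simp_all add: up_def)
    note r = assoc_rule[OF e(3)] assoc_rule[OF e(4)] assoc_rule[OF e'(3)] assoc_rule[OF e'(4)] e(3,4) e'(3,4) idm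
      mult.assoc ring_distribs scal_comm2[of m0] scal_comm2[of m1] scal_comm2[of \<phi>'] scal_comm2[of \<psi>']
    have "scal uu * (l1 * \<phi>) = scal uu * (\<phi>' * l0)" "scal uu * (l0 * \<psi>) = scal uu * (\<psi>' * l1)"
      using Suc.prems(3,4) unfolding eq by (simp_all add: r)
    then have cl: "l1 * \<phi> = \<phi>' * l0" "l0 * \<psi> = \<psi>' * l1" using scal_cancel u_nz by blast+
    have m': "u.DD m0 \<in> u.vhom (fst X0) (fst Y1)" "u.DD m1 \<in> u.vhom (fst X1) (fst Y0)"
      using u.thom_vhom[OF u.hom_de[OF m(1)]] u.thom_vhom[OF u.hom_de[OF m(2)]] by (simp_all add: up_def)
    have "u.thtp ?E ?E' (u.DD k0, u.DD k1) (u.DD l0, u.DD l1)"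
      unfolding u.thtp_def
    proof (intro bexI conjI)
      show "fst (u.DD k0, u.DD k1) = fst (u.DD l0, u.DD l1) + (psi ?E' * u.DD m0 + u.DD m1 * phi ?E)"
        by (simp add: eq u.del.cmap_add u.del.cmap_mult DD_u add_ac del: u.del.cmap_consts(7))
      show "snd (u.DD k0, u.DD k1) = snd (u.DD l0, u.DD l1) + (phi ?E' * u.DD m1 + u.DD m0 * psi ?E)"
        by (simp add: eq u.del.cmap_add u.del.cmap_mult DD_u add_ac del: u.del.cmap_consts(7))
    qed (use m' in \<open>simp_all add: u_thom\<close>)
    then show ?case using Suc.IH[OF l cl] u.thtp_trans by blast
  qed note main = this
  obtain a0 a1 where a': "a = (a0, a1)" "a0 \<in> u.vhom (fst X0) (fst Y0)" "a1 \<in> u.vhom (fst X1) (fst Y1)"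
    "a1 * u.DD \<phi> = u.DD \<phi>' * a0" "a0 * u.DD \<psi> = u.DD \<psi>' * a1"
    using a by (auto simp: u.tmaps_def u_thom)
  have fin: "finite (fst X0)" "finite (fst X1)" "finite (fst Y0)" "finite (fst Y1)" using sm by (auto simp: small_def)
  obtain p0 p1 where p01: "\<And>p. p \<ge> p0 \<Longrightarrow> \<exists>b\<in>u.gh X0 (up (int p) Y0). u.DD b = a0"
    "\<And>p. p \<ge> p1 \<Longrightarrow> \<exists>b\<in>u.gh X1 (up (int p) Y1). u.DD b = a1"
    using homogenize[OF a'(2) fin(1,3)] homogenize[OF a'(3) fin(2,4)] by blast
  define p where "p = max p0 p1"
  obtain k0 where k0: "k0 \<in> u.gh X0 (up (int p) Y0)" "u.DD k0 = a0" using p01(1)[of p] by (auto simp: p_def)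
  obtain k1 where k1: "k1 \<in> u.gh X1 (up (int p) Y1)" "u.DD k1 = a1" using p01(2)[of p] by (auto simp: p_def)
  have eu: "\<phi>' \<in> u.gh (up (int p) Y0) (up (int p) Y1)" "\<psi>' \<in> u.gh (up (int p) Y1) (up (int p) Y0)"
    using e' by (simp_all add: up_gh)
  have "k1 * \<phi> = \<phi>' * k0"
    by (rule u.hom_inj_eq[OF ghom_comp[OF k1(1) e(1)] ghom_comp[OF eu(1) k0(1)]]) (simp add: u.del.cmap_mult k0 k1 a')
  moreover have "k0 * \<psi> = \<psi>' * k1"
    by (rule u.hom_inj_eq[OF ghom_comp[OF k0(1) e(2)] ghom_comp[OF eu(2) k1(1)]]) (simp add: u.del.cmap_mult k0 k1 a')
  ultimately show ?thesis using main[OF k0(1) k1(1)] unfolding a'(1) k0(2) k1(2) by blast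
qed

text \<open>
  A null homotopy in the chart becomes one of \<open>u\<^sup>p b\<close> in the graded ring, and the same descent removes the factors
  \<open>u\<close> one by one.
\<close>

theorem chart_faithful:
  fixes X0 X1 Y0 Y1 :: gmod
  assumes E: "u.gmf X0 X1 \<phi> \<psi>" and E': "u.gmf Y0 Y1 \<phi>' \<psi>'"
    and sm: "small X0" "small X1" "small Y0" "small Y1"
    and b: "b0 \<in> u.gh X0 Y0" "b1 \<in> u.gh X1 Y1"
    and h: "u.thtp (u.demf X0 X1 \<phi> \<psi>) (u.demf Y0 Y1 \<phi>' \<psi>') (u.DD b0, u.DD b1) (0, 0)"
  shows "\<exists>k0 k1. k0 \<in> u.gh X0 Y1 \<and> k1 \<in> u.gh X1 Y0 \<and> b0 = \<psi>' * k0 + k1 * \<phi> \<and> b1 = \<phi>' * k1 + k0 * \<psi>"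
proof -
  have e: "\<phi> \<in> u.gh X0 X1" "\<psi> \<in> u.gh X1 X0" "\<psi> * \<phi> = scal FF * cproj (fst X0)" "\<phi> * \<psi> = scal FF * cproj (fst X1)"
    using E by (auto simp: u.gmf_def)
  have e': "\<phi>' \<in> u.gh Y0 Y1" "\<psi>' \<in> u.gh Y1 Y0" "\<psi>' * \<phi>' = scal FF * cproj (fst Y0)" "\<phi>' * \<psi>' = scal FF * cproj (fst Y1)"
    using E' by (auto simp: u.gmf_def)
  have up0: "up 0 Z = Z" for Z by (simp add: up_def)
  have main: "\<exists>k0 k1. k0 \<in> u.gh X0 Y1 \<and> k1 \<in> u.gh X1 Y0 \<and> b0 = \<psi>' * k0 + k1 * \<phi> \<and> b1 = \<phi>' * k1 + k0 * \<psi>"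
    if "h0 \<in> u.gh X0 (up (int p) Y1)" "h1 \<in> u.gh X1 (up (int p) Y0)"
      "scal (uu ^ p) * b0 = \<psi>' * h0 + h1 * \<phi>" "scal (uu ^ p) * b1 = \<phi>' * h1 + h0 * \<psi>" for p h0 h1
    using that
  proof (induction p arbitrary: h0 h1)
    case 0
    then show ?case by (auto simp: up0)
  next
    case (Suc p h0 h1)
    have div: "\<psi>' * h0 - - h1 * \<phi> = scal uu * (scal (uu ^ p) * b0)" "\<phi>' * - h1 - h0 * \<psi> = scal uu * (- scal (uu ^ p) * b1)"
      using Suc.prems(3,4) by (simp_all add: scal_mult mult.assoc)
    obtain m0 m1 l0 l1 where m: "m0 \<in> u.gh X0 (up (int (Suc p)) Y0)" "m1 \<in> u.gh X1 (up (int (Suc p)) Y1)"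
      and l: "l0 \<in> u.gh X0 (up (int p) Y1)" "l1 \<in> u.gh X1 (up (int p) Y0)"
      and eq: "h0 = \<phi>' * m0 + m1 * \<phi> + scal uu * l0" "- h1 = \<psi>' * m1 + m0 * \<psi> + scal uu * l1"
      using descend_half[OF E u.gmf_sh[OF E'] sm(1,2,4,3) _ Suc.prems(1), of "- h1", OF _ _ div] Suc.prems(2) by auto
    have h1: "h1 = - (\<psi>' * m1 + m0 * \<psi> + scal uu * l1)" using eq(2) by (metis minus_minus)
    have idm: "cproj (fst Y0) * m0 = m0" "cproj (fst Y1) * m1 = m1" "m0 * cproj (fst X0) = m0" "m1 * cproj (fst X1) = m1"
      using ghom_idL[OF m(1)] ghom_idL[OF m(2)] ghom_idR[OF m(1)] ghom_idR[OF m(2)] by (simp_all add: up_def)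
    note r = assoc_rule[OF e(3)] assoc_rule[OF e(4)] assoc_rule[OF e'(3)] assoc_rule[OF e'(4)] e(3,4) e'(3,4) idm
      mult.assoc ring_distribs right_diff_distrib left_diff_distrib
      scal_comm2[of m0] scal_comm2[of m1] scal_comm2[of \<phi>'] scal_comm2[of \<psi>']
    have "scal uu * (scal (uu ^ p) * b0) = scal uu * (\<psi>' * l0 + - l1 * \<phi>)"
      "scal uu * (scal (uu ^ p) * b1) = scal uu * (\<phi>' * - l1 + l0 * \<psi>)"
      using Suc.prems(3,4) unfolding eq(1) h1 by (simp_all add: r scal_mult)
    then have "scal (uu ^ p) * b0 = \<psi>' * l0 + - l1 * \<phi>" "scal (uu ^ p) * b1 = \<phi>' * - l1 + l0 * \<psi>"
      using scal_cancel u_nz by blast+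
    then show ?case using Suc.IH[OF l(1), of "- l1"] l(2) by simp
  qed
  obtain g0 g1 where g: "g0 \<in> u.vhom (fst X0) (fst Y1)" "g1 \<in> u.vhom (fst X1) (fst Y0)"
    "u.DD b0 = u.DD \<psi>' * g0 + g1 * u.DD \<phi>" "u.DD b1 = u.DD \<phi>' * g1 + g0 * u.DD \<psi>"
    using h by (auto simp: u.thtp_def u_thom)
  have fin: "finite (fst X0)" "finite (fst X1)" "finite (fst Y0)" "finite (fst Y1)" using sm by (auto simp: small_def)
  obtain p0 p1 where p01: "\<And>p. p \<ge> p0 \<Longrightarrow> \<exists>b\<in>u.gh X0 (up (int p) Y1). u.DD b = g0"
    "\<And>p. p \<ge> p1 \<Longrightarrow> \<exists>b\<in>u.gh X1 (up (int p) Y0). u.DD b = g1"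
    using homogenize[OF g(1) fin(1,4)] homogenize[OF g(2) fin(2,3)] by blast
  define p where "p = max p0 p1"
  obtain h0 where h0: "h0 \<in> u.gh X0 (up (int p) Y1)" "u.DD h0 = g0" using p01(1)[of p] by (auto simp: p_def)
  obtain h1 where h1: "h1 \<in> u.gh X1 (up (int p) Y0)" "u.DD h1 = g1" using p01(2)[of p] by (auto simp: p_def)
  have eu: "\<phi>' \<in> u.gh (up (int p) Y0) (up (int p) Y1)" "\<psi>' \<in> u.gh (up (int p) Y1) (up (int p) Y0)"
    using e' by (simp_all add: up_gh)
  have DDp: "u.DD (scal (uu ^ p)) = 1" by (induction p) (simp_all add: scal_mult u.del.cmap_mult DD_u del: u.del.cmap_consts(7))
  have sb: "scal (uu ^ p) * b \<in> u.gh Z (up (int p) Z')" if b: "b \<in> u.gh Z Z'" for b Z Z'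
  proof (rule ghomI)
    fix i j assume nz: "ent (scal (uu ^ p) * b) i j \<noteq> 0"
    then have nz': "ent b i j \<noteq> 0" by auto
    have "uu ^ p * ent b i j \<in> hmg cdeg WW (int p + (snd Z' i - snd Z j))"
      by (rule hmg_mult[OF hmg_var_power ghomD[OF b]]) (auto simp: cdeg_def)
    then show "i \<in> fst (up (int p) Z') \<and> j \<in> fst Z \<and> ent (scal (uu ^ p) * b) i j \<in> hmg cdeg WW (snd (up (int p) Z') i - snd Z j)"
      using ghomD1[OF b nz'] ghomD2[OF b nz'] by (simp add: up_def algebra_simps)
  qed
  have "scal (uu ^ p) * b0 = \<psi>' * h0 + h1 * \<phi>"
    by (rule u.hom_inj_eq[OF sb[OF b(1)] ghom_add[OF ghom_comp[OF eu(2) h0(1)] ghom_comp[OF h1(1) e(1)]]])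
       (simp add: u.del.cmap_mult u.del.cmap_add DDp h0 h1 g del: u.del.cmap_consts(7))
  moreover have "scal (uu ^ p) * b1 = \<phi>' * h1 + h0 * \<psi>"
    by (rule u.hom_inj_eq[OF sb[OF b(2)] ghom_add[OF ghom_comp[OF eu(1) h1(1)] ghom_comp[OF h0(1) e(2)]]])
       (simp add: u.del.cmap_mult u.del.cmap_add DDp h0 h1 g del: u.del.cmap_consts(7))
  ultimately show ?thesis using main[OF h0(1) h1(1)] by blast
qed

end

section \<open>Equivalences from spans\<close>

locale category =
  fixes C :: "('o, 'm) cat"
  assumes cat: "is_category C"
begin

lemma cmp_in: "X \<in> Obj C \<Longrightarrow> Y \<in> Obj C \<Longrightarrow> Z \<in> Obj C \<Longrightarrow> u \<in> Hom C X Y \<Longrightarrow> v \<in> Hom C Y Z \<Longrightarrow> Cmp C X Y Z v u \<in> Hom C X Z"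
  using cat unfolding is_category_def by blast

lemma ide_right: "X \<in> Obj C \<Longrightarrow> Y \<in> Obj C \<Longrightarrow> u \<in> Hom C X Y \<Longrightarrow> Cmp C X X Y u (Ide C X) = u"
  using cat unfolding is_category_def by blast

lemma ide_left: "X \<in> Obj C \<Longrightarrow> Y \<in> Obj C \<Longrightarrow> u \<in> Hom C X Y \<Longrightarrow> Cmp C X Y Y (Ide C Y) u = u"
  using cat unfolding is_category_def by blast

lemma assoc: "W \<in> Obj C \<Longrightarrow> X \<in> Obj C \<Longrightarrow> Y \<in> Obj C \<Longrightarrow> Z \<in> Obj C \<Longrightarrow> u \<in> Hom C W X \<Longrightarrow> v \<in> Hom C X Y \<Longrightarrow> w \<in> Hom C Y Z \<Longrightarrow>
    Cmp C W X Z (Cmp C X Y Z w v) u = Cmp C W Y Z w (Cmp C W X Y v u)"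
  using cat unfolding is_category_def by metis

lemma cancel:
  assumes "W \<in> Obj C" "X \<in> Obj C" "Y \<in> Obj C" "u \<in> Hom C W X" "i \<in> Hom C X Y" "j \<in> Hom C Y X"
    "Cmp C X Y X j i = Ide C X"
  shows "Cmp C W Y X j (Cmp C W X Y i u) = u"
  using assoc[of W X Y X u i j] assms ide_left by simp

end

text \<open>
  Two categories are compared by means of common objects \<open>Z\<close> and common representatives \<open>A x y\<close> of morphisms. In both
  categories every object is isomorphic to one from \<open>Z\<close>, every morphism has a representative, and the same
  representatives become equal; composition is defined on representatives.
\<close>

locale span =
  C: category C + D: category D for C :: "('o, 'm) cat" and D :: "('p, 'n) cat" +
  fixes Z :: "'z set" and A :: "'z \<Rightarrow> 'z \<Rightarrow> 'a set" and i :: "'z \<Rightarrow> 'a" and m :: "'z \<Rightarrow> 'z \<Rightarrow> 'z \<Rightarrow> 'a \<Rightarrow> 'a \<Rightarrow> 'a"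
    and F :: "'z \<Rightarrow> 'o" and cF :: "'z \<Rightarrow> 'z \<Rightarrow> 'a \<Rightarrow> 'm" and F' :: "'z \<Rightarrow> 'p" and cF' :: "'z \<Rightarrow> 'z \<Rightarrow> 'a \<Rightarrow> 'n"
  assumes F: "z \<in> Z \<Longrightarrow> F z \<in> Obj C" and F': "z \<in> Z \<Longrightarrow> F' z \<in> Obj D"
    and onto: "x \<in> Z \<Longrightarrow> y \<in> Z \<Longrightarrow> cF x y ` A x y = Hom C (F x) (F y)"
    and onto': "x \<in> Z \<Longrightarrow> y \<in> Z \<Longrightarrow> cF' x y ` A x y = Hom D (F' x) (F' y)"
    and eq: "x \<in> Z \<Longrightarrow> y \<in> Z \<Longrightarrow> a \<in> A x y \<Longrightarrow> b \<in> A x y \<Longrightarrow> cF x y a = cF x y b \<longleftrightarrow> cF' x y a = cF' x y b"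
    and ident: "z \<in> Z \<Longrightarrow> i z \<in> A z z" "z \<in> Z \<Longrightarrow> cF z z (i z) = Ide C (F z)" "z \<in> Z \<Longrightarrow> cF' z z (i z) = Ide D (F' z)"
    and comp: "x \<in> Z \<Longrightarrow> y \<in> Z \<Longrightarrow> z \<in> Z \<Longrightarrow> a \<in> A x y \<Longrightarrow> b \<in> A y z \<Longrightarrow> m x y z b a \<in> A x z"
      "x \<in> Z \<Longrightarrow> y \<in> Z \<Longrightarrow> z \<in> Z \<Longrightarrow> a \<in> A x y \<Longrightarrow> b \<in> A y z \<Longrightarrow> cF x z (m x y z b a) = Cmp C (F x) (F y) (F z) (cF y z b) (cF x y a)"
      "x \<in> Z \<Longrightarrow> y \<in> Z \<Longrightarrow> z \<in> Z \<Longrightarrow> a \<in> A x y \<Longrightarrow> b \<in> A y z \<Longrightarrow> cF' x z (m x y z b a) = Cmp D (F' x) (F' y) (F' z) (cF' y z b) (cF' x y a)"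
    and ess: "X \<in> Obj C \<Longrightarrow> \<exists>z\<in>Z. \<exists>u. is_iso C (F z) X u" and ess': "Y \<in> Obj D \<Longrightarrow> \<exists>z\<in>Z. \<exists>u. is_iso D (F' z) Y u"
begin

text \<open>The bijection on morphisms induced by the span.\<close>

definition th :: "'z \<Rightarrow> 'z \<Rightarrow> 'm \<Rightarrow> 'n" where
  "th x y u = cF' x y (SOME a. a \<in> A x y \<and> cF x y a = u)"

lemma th_cF: "x \<in> Z \<Longrightarrow> y \<in> Z \<Longrightarrow> a \<in> A x y \<Longrightarrow> th x y (cF x y a) = cF' x y a"
proof -
  assume *: "x \<in> Z" "y \<in> Z" "a \<in> A x y"
  let ?b = "SOME b. b \<in> A x y \<and> cF x y b = cF x y a"
  have "?b \<in> A x y \<and> cF x y ?b = cF x y a" by (rule someI[of _ a]) (use * in simp)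
  then show ?thesis unfolding th_def using eq[of x y ?b a] * by blast
qed

lemma hom_rep: "x \<in> Z \<Longrightarrow> y \<in> Z \<Longrightarrow> u \<in> Hom C (F x) (F y) \<Longrightarrow> \<exists>a\<in>A x y. u = cF x y a"
  using onto by blast

lemma th_in: "x \<in> Z \<Longrightarrow> y \<in> Z \<Longrightarrow> u \<in> Hom C (F x) (F y) \<Longrightarrow> th x y u \<in> Hom D (F' x) (F' y)"
  using hom_rep[of x y u] th_cF[of x y] onto'[of x y] by auto

lemma th_ide: "z \<in> Z \<Longrightarrow> th z z (Ide C (F z)) = Ide D (F' z)"
  using ident th_cF by metis

lemma th_cmp: "x \<in> Z \<Longrightarrow> y \<in> Z \<Longrightarrow> z \<in> Z \<Longrightarrow> u \<in> Hom C (F x) (F y) \<Longrightarrow> v \<in> Hom C (F y) (F z) \<Longrightarrow>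
    th x z (Cmp C (F x) (F y) (F z) v u) = Cmp D (F' x) (F' y) (F' z) (th y z v) (th x y u)"
proof -
  assume *: "x \<in> Z" "y \<in> Z" "z \<in> Z" "u \<in> Hom C (F x) (F y)" "v \<in> Hom C (F y) (F z)"
  obtain a b where ab: "a \<in> A x y" "u = cF x y a" "b \<in> A y z" "v = cF y z b" using hom_rep * by meson
  have "Cmp C (F x) (F y) (F z) v u = cF x z (m x y z b a)" using comp(2)[OF *(1-3) ab(1,3)] ab by simp
  then show ?thesis using th_cF comp(1,3) * ab by simp
qed

definition ob :: "'o \<Rightarrow> 'z" where "ob X = (SOME z. z \<in> Z \<and> (\<exists>u. is_iso C (F z) X u))"
definition iso :: "'o \<Rightarrow> 'm" where "iso X = (SOME u. is_iso C (F (ob X)) X u)"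
definition iinv :: "'o \<Rightarrow> 'm" where "iinv X = (SOME v. v \<in> Hom C X (F (ob X)) \<and>
   Cmp C (F (ob X)) X (F (ob X)) v (iso X) = Ide C (F (ob X)) \<and> Cmp C X (F (ob X)) X (iso X) v = Ide C X)"

lemma ob: assumes "X \<in> Obj C" shows "ob X \<in> Z" "is_iso C (F (ob X)) X (iso X)"
proof -
  have *: "ob X \<in> Z \<and> (\<exists>u. is_iso C (F (ob X)) X u)" unfolding ob_def by (rule someI_ex) (use ess[OF assms] in blast)
  then show "ob X \<in> Z" by blast
  show "is_iso C (F (ob X)) X (iso X)" unfolding iso_def by (rule someI_ex) (use * in blast)
qed

lemma iso_inv: assumes "X \<in> Obj C"
  shows "iso X \<in> Hom C (F (ob X)) X" "iinv X \<in> Hom C X (F (ob X))"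
    "Cmp C (F (ob X)) X (F (ob X)) (iinv X) (iso X) = Ide C (F (ob X))" "Cmp C X (F (ob X)) X (iso X) (iinv X) = Ide C X"
proof -
  show "iso X \<in> Hom C (F (ob X)) X" using ob(2)[OF assms] by (simp add: is_iso_def)
  have "iinv X \<in> Hom C X (F (ob X)) \<and> Cmp C (F (ob X)) X (F (ob X)) (iinv X) (iso X) = Ide C (F (ob X)) \<and>
      Cmp C X (F (ob X)) X (iso X) (iinv X) = Ide C X"
    unfolding iinv_def by (rule someI_ex) (use ob(2)[OF assms] in \<open>auto simp: is_iso_def\<close>)
  then show "iinv X \<in> Hom C X (F (ob X))" "Cmp C (F (ob X)) X (F (ob X)) (iinv X) (iso X) = Ide C (F (ob X))"
    "Cmp C X (F (ob X)) X (iso X) (iinv X) = Ide C X" by auto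
qed

definition fo :: "'o \<Rightarrow> 'p" where "fo X = F' (ob X)"
definition fm :: "'o \<Rightarrow> 'o \<Rightarrow> 'm \<Rightarrow> 'n" where
  "fm X Y u = th (ob X) (ob Y) (Cmp C (F (ob X)) Y (F (ob Y)) (iinv Y) (Cmp C (F (ob X)) X Y u (iso X)))"

lemma conj_in: assumes "X \<in> Obj C" "Y \<in> Obj C" "u \<in> Hom C X Y"
  shows "Cmp C (F (ob X)) Y (F (ob Y)) (iinv Y) (Cmp C (F (ob X)) X Y u (iso X)) \<in> Hom C (F (ob X)) (F (ob Y))"
  using assms ob F iso_inv by (meson C.cmp_in)

lemma functor_fo: "is_functor C D fo fm"
  unfolding is_functor_def
proof (intro conjI ballI)
  fix X assume X: "X \<in> Obj C"
  show "fo X \<in> Obj D" using ob[OF X] F' by (simp add: fo_def)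
  show "fm X X (Ide C X) = Ide D (fo X)"
    using ob[OF X] F iso_inv[OF X] X by (simp add: fm_def fo_def C.ide_left th_ide)
next
  fix X Y u assume "X \<in> Obj C" "Y \<in> Obj C" "u \<in> Hom C X Y"
  then show "fm X Y u \<in> Hom D (fo X) (fo Y)"
    unfolding fm_def fo_def by (intro th_in ob conj_in)
next
  fix X Y Z' u v assume o: "X \<in> Obj C" "Y \<in> Obj C" "Z' \<in> Obj C" and h: "u \<in> Hom C X Y" "v \<in> Hom C Y Z'"
  note f = F[OF ob(1)[OF o(1)]] F[OF ob(1)[OF o(2)]] F[OF ob(1)[OF o(3)]]
  note k = iso_inv[OF o(1)] iso_inv[OF o(2)] iso_inv[OF o(3)]
  let ?cu = "Cmp C (F (ob X)) Y (F (ob Y)) (iinv Y) (Cmp C (F (ob X)) X Y u (iso X))"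
  let ?cv = "Cmp C (F (ob Y)) Z' (F (ob Z')) (iinv Z') (Cmp C (F (ob Y)) Y Z' v (iso Y))"
  have "Cmp C (F (ob X)) (F (ob Y)) (F (ob Z')) ?cv ?cu =
      Cmp C (F (ob X)) Z' (F (ob Z')) (iinv Z') (Cmp C (F (ob X)) X Z' (Cmp C X Y Z' v u) (iso X))"
    using o h f k by (simp add: C.assoc C.cmp_in C.cancel[of _ Y "F (ob Y)" _ "iinv Y" "iso Y"])
  then show "fm X Z' (Cmp C X Y Z' v u) = Cmp D (fo X) (fo Y) (fo Z') (fm Y Z' v) (fm X Y u)"
    unfolding fm_def fo_def using th_cmp[OF ob(1)[OF o(1)] ob(1)[OF o(2)] ob(1)[OF o(3)] conj_in[OF o(1,2) h(1)] conj_in[OF o(2,3) h(2)]]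
    by simp
qed

end

sublocale span \<subseteq> opp: span D C Z A i m F' cF' F cF
  by unfold_locales (use F F' onto onto' eq ident comp ess ess' in \<open>auto\<close>)

context span
begin

lemma th_opp: "x \<in> Z \<Longrightarrow> y \<in> Z \<Longrightarrow> u \<in> Hom C (F x) (F y) \<Longrightarrow> opp.th x y (th x y u) = u"
  using hom_rep[of x y u] th_cF[of x y] opp.th_cF[of x y] by auto

lemma unit: "naturally_isomorphic C C (\<lambda>X. X) (\<lambda>X Y u. u) (\<lambda>X. opp.fo (fo X)) (\<lambda>X Y u. opp.fm (fo X) (fo Y) (fm X Y u))"
  unfolding naturally_isomorphic_def
proof (intro exI conjI ballI)
  let ?t = "\<lambda>X. Cmp C X (F (ob X)) (opp.fo (fo X)) (opp.th (ob X) (opp.ob (fo X)) (opp.iinv (fo X))) (iinv X)"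
  have base: "fo X \<in> Obj D" "ob X \<in> Z" "opp.ob (fo X) \<in> Z" "F (ob X) \<in> Obj C" "opp.fo (fo X) \<in> Obj C" "fo X = F' (ob X)" "opp.fo (fo X) = F (opp.ob (fo X))" "F' (opp.ob (fo X)) \<in> Obj D"
    if "X \<in> Obj C" for X
    using that ob F F' opp.ob by (auto simp: fo_def opp.fo_def)
  have l: "opp.th (ob X) (opp.ob (fo X)) (opp.iinv (fo X)) \<in> Hom C (F (ob X)) (opp.fo (fo X))"
    "opp.th (opp.ob (fo X)) (ob X) (opp.iso (fo X)) \<in> Hom C (opp.fo (fo X)) (F (ob X))"
    "Cmp C (F (ob X)) (opp.fo (fo X)) (F (ob X)) (opp.th (opp.ob (fo X)) (ob X) (opp.iso (fo X))) (opp.th (ob X) (opp.ob (fo X)) (opp.iinv (fo X))) = Ide C (F (ob X))"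
    "Cmp C (opp.fo (fo X)) (F (ob X)) (opp.fo (fo X)) (opp.th (ob X) (opp.ob (fo X)) (opp.iinv (fo X))) (opp.th (opp.ob (fo X)) (ob X) (opp.iso (fo X))) = Ide C (opp.fo (fo X))"
    if X: "X \<in> Obj C" for X
  proof -
    note b = base[OF X] and k = opp.iso_inv[OF base(1)[OF X]]
    show "opp.th (ob X) (opp.ob (fo X)) (opp.iinv (fo X)) \<in> Hom C (F (ob X)) (opp.fo (fo X))"
      "opp.th (opp.ob (fo X)) (ob X) (opp.iso (fo X)) \<in> Hom C (opp.fo (fo X)) (F (ob X))"
      using opp.th_in b k by auto
    have "opp.th (ob X) (ob X) (Cmp D (F' (ob X)) (F' (opp.ob (fo X))) (F' (ob X)) (opp.iso (fo X)) (opp.iinv (fo X))) = Ide C (F (ob X))"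
      using k(4) b opp.th_ide by metis
    then show "Cmp C (F (ob X)) (opp.fo (fo X)) (F (ob X)) (opp.th (opp.ob (fo X)) (ob X) (opp.iso (fo X))) (opp.th (ob X) (opp.ob (fo X)) (opp.iinv (fo X))) = Ide C (F (ob X))"
      using opp.th_cmp[OF b(2,3,2), of "opp.iinv (fo X)" "opp.iso (fo X)"] k b by simp
    have "opp.th (opp.ob (fo X)) (opp.ob (fo X)) (Cmp D (F' (opp.ob (fo X))) (F' (ob X)) (F' (opp.ob (fo X))) (opp.iinv (fo X)) (opp.iso (fo X))) = Ide C (opp.fo (fo X))"
      using k(3) b opp.th_ide by metis
    then show "Cmp C (opp.fo (fo X)) (F (ob X)) (opp.fo (fo X)) (opp.th (ob X) (opp.ob (fo X)) (opp.iinv (fo X))) (opp.th (opp.ob (fo X)) (ob X) (opp.iso (fo X))) = Ide C (opp.fo (fo X))"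
      using opp.th_cmp[OF b(3,2,3), of "opp.iso (fo X)" "opp.iinv (fo X)"] k b by simp
  qed
  fix X assume X: "X \<in> Obj C"
  note b = base[OF X] and lX = l[OF X] and kX = iso_inv[OF X]
  show "is_iso C X (opp.fo (fo X)) (?t X)"
    unfolding is_iso_def
  proof (intro conjI bexI)
    let ?s = "Cmp C (opp.fo (fo X)) (F (ob X)) X (iso X) (opp.th (opp.ob (fo X)) (ob X) (opp.iso (fo X)))"
    show "?t X \<in> Hom C X (opp.fo (fo X))" "?s \<in> Hom C (opp.fo (fo X)) X"
      using X b lX kX C.cmp_in by blast+
    show "Cmp C X (opp.fo (fo X)) X ?s (?t X) = Ide C X"
      using X b(1-5) lX kX by (simp add: C.assoc C.cmp_in C.cancel[OF X b(4,5)])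
    show "Cmp C (opp.fo (fo X)) X (opp.fo (fo X)) (?t X) ?s = Ide C (opp.fo (fo X))"
      using X b(1-5) lX kX by (simp add: C.assoc C.cmp_in C.cancel[OF b(5,4) X])
  qed
  fix Y u assume Y: "Y \<in> Obj C" and u: "u \<in> Hom C X Y"
  note bY = base[OF Y] and lY = l[OF Y] and kY = iso_inv[OF Y]
  let ?c = "Cmp C (F (ob X)) Y (F (ob Y)) (iinv Y) (Cmp C (F (ob X)) X Y u (iso X))"
  have c: "?c \<in> Hom C (F (ob X)) (F (ob Y))" by (rule conj_in[OF X Y u])
  note ox = opp.iso_inv[OF b(1)] and oy = opp.iso_inv[OF bY(1)]
  have thc: "th (ob X) (ob Y) ?c \<in> Hom D (F' (ob X)) (F' (ob Y))" using th_in b bY c by blast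
  have "opp.fm (fo X) (fo Y) (fm X Y u) =
      Cmp C (opp.fo (fo X)) (F (ob Y)) (opp.fo (fo Y)) (opp.th (ob Y) (opp.ob (fo Y)) (opp.iinv (fo Y)))
        (Cmp C (opp.fo (fo X)) (F (ob X)) (F (ob Y)) ?c (opp.th (opp.ob (fo X)) (ob X) (opp.iso (fo X))))"
  proof -
    have 1: "opp.th (opp.ob (fo X)) (ob Y) (Cmp D (F' (opp.ob (fo X))) (F' (ob X)) (F' (ob Y)) (th (ob X) (ob Y) ?c) (opp.iso (fo X))) =
        Cmp C (opp.fo (fo X)) (F (ob X)) (F (ob Y)) ?c (opp.th (opp.ob (fo X)) (ob X) (opp.iso (fo X)))"
      using opp.th_cmp[OF b(3,2) bY(2), of "opp.iso (fo X)" "th (ob X) (ob Y) ?c"] ox thc b bY th_opp[OF b(2) bY(2) c] by simp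
    have 2: "Cmp D (F' (opp.ob (fo X))) (F' (ob X)) (F' (ob Y)) (th (ob X) (ob Y) ?c) (opp.iso (fo X)) \<in> Hom D (F' (opp.ob (fo X))) (F' (ob Y))"
      using ox thc b bY D.cmp_in by metis
    show ?thesis
      unfolding opp.fm_def fm_def
      using opp.th_cmp[OF b(3) bY(2,3), of _ "opp.iinv (fo Y)"] 2 oy b bY 1 by simp
  qed
  then show "Cmp C X Y (opp.fo (fo Y)) (?t Y) u = Cmp C X (opp.fo (fo X)) (opp.fo (fo Y)) (opp.fm (fo X) (fo Y) (fm X Y u)) (?t X)"
    using X Y u b(1-5) bY(1-5) lX lY kX kY c
    by (simp add: C.assoc C.cmp_in C.cancel[OF X b(4,5)] C.cancel[OF X X b(4)] C.ide_right)
qed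

lemma naturally_isomorphic_sym:
  assumes "naturally_isomorphic C C (\<lambda>X. X) (\<lambda>X Y u. u) H H'" and H: "is_functor C C H H'"
  shows "naturally_isomorphic C C H H' (\<lambda>X. X) (\<lambda>X Y u. u)"
proof -
  obtain t where t: "\<And>X. X \<in> Obj C \<Longrightarrow> is_iso C X (H X) (t X)"
    and nat: "\<And>X Y u. X \<in> Obj C \<Longrightarrow> Y \<in> Obj C \<Longrightarrow> u \<in> Hom C X Y \<Longrightarrow> Cmp C X Y (H Y) (t Y) u = Cmp C X (H X) (H Y) (H' X Y u) (t X)"
    using assms(1) unfolding naturally_isomorphic_def by blast
  have "\<exists>s. s \<in> Hom C (H X) X \<and> Cmp C X (H X) X s (t X) = Ide C X \<and> Cmp C (H X) X (H X) (t X) s = Ide C (H X)" if "X \<in> Obj C" for X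
    using t[OF that] unfolding is_iso_def by blast
  then obtain s where s: "\<And>X. X \<in> Obj C \<Longrightarrow> s X \<in> Hom C (H X) X \<and> Cmp C X (H X) X (s X) (t X) = Ide C X \<and> Cmp C (H X) X (H X) (t X) (s X) = Ide C (H X)"
    by metis
  show ?thesis unfolding naturally_isomorphic_def
  proof (intro exI[of _ s] conjI ballI)
    fix X assume X: "X \<in> Obj C"
    show "is_iso C (H X) X (s X)" using s[OF X] t[OF X] unfolding is_iso_def by blast
    fix Y u assume Y: "Y \<in> Obj C" and u: "u \<in> Hom C X Y"
    have HX: "H X \<in> Obj C" "H Y \<in> Obj C" "H' X Y u \<in> Hom C (H X) (H Y)" using H X Y u unfolding is_functor_def by blast+
    have tt: "t X \<in> Hom C X (H X)" "t Y \<in> Hom C Y (H Y)" using t X Y by (auto simp: is_iso_def)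
    note sX = s[OF X] and sY = s[OF Y]
    have "Cmp C (H X) (H Y) Y (s Y) (Cmp C (H X) X (H Y) (Cmp C X Y (H Y) (t Y) u) (s X)) = Cmp C (H X) X Y u (s X)"
      using X Y u HX tt sX sY by (simp add: C.assoc C.cmp_in C.cancel[OF HX(1) Y HX(2)])
    moreover have "Cmp C (H X) (H Y) Y (s Y) (Cmp C (H X) X (H Y) (Cmp C X (H X) (H Y) (H' X Y u) (t X)) (s X)) = Cmp C (H X) (H Y) Y (s Y) (H' X Y u)"
      using X Y u HX tt sX sY by (simp add: C.assoc C.cmp_in C.ide_right)
    ultimately show "Cmp C (H X) (H Y) Y (s Y) (H' X Y u) = Cmp C (H X) X Y u (s X)" using nat[OF X Y u] by simp
  qed
qed

lemma functor_comp: "is_functor C C (\<lambda>X. opp.fo (fo X)) (\<lambda>X Y u. opp.fm (fo X) (fo Y) (fm X Y u))"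
  using functor_fo opp.functor_fo unfolding is_functor_def by simp

end

theorem (in span) span_equivalence: "equivalent_categories C D"
  unfolding equivalent_categories_def
  using C.cat D.cat functor_fo opp.functor_fo unit opp.naturally_isomorphic_sym[OF opp.unit opp.functor_comp] by blast

section \<open>Equivariant matrix factorizations as twisted ones\<close>

lemma prod_mon: "(\<Prod>i\<in>A. mon (h i) (c i)) = (mon (\<Sum>i\<in>A. h i) (\<Prod>i\<in>A. c i) :: mpoly)"
proof (induction A rule: infinite_finite_induct)
  case (insert x A)
  then show ?case by (simp add: mult_single)
qed (simp_all add: single_one)

lemma sum_mon_look: "(\<Sum>i\<in>supp m. mon i (look m i)) = (m :: monom)"
proof (rule poly_mapping_eqI)
  fix k
  have "look (\<Sum>i\<in>supp m. mon i (look m i)) k = (\<Sum>i\<in>supp m. if i = k then look m i else 0)"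
    by (simp add: lookup_sum lookup_single when_def)
  also have "\<dots> = look m k" by (simp add: in_keys_iff)
  finally show "look (\<Sum>i\<in>supp m. mon i (look m i)) k = look m k" .
qed

lemma diag_act_eq: "diag_act g = mono_op (\<lambda>m. m) (\<lambda>m. \<Prod>i\<in>supp m. g i ^ look m i)"
proof
  fix p
  have "const (g i) * var i = mon (mon i 1) (g i)" for i by (simp add: var_def mult_single)
  moreover have "mon (mon i 1) c ^ k = (mon (mon i k) (c ^ k) :: mpoly)" for i k and c :: complex
  proof (induction k)
    case (Suc k)
    then show ?case by (simp add: mult_single single_add[symmetric] plus_1_eq_Suc)
  qed (simp add: single_one)
  ultimately have "const (look p m) * (\<Prod>i\<in>supp m. (const (g i) * var i) ^ look m i) =
      mon m ((\<Prod>i\<in>supp m. g i ^ look m i) * look p m)" for m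
    by (simp add: prod_mon sum_mon_look mult_single mult.commute)
  then show "diag_act g p = mono_op (\<lambda>m. m) (\<lambda>m. \<Prod>i\<in>supp m. g i ^ look m i) p"
    by (simp add: diag_act_def poly_subst_def poly_hom_def mono_op_def)
qed

lemma diag_act_one: "diag_act (\<lambda>i. 1) p = p"
  unfolding diag_act_eq by (induction p rule: mpoly_induct) (auto simp: mono_op_add)

definition emb :: "mpoly mat \<Rightarrow> mpoly cmat" where
  "emb A = CMat (\<lambda>i j. if i < dim_row A \<and> j < dim_col A then A $$ (i, j) else 0)"

definition bk :: "nat \<Rightarrow> nat \<Rightarrow> mpoly cmat \<Rightarrow> mpoly mat" where
  "bk r s a = mat r s (\<lambda>(i, j). ent a i j)"

lemma ent_emb: "ent (emb A) i j = (if i < dim_row A \<and> j < dim_col A then A $$ (i, j) else 0)"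
  unfolding emb_def by (rule ent_CMat_within[where S = "\<lambda>_. {..<dim_row A}"]) (auto split: if_splits)

lemma emb_mult: "dim_col A = dim_row B \<Longrightarrow> emb (A * B) = emb A * emb B"
proof (rule cmat_eqI)
  fix i j assume d: "dim_col A = dim_row B"
  have "ent (emb A * emb B) i j = (\<Sum>k\<in>{0..<dim_row B}. ent (emb A) i k * ent (emb B) k j)"
    by (rule ent_mult_superset) (auto simp: ent_emb split: if_splits)
  also have "\<dots> = ent (emb (A * B)) i j"
    using d by (auto simp: ent_emb scalar_prod_def intro!: sum.cong)
  finally show "ent (emb (A * B)) i j = ent (emb A * emb B) i j" ..
qed

lemma emb_add: "dim_row A = dim_row B \<Longrightarrow> dim_col A = dim_col B \<Longrightarrow> emb (A + B) = emb A + emb B"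
  by (rule cmat_eqI) (simp add: ent_emb)

lemma emb_one: "emb (1\<^sub>m r) = cproj {..<r}"
  by (rule cmat_eqI) (simp add: ent_emb)

lemma emb_smult_one: "emb (p \<cdot>\<^sub>m 1\<^sub>m r) = scal p * cproj {..<r}"
  by (rule cmat_eqI) (simp add: ent_emb)

lemma emb_map: "h 0 = 0 \<Longrightarrow> emb (map_mat h A) = cmap h (emb A)"
  by (rule cmat_eqI) (simp add: ent_emb ent_cmap)

lemma emb_inj: "A \<in> carrier_mat r s \<Longrightarrow> B \<in> carrier_mat r s \<Longrightarrow> emb A = emb B \<longleftrightarrow> A = B"
  by (metis bk_def carrier_matD cong_mat ent_emb eq_matI index_mat(1) mat_carrier old.prod.case)

lemma bk_carrier [simp]: "bk r s a \<in> carrier_mat r s" by (simp add: bk_def)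

lemma bk_dims [simp]: "dim_row (bk r s a) = r" "dim_col (bk r s a) = s" by (simp_all add: bk_def)

lemma bk_emb: "A \<in> carrier_mat r s \<Longrightarrow> bk r s (emb A) = A"
  by (rule eq_matI) (auto simp: bk_def ent_emb)

lemma poly_mats_iff: "A \<in> poly_mats V r s \<longleftrightarrow> A \<in> carrier_mat r s \<and> (\<forall>i<r. \<forall>j<s. A $$ (i, j) \<in> poly_ring V)"
  by (auto simp: poly_mats_def elements_mat_def UN_subset_iff image_subset_iff)

context involution
begin

lemma emb_bk: "a \<in> vhom {..<s} {..<r} \<Longrightarrow> emb (bk r s a) = a"
  by (rule cmat_eqI) (auto simp: ent_emb bk_def vhom_def)

lemma emb_vhom: "A \<in> carrier_mat r s \<Longrightarrow> emb A \<in> vhom {..<s} {..<r} \<longleftrightarrow> A \<in> poly_mats V r s"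
  by (auto simp: poly_mats_iff vhom_def ent_emb)

end

text \<open>
  An equivariant structure for the group \<open>{1, g}\<close> amounts to the one matrix by which \<open>g\<close> acts. The case \<open>g = 1\<close> is
  included, in order to treat the trivial group and the group of order two alike.
\<close>

locale cyclic_two = involution V \<gamma> f for V \<gamma> f +
  fixes g :: "nat \<Rightarrow> complex"
  assumes act: "diag_act g = \<gamma>" and gg: "g i * g i = 1"
begin

abbreviation GG :: "(nat \<Rightarrow> complex) set" where "GG \<equiv> {\<lambda>i. 1, g}"

text \<open>
  The functions \<open>tw\<close>, \<open>em\<close> and \<open>ba\<close> translate between matrices with dimensions and elements of the ring of
  column-finite matrices; \<open>cls\<close> is the morphism of the homotopy category represented by a pair of the latter.
\<close>

definition tw :: "matrix_fact \<Rightarrow> tmf" where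
  "tw E = \<lparr>X0 = ({..<rk0 E}, emb (act0 E g)), X1 = ({..<rk1 E}, emb (act1 E g)), phi = emb (dif0 E), psi = emb (dif1 E)\<rparr>"

lemma tw_simps [simp]: "X0 (tw E) = ({..<rk0 E}, emb (act0 E g))" "X1 (tw E) = ({..<rk1 E}, emb (act1 E g))"
  "phi (tw E) = emb (dif0 E)" "psi (tw E) = emb (dif1 E)"
  by (simp_all add: tw_def)

lemma structure_carrier: "equivariant_structure V GG r \<rho> \<Longrightarrow> \<rho> g \<in> poly_mats V r r"
  by (auto simp: equivariant_structure_def)

lemma structure_tmod: "equivariant_structure V GG r \<rho> \<Longrightarrow> tmod ({..<r}, emb (\<rho> g))"
proof -
  assume s: "equivariant_structure V GG r \<rho>"
  then have c: "\<rho> g \<in> carrier_mat r r" "\<rho> g \<in> poly_mats V r r"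
    using structure_carrier by (auto simp: poly_mats_def)
  have "\<rho> (\<lambda>i. g i * g i) = \<rho> g * map_mat (diag_act g) (\<rho> g)" "\<rho> (\<lambda>i. 1) = 1\<^sub>m r"
    using s unfolding equivariant_structure_def by blast+
  then have "1\<^sub>m r = \<rho> g * map_mat \<gamma> (\<rho> g)" by (simp add: gg act)
  then have "emb (1\<^sub>m r) = emb (\<rho> g) * G (emb (\<rho> g))"
    using c by (simp add: emb_mult emb_map)
  then show ?thesis using c emb_vhom by (simp add: tmod_def emb_one)
qed

lemma equiv_maps_iff:
  assumes "equivariant_structure V GG r \<rho>" "equivariant_structure V GG s \<sigma>"
  shows "A \<in> equiv_maps V GG r \<rho> s \<sigma> \<longleftrightarrow>
    A \<in> carrier_mat s r \<and> emb A \<in> thom ({..<r}, emb (\<rho> g)) ({..<s}, emb (\<sigma> g))"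
proof (cases "A \<in> carrier_mat s r")
  case True
  have c: "\<rho> g \<in> carrier_mat r r" "\<sigma> g \<in> carrier_mat s s" "\<rho> (\<lambda>i. 1) = 1\<^sub>m r" "\<sigma> (\<lambda>i. 1) = 1\<^sub>m s"
    using assms structure_carrier by (auto simp: poly_mats_def equivariant_structure_def)
  have "map_mat (diag_act (\<lambda>i. 1)) A = A" by (rule eq_matI) (auto simp: diag_act_one)
  then have "equivariant_mat GG \<rho> \<sigma> A \<longleftrightarrow> A * \<rho> g = \<sigma> g * map_mat \<gamma> A"
    using c True by (auto simp: equivariant_mat_def act)
  also have "\<dots> \<longleftrightarrow> emb (A * \<rho> g) = emb (\<sigma> g * map_mat \<gamma> A)"
    by (rule emb_inj[symmetric, of _ s r]) (use c True in auto)
  also have "\<dots> \<longleftrightarrow> emb A * emb (\<rho> g) = emb (\<sigma> g) * G (emb A)"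
    using c True by (simp add: emb_mult emb_map)
  finally show ?thesis using emb_vhom[OF True] True by (auto simp: equiv_maps_def thom_def)
qed (auto simp: equiv_maps_def poly_mats_def)

abbreviation em :: "mpoly mat \<times> mpoly mat \<Rightarrow> mpoly cmat \<times> mpoly cmat" where "em x \<equiv> (emb (fst x), emb (snd x))"

definition ba :: "matrix_fact \<Rightarrow> matrix_fact \<Rightarrow> mpoly cmat \<times> mpoly cmat \<Rightarrow> mpoly mat \<times> mpoly mat" where
  "ba E E' a = (bk (rk0 E') (rk0 E) (fst a), bk (rk1 E') (rk1 E) (snd a))"

abbreviation "Ob \<equiv> mf_objects V GG f"

lemma is_mf_tw: assumes "E \<in> Ob" shows "is_mf (tw E)"
proof -
  have s: "equivariant_structure V GG (rk0 E) (act0 E)" "equivariant_structure V GG (rk1 E) (act1 E)"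
    and d: "dif0 E \<in> equiv_maps V GG (rk0 E) (act0 E) (rk1 E) (act1 E)" "dif1 E \<in> equiv_maps V GG (rk1 E) (act1 E) (rk0 E) (act0 E)"
    and e: "dif1 E * dif0 E = f \<cdot>\<^sub>m 1\<^sub>m (rk0 E)" "dif0 E * dif1 E = f \<cdot>\<^sub>m 1\<^sub>m (rk1 E)"
    using assms by (auto simp: mf_objects_def)
  have "emb (dif1 E) * emb (dif0 E) = scal f * cproj {..<rk0 E}" "emb (dif0 E) * emb (dif1 E) = scal f * cproj {..<rk1 E}"
    using d arg_cong[OF e(1), of emb] arg_cong[OF e(2), of emb] s
    by (auto simp: equiv_maps_iff emb_mult emb_smult_one)
  then show ?thesis using d s structure_tmod by (simp add: is_mf_def equiv_maps_iff)
qed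

lemma mf_maps_iff:
  assumes "E \<in> Ob" "E' \<in> Ob"
  shows "x \<in> mf_maps V GG E E' \<longleftrightarrow> fst x \<in> carrier_mat (rk0 E') (rk0 E) \<and> snd x \<in> carrier_mat (rk1 E') (rk1 E) \<and>
    em x \<in> tmaps (tw E) (tw E')"
proof -
  obtain a0 a1 where x: "x = (a0, a1)" by (cases x)
  have s: "equivariant_structure V GG (rk0 E) (act0 E)" "equivariant_structure V GG (rk1 E) (act1 E)"
    "equivariant_structure V GG (rk0 E') (act0 E')" "equivariant_structure V GG (rk1 E') (act1 E')"
    using assms by (auto simp: mf_objects_def)
  have d: "dif0 E \<in> carrier_mat (rk1 E) (rk0 E)" "dif1 E \<in> carrier_mat (rk0 E) (rk1 E)"
    "dif0 E' \<in> carrier_mat (rk1 E') (rk0 E')" "dif1 E' \<in> carrier_mat (rk0 E') (rk1 E')"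
    using assms by (auto simp: mf_objects_def equiv_maps_def poly_mats_def)
  have "(a1 * dif0 E = dif0 E' * a0 \<longleftrightarrow> emb a1 * emb (dif0 E) = emb (dif0 E') * emb a0) \<and>
      (a0 * dif1 E = dif1 E' * a1 \<longleftrightarrow> emb a0 * emb (dif1 E) = emb (dif1 E') * emb a1)"
    if "a0 \<in> carrier_mat (rk0 E') (rk0 E)" "a1 \<in> carrier_mat (rk1 E') (rk1 E)"
    using that d emb_inj[of "a1 * dif0 E" "rk1 E'" "rk0 E" "dif0 E' * a0"]
      emb_inj[of "a0 * dif1 E" "rk0 E'" "rk1 E" "dif1 E' * a1"] by (simp add: emb_mult)
  then show ?thesis using s unfolding x mf_maps_def tmaps_def by (auto simp: equiv_maps_iff)
qed

lemma mf_homotopy_iff: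
  assumes "E \<in> Ob" "E' \<in> Ob"
  shows "(x, y) \<in> mf_homotopy V GG E E' \<longleftrightarrow> x \<in> mf_maps V GG E E' \<and> y \<in> mf_maps V GG E E' \<and> thtp (tw E) (tw E') (em x) (em y)"
proof -
  obtain a0 a1 b0 b1 where xy: "x = (a0, a1)" "y = (b0, b1)" by (cases x, cases y)
  have s: "equivariant_structure V GG (rk0 E) (act0 E)" "equivariant_structure V GG (rk1 E) (act1 E)"
    "equivariant_structure V GG (rk0 E') (act0 E')" "equivariant_structure V GG (rk1 E') (act1 E')"
    using assms by (auto simp: mf_objects_def)
  have d: "dif0 E \<in> carrier_mat (rk1 E) (rk0 E)" "dif1 E \<in> carrier_mat (rk0 E) (rk1 E)"
    "dif0 E' \<in> carrier_mat (rk1 E') (rk0 E')" "dif1 E' \<in> carrier_mat (rk0 E') (rk1 E')"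
    using assms by (auto simp: mf_objects_def equiv_maps_def poly_mats_def)
  have *: "(a0 = b0 + (dif1 E' * h0 + h1 * dif0 E) \<longleftrightarrow> emb a0 = emb b0 + (emb (dif1 E') * emb h0 + emb h1 * emb (dif0 E))) \<and>
      (a1 = b1 + (dif0 E' * h1 + h0 * dif1 E) \<longleftrightarrow> emb a1 = emb b1 + (emb (dif0 E') * emb h1 + emb h0 * emb (dif1 E)))"
    if c: "a0 \<in> carrier_mat (rk0 E') (rk0 E)" "a1 \<in> carrier_mat (rk1 E') (rk1 E)"
      "b0 \<in> carrier_mat (rk0 E') (rk0 E)" "b1 \<in> carrier_mat (rk1 E') (rk1 E)"
      "h0 \<in> carrier_mat (rk1 E') (rk0 E)" "h1 \<in> carrier_mat (rk0 E') (rk1 E)" for h0 h1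
    using c d emb_inj[of a0 "rk0 E'" "rk0 E" "b0 + (dif1 E' * h0 + h1 * dif0 E)"]
      emb_inj[of a1 "rk1 E'" "rk1 E" "b1 + (dif0 E' * h1 + h0 * dif1 E)"] by (simp add: emb_mult emb_add)
  have lift: "\<exists>A\<in>carrier_mat r' r. emb A = h" if "h \<in> thom X Y" "fst X = {..<r}" "fst Y = {..<r'}" for h r r' X Y
    using emb_bk[of h r r'] thom_vhom[OF that(1)] bk_carrier[of r' r h] that(2,3) by auto
  show ?thesis
  proof
    assume l: "(x, y) \<in> mf_homotopy V GG E E'"
    then show "x \<in> mf_maps V GG E E' \<and> y \<in> mf_maps V GG E E' \<and> thtp (tw E) (tw E') (em x) (em y)"
      using * s unfolding mf_homotopy_def xy thtp_def mf_maps_iff[OF assms] by (auto simp: equiv_maps_iff) blast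
  next
    assume r: "x \<in> mf_maps V GG E E' \<and> y \<in> mf_maps V GG E E' \<and> thtp (tw E) (tw E') (em x) (em y)"
    then obtain k0 k1 where k: "k0 \<in> thom (X0 (tw E)) (X1 (tw E'))" "k1 \<in> thom (X1 (tw E)) (X0 (tw E'))"
      "emb a0 = emb b0 + (emb (dif1 E') * k0 + k1 * emb (dif0 E))" "emb a1 = emb b1 + (emb (dif0 E') * k1 + k0 * emb (dif1 E))"
      by (auto simp: thtp_def xy)
    obtain h0 where h0: "h0 \<in> carrier_mat (rk1 E') (rk0 E)" "emb h0 = k0" using lift[OF k(1)] by auto
    obtain h1 where h1: "h1 \<in> carrier_mat (rk0 E') (rk1 E)" "emb h1 = k1" using lift[OF k(2)] by auto
    have "h0 \<in> equiv_maps V GG (rk0 E) (act0 E) (rk1 E') (act1 E')" "h1 \<in> equiv_maps V GG (rk1 E) (act1 E) (rk0 E') (act0 E')"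
      using h0 h1 k s by (auto simp: equiv_maps_iff)
    then show "(x, y) \<in> mf_homotopy V GG E E'"
      using r *[of h0 h1] h0 h1 k unfolding mf_homotopy_def xy by (auto simp: mf_maps_iff[OF assms])
  qed
qed

lemma equiv_homotopy: assumes "E \<in> Ob" "E' \<in> Ob" shows "equiv (mf_maps V GG E E') (mf_homotopy V GG E E')"
proof (rule equivI)
  show "mf_homotopy V GG E E' \<subseteq> mf_maps V GG E E' \<times> mf_maps V GG E E'"
    using mf_homotopy_iff[OF assms] by auto
  show "refl_on (mf_maps V GG E E') (mf_homotopy V GG E E')"
    using mf_homotopy_iff[OF assms] thtp_refl by (auto simp: refl_on_def)
  show "sym (mf_homotopy V GG E E')" using mf_homotopy_iff[OF assms] thtp_sym by (auto simp: sym_def)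
  show "trans (mf_homotopy V GG E E')" using mf_homotopy_iff[OF assms] thtp_trans by (meson transI)
qed

definition cls :: "matrix_fact \<Rightarrow> matrix_fact \<Rightarrow> mpoly cmat \<times> mpoly cmat \<Rightarrow> (mpoly mat \<times> mpoly mat) set" where
  "cls E E' a = mf_homotopy V GG E E' `` {ba E E' a}"

lemma em_ba: assumes "a \<in> tmaps (tw E) (tw E')" shows "em (ba E E' a) = a"
proof -
  have "fst a \<in> vhom {..<rk0 E} {..<rk0 E'}" "snd a \<in> vhom {..<rk1 E} {..<rk1 E'}"
    using assms thom_vhom by (fastforce simp: tmaps_def)+
  then show ?thesis by (simp add: ba_def emb_bk)
qed

lemma ba_in: assumes "E \<in> Ob" "E' \<in> Ob" "a \<in> tmaps (tw E) (tw E')" shows "ba E E' a \<in> mf_maps V GG E E'"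
  unfolding mf_maps_iff[OF assms(1,2)] em_ba[OF assms(3)] using assms(3) by (simp add: ba_def)

lemma ba_em: assumes "E \<in> Ob" "E' \<in> Ob" "x \<in> mf_maps V GG E E'" shows "ba E E' (em x) = x"
  using assms(3) unfolding mf_maps_iff[OF assms(1,2)] by (simp add: ba_def bk_emb)

lemma cls_eq:
  assumes "E \<in> Ob" "E' \<in> Ob" "a \<in> tmaps (tw E) (tw E')" "b \<in> tmaps (tw E) (tw E')"
  shows "cls E E' a = cls E E' b \<longleftrightarrow> thtp (tw E) (tw E') a b"
  unfolding cls_def using eq_equiv_class_iff[OF equiv_homotopy[OF assms(1,2)] ba_in[OF assms(1-3)] ba_in[OF assms(1,2,4)]]
    ba_in[OF assms(1-3)] ba_in[OF assms(1,2,4)] em_ba[OF assms(3)] em_ba[OF assms(4)]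
  by (simp add: mf_homotopy_iff[OF assms(1,2)])

abbreviation "CC \<equiv> MF_equiv V GG f"

lemma Obj_CC: "Obj CC = Ob" by (simp add: MF_equiv_def)

lemma Hom_CC: assumes "E \<in> Ob" "E' \<in> Ob" shows "Hom CC E E' = cls E E' ` tmaps (tw E) (tw E')"
proof
  show "Hom CC E E' \<subseteq> cls E E' ` tmaps (tw E) (tw E')"
  proof
    fix u assume "u \<in> Hom CC E E'"
    then obtain x where x: "x \<in> mf_maps V GG E E'" "u = mf_homotopy V GG E E' `` {x}"
      by (auto simp: MF_equiv_def elim: quotientE)
    then have "u = cls E E' (em x)" by (simp only: cls_def ba_em[OF assms x(1)])
    then show "u \<in> cls E E' ` tmaps (tw E) (tw E')" using x(1) unfolding mf_maps_iff[OF assms] by blast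
  qed
  show "cls E E' ` tmaps (tw E) (tw E') \<subseteq> Hom CC E E'"
    using ba_in[OF assms] by (auto simp: MF_equiv_def cls_def intro: quotientI)
qed

lemma Ide_CC: assumes "E \<in> Ob" shows "Ide CC E = cls E E (tid (tw E))"
proof -
  have "ba E E (tid (tw E)) = (1\<^sub>m (rk0 E), 1\<^sub>m (rk1 E))"
    by (auto simp: ba_def tid_def bk_def one_mat_def intro!: cong_mat)
  then show ?thesis by (simp add: MF_equiv_def cls_def)
qed

lemma Cmp_CC:
  assumes o: "E \<in> Ob" "E' \<in> Ob" "E'' \<in> Ob" and a: "a \<in> tmaps (tw E) (tw E')" and b: "b \<in> tmaps (tw E') (tw E'')"
  shows "Cmp CC E E' E'' (cls E' E'' b) (cls E E' a) = cls E E'' (pmul b a)"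
proof -
  have *: "mf_homotopy V GG E E'' `` {(b0 * a0, b1 * a1)} = cls E E'' (pmul b a)"
    if y: "(b0, b1) \<in> cls E' E'' b" and x: "(a0, a1) \<in> cls E E' a" for a0 a1 b0 b1
  proof -
    have x': "(a0, a1) \<in> mf_maps V GG E E'" "thtp (tw E) (tw E') a (em (a0, a1))"
      using x unfolding cls_def Image_singleton_iff mf_homotopy_iff[OF o(1,2)] em_ba[OF a] by auto
    have y': "(b0, b1) \<in> mf_maps V GG E' E''" "thtp (tw E') (tw E'') b (em (b0, b1))"
      using y unfolding cls_def Image_singleton_iff mf_homotopy_iff[OF o(2,3)] em_ba[OF b] by auto
    have x'': "em (a0, a1) \<in> tmaps (tw E) (tw E')" and y'': "em (b0, b1) \<in> tmaps (tw E') (tw E'')"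
      and ca: "a0 \<in> carrier_mat (rk0 E') (rk0 E)" "a1 \<in> carrier_mat (rk1 E') (rk1 E)"
        "b0 \<in> carrier_mat (rk0 E'') (rk0 E')" "b1 \<in> carrier_mat (rk1 E'') (rk1 E')"
      using x'(1) y'(1) unfolding mf_maps_iff[OF o(1,2)] mf_maps_iff[OF o(2,3)] by auto
    have e: "em (b0 * a0, b1 * a1) = pmul (em (b0, b1)) (em (a0, a1))" using ca by (simp add: emb_mult)
    have t: "em (b0 * a0, b1 * a1) \<in> tmaps (tw E) (tw E'')" unfolding e by (rule tmaps_comp[OF y'' x''])
    have m: "(b0 * a0, b1 * a1) \<in> mf_maps V GG E E''" unfolding mf_maps_iff[OF o(1,3)] using t ca by simp
    have h: "thtp (tw E) (tw E'') (em (b0 * a0, b1 * a1)) (pmul b a)"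
      unfolding e by (rule thtp_sym[OF thtp_trans[OF thtp_left[OF x'(2) b] thtp_right[OF y'(2) x'']]])
    then have "cls E E'' (em (b0 * a0, b1 * a1)) = cls E E'' (pmul b a)"
      unfolding cls_eq[OF o(1,3) t tmaps_comp[OF b a]] .
    then show ?thesis unfolding cls_def ba_em[OF o(1,3) m] .
  qed
  have ne: "ba E E' a \<in> cls E E' a" "ba E' E'' b \<in> cls E' E'' b"
    unfolding cls_def by (rule equiv_class_self[OF equiv_homotopy[OF o(1,2)] ba_in[OF o(1,2) a]],
      rule equiv_class_self[OF equiv_homotopy[OF o(2,3)] ba_in[OF o(2,3) b]])
  have ne_empty: "S \<noteq> {}" if "s \<in> S" for s and S :: "(mpoly mat \<times> mpoly mat) set" using that by blast
  have "Cmp CC E E' E'' (cls E' E'' b) (cls E E' a) =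
      (\<Union>(b0, b1)\<in>cls E' E'' b. \<Union>(a0, a1)\<in>cls E E' a. mf_homotopy V GG E E'' `` {(b0 * a0, b1 * a1)})"
    by (simp add: MF_equiv_def)
  also have "\<dots> = cls E E'' (pmul b a)"
  proof (rule SUP_eq_const)
    show "cls E' E'' b \<noteq> {}" using ne(2) by (rule ne_empty)
    fix y assume y: "y \<in> cls E' E'' b"
    obtain b0 b1 where yb: "y = (b0, b1)" by (cases y)
    have "(\<Union>x\<in>cls E E' a. case x of (a0, a1) \<Rightarrow> mf_homotopy V GG E E'' `` {(b0 * a0, b1 * a1)}) = cls E E'' (pmul b a)"
    proof (rule SUP_eq_const)
      show "cls E E' a \<noteq> {}" using ne(1) by (rule ne_empty)
      fix x assume x: "x \<in> cls E E' a"
      show "(case x of (a0, a1) \<Rightarrow> mf_homotopy V GG E E'' `` {(b0 * a0, b1 * a1)}) = cls E E'' (pmul b a)"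
        using * x y yb by (cases x) simp
    qed
    then show "(case y of (b0, b1) \<Rightarrow> \<Union>(a0, a1)\<in>cls E E' a. mf_homotopy V GG E E'' `` {(b0 * a0, b1 * a1)}) = cls E E'' (pmul b a)"
      by (simp only: yb case_prod_conv)
  qed
  finally show ?thesis .
qed

lemma tid_in: "E \<in> Ob \<Longrightarrow> tid (tw E) \<in> tmaps (tw E) (tw E)"
  by (rule tid_tmaps[OF is_mf_tw])

lemma category_CC: "is_category CC"
  unfolding is_category_def Obj_CC
proof (intro conjI ballI)
  fix X assume "X \<in> Ob"
  then show "Ide CC X \<in> Hom CC X X" by (simp add: Ide_CC Hom_CC tid_in)
next
  fix X Y Z u v assume o: "X \<in> Ob" "Y \<in> Ob" "Z \<in> Ob" and "u \<in> Hom CC X Y" "v \<in> Hom CC Y Z"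
  then obtain a b where a: "a \<in> tmaps (tw X) (tw Y)" "u = cls X Y a" and b: "b \<in> tmaps (tw Y) (tw Z)" "v = cls Y Z b"
    by (auto simp: Hom_CC)
  show "Cmp CC X Y Z v u \<in> Hom CC X Z"
    unfolding a(2) b(2) Cmp_CC[OF o a(1) b(1)] Hom_CC[OF o(1,3)] by (rule imageI[OF tmaps_comp[OF b(1) a(1)]])
next
  fix X Y u assume o: "X \<in> Ob" "Y \<in> Ob" and "u \<in> Hom CC X Y"
  then obtain a where a: "a \<in> tmaps (tw X) (tw Y)" "u = cls X Y a" by (auto simp: Hom_CC)
  show "Cmp CC X X Y u (Ide CC X) = u"
    unfolding a(2) Ide_CC[OF o(1)] Cmp_CC[OF o(1,1,2) tid_in[OF o(1)] a(1)] pmul_tid(2)[OF a(1)] ..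
  show "Cmp CC X Y Y (Ide CC Y) u = u"
    unfolding a(2) Ide_CC[OF o(2)] Cmp_CC[OF o(1,2,2) a(1) tid_in[OF o(2)]] pmul_tid(1)[OF a(1)] ..
next
  fix W X Y Z u v w assume o: "W \<in> Ob" "X \<in> Ob" "Y \<in> Ob" "Z \<in> Ob"
    and "u \<in> Hom CC W X" "v \<in> Hom CC X Y" "w \<in> Hom CC Y Z"
  then obtain a b c where a: "a \<in> tmaps (tw W) (tw X)" "u = cls W X a" and b: "b \<in> tmaps (tw X) (tw Y)" "v = cls X Y b"
    and c: "c \<in> tmaps (tw Y) (tw Z)" "w = cls Y Z c" by (auto simp: Hom_CC)
  show "Cmp CC W Y Z w (Cmp CC W X Y v u) = Cmp CC W X Z (Cmp CC X Y Z w v) u"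
    unfolding a(2) b(2) c(2) Cmp_CC[OF o(1,2,3) a(1) b(1)] Cmp_CC[OF o(2,3,4) b(1) c(1)]
      Cmp_CC[OF o(1,3,4) tmaps_comp[OF b(1) a(1)] c(1)] Cmp_CC[OF o(1,2,4) a(1) tmaps_comp[OF c(1) b(1)]]
    by (simp add: mult.assoc)
qed

lemma heq_iso:
  assumes "E \<in> Ob" "E' \<in> Ob" "heq (tw E) (tw E')"
  shows "\<exists>u. is_iso CC E E' u"
proof -
  obtain a b where a: "a \<in> tmaps (tw E) (tw E')" and b: "b \<in> tmaps (tw E') (tw E)"
    and h: "thtp (tw E) (tw E) (pmul b a) (tid (tw E))" "thtp (tw E') (tw E') (pmul a b) (tid (tw E'))"
    using assms(3) by (auto simp: heq_def)
  have "is_iso CC E E' (cls E E' a)"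
    unfolding is_iso_def Hom_CC[OF assms(1,2)] Hom_CC[OF assms(2,1)] Ide_CC[OF assms(1)] Ide_CC[OF assms(2)]
  proof (intro conjI bexI)
    show "Cmp CC E E' E (cls E' E b) (cls E E' a) = cls E E (tid (tw E))"
      unfolding Cmp_CC[OF assms(1,2,1) a b] cls_eq[OF assms(1,1) tmaps_comp[OF b a] tid_in[OF assms(1)]] by (rule h)
    show "Cmp CC E' E E' (cls E E' a) (cls E' E b) = cls E' E' (tid (tw E'))"
      unfolding Cmp_CC[OF assms(2,1,2) b a] cls_eq[OF assms(2,2) tmaps_comp[OF a b] tid_in[OF assms(2)]] by (rule h)
  qed (use a b in auto)
  then show ?thesis ..
qed

text \<open>Every twisted factorization on initial segments comes from an equivariant one.\<close>

definition un :: "nat \<Rightarrow> nat \<Rightarrow> tmf \<Rightarrow> matrix_fact" where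
  "un n0 n1 t = \<lparr>rk0 = n0, rk1 = n1, act0 = (\<lambda>x\<in>GG. if x = (\<lambda>i. 1) then 1\<^sub>m n0 else bk n0 n0 (snd (X0 t))),
     act1 = (\<lambda>x\<in>GG. if x = (\<lambda>i. 1) then 1\<^sub>m n1 else bk n1 n1 (snd (X1 t))),
     dif0 = bk n1 n0 (phi t), dif1 = bk n0 n1 (psi t)\<rparr>"

lemma structure_of_tmod:
  assumes "tmod X" "fst X = {..<r}" "g = (\<lambda>i. 1) \<Longrightarrow> snd X = cproj (fst X)"
  defines "\<rho> \<equiv> (\<lambda>x\<in>GG. if x = (\<lambda>i. 1) then 1\<^sub>m r else bk r r (snd X))"
  shows "equivariant_structure V GG r \<rho>" "emb (\<rho> g) = snd X"
proof -
  have v: "snd X \<in> vhom {..<r} {..<r}" "snd X * G (snd X) = cproj {..<r}" using assms by (auto simp: tmod_def)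
  have one: "bk r r (cproj {..<r}) = 1\<^sub>m r" by (auto simp: bk_def one_mat_def intro!: cong_mat)
  have \<rho>: "\<rho> (\<lambda>i. 1) = 1\<^sub>m r" "\<rho> g = bk r r (snd X)" using assms(2,3) one by (auto simp: \<rho>_def)
  show e: "emb (\<rho> g) = snd X" by (simp add: \<rho> emb_bk[OF v(1)])
  have c: "\<rho> g \<in> carrier_mat r r" by (simp add: \<rho>)
  have "emb (\<rho> g * map_mat \<gamma> (\<rho> g)) = emb (1\<^sub>m r)" using c e v by (simp add: emb_mult emb_map emb_one)
  then have sq: "\<rho> g * map_mat \<gamma> (\<rho> g) = 1\<^sub>m r" using emb_inj[of "\<rho> g * map_mat \<gamma> (\<rho> g)" r r "1\<^sub>m r"] c by simp
  have id: "map_mat (diag_act (\<lambda>i. 1)) A = A" for A by (rule eq_matI) (auto simp: diag_act_one)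
  have m1: "map_mat \<gamma> (1\<^sub>m r) = 1\<^sub>m r" by (rule eq_matI) (auto simp: gam.one)
  have p: "\<rho> g \<in> poly_mats V r r" "1\<^sub>m r \<in> poly_mats V r r"
    using emb_vhom[OF c] v e by (auto simp: poly_mats_iff)
  have gg': "(\<lambda>i. g i * g i) = (\<lambda>i. 1)" using gg by auto
  show "equivariant_structure V GG r \<rho>"
    unfolding equivariant_structure_def
  proof (intro conjI)
    show "\<rho> \<in> GG \<rightarrow>\<^sub>E poly_mats V r r" using p \<rho> by (auto simp: \<rho>_def)
    show "\<forall>g\<in>GG. \<forall>h\<in>GG. \<rho> (\<lambda>i. g i * h i) = \<rho> g * map_mat (diag_act g) (\<rho> h)"
      using \<rho>(1) c sq by (auto simp: id act m1 gg')
  qed (rule \<rho>)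
qed

lemma un:
  assumes t: "is_mf t" "fst (X0 t) = {..<n0}" "fst (X1 t) = {..<n1}"
    and 1: "g = (\<lambda>i. 1) \<Longrightarrow> snd (X0 t) = cproj {..<n0} \<and> snd (X1 t) = cproj {..<n1}"
  shows "un n0 n1 t \<in> Ob" "tw (un n0 n1 t) = t"
proof -
  have m: "tmod (X0 t)" "tmod (X1 t)" using t by (auto simp: is_mf_def)
  note s0 = structure_of_tmod[OF m(1) t(2)] and s1 = structure_of_tmod[OF m(2) t(3)]
  have v: "phi t \<in> vhom {..<n0} {..<n1}" "psi t \<in> vhom {..<n1} {..<n0}"
    using t thom_vhom[of "phi t" "X0 t" "X1 t"] thom_vhom[of "psi t" "X1 t" "X0 t"] by (simp_all add: is_mf_def)
  let ?E = "un n0 n1 t"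
  have rk: "rk0 ?E = n0" "rk1 ?E = n1" "dif0 ?E = bk n1 n0 (phi t)" "dif1 ?E = bk n0 n1 (psi t)" by (simp_all add: un_def)
  have g1: "g = (\<lambda>i. 1) \<Longrightarrow> snd (X0 t) = cproj (fst (X0 t))" "g = (\<lambda>i. 1) \<Longrightarrow> snd (X1 t) = cproj (fst (X1 t))"
    using 1 t(2,3) by simp_all
  have a: "emb (act0 ?E g) = snd (X0 t)" "emb (act1 ?E g) = snd (X1 t)"
    using s0(2)[OF g1(1)] s1(2)[OF g1(2)] by (simp_all only: un_def matrix_fact.simps)
  show tw: "tw ?E = t"
  proof (rule tmf.equality)
    show "X0 (tw ?E) = X0 t" "X1 (tw ?E) = X1 t"
      using a t(2,3) by (simp_all only: tw_simps rk) (simp_all add: prod_eq_iff)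
    show "phi (tw ?E) = phi t" "psi (tw ?E) = psi t"
      by (simp_all only: tw_simps rk emb_bk[OF v(1)] emb_bk[OF v(2)])
  qed simp
  have st: "equivariant_structure V GG n0 (act0 ?E)" "equivariant_structure V GG n1 (act1 ?E)"
    using s0(1)[OF g1(1)] s1(1)[OF g1(2)] by (simp_all only: un_def matrix_fact.simps)
  have x: "({..<n0}, emb (act0 ?E g)) = X0 t" "({..<n1}, emb (act1 ?E g)) = X1 t"
    using arg_cong[OF tw, of X0] arg_cong[OF tw, of X1] by (simp_all only: tw_simps rk)
  have e: "dif1 ?E * dif0 ?E = f \<cdot>\<^sub>m 1\<^sub>m n0" "dif0 ?E * dif1 ?E = f \<cdot>\<^sub>m 1\<^sub>m n1"
  proof -
    have "emb (dif1 ?E * dif0 ?E) = emb (f \<cdot>\<^sub>m 1\<^sub>m n0)" "emb (dif0 ?E * dif1 ?E) = emb (f \<cdot>\<^sub>m 1\<^sub>m n1)"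
      using t by (simp_all add: rk emb_mult emb_bk[OF v(1)] emb_bk[OF v(2)] emb_smult_one is_mf_def)
    then show "dif1 ?E * dif0 ?E = f \<cdot>\<^sub>m 1\<^sub>m n0" "dif0 ?E * dif1 ?E = f \<cdot>\<^sub>m 1\<^sub>m n1"
      using emb_inj[of "dif1 ?E * dif0 ?E" n0 n0 "f \<cdot>\<^sub>m 1\<^sub>m n0"] emb_inj[of "dif0 ?E * dif1 ?E" n1 n1 "f \<cdot>\<^sub>m 1\<^sub>m n1"]
      by (simp_all add: rk mult_carrier_mat[OF bk_carrier bk_carrier])
  qed
  show "?E \<in> Ob"
    unfolding mf_objects_def mem_Collect_eq rk(1,2)
    using st e t(1) unfolding equiv_maps_iff[OF st] equiv_maps_iff[OF st(2,1)] x rk(3,4) emb_bk[OF v(1)] emb_bk[OF v(2)]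
    by (simp add: is_mf_def)
qed

end

section \<open>The two charts have the same small factorizations\<close>

context dehom
begin

lemma thom_eigen:
  assumes a: "a \<in> thom (de X) (de Y)" and ij: "i \<in> fst Y" "j \<in> fst X"
  shows "\<gamma> (ent a i j) = const (if even (snd Y i - snd X j) then 1 else eps) * ent a i j"
proof -
  have "a * TD X = TD Y * G a" using a by (simp add: thom_def)
  then have "ent (a * TD X) i j = ent (TD Y * G a) i j" by simp
  then have "const (sg (snd Y i)) * \<gamma> (ent a i j) = const (sg (snd X j)) * ent a i j"
    using ij by (simp add: TD_def ent_cmap mult.commute)
  then have "const (sg (snd Y i)) * (const (sg (snd Y i)) * \<gamma> (ent a i j)) = const (sg (snd Y i)) * (const (sg (snd X j)) * ent a i j)"
    by simp
  moreover have "sg (snd Y i) * sg (snd X j) = sg (snd Y i - snd X j)" using eps by (auto simp: sg_def)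
  ultimately show ?thesis
    unfolding sg_def[symmetric] by (simp add: const_mult[symmetric] sg_mult flip: mult.assoc)
qed

lemma demf_tmaps:
  assumes "b0 \<in> gh P P'" "b1 \<in> gh Q Q'" "b1 * a = a' * b0" "b0 * b = b' * b1"
  shows "(DD b0, DD b1) \<in> tmaps (demf P Q a b) (demf P' Q' a' b')"
  using assms(1,2) arg_cong[OF assms(3), of DD] arg_cong[OF assms(4), of DD]
  by (simp add: tmaps_def hom_de del.cmap_mult)

lemma demf_thtp:
  assumes "k0 \<in> gh P Q'" "k1 \<in> gh Q P'" "b0 = c0 + (b' * k0 + k1 * a)" "b1 = c1 + (a' * k1 + k0 * b)"
  shows "thtp (demf P Q a b) (demf P' Q' a' b') (DD b0, DD b1) (DD c0, DD c1)"
  unfolding thtp_def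
proof (intro bexI conjI)
  show "DD k0 \<in> thom (X0 (demf P Q a b)) (X1 (demf P' Q' a' b'))" "DD k1 \<in> thom (X1 (demf P Q a b)) (X0 (demf P' Q' a' b'))"
    using assms(1,2) by (simp_all add: hom_de)
qed (simp_all add: assms(3,4) del.cmap_add del.cmap_mult)

text \<open>Renumbering a finite basis by an initial segment.\<close>

lemma relabel:
  assumes "finite (fst P)"
  shows "\<exists>r P' \<sigma> \<tau>. fst P' = {..<r} \<and> snd P' ` fst P' \<subseteq> snd P ` fst P \<and> \<sigma> \<in> gh P' P \<and> \<tau> \<in> gh P P' \<and>
    \<tau> * \<sigma> = cproj (fst P') \<and> \<sigma> * \<tau> = cproj (fst P)"
proof -
  define r where "r = card (fst P)"
  obtain h where h: "bij_betw h {..<r} (fst P)"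
    using ex_bij_betw_nat_finite[OF assms] by (auto simp: r_def atLeast0LessThan)
  have hP: "h k \<in> fst P" if "k < r" for k using h that by (auto simp: bij_betw_def)
  have hi: "h k = h l \<longleftrightarrow> k = l" if "k < r" "l < r" for k l using h that by (auto simp: bij_betw_def inj_on_def)
  define P' where "P' = ({..<r}, \<lambda>k. snd P (h k))"
  define \<sigma> where "\<sigma> = CMat (\<lambda>i j. if j < r \<and> i = h j then 1 else 0 :: mpoly)"
  define \<tau> where "\<tau> = CMat (\<lambda>i j. if i < r \<and> j = h i then 1 else 0 :: mpoly)"
  have \<sigma>: "ent \<sigma> i j = (if j < r \<and> i = h j then 1 else 0)" for i j
    unfolding \<sigma>_def by (rule ent_CMat_within[where S = "\<lambda>j. {h j}"]) (auto split: if_splits)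
  have \<tau>: "ent \<tau> i j = (if i < r \<and> j = h i then 1 else 0)" for i j
    unfolding \<tau>_def by (rule ent_CMat_within[where S = "\<lambda>_. {..<r}"]) (auto split: if_splits)
  have r\<sigma>: "ent (x * \<sigma>) i j = (if j < r then ent x i (h j) else 0)" for x i j
    by (subst ent_mult_superset[of "{h j}"]) (auto simp: \<sigma> split: if_splits)
  have 1: "\<tau> * \<sigma> = cproj {..<r}"
    by (rule cmat_eqI) (auto simp: r\<sigma> \<tau> hi)
  have 2: "\<sigma> * \<tau> = cproj (fst P)"
  proof (rule cmat_eqI)
    fix i j
    show "ent (\<sigma> * \<tau>) i j = ent (cproj (fst P)) i j"
    proof (cases "j \<in> fst P")
      case True
      then obtain k where k: "k < r" "j = h k" using h by (auto simp: bij_betw_def)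
      have "ent (\<sigma> * \<tau>) i j = (\<Sum>l\<in>{k}. ent \<sigma> i l * ent \<tau> l j)"
        by (rule ent_mult_superset) (use k hi in \<open>auto simp: \<tau> split: if_splits\<close>)
      then show ?thesis using k True by (auto simp: \<sigma> \<tau>)
    next
      case False
      then have "ent (\<sigma> * \<tau>) i j = (\<Sum>l\<in>{}. ent \<sigma> i l * ent \<tau> l j)"
        by (intro ent_mult_superset) (use hP in \<open>auto simp: \<tau> split: if_splits\<close>)
      then show ?thesis using False by auto
    qed
  qed
  have "\<sigma> \<in> gh P' P" "\<tau> \<in> gh P P'" by (rule ghomI; auto simp: \<sigma> \<tau> P'_def hP split: if_splits)+
  moreover have "snd P' ` fst P' \<subseteq> snd P ` fst P" using hP by (auto simp: P'_def)
  ultimately show ?thesis using 1 2 by (intro exI[of _ r] exI[of _ P'] exI[of _ \<sigma>] exI[of _ \<tau>]) (auto simp: P'_def)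
qed

lemma heq_relabel:
  assumes g: "gmf P Q a b"
  shows "\<exists>P' Q' a' b' r s. fst P' = {..<r} \<and> fst Q' = {..<s} \<and> snd P' ` fst P' \<subseteq> snd P ` fst P \<and>
    snd Q' ` fst Q' \<subseteq> snd Q ` fst Q \<and> gmf P' Q' a' b' \<and> heq (demf P Q a b) (demf P' Q' a' b')"
proof -
  have fin: "finite (fst P)" "finite (fst Q)" and a: "a \<in> gh P Q" and b: "b \<in> gh Q P"
    and ba: "b * a = scal F * cproj (fst P)" and ab: "a * b = scal F * cproj (fst Q)"
    using g by (auto simp: gmf_def)
  obtain r P' \<sigma> \<tau> where P: "fst P' = {..<r}" "snd P' ` fst P' \<subseteq> snd P ` fst P" "\<sigma> \<in> gh P' P" "\<tau> \<in> gh P P'"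
    "\<tau> * \<sigma> = cproj (fst P')" "\<sigma> * \<tau> = cproj (fst P)" using relabel[OF fin(1)] by blast
  obtain s Q' \<sigma>' \<tau>' where Q: "fst Q' = {..<s}" "snd Q' ` fst Q' \<subseteq> snd Q ` fst Q" "\<sigma>' \<in> gh Q' Q" "\<tau>' \<in> gh Q Q'"
    "\<tau>' * \<sigma>' = cproj (fst Q')" "\<sigma>' * \<tau>' = cproj (fst Q)" using relabel[OF fin(2)] by blast
  define a' b' where "a' = \<tau>' * (a * \<sigma>)" and "b' = \<tau> * (b * \<sigma>')"
  have a': "a' \<in> gh P' Q'" and b': "b' \<in> gh Q' P'"
    unfolding a'_def b'_def by (intro ghom_comp[OF Q(4)] ghom_comp[OF a P(3)] ghom_comp[OF P(4)] ghom_comp[OF b Q(3)])+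
  note i = ghom_idL[OF a] ghom_idL[OF b] ghom_idR[OF a] ghom_idR[OF b] ghom_idL[OF P(3)] ghom_idL[OF Q(3)]
    ghom_idR[OF P(4)] ghom_idR[OF Q(4)] ghom_idL[OF a, THEN assoc_rule] ghom_idL[OF b, THEN assoc_rule]
    ghom_idR[OF a, THEN assoc_rule] ghom_idR[OF b, THEN assoc_rule]
  note m = mult.assoc P(5,6) Q(5,6) P(5,6)[THEN assoc_rule] Q(5,6)[THEN assoc_rule] ba ab ba[THEN assoc_rule] ab[THEN assoc_rule]
  have "b' * a' = scal F * cproj (fst P')" "a' * b' = scal F * cproj (fst Q')"
    unfolding a'_def b'_def by (simp_all add: m i scal_comm2[of \<tau>] scal_comm2[of \<tau>'])
  then have g': "gmf P' Q' a' b'" using a' b' P(1) Q(1) by (simp add: gmf_def)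
  have 1: "(DD \<tau>, DD \<tau>') \<in> tmaps (demf P Q a b) (demf P' Q' a' b')"
    by (rule demf_tmaps[OF P(4) Q(4)]) (simp_all add: a'_def b'_def m i)
  have 2: "(DD \<sigma>, DD \<sigma>') \<in> tmaps (demf P' Q' a' b') (demf P Q a b)"
    by (rule demf_tmaps[OF P(3) Q(3)]) (simp_all add: a'_def b'_def m i ghom_idL[OF ghom_comp[OF a P(3)]] ghom_idL[OF ghom_comp[OF b Q(3)]])
  have "pmul (DD \<sigma>, DD \<sigma>') (DD \<tau>, DD \<tau>') = tid (demf P Q a b)" "pmul (DD \<tau>, DD \<tau>') (DD \<sigma>, DD \<sigma>') = tid (demf P' Q' a' b')"
    using P(5,6) Q(5,6) by (simp_all add: tid_def flip: del.cmap_mult)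
  then have "heq (demf P Q a b) (demf P' Q' a' b')"
    unfolding heq_def using 1 2 thtp_refl by (intro bexI[OF _ 1] bexI[OF _ 2]) simp
  then show ?thesis using P(1,2) Q(1,2) g' by blast
qed

end

context cox
begin

abbreviation gflip :: "nat \<Rightarrow> complex" where "gflip \<equiv> (\<lambda>m. if m \<in> {1, N + 1} then - 1 else 1)"

lemma diag_act_gflip: "diag_act gflip = flip"
proof -
  have "(\<Prod>i\<in>supp m. gflip i ^ look m i) = (- 1) ^ (look m 1 + look m (N + 1))" for m :: monom
  proof -
    have "(\<Prod>i\<in>supp m. gflip i ^ look m i) = (\<Prod>i\<in>supp m \<union> {1, N + 1}. gflip i ^ look m i)"
      by (rule prod.mono_neutral_left) (auto simp: in_keys_iff)
    also have "\<dots> = (\<Prod>i\<in>{1, N + 1}. gflip i ^ look m i)"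
      by (rule prod.mono_neutral_right) auto
    finally show ?thesis using N1 by (simp add: power_add)
  qed
  then show ?thesis by (simp only: diag_act_eq flip_def)
qed

sublocale uc: cyclic_two VV ident fbar "\<lambda>_. 1"
  by unfold_locales (auto simp: diag_act_one ident_def)

sublocale yc: cyclic_two VV flip ff gflip
  by unfold_locales (rule diag_act_gflip, simp)

text \<open>
  The lift of a monomial in \<open>u\<close> and \<open>t\<close> of the right parity to degree \<open>c\<close> needs the power of \<open>y\<close> with exponent half the
  excess of its degree over \<open>c\<close>. For \<open>c \<le> 1\<close> this exponent is never negative.
\<close>

lemma y_lift_entry:
  assumes "q \<in> poly_ring VV" "flip q = const (if even c then 1 else - 1) * q" "c \<le> 1"
  shows "\<exists>p\<in>hmg cdeg WW c. del_y p = q"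
  unfolding hmg_def del_y_def
proof (rule mono_op_surj[OF even_span[OF assms(1,2)]])
  fix m :: monom assume "m \<in> {m. supp m \<subseteq> VV \<and> (even c \<longleftrightarrow> even (look m 1 + look m (N + 1)))}"
  then have m: "supp m \<subseteq> VV" "even (int (look m 1) + int (look m (N + 1)) - c)" by auto
  have z: "look m 0 = 0" using m(1) by (auto simp: in_keys_iff)
  define b where "b = (int (look m 1) + int (look m (N + 1)) - c) div 2"
  have b: "2 * b = int (look m 1) + int (look m (N + 1)) - c" using m(2) by (simp add: b_def)
  have b0: "b \<ge> 0" using b assms(3) by linarith
  define m' where "m' = m - mon 1 (look m 1) + mon 0 (look m 1) + mon 1 (nat b)"
  have lm': "look m' i = (if i = 0 then look m 1 else if i = 1 then nat b else look m i)" for i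
    using z by (auto simp: m'_def lookup_add lookup_minus lookup_single when_def)
  show "\<exists>m'\<in>hmons cdeg WW c. m' - mon 0 (look m' 0) - mon 1 (look m' 1) + mon 1 (look m' 0) = m \<and> (1::complex) \<noteq> 0"
  proof (intro bexI conjI)
    show "m' - mon 0 (look m' 0) - mon 1 (look m' 1) + mon 1 (look m' 0) = m"
      by (rule lookup_eqI, subst look_y) (auto simp: lm' z)
    have s: "supp m' \<subseteq> WW"
    proof
      fix i assume "i \<in> supp m'"
      then have "i = 0 \<or> i = 1 \<or> i \<in> supp m" by (auto simp: in_keys_iff lm' split: if_splits)
      then show "i \<in> WW" using m(1) by auto
    qed
    show "m' \<in> hmons cdeg WW c"
      using s N b b0 by (simp add: hmons_def mdeg_cox lm')
  qed simp
qed

text \<open>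
  Between modules with weights in \<open>{0, 1}\<close> all degrees are at most \<open>1\<close>, so that equivariant matrices over the chart
  \<open>y = 1\<close> are the same as graded matrices. This replaces the descent of the other chart.
\<close>

lemma y_lift:
  assumes a: "a \<in> y.thom (y.de X) (y.de Y)" and sm: "small X" "small Y"
  shows "\<exists>b\<in>y.gh X Y. y.DD b = a"
proof -
  have av: "a \<in> y.vhom (fst X) (fst Y)" using y.thom_vhom[OF a] by simp
  have "\<exists>p\<in>hmg cdeg WW (snd Y i - snd X j). del_y p = ent a i j" if "i \<in> fst Y" "j \<in> fst X" for i j
  proof (rule y_lift_entry)
    show "ent a i j \<in> poly_ring VV" using av by (simp add: y.vhom_def)
    show "flip (ent a i j) = const (if even (snd Y i - snd X j) then 1 else - 1) * ent a i j"
      by (rule y.thom_eigen[OF a that])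
    have "snd Y i \<in> {0, 1}" "snd X j \<in> {0, 1}" using sm that unfolding small_def by blast+
    then show "snd Y i - snd X j \<le> 1" by auto
  qed
  then obtain p where p: "\<And>i j. i \<in> fst Y \<Longrightarrow> j \<in> fst X \<Longrightarrow> p i j \<in> hmg cdeg WW (snd Y i - snd X j) \<and> del_y (p i j) = ent a i j"
    by metis
  have fin: "finite (fst Y)" using sm by (simp add: small_def)
  define b where "b = CMat (\<lambda>i j. if i \<in> fst Y \<and> j \<in> fst X then p i j else 0)"
  have b: "ent b i j = (if i \<in> fst Y \<and> j \<in> fst X then p i j else 0)" for i j
    unfolding b_def by (rule ent_CMat_within[where S = "\<lambda>_. fst Y"]) (auto simp: fin split: if_splits)
  show ?thesis
  proof (rule bexI)
    show "b \<in> y.gh X Y" by (rule ghomI) (use p in \<open>auto simp: b split: if_splits\<close>)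
    show "y.DD b = a"
    proof (rule cmat_eqI)
      fix i j show "ent (y.DD b) i j = ent a i j"
        using p[of i j] av by (cases "i \<in> fst Y \<and> j \<in> fst X") (auto simp: ent_cmap b y.vhom_def)
    qed
  qed
qed

lemma gh_FF: "scal FF * cproj (fst X) \<in> y.gh X X"
  by (rule ghom_scal[OF ghom_id FF]) auto

text \<open>The chart \<open>y = 1\<close> only sees the parity of the weights.\<close>

lemma y_small:
  assumes g: "y.gmf P Q a b"
  shows "\<exists>P' Q' a' b'. y.gmf P' Q' a' b' \<and> small P' \<and> small Q' \<and> y.demf P' Q' a' b' = y.demf P Q a b"
proof -
  define md :: "gmod \<Rightarrow> gmod" where "md X = (fst X, \<lambda>i. snd X i mod 2)" for X
  have fst_md [simp]: "fst (md X) = fst X" for X by (simp add: md_def)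
  have md: "y.de (md X) = y.de X" for X
    unfolding y.de_def y.TD_def y.sg_def by (simp add: md_def even_iff_mod_2_eq_zero cong: if_cong)
  have fin: "finite (fst P)" "finite (fst Q)" and a: "a \<in> y.gh P Q" and b: "b \<in> y.gh Q P"
    and ba: "b * a = scal FF * cproj (fst P)" and ab: "a * b = scal FF * cproj (fst Q)"
    using g by (auto simp: y.gmf_def)
  have sm: "small (md P)" "small (md Q)" using fin by (auto simp: small_def md_def)
  have "y.DD a \<in> y.thom (y.de (md P)) (y.de (md Q))" "y.DD b \<in> y.thom (y.de (md Q)) (y.de (md P))"
    using y.hom_de[OF a] y.hom_de[OF b] by (simp_all only: md)
  then obtain a' b' where a': "a' \<in> y.gh (md P) (md Q)" "y.DD a' = y.DD a" and b': "b' \<in> y.gh (md Q) (md P)" "y.DD b' = y.DD b"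
    using y_lift sm by meson
  have "b' * a' = scal FF * cproj (fst (md P))"
    by (rule y.hom_inj_eq[OF ghom_comp[OF b'(1) a'(1)] gh_FF]) (simp only: y.del.cmap_mult a' b' ba[symmetric] fst_md)
  moreover have "a' * b' = scal FF * cproj (fst (md Q))"
    by (rule y.hom_inj_eq[OF ghom_comp[OF a'(1) b'(1)] gh_FF]) (simp only: y.del.cmap_mult a' b' ab[symmetric] fst_md)
  ultimately have "y.gmf (md P) (md Q) a' b'" using fin a' b' by (simp add: y.gmf_def)
  moreover have "y.demf (md P) (md Q) a' b' = y.demf P Q a b" by (simp only: y.demf_def md a'(2) b'(2))
  ultimately show ?thesis using sm by blast
qed

lemma u_narrow:
  assumes "u.gmf P Q a b"
    "\<And>j. j \<in> fst P \<Longrightarrow> lo \<le> snd P j \<and> snd P j \<le> lo + 1 + int n" "\<And>j. j \<in> fst Q \<Longrightarrow> lo \<le> snd Q j \<and> snd Q j \<le> lo + 1 + int n"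
  shows "\<exists>P' Q' a' b'. u.gmf P' Q' a' b' \<and> u.heq (u.demf P Q a b) (u.demf P' Q' a' b') \<and>
    (\<forall>j\<in>fst P'. lo \<le> snd P' j \<and> snd P' j \<le> lo + 1) \<and> (\<forall>j\<in>fst Q'. lo \<le> snd Q' j \<and> snd Q' j \<le> lo + 1)"
  using assms
proof (induction n arbitrary: P Q a b)
  case 0
  then show ?case using u.heq_refl[OF u.is_mf_demf[OF 0(1)]] by (intro exI[of _ P] exI[of _ Q] exI[of _ a] exI[of _ b]) simp
next
  case (Suc n)
  obtain P' Q' a' b' where r: "u.gmf P' Q' a' b'" "u.heq (u.demf P Q a b) (u.demf P' Q' a' b')"
    "\<forall>j\<in>fst P'. lo \<le> snd P' j \<and> snd P' j \<le> (lo + 2 + int n) - 1" "\<forall>j\<in>fst Q'. lo \<le> snd Q' j \<and> snd Q' j \<le> (lo + 2 + int n) - 1"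
    using reduce_top[OF Suc.prems(1), of "lo + 2 + int n" lo] Suc.prems(2,3) by (auto simp: algebra_simps)
  obtain P'' Q'' a'' b'' where s: "u.gmf P'' Q'' a'' b''" "u.heq (u.demf P' Q' a' b') (u.demf P'' Q'' a'' b'')"
    "\<forall>j\<in>fst P''. lo \<le> snd P'' j \<and> snd P'' j \<le> lo + 1" "\<forall>j\<in>fst Q''. lo \<le> snd Q'' j \<and> snd Q'' j \<le> lo + 1"
    using Suc.IH[OF r(1)] r(3,4) by (auto simp: algebra_simps)
  show ?case using s u.heq_trans[OF r(2) s(2)] by blast
qed

lemma u_small:
  assumes g: "u.gmf P Q a b"
  shows "\<exists>P' Q' a' b'. u.gmf P' Q' a' b' \<and> small P' \<and> small Q' \<and> u.heq (u.demf P Q a b) (u.demf P' Q' a' b')"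
proof -
  define S where "S = insert 0 (snd P ` fst P \<union> snd Q ` fst Q)"
  have fin: "finite S" using g by (simp add: S_def u.gmf_def)
  define lo where "lo = Min S"
  define n where "n = nat (Max S - lo)"
  have "lo \<le> x \<and> x \<le> lo + 1 + int n" if "x \<in> S" for x
    using Min_le[OF fin that] Max_ge[OF fin that] by (simp add: lo_def n_def)
  then obtain P' Q' a' b' where r: "u.gmf P' Q' a' b'" "u.heq (u.demf P Q a b) (u.demf P' Q' a' b')"
    "\<forall>j\<in>fst P'. lo \<le> snd P' j \<and> snd P' j \<le> lo + 1" "\<forall>j\<in>fst Q'. lo \<le> snd Q' j \<and> snd Q' j \<le> lo + 1"
    using u_narrow[OF g, of lo n] unfolding S_def by blast
  have f: "fst (up p X) = fst X" for p X by (simp add: up_def)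
  have de: "u.de (up p X) = u.de X" for p X unfolding u.de_def u.TD_def u.sg_def f by (simp cong: if_cong)
  have fin': "finite (fst P')" "finite (fst Q')" using r(1) by (auto simp: u.gmf_def)
  have sm: "small (up (- lo) X)" if X: "finite (fst X)" "\<forall>j\<in>fst X. lo \<le> snd X j \<and> snd X j \<le> lo + 1" for X
  proof -
    have "snd X i - lo \<in> {0, 1}" if "i \<in> fst X" for i
    proof -
      have "lo \<le> snd X i \<and> snd X i \<le> lo + 1" using X(2) that by blast
      then have "snd X i = lo \<or> snd X i = lo + 1" by linarith
      then show ?thesis by auto
    qed
    then show ?thesis using X(1) by (simp add: small_def up_def)
  qed
  have "small (up (- lo) P')" "small (up (- lo) Q')"
    by (rule sm[OF fin'(1) r(3)], rule sm[OF fin'(2) r(4)])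
  moreover have "u.gmf (up (- lo) P') (up (- lo) Q') a' b'" using r(1) by (simp add: u.gmf_def up_gh f)
  moreover have "u.demf (up (- lo) P') (up (- lo) Q') a' b' = u.demf P' Q' a' b'" by (simp only: u.demf_def de)
  ultimately show ?thesis using r(2) by metis
qed

type_synonym small_mf = "gmod \<times> gmod \<times> mpoly cmat \<times> mpoly cmat"

text \<open>
  The common objects are the graded factorizations with weights in \<open>{0, 1}\<close>. The index sets are initial segments,
  so that both charts turn them into matrices with dimensions.
\<close>

definition ZZ :: "small_mf set" where
  "ZZ = {(P, Q, a, b). u.gmf P Q a b \<and> small P \<and> small Q \<and> fst P = {..<card (fst P)} \<and> fst Q = {..<card (fst Q)}}"

definition zA :: "small_mf \<Rightarrow> small_mf \<Rightarrow> (mpoly cmat \<times> mpoly cmat) set" where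
  "zA = (\<lambda>(P, Q, a, b) (P', Q', a', b'). {x. fst x \<in> u.gh P P' \<and> snd x \<in> u.gh Q Q' \<and>
     snd x * a = a' * fst x \<and> fst x * b = b' * snd x})"

definition zu :: "small_mf \<Rightarrow> tmf" where "zu = (\<lambda>(P, Q, a, b). u.demf P Q a b)"
definition zy :: "small_mf \<Rightarrow> tmf" where "zy = (\<lambda>(P, Q, a, b). y.demf P Q a b)"
definition zi :: "small_mf \<Rightarrow> mpoly cmat \<times> mpoly cmat" where "zi z = (cproj (fst (fst z)), cproj (fst (fst (snd z))))"

definition Fu :: "small_mf \<Rightarrow> matrix_fact" where "Fu z = uc.un (card (fst (fst z))) (card (fst (fst (snd z)))) (zu z)"
definition Fy :: "small_mf \<Rightarrow> matrix_fact" where "Fy z = yc.un (card (fst (fst z))) (card (fst (fst (snd z)))) (zy z)"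

lemma TD_u: "u.TD X = cproj (fst X)"
  unfolding u.TD_def u.sg_def by (rule cmat_eqI) (simp add: single_one)

lemma Fu: assumes "z \<in> ZZ" shows "Fu z \<in> uc.Ob" "uc.tw (Fu z) = zu z"
proof -
  obtain P Q a b where z: "z = (P, Q, a, b)" by (cases z)
  have g: "u.gmf P Q a b" "fst P = {..<card (fst P)}" "fst Q = {..<card (fst Q)}" using assms by (auto simp: ZZ_def z)
  have 1: "u.is_mf (u.demf P Q a b)" by (rule u.is_mf_demf[OF g(1)])
  have 2: "fst (X0 (u.demf P Q a b)) = {..<card (fst P)}" "fst (X1 (u.demf P Q a b)) = {..<card (fst Q)}" using g by simp_all
  have 3: "snd (X0 (u.demf P Q a b)) = cproj {..<card (fst P)} \<and> snd (X1 (u.demf P Q a b)) = cproj {..<card (fst Q)}"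
    using g(2,3) by (simp add: TD_u)
  show "Fu z \<in> uc.Ob" "uc.tw (Fu z) = zu z"
    unfolding Fu_def zu_def z fst_conv snd_conv case_prod_conv by (rule uc.un[OF 1 2 3])+
qed

lemma Fy: assumes "z \<in> ZZ" shows "Fy z \<in> yc.Ob" "yc.tw (Fy z) = zy z"
proof -
  obtain P Q a b where z: "z = (P, Q, a, b)" by (cases z)
  have g: "y.gmf P Q a b" "fst P = {..<card (fst P)}" "fst Q = {..<card (fst Q)}" using assms by (auto simp: ZZ_def z)
  have 1: "y.is_mf (y.demf P Q a b)" by (rule y.is_mf_demf[OF g(1)])
  have 2: "fst (X0 (y.demf P Q a b)) = {..<card (fst P)}" "fst (X1 (y.demf P Q a b)) = {..<card (fst Q)}" using g by simp_all
  have 3: "snd (X0 (y.demf P Q a b)) = cproj {..<card (fst P)} \<and> snd (X1 (y.demf P Q a b)) = cproj {..<card (fst Q)}"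
    if "gflip = (\<lambda>i. 1)"
    using fun_cong[OF that, of 1] by simp
  show "Fy z \<in> yc.Ob"
    unfolding Fy_def zy_def z fst_conv snd_conv case_prod_conv by (rule yc.un(1)[OF 1 2 3])
  show "yc.tw (Fy z) = zy z"
    unfolding Fy_def zy_def z fst_conv snd_conv case_prod_conv by (rule yc.un(2)[OF 1 2 3])
qed

abbreviation uD :: "mpoly cmat \<times> mpoly cmat \<Rightarrow> mpoly cmat \<times> mpoly cmat" where "uD x \<equiv> (u.DD (fst x), u.DD (snd x))"
abbreviation yD :: "mpoly cmat \<times> mpoly cmat \<Rightarrow> mpoly cmat \<times> mpoly cmat" where "yD x \<equiv> (y.DD (fst x), y.DD (snd x))"

lemma uD_in: "x \<in> zA z z' \<Longrightarrow> uD x \<in> u.tmaps (zu z) (zu z')"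
  unfolding zA_def zu_def by (cases z; cases z') (simp add: u.demf_tmaps)

lemma yD_in: "x \<in> zA z z' \<Longrightarrow> yD x \<in> y.tmaps (zy z) (zy z')"
  unfolding zA_def zy_def by (cases z; cases z') (simp add: y.demf_tmaps)

lemma uD_full:
  assumes "z \<in> ZZ" "z' \<in> ZZ" "t \<in> u.tmaps (zu z) (zu z')"
  shows "\<exists>x\<in>zA z z'. u.thtp (zu z) (zu z') t (uD x)"
proof -
  obtain P Q a b P' Q' a' b' where z: "z = (P, Q, a, b)" "z' = (P', Q', a', b')" by (cases z, cases z')
  have "\<exists>b0 b1. b0 \<in> u.gh P P' \<and> b1 \<in> u.gh Q Q' \<and> b1 * a = a' * b0 \<and> b0 * b = b' * b1 \<and>
      u.thtp (u.demf P Q a b) (u.demf P' Q' a' b') t (u.DD b0, u.DD b1)"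
    by (rule chart_full) (use assms in \<open>auto simp: ZZ_def zu_def z\<close>)
  then obtain b0 b1 where "b0 \<in> u.gh P P'" "b1 \<in> u.gh Q Q'" "b1 * a = a' * b0" "b0 * b = b' * b1"
      "u.thtp (u.demf P Q a b) (u.demf P' Q' a' b') t (u.DD b0, u.DD b1)" by blast
  then show ?thesis by (intro bexI[of _ "(b0, b1)"]) (simp_all add: zA_def zu_def z)
qed

lemma yD_full:
  assumes "z \<in> ZZ" "z' \<in> ZZ" "t \<in> y.tmaps (zy z) (zy z')"
  shows "\<exists>x\<in>zA z z'. yD x = t"
proof -
  obtain P Q a b P' Q' a' b' where z: "z = (P, Q, a, b)" "z' = (P', Q', a', b')" by (cases z, cases z')
  have g: "a \<in> y.gh P Q" "b \<in> y.gh Q P" "a' \<in> y.gh P' Q'" "b' \<in> y.gh Q' P'" "small P" "small Q" "small P'" "small Q'"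
    using assms(1,2) by (auto simp: ZZ_def z u.gmf_def)
  obtain t0 t1 where t: "t = (t0, t1)" "t0 \<in> y.thom (y.de P) (y.de P')" "t1 \<in> y.thom (y.de Q) (y.de Q')"
    "t1 * y.DD a = y.DD a' * t0" "t0 * y.DD b = y.DD b' * t1"
    using assms(3) by (auto simp: zy_def z y.tmaps_def)
  obtain b0 where b0: "b0 \<in> y.gh P P'" "y.DD b0 = t0" using y_lift[OF t(2)] g by blast
  obtain b1 where b1: "b1 \<in> y.gh Q Q'" "y.DD b1 = t1" using y_lift[OF t(3)] g by blast
  have "b1 * a = a' * b0"
    by (rule y.hom_inj_eq[OF ghom_comp[OF b1(1) g(1)] ghom_comp[OF g(3) b0(1)]]) (simp only: y.del.cmap_mult b0 b1 t)
  moreover have "b0 * b = b' * b1"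
    by (rule y.hom_inj_eq[OF ghom_comp[OF b0(1) g(2)] ghom_comp[OF g(4) b1(1)]]) (simp only: y.del.cmap_mult b0 b1 t)
  ultimately show ?thesis using b0 b1 t(1) by (intro bexI[of _ "(b0, b1)"]) (simp_all add: zA_def z)
qed

text \<open>In either chart, a homotopy between the images of graded maps comes from a graded homotopy.\<close>

lemma same_homotopy:
  assumes "z \<in> ZZ" "z' \<in> ZZ" and x: "x \<in> zA z z'" and w: "w \<in> zA z z'"
  shows "u.thtp (zu z) (zu z') (uD x) (uD w) \<longleftrightarrow> y.thtp (zy z) (zy z') (yD x) (yD w)"
proof -
  obtain P Q a b P' Q' a' b' where z: "z = (P, Q, a, b)" "z' = (P', Q', a', b')" by (cases z, cases z')
  obtain x0 x1 w0 w1 where xw: "x = (x0, x1)" "w = (w0, w1)" by (cases x, cases w)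
  have G: "u.gmf P Q a b" "u.gmf P' Q' a' b'" and sm: "small P" "small Q" "small P'" "small Q'"
    using assms(1,2) by (auto simp: ZZ_def z)
  have g: "a \<in> y.gh P Q" "b \<in> y.gh Q P" "a' \<in> y.gh P' Q'" "b' \<in> y.gh Q' P'"
    using G by (auto simp: u.gmf_def)
  have xg: "x0 \<in> u.gh P P'" "x1 \<in> u.gh Q Q'" "w0 \<in> u.gh P P'" "w1 \<in> u.gh Q Q'"
    using x w by (auto simp: zA_def z xw)
  let ?H = "\<exists>k0 k1. k0 \<in> u.gh P Q' \<and> k1 \<in> u.gh Q P' \<and> x0 = w0 + (b' * k0 + k1 * a) \<and> x1 = w1 + (a' * k1 + k0 * b)"
  have u1: "?H \<Longrightarrow> u.thtp (zu z) (zu z') (uD x) (uD w)"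
    unfolding zu_def z xw using u.demf_thtp by (auto simp: u.demf_thtp)
  have y1: "?H \<Longrightarrow> y.thtp (zy z) (zy z') (yD x) (yD w)"
    unfolding zy_def z xw using y.demf_thtp by (auto simp: y.demf_thtp)
  have y2: ?H if "y.thtp (zy z) (zy z') (yD x) (yD w)"
  proof -
    note th = that
    obtain h0 h1 where h: "h0 \<in> y.thom (y.de P) (y.de Q')" "h1 \<in> y.thom (y.de Q) (y.de P')"
      "y.DD x0 = y.DD w0 + (y.DD b' * h0 + h1 * y.DD a)" "y.DD x1 = y.DD w1 + (y.DD a' * h1 + h0 * y.DD b)"
      using th by (auto simp: zy_def z xw y.thtp_def)
    obtain k0 where k0: "k0 \<in> y.gh P Q'" "y.DD k0 = h0" using y_lift[OF h(1) sm(1,4)] by blast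
    obtain k1 where k1: "k1 \<in> y.gh Q P'" "y.DD k1 = h1" using y_lift[OF h(2) sm(2,3)] by blast
    have "x0 = w0 + (b' * k0 + k1 * a)"
      by (rule y.hom_inj_eq[OF xg(1) ghom_add[OF xg(3) ghom_add[OF ghom_comp[OF g(4) k0(1)] ghom_comp[OF k1(1) g(1)]]]])
         (simp only: y.del.cmap_mult y.del.cmap_add k0 k1 h)
    moreover have "x1 = w1 + (a' * k1 + k0 * b)"
      by (rule y.hom_inj_eq[OF xg(2) ghom_add[OF xg(4) ghom_add[OF ghom_comp[OF g(3) k1(1)] ghom_comp[OF k0(1) g(2)]]]])
         (simp only: y.del.cmap_mult y.del.cmap_add k0 k1 h)
    ultimately show ?H using k0(1) k1(1) by blast
  qed
  have u2: ?H if th: "u.thtp (zu z) (zu z') (uD x) (uD w)"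
  proof -
    have t: "u.thtp (u.demf P Q a b) (u.demf P' Q' a' b') (u.DD (x0 - w0), u.DD (x1 - w1)) (0, 0)"
    proof -
      obtain h0 h1 where h: "h0 \<in> u.thom (u.de P) (u.de Q')" "h1 \<in> u.thom (u.de Q) (u.de P')"
        "u.DD x0 = u.DD w0 + (u.DD b' * h0 + h1 * u.DD a)" "u.DD x1 = u.DD w1 + (u.DD a' * h1 + h0 * u.DD b)"
        using th by (auto simp: zu_def z xw u.thtp_def)
      show ?thesis
        unfolding u.thtp_def by (intro bexI[of _ h0] bexI[of _ h1]) (simp_all add: h u.del.cmap_diff)
    qed
    obtain k0 k1 where "k0 \<in> u.gh P Q'" "k1 \<in> u.gh Q P'" "x0 - w0 = b' * k0 + k1 * a" "x1 - w1 = a' * k1 + k0 * b"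
      using chart_faithful[OF G sm ghom_diff[OF xg(1,3)] ghom_diff[OF xg(2,4)] t] by blast
    then show ?H by (metis add.commute diff_add_cancel)
  qed
  show ?thesis using u1 u2 y1 y2 by blast
qed

lemma zi_in: "z \<in> ZZ \<Longrightarrow> zi z \<in> zA z z"
proof -
  assume "z \<in> ZZ"
  then obtain P Q a b where z: "z = (P, Q, a, b)" "u.gmf P Q a b" by (cases z) (auto simp: ZZ_def)
  then have "a \<in> u.gh P Q" "b \<in> u.gh Q P" by (simp_all add: u.gmf_def)
  then show ?thesis
    using ghom_idL[of a cdeg WW P Q] ghom_idR[of a cdeg WW P Q] ghom_idL[of b cdeg WW Q P] ghom_idR[of b cdeg WW Q P]
    by (simp add: zA_def zi_def z)
qed

lemma zA_comp: assumes "x \<in> zA z z'" "w \<in> zA z' z''" shows "(fst w * fst x, snd w * snd x) \<in> zA z z''"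
proof -
  obtain P Q a b P' Q' a' b' P'' Q'' a'' b'' where z: "z = (P, Q, a, b)" "z' = (P', Q', a', b')" "z'' = (P'', Q'', a'', b'')"
    by (cases z, cases z', cases z'')
  have x: "fst x \<in> u.gh P P'" "snd x \<in> u.gh Q Q'" "snd x * a = a' * fst x" "fst x * b = b' * snd x"
    using assms(1) by (auto simp: zA_def z)
  have w: "fst w \<in> u.gh P' P''" "snd w \<in> u.gh Q' Q''" "snd w * a' = a'' * fst w" "fst w * b' = b'' * snd w"
    using assms(2) by (auto simp: zA_def z)
  show ?thesis
    using ghom_comp[OF w(1) x(1)] ghom_comp[OF w(2) x(2)] by (simp add: zA_def z mult.assoc x(3,4) w(3,4)[THEN assoc_rule])
qed

lemma relabel_small:
  assumes "u.gmf P Q a b" "small P" "small Q"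
  shows "\<exists>z\<in>ZZ. u.heq (u.demf P Q a b) (zu z)" "\<exists>z\<in>ZZ. y.heq (y.demf P Q a b) (zy z)"
proof -
  have s: "small P'" if "fst P' = {..<r}" "snd P' ` fst P' \<subseteq> snd P ` fst P" "small P" for P P' :: gmod and r
  proof -
    have "snd P' i \<in> {0, 1}" if i: "i \<in> fst P'" for i
    proof -
      obtain j where "j \<in> fst P" "snd P' i = snd P j" using \<open>snd P' ` fst P' \<subseteq> snd P ` fst P\<close> i by blast
      then show ?thesis using \<open>small P\<close> by (simp add: small_def)
    qed
    then show ?thesis using that(1) by (simp add: small_def)
  qed
  obtain P' Q' a' b' r n where 1: "fst P' = {..<r}" "fst Q' = {..<n}" "snd P' ` fst P' \<subseteq> snd P ` fst P"
    "snd Q' ` fst Q' \<subseteq> snd Q ` fst Q" "u.gmf P' Q' a' b'" "u.heq (u.demf P Q a b) (u.demf P' Q' a' b')"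
    using u.heq_relabel[OF assms(1)] by (elim exE conjE) (rule that)
  have "(P', Q', a', b') \<in> ZZ" using 1(1,2,5) s[OF 1(1,3) assms(2)] s[OF 1(2,4) assms(3)] by (simp add: ZZ_def)
  moreover have "u.heq (u.demf P Q a b) (zu (P', Q', a', b'))" using 1(6) by (simp add: zu_def)
  ultimately show "\<exists>z\<in>ZZ. u.heq (u.demf P Q a b) (zu z)" by blast
  obtain P' Q' a' b' r n where 2: "fst P' = {..<r}" "fst Q' = {..<n}" "snd P' ` fst P' \<subseteq> snd P ` fst P"
    "snd Q' ` fst Q' \<subseteq> snd Q ` fst Q" "y.gmf P' Q' a' b'" "y.heq (y.demf P Q a b) (y.demf P' Q' a' b')"
    using y.heq_relabel[OF assms(1)] by (elim exE conjE) (rule that)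
  have "(P', Q', a', b') \<in> ZZ" using 2(1,2,5) s[OF 2(1,3) assms(2)] s[OF 2(2,4) assms(3)] by (simp add: ZZ_def)
  moreover have "y.heq (y.demf P Q a b) (zy (P', Q', a', b'))" using 2(6) by (simp add: zy_def)
  ultimately show "\<exists>z\<in>ZZ. y.heq (y.demf P Q a b) (zy z)" by blast
qed

lemma u_ess: assumes "E \<in> uc.Ob" shows "\<exists>z\<in>ZZ. \<exists>i. is_iso uc.CC (Fu z) E i"
proof -
  have m: "u.is_mf (uc.tw E)" by (rule uc.is_mf_tw[OF assms])
  have "act1 E (\<lambda>_. 1) = 1\<^sub>m (rk1 E)" using assms by (simp add: mf_objects_def equivariant_structure_def)
  then have t: "snd (X1 (uc.tw E)) = cproj (fst (X1 (uc.tw E)))" by (simp add: emb_one)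
  obtain P Q a b where 1: "u.gmf P Q a b" "u.heq (uc.tw E) (u.demf P Q a b)" using u.graded_model[OF m t] by blast
  obtain P' Q' a' b' where 2: "u.gmf P' Q' a' b'" "small P'" "small Q'" "u.heq (u.demf P Q a b) (u.demf P' Q' a' b')"
    using u_small[OF 1(1)] by blast
  obtain z where z: "z \<in> ZZ" "u.heq (u.demf P' Q' a' b') (zu z)" using relabel_small(1)[OF 2(1-3)] by blast
  have "u.heq (uc.tw (Fu z)) (uc.tw E)"
    unfolding Fu(2)[OF z(1)] by (rule u.heq_sym[OF u.heq_trans[OF 1(2) u.heq_trans[OF 2(4) z(2)]]])
  then show ?thesis using uc.heq_iso[OF Fu(1)[OF z(1)] assms] z(1) by blast
qed

lemma y_ess: assumes "E \<in> yc.Ob" shows "\<exists>z\<in>ZZ. \<exists>i. is_iso yc.CC (Fy z) E i"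
proof -
  have m: "y.is_mf (yc.tw E)" by (rule yc.is_mf_tw[OF assms])
  have "\<exists>Q0 Q1 a b. y.gmf Q0 Q1 a b \<and> y.heq (yc.tw E) (y.demf Q0 Q1 a b)"
    by (rule y.graded_model[OF m]) simp
  then obtain P Q a b where 1: "y.gmf P Q a b" "y.heq (yc.tw E) (y.demf P Q a b)" by blast
  obtain P' Q' a' b' where 2: "y.gmf P' Q' a' b'" "small P'" "small Q'" "y.demf P' Q' a' b' = y.demf P Q a b"
    using y_small[OF 1(1)] by blast
  obtain z where z: "z \<in> ZZ" "y.heq (y.demf P' Q' a' b') (zy z)" using relabel_small(2)[OF 2(1-3)] by blast
  have "y.heq (yc.tw (Fy z)) (yc.tw E)"
    unfolding Fy(2)[OF z(1)] by (rule y.heq_sym[OF y.heq_trans[OF 1(2) z(2)[unfolded 2(4)]]])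
  then show ?thesis using yc.heq_iso[OF Fy(1)[OF z(1)] assms] z(1) by blast
qed

lemma uD_tid: "z \<in> ZZ \<Longrightarrow> uD (zi z) = u.tid (zu z)"
  by (cases z) (simp add: zi_def zu_def u.tid_def)
lemma yD_tid: "z \<in> ZZ \<Longrightarrow> yD (zi z) = y.tid (zy z)"
  by (cases z) (simp add: zi_def zy_def y.tid_def)

theorem charts_equivalent: "equivalent_categories uc.CC yc.CC"
proof -
  interpret span uc.CC yc.CC ZZ zA zi "\<lambda>_ _ _ w x. (fst w * fst x, snd w * snd x)"
    Fu "\<lambda>z z' x. uc.cls (Fu z) (Fu z') (uD x)" Fy "\<lambda>z z' x. yc.cls (Fy z) (Fy z') (yD x)"
  proof (intro span.intro span_axioms.intro)
    show "category uc.CC" "category yc.CC" by (intro category.intro uc.category_CC yc.category_CC)+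
  next
    fix z assume z: "z \<in> ZZ"
    show "Fu z \<in> Obj uc.CC" unfolding uc.Obj_CC by (rule Fu(1)[OF z])
    show "Fy z \<in> Obj yc.CC" unfolding yc.Obj_CC by (rule Fy(1)[OF z])
    show "zi z \<in> zA z z" by (rule zi_in[OF z])
    show "uc.cls (Fu z) (Fu z) (uD (zi z)) = Ide uc.CC (Fu z)"
      unfolding uc.Ide_CC[OF Fu(1)[OF z]] Fu(2)[OF z] uD_tid[OF z] ..
    show "yc.cls (Fy z) (Fy z) (yD (zi z)) = Ide yc.CC (Fy z)"
      unfolding yc.Ide_CC[OF Fy(1)[OF z]] Fy(2)[OF z] yD_tid[OF z] ..
  next
    fix x z assume xz: "x \<in> ZZ" "z \<in> ZZ"
    show "(\<lambda>t. uc.cls (Fu x) (Fu z) (uD t)) ` zA x z = Hom uc.CC (Fu x) (Fu z)"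
      unfolding uc.Hom_CC[OF Fu(1)[OF xz(1)] Fu(1)[OF xz(2)]]
    proof (intro equalityI subsetI)
      fix c assume "c \<in> (\<lambda>t. uc.cls (Fu x) (Fu z) (uD t)) ` zA x z"
      then show "c \<in> uc.cls (Fu x) (Fu z) ` u.tmaps (uc.tw (Fu x)) (uc.tw (Fu z))"
        unfolding Fu(2)[OF xz(1)] Fu(2)[OF xz(2)] using uD_in by blast
    next
      fix c assume "c \<in> uc.cls (Fu x) (Fu z) ` u.tmaps (uc.tw (Fu x)) (uc.tw (Fu z))"
      then obtain t where t: "t \<in> u.tmaps (zu x) (zu z)" "c = uc.cls (Fu x) (Fu z) t"
        unfolding Fu(2)[OF xz(1)] Fu(2)[OF xz(2)] by blast
      obtain d where d: "d \<in> zA x z" "u.thtp (zu x) (zu z) t (uD d)" using uD_full[OF xz t(1)] by blast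
      have "uc.cls (Fu x) (Fu z) t = uc.cls (Fu x) (Fu z) (uD d)"
        using uc.cls_eq[OF Fu(1)[OF xz(1)] Fu(1)[OF xz(2)], unfolded Fu(2)[OF xz(1)] Fu(2)[OF xz(2)], OF t(1) uD_in[OF d(1)]] d(2) by blast
      then show "c \<in> (\<lambda>t. uc.cls (Fu x) (Fu z) (uD t)) ` zA x z" using d(1) t(2) by blast
    qed
    show "(\<lambda>t. yc.cls (Fy x) (Fy z) (yD t)) ` zA x z = Hom yc.CC (Fy x) (Fy z)"
      unfolding yc.Hom_CC[OF Fy(1)[OF xz(1)] Fy(1)[OF xz(2)]] Fy(2)[OF xz(1)] Fy(2)[OF xz(2)]
    proof (intro equalityI subsetI)
      fix c assume "c \<in> (\<lambda>t. yc.cls (Fy x) (Fy z) (yD t)) ` zA x z"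
      then show "c \<in> yc.cls (Fy x) (Fy z) ` y.tmaps (zy x) (zy z)" using yD_in by blast
    next
      fix c assume "c \<in> yc.cls (Fy x) (Fy z) ` y.tmaps (zy x) (zy z)"
      then show "c \<in> (\<lambda>t. yc.cls (Fy x) (Fy z) (yD t)) ` zA x z" using yD_full[OF xz] by blast
    qed
    fix s t assume st: "s \<in> zA x z" "t \<in> zA x z"
    show "uc.cls (Fu x) (Fu z) (uD s) = uc.cls (Fu x) (Fu z) (uD t) \<longleftrightarrow> yc.cls (Fy x) (Fy z) (yD s) = yc.cls (Fy x) (Fy z) (yD t)"
      using uc.cls_eq[OF Fu(1)[OF xz(1)] Fu(1)[OF xz(2)], unfolded Fu(2)[OF xz(1)] Fu(2)[OF xz(2)], OF uD_in[OF st(1)] uD_in[OF st(2)]]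
        yc.cls_eq[OF Fy(1)[OF xz(1)] Fy(1)[OF xz(2)], unfolded Fy(2)[OF xz(1)] Fy(2)[OF xz(2)], OF yD_in[OF st(1)] yD_in[OF st(2)]]
        same_homotopy[OF xz st] by blast
  next
    fix x w z s t assume o: "x \<in> ZZ" "w \<in> ZZ" "z \<in> ZZ" and st: "s \<in> zA x w" "t \<in> zA w z"
    show "(fst t * fst s, snd t * snd s) \<in> zA x z" by (rule zA_comp[OF st])
    have tu: "uD s \<in> u.tmaps (uc.tw (Fu x)) (uc.tw (Fu w))" "uD t \<in> u.tmaps (uc.tw (Fu w)) (uc.tw (Fu z))"
      unfolding Fu(2)[OF o(1)] Fu(2)[OF o(2)] Fu(2)[OF o(3)] by (rule uD_in[OF st(1)], rule uD_in[OF st(2)])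
    show "uc.cls (Fu x) (Fu z) (uD (fst t * fst s, snd t * snd s)) =
        Cmp uc.CC (Fu x) (Fu w) (Fu z) (uc.cls (Fu w) (Fu z) (uD t)) (uc.cls (Fu x) (Fu w) (uD s))"
      unfolding uc.Cmp_CC[OF Fu(1)[OF o(1)] Fu(1)[OF o(2)] Fu(1)[OF o(3)] tu] by (simp only: fst_conv snd_conv u.del.cmap_mult)
    have ty: "yD s \<in> y.tmaps (yc.tw (Fy x)) (yc.tw (Fy w))" "yD t \<in> y.tmaps (yc.tw (Fy w)) (yc.tw (Fy z))"
      unfolding Fy(2)[OF o(1)] Fy(2)[OF o(2)] Fy(2)[OF o(3)] by (rule yD_in[OF st(1)], rule yD_in[OF st(2)])
    show "yc.cls (Fy x) (Fy z) (yD (fst t * fst s, snd t * snd s)) =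
        Cmp yc.CC (Fy x) (Fy w) (Fy z) (yc.cls (Fy w) (Fy z) (yD t)) (yc.cls (Fy x) (Fy w) (yD s))"
      unfolding yc.Cmp_CC[OF Fy(1)[OF o(1)] Fy(1)[OF o(2)] Fy(1)[OF o(3)] ty] by (simp only: fst_conv snd_conv y.del.cmap_mult)
  next
    fix E assume "E \<in> Obj uc.CC"
    then show "\<exists>z\<in>ZZ. \<exists>i. is_iso uc.CC (Fu z) E i" unfolding uc.Obj_CC by (rule u_ess)
  next
    fix E assume "E \<in> Obj yc.CC"
    then show "\<exists>z\<in>ZZ. \<exists>i. is_iso yc.CC (Fy z) E i" unfolding yc.Obj_CC by (rule y_ess)
  qed
  show ?thesis by (rule span_equivalence)
qed

end

section \<open>The polynomial of the other chart\<close>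

lemma cyclic_group_two:
  assumes "\<And>i. g i * g i = 1"
  shows "cyclic_group g = {\<lambda>i. 1, g}"
proof -
  have nz: "g i \<noteq> 0" for i using assms[of i] by auto
  have ev: "g i powi (2 * k) = 1" for i k
    using assms[of i] by (simp add: power_int_mult power2_eq_square)
  have od: "g i powi (2 * k + 1) = g i" for i k using ev[of i k] nz[of i] by (simp add: power_int_add)
  have "(\<lambda>i. g i powi n) \<in> {\<lambda>i. 1, g}" for n
  proof (cases "even n")
    case True
    then obtain k where "n = 2 * k" by (rule evenE)
    then show ?thesis by (simp add: ev)
  next
    case False
    then obtain k where "n = 2 * k + 1" by (rule oddE)
    then have "(\<lambda>i. g i powi n) = g" by (simp only: od)
    then show ?thesis by simp
  qed
  moreover have "(\<lambda>i. 1) = (\<lambda>i. g i powi 0)" "g = (\<lambda>i. g i powi 1)" by simp_all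
  ultimately show ?thesis unfolding cyclic_group_def by blast
qed

abbreviation dbl :: "mpoly \<Rightarrow> mpoly" where "dbl \<equiv> mono_op (\<lambda>m. m + mon 1 (look m 1)) (\<lambda>_. 1)"

lemma poly_subst_square: "poly_subst (var(1 := var 1 ^ 2)) p = dbl p"
proof -
  have "const (look p m) * (\<Prod>i\<in>supp m. (var(1 := var 1 ^ 2)) i ^ look m i) = mon (m + mon 1 (look m 1)) (look p m)" for m
  proof -
    have "(var(1 := var 1 ^ 2)) i ^ look m i = mon (mon i (if i = 1 then 2 * look m i else look m i)) 1" for i
    proof (cases "i = 1")
      case True
      have "(var 1 ^ 2) ^ look m 1 = mon (mon 1 (2 * look m 1)) 1" unfolding power_mult[symmetric] by (rule var_power)
      then show ?thesis by (simp only: True fun_upd_same if_True refl)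
    qed (simp add: var_power)
    moreover have "(\<Sum>i\<in>supp m. mon i (if i = 1 then 2 * look m i else look m i)) = m + mon 1 (look m 1)"
    proof (rule poly_mapping_eqI)
      fix k
      have "look (\<Sum>i\<in>supp m. mon i (if i = 1 then 2 * look m i else look m i)) k =
          (\<Sum>i\<in>supp m. if i = k then (if k = 1 then 2 * look m k else look m k) else 0)"
        by (auto simp: lookup_sum lookup_single when_def intro!: sum.cong)
      also have "\<dots> = look (m + mon 1 (look m 1)) k"
        by (auto simp: lookup_add lookup_single in_keys_iff)
      finally show "look (\<Sum>i\<in>supp m. mon i (if i = 1 then 2 * look m i else look m i)) k = look (m + mon 1 (look m 1)) k" .
    qed
    ultimately show ?thesis by (simp add: prod_mon mult_single)
  qed
  then show ?thesis by (simp add: poly_subst_def poly_hom_def mono_op_def)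
qed

lemma partial_deriv_eq: "partial_deriv i = mono_op (\<lambda>m. m - mon i 1) (\<lambda>m. of_nat (look m i))"
  by (intro ext) (simp add: partial_deriv_def mono_op_def)

lemma poly_eval_superset:
  assumes "finite A" "supp p \<subseteq> A"
  shows "poly_eval x p = (\<Sum>m\<in>A. look p m * (\<Prod>i\<in>supp m. x i ^ look m i))"
  unfolding poly_eval_def poly_hom_def
  by (rule sum.mono_neutral_left) (use assms in \<open>auto simp: in_keys_iff\<close>)

lemma poly_eval_add: "poly_eval x (p + q) = poly_eval x p + poly_eval x q"
proof -
  have "supp (p + q) \<subseteq> supp p \<union> supp q" by (rule Poly_Mapping.keys_add)
  then show ?thesis
    using poly_eval_superset[of "supp p \<union> supp q" "p + q" x] poly_eval_superset[of "supp p \<union> supp q" p x]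
      poly_eval_superset[of "supp p \<union> supp q" q x]
    by (simp add: lookup_add ring_distribs sum.distrib)
qed

lemma poly_eval_0 [simp]: "poly_eval x 0 = 0" by (simp add: poly_eval_def poly_hom_def)

lemma poly_eval_mon:
  assumes "finite V" "supp m \<subseteq> V"
  shows "poly_eval x (mon m c) = c * (\<Prod>i\<in>V. x i ^ look m i)"
proof -
  have "(\<Prod>i\<in>supp m. x i ^ look m i) = (\<Prod>i\<in>V. x i ^ look m i)"
    by (rule prod.mono_neutral_left) (use assms in \<open>auto simp: in_keys_iff\<close>)
  then show ?thesis using poly_eval_superset[of "{m}" "mon m c" x] by simp
qed

lemma supp_minus: "supp (m - n) \<subseteq> supp m" for m n :: monom
  by (auto simp: in_keys_iff lookup_minus)

text \<open>A polynomial without linear terms has a critical point at the origin.\<close>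

lemma eval_deriv_zero:
  assumes "p \<in> span_of {m. supp m \<subseteq> V \<and> m \<noteq> mon i 1}" "finite V" "\<And>k. k \<in> V \<Longrightarrow> x k = 0"
  shows "poly_eval x (partial_deriv i p) = 0"
  using assms(1)
proof (induction rule: span_of_induct)
  case (mon m c)
  show ?case
  proof (cases "look m i = 0")
    case False
    have "m - mon i 1 \<noteq> 0"
    proof
      assume z: "m - mon i 1 = 0"
      have "look m k = look (mon i 1) k" for k
        using arg_cong[OF z, of "\<lambda>n. look n k"] False by (auto simp: lookup_minus lookup_single when_def split: if_splits)
      then have "m = mon i 1" by (intro poly_mapping_eqI)
      then show False using mon by simp
    qed
    then obtain k where k: "k \<in> supp (m - mon i 1)" by fastforce
    have kV: "k \<in> V" using supp_minus[of m "mon i 1"] mon k by auto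
    moreover have "x k ^ look (m - mon i 1) k = 0" using k assms(3)[OF kV] by (simp add: in_keys_iff)
    ultimately
    have "(\<Prod>j\<in>V. x j ^ look (m - mon i 1) j) = 0" using assms(2) by (meson prod_zero)
    moreover have "supp (m - mon i 1) \<subseteq> V" using supp_minus[of m "mon i 1"] mon by auto
    ultimately show ?thesis using poly_eval_mon[OF assms(2), of "m - mon i 1" x] by (simp add: partial_deriv_eq)
  qed (simp add: partial_deriv_eq)
qed (simp_all add: partial_deriv_eq mono_op_add poly_eval_add)

text \<open>The chain rule for the substitution \<open>x\<^sub>1 \<mapsto> x\<^sub>1\<^sup>2\<close>.\<close>

lemma eval_deriv_dbl:
  fixes N :: nat
  assumes p: "p \<in> poly_ring {1..N}" and N: "N \<ge> 1" and x: "x 1 = s ^ 2"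
    and x': "x' 1 = s" "\<And>i. i \<in> {1..N} \<Longrightarrow> i \<noteq> 1 \<Longrightarrow> x' i = x i" and j: "j \<in> {1..N}"
  shows "poly_eval x' (partial_deriv j (dbl p)) = (if j = 1 then 2 * s else 1) * poly_eval x (partial_deriv j p)"
  using p[unfolded poly_ring_eq]
proof (induction rule: span_of_induct)
  case (mon m c)
  have m: "supp m \<subseteq> {1..N}" using mon by (simp add: mons_def)
  let ?d = "m + mon 1 (look m 1)"
  have s: "supp (m - mon j 1) \<subseteq> {1..N}" "supp (?d - mon j 1) \<subseteq> {1..N}"
    using supp_minus[of m "mon j 1"] supp_minus[of ?d "mon j 1"] m N by (auto simp: keys_add_nat split: if_splits)
  have split: "(\<Prod>i\<in>{1..N}. h i) = h 1 * (\<Prod>i\<in>{1..N} - {1}. h i)" for h :: "nat \<Rightarrow> complex"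
    by (rule prod.remove) (use N in auto)
  have rest: "(\<Prod>i\<in>{1..N} - {1}. x' i ^ look (?d - mon j 1) i) = (\<Prod>i\<in>{1..N} - {1}. x i ^ look (m - mon j 1) i)"
    by (rule prod.cong) (auto simp: x' lookup_minus lookup_add lookup_single)
  have L: "poly_eval x' (partial_deriv j (dbl (mon m c))) =
      of_nat (look ?d j) * c * (s ^ look (?d - mon j 1) 1 * (\<Prod>i\<in>{1..N} - {1}. x i ^ look (m - mon j 1) i))"
    using s by (simp add: partial_deriv_eq poly_eval_mon[of "{1..N}"] split rest x'(1))
  have R: "poly_eval x (partial_deriv j (mon m c)) =
      of_nat (look m j) * c * ((s ^ 2) ^ look (m - mon j 1) 1 * (\<Prod>i\<in>{1..N} - {1}. x i ^ look (m - mon j 1) i))"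
    using s by (simp add: partial_deriv_eq poly_eval_mon[of "{1..N}"] split x)
  show ?case
  proof (cases "j = 1")
    case False
    then have "s ^ look (?d - mon j 1) 1 = (s ^ 2) ^ look (m - mon j 1) 1" "look ?d j = look m j"
      by (simp_all add: lookup_minus lookup_add lookup_single mult_2 flip: power_mult)
    then show ?thesis unfolding L R using False by simp
  next
    case True
    show ?thesis
    proof (cases "look m 1")
      case 0
      then show ?thesis unfolding L R using True by (simp add: lookup_add)
    next
      case (Suc k)
      then have "look (?d - mon j 1) 1 = Suc (2 * k)" "look (m - mon j 1) 1 = k" "look ?d j = 2 * look m j"
        using True by (simp_all add: lookup_minus lookup_add lookup_single)
      then show ?thesis unfolding L R using True by (simp add: power_mult)
    qed
  qed
qed (simp_all add: partial_deriv_eq mono_op_add poly_eval_add ring_distribs)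

text \<open>
  The derivative \<open>2 y t\<close> of \<open>h + y t\<^sup>2\<close> shows that \<open>y = 0\<close> or \<open>t = 0\<close> at a critical point. In both cases, the point with
  \<open>t\<close> omitted and \<open>y\<close> replaced by its square root is critical for \<open>h(x\<^sub>1\<^sup>2, x\<^sub>2, \<dots>)\<close>, hence zero. Then the
  derivative by \<open>y\<close> gives \<open>t = 0\<close>, as \<open>h\<close> has no linear terms.
\<close>

lemma (in cox) nondegenerate_fbar:
  assumes nd: "nondegenerate {1..N} (dbl hp)" and nl: "hp \<in> span_of {m. \<forall>i. m \<noteq> mon i 1}"
  shows "nondegenerate VV fbar"
proof -
  have hp': "hp \<in> span_of {m. supp m \<subseteq> {1..N} \<and> (\<forall>i. m \<noteq> mon i 1)}"
    using hp nl by (auto simp: poly_ring_eq span_of_def mons_def)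
  define m2 where "m2 = (mon 1 1 + mon (N + 1) 2 :: monom)"
  have fb: "fbar = hp + mon m2 1" by (simp add: fbar_def m2_def var_power mult_single) (simp add: var_def mult_single)
  have lm2: "look m2 i = (if i = 1 then 1 else if i = N + 1 then 2 else 0)" for i
    using N1 by (auto simp: m2_def lookup_add lookup_single when_def)
  have sm2: "supp m2 \<subseteq> VV" using N by (auto simp: in_keys_iff lm2 split: if_splits)
  have ev2: "poly_eval x (partial_deriv i (mon m2 1)) = of_nat (look m2 i) * (\<Prod>j\<in>VV. x j ^ look (m2 - mon i 1) j)" for x i
    using poly_eval_mon[of VV "m2 - mon i 1" x "of_nat (look m2 i)"] supp_minus[of m2 "mon i 1"] sm2 by (simp add: partial_deriv_eq)
  have VVs: "VV = insert (N + 1) (insert 1 ({1..N} - {1}))" using N by auto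
  have pr: "(\<Prod>j\<in>VV. h j) = h (N + 1) * (h 1 * (\<Prod>j\<in>{1..N} - {1}. h j))" for h :: "nat \<Rightarrow> complex"
  proof -
    have "N + 1 \<notin> insert 1 ({1..N} - {1})" "1 \<notin> {1..N} - {1}" using N by auto
    then show ?thesis
      unfolding VVs by (simp only: prod.insert finite_insert finite_Diff finite_atLeastAtMost not_False_eq_True)
  qed
  have rest: "(\<Prod>j\<in>{1..N} - {1}. x j ^ look (m2 - mon i 1) j) = 1" for x :: "nat \<Rightarrow> complex" and i
    by (rule prod.neutral) (auto simp: lookup_minus lm2)
  have e: "poly_eval x (partial_deriv i fbar) = poly_eval x (partial_deriv i hp) +
      of_nat (look m2 i) * (x (N + 1) ^ look (m2 - mon i 1) (N + 1) * x 1 ^ look (m2 - mon i 1) 1)" for x i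
    unfolding fb partial_deriv_eq mono_op_add poly_eval_add ev2[unfolded partial_deriv_eq] pr rest by simp
  have eN: "partial_deriv (N + 1) hp = 0"
    using hp[unfolded poly_ring_eq]
  proof (induction rule: span_of_induct)
    case (mon m c)
    then have "look m (N + 1) = 0" by (auto simp: mons_def in_keys_iff subset_iff)
    then show ?case by (simp add: partial_deriv_eq)
  qed (simp_all add: partial_deriv_eq mono_op_add)
  have "{x. (\<forall>i. i \<notin> VV \<longrightarrow> x i = 0) \<and> (\<forall>i\<in>VV. poly_eval x (partial_deriv i fbar) = 0)} = {\<lambda>i. 0}"
  proof (intro equalityI subsetI)
    fix x :: "nat \<Rightarrow> complex" assume "x \<in> {\<lambda>i. 0}"
    then have x: "x i = 0" for i by simp
    have "poly_eval x (partial_deriv i fbar) = 0" for i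
    proof (rule eval_deriv_zero)
      have "m2 \<noteq> mon i 1"
      proof
        assume "m2 = mon i 1"
        then have "look m2 (N + 1) \<le> 1" by (simp add: lookup_single when_def)
        then show False using N1 by (simp add: lm2)
      qed
      moreover have "hp \<in> span_of {m. supp m \<subseteq> VV \<and> m \<noteq> mon i 1}" by (rule span_of_mono[OF hp']) auto
      ultimately show "fbar \<in> span_of {m. supp m \<subseteq> VV \<and> m \<noteq> mon i 1}"
        unfolding fb using sm2 by (intro span_of_add span_of_mon) auto
    qed (use x in auto)
    then show "x \<in> {x. (\<forall>i. i \<notin> VV \<longrightarrow> x i = 0) \<and> (\<forall>i\<in>VV. poly_eval x (partial_deriv i fbar) = 0)}" using x by simp
  next
    fix x assume "x \<in> {x. (\<forall>i. i \<notin> VV \<longrightarrow> x i = 0) \<and> (\<forall>i\<in>VV. poly_eval x (partial_deriv i fbar) = 0)}"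
    then have x: "x i = 0" if "i \<notin> VV" for i using that by auto
    have d: "poly_eval x (partial_deriv i fbar) = 0" if "i \<in> VV" for i
      using that \<open>x \<in> {x. _ x}\<close> by auto
    have dN: "2 * (x (N + 1) * x 1) = 0"
      using d[of "N + 1"] unfolding e eN using N N1 by (simp add: lm2 lookup_minus lookup_single)
    have d1: "poly_eval x (partial_deriv 1 hp) + x (N + 1) ^ 2 = 0"
      using d[of 1] unfolding e using N N1 by (simp add: lm2 lookup_minus lookup_single)
    have dj: "poly_eval x (partial_deriv j hp) = 0" if "j \<in> {1..N}" "j \<noteq> 1" for j
      using d[of j] that unfolding e by (simp add: lm2)
    define s where "s = csqrt (x 1)"
    have s2: "x 1 = s ^ 2" by (simp add: s_def)
    define x' where "x' = x(1 := s, N + 1 := 0)"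
    have x'1: "x' 1 = s" "x' i = x i" if "i \<in> {1..N}" "i \<noteq> 1" for i using N1 that by (auto simp: x'_def)
    have x'1': "x' 1 = s" using N1 by (auto simp: x'_def)
    have s0: "s = 0 \<or> x (N + 1) = 0" using dN s2 by auto
    have "poly_eval x' (partial_deriv j (dbl hp)) = 0" if j: "j \<in> {1..N}" for j
    proof (cases "j = 1")
      case True
      have "s * poly_eval x (partial_deriv 1 hp) = 0" using s0 d1 by auto
      then show ?thesis using eval_deriv_dbl[where p = hp and N = N and x = x and s = s and x' = x' and j = j, OF hp N s2 x'1' x'1(2) j] True by auto
    next
      case False
      then show ?thesis using eval_deriv_dbl[where p = hp and N = N and x = x and s = s and x' = x' and j = j, OF hp N s2 x'1' x'1(2) j] dj[OF j] by simp
    qed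
    moreover have "x' i = 0" if "i \<notin> {1..N}" for i using x[of i] that N by (auto simp: x'_def)
    ultimately have "x' \<in> {\<lambda>i. 0}" using nd unfolding nondegenerate_def by blast
    then have z: "x' i = 0" for i by simp
    have xz: "x i = 0" if "i \<in> {1..N}" for i
      using z[of i] z[of 1] x'1(2)[OF that] x'1' s2 by (cases "i = 1") auto
    have "poly_eval x (partial_deriv 1 hp) = 0"
      by (rule eval_deriv_zero[of _ "{1..N}"]) (use hp' xz in \<open>auto elim: span_of_mono\<close>)
    then have "x (N + 1) = 0" using d1 by simp
    moreover have "i \<notin> VV \<or> i \<in> {1..N} \<or> i = N + 1" for i by auto
    ultimately have "x i = 0" for i using x xz by blast
    then show "x \<in> {\<lambda>i. 0}" by auto
  qed
  then show ?thesis by (simp add: nondegenerate_def)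
qed

definition wt :: "nat set \<Rightarrow> (nat \<Rightarrow> rat) \<Rightarrow> monom \<Rightarrow> rat" where
  "wt V q m = (\<Sum>i\<in>V. of_nat (look m i) * q i)"

lemma wt_add: "wt V q (m + n) = wt V q m + wt V q n"
  by (simp add: wt_def lookup_add ring_distribs sum.distrib)

lemma wt_mon: "finite V \<Longrightarrow> i \<in> V \<Longrightarrow> wt V q (mon i k) = of_nat k * q i"
proof -
  assume *: "finite V" "i \<in> V"
  have "wt V q (mon i k) = (\<Sum>j\<in>V. if j = i then of_nat k * q i else 0)"
    unfolding wt_def by (rule sum.cong) (auto simp: lookup_single)
  then show ?thesis using * by simp
qed

lemma halve:
  assumes "p \<in> span_of {m. supp m \<subseteq> {1..N} \<and> even (look m 1) \<and> wt {1..N} q m = 1 \<and> card (supp m) \<ge> 2}"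
  shows "\<exists>h\<in>span_of {m. supp m \<subseteq> {1..N} \<and> wt {1..N} (q(1 := 2 * q 1)) m = 1 \<and> card (supp m) \<ge> 2}. dbl h = p"
proof (rule mono_op_surj[OF assms])
  fix n assume "n \<in> {m. supp m \<subseteq> {1..N} \<and> even (look m 1) \<and> wt {1..N} q m = 1 \<and> card (supp m) \<ge> 2}"
  then have n: "supp n \<subseteq> {1..N}" "even (look n 1)" "wt {1..N} q n = 1" "card (supp n) \<ge> 2" by auto
  obtain k where k: "look n 1 = 2 * k" using n(2) by (rule evenE)
  define m where "m = n - mon 1 k"
  have lm: "look m i = (if i = 1 then k else look n i)" for i
    by (auto simp: m_def lookup_minus lookup_single k)
  have s: "supp m = supp n" by (auto simp: in_keys_iff lm k split: if_splits)
  have "wt {1..N} (q(1 := 2 * q 1)) m = wt {1..N} q n"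
    unfolding wt_def by (rule sum.cong) (auto simp: lm k)
  moreover have "m + mon 1 (look m 1) = n"
    by (rule poly_mapping_eqI) (auto simp: lookup_add lookup_single lm k)
  ultimately show "\<exists>m\<in>{m. supp m \<subseteq> {1..N} \<and> wt {1..N} (q(1 := 2 * q 1)) m = 1 \<and> card (supp m) \<ge> 2}. m + mon 1 (look m 1) = n \<and> (1::complex) \<noteq> 0"
    using n s by (intro bexI[of _ m]) auto
qed

lemma var_mult: "var i ^ k * var j = mon (mon i k + mon j 1) 1"
  unfolding var_power by (simp add: var_def mult_single)

theorem theorem26:
  fixes N :: nat
    and \<kappa>\<^sub>0 \<kappa> :: "nat \<Rightarrow> nat"
    and a :: "nat \<Rightarrow> nat"
    and q :: "nat \<Rightarrow> rat"
    and A :: "nat set set"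
    and b :: "nat set \<Rightarrow> nat \<Rightarrow> nat"
    and \<epsilon> :: "nat set \<Rightarrow> complex"
    and f\<^sub>\<kappa>\<^sub>0 f_add f\<^sub>0 f :: mpoly
    and g :: "nat \<Rightarrow> complex"
    and G :: "(nat \<Rightarrow> complex) set"
  assumes loop: "loop_with_branches {1..N} \<kappa>\<^sub>0"
    and leaf: "is_leaf {1..N} \<kappa>\<^sub>0 1"
    and \<kappa>\<^sub>0_1: "\<kappa>\<^sub>0 1 = 2"
    and a_1: "a 1 \<ge> 1"
    and a_ge_2: "\<And>j. j \<in> {2..N} \<Longrightarrow> a j \<ge> 2"
    and f\<^sub>\<kappa>\<^sub>0: "f\<^sub>\<kappa>\<^sub>0 = var 1 ^ (2 * a 1) * var 2 + (\<Sum>j\<in>{2..N}. var j ^ a j * var (\<kappa>\<^sub>0 j))"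
    and q_1: "2 * of_nat (a 1) * q 1 + q 2 = 1"
    and q_j: "\<And>j. j \<in> {2..N} \<Longrightarrow> of_nat (a j) * q j + q (\<kappa>\<^sub>0 j) = 1"
    and A: "A = (\<Union>m\<in>loop_vertices {1..N} \<kappa>\<^sub>0.
              {J. J \<subseteq> in_nbrs (map_graph {1..N} \<kappa>\<^sub>0) m \<and> card J \<ge> 2})"
    and b_pos: "\<And>J s. J \<in> A \<Longrightarrow> s \<in> J \<Longrightarrow> b J s > 0"
    and b_weight: "\<And>J. J \<in> A \<Longrightarrow> (\<Sum>s\<in>J. of_nat (b J s) * q s) = 1"
    and \<epsilon>: "\<And>J. J \<in> A \<Longrightarrow> \<epsilon> J \<noteq> 0"
    and f_add: "f_add = (\<Sum>J\<in>A. const (\<epsilon> J) * (\<Prod>s\<in>J. var s ^ b J s))"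
    and f\<^sub>0: "f\<^sub>0 = f\<^sub>\<kappa>\<^sub>0 + f_add"
    and nondeg: "nondegenerate {1..N} f\<^sub>0"
    and \<kappa>: "\<kappa> = \<kappa>\<^sub>0(N + 1 := N + 1)"
    and f: "f = f\<^sub>\<kappa>\<^sub>0 + var (N + 1) ^ 2 + f_add"
    and g: "g = (\<lambda>m. if m \<in> {1, N + 1} then - 1 else 1)"
    and G: "G = cyclic_group g"
    and sym: "symmetry_group G f"
  shows "\<exists>fbar \<kappa>bar abar fbar_add.
    nondegenerate {1..N+1} fbar \<and>
    quasihomogeneous {1..N+1} (q(1 := 2 * q 1, N + 1 := 1 / 2 - q 1)) fbar \<and>
    \<kappa>bar \<in> {1..N+1} \<rightarrow> {1..N+1} \<and>
    map_graph {1..N+1} \<kappa>bar = add_arrow (map_graph {1..N+1} \<kappa>) (N + 1) 1 \<and>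
    (\<forall>j\<in>{1..N+1}. abar j > 0) \<and>
    fbar_add \<in> poly_ring {1..N} \<and>
    poly_subst (var(1 := var 1 ^ 2)) fbar_add = f_add \<and>
    fbar = (\<Sum>j\<in>{1..N+1}. var j ^ abar j * var (\<kappa>bar j)) + fbar_add \<and>
    orbifold_equivalent {1..N+1} f G fbar"
proof -
  let ?M = "\<lambda>j k. mon (mon j k + mon (\<kappa>\<^sub>0 j) 1) 1 :: mpoly"
  let ?Q = "q(1 := 2 * q 1, N + 1 := 1 / 2 - q 1)"
  have one: "1 \<in> {1..N}" and no_arrow: "in_nbrs (map_graph {1..N} \<kappa>\<^sub>0) 1 = {}" using leaf by (auto simp: is_leaf_def)
  have mapsto: "\<kappa>\<^sub>0 \<in> {1..N} \<rightarrow> {1..N}" using loop by (simp add: loop_with_branches_def)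
  have two: "2 \<in> {1..N}" using funcset_mem[OF mapsto one] by (simp only: \<kappa>\<^sub>0_1)
  then have N: "N \<ge> 2" by simp
  have not1: "\<kappa>\<^sub>0 j \<noteq> 1" if "j \<in> {1..N}" for j
    using no_arrow that \<kappa>\<^sub>0_1 by (cases "j = 1") (auto simp: in_nbrs_def map_graph_def)
  have \<kappa>j: "\<kappa>\<^sub>0 j \<in> {2..N}" if "j \<in> {1..N}" for j using funcset_mem[OF mapsto that] not1[OF that] by auto
  have f\<kappa>: "f\<^sub>\<kappa>\<^sub>0 = ?M 1 (2 * a 1) + (\<Sum>j\<in>{2..N}. ?M j (a j))"
    unfolding f\<^sub>\<kappa>\<^sub>0 var_mult \<kappa>\<^sub>0_1 ..
  have g2: "g i * g i = 1" for i by (simp add: g)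
  have G': "G = {\<lambda>i. 1, g}" unfolding G by (rule cyclic_group_two[OF g2])
  have c0: "cox N 0" by (rule cox.intro) (use N in auto)
  have flip: "diag_act g = cox.flip N" unfolding g by (rule cox.diag_act_gflip[OF c0])
  have flip_add: "cox.flip N (p + r) = cox.flip N p + cox.flip N r" for p r
    by (simp add: cox.flip_def[OF c0] mono_op_add)
  have flip_even: "cox.flip N p = p" if "p \<in> span_of {m. even (look m 1 + look m (N + 1))}" for p
    using that by (induction rule: span_of_induct) (auto simp: cox.flip_def[OF c0] mono_op_add)
  have JA: "J \<subseteq> {1..N}" "card J \<ge> 2" if "J \<in> A" for J
    using that unfolding A by (auto simp: in_nbrs_def map_graph_def)
  have term_eq: "const (\<epsilon> J) * (\<Prod>s\<in>J. var s ^ b J s) = mon (\<Sum>s\<in>J. mon s (b J s)) (\<epsilon> J)" for J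
    by (simp add: var_power prod_mon mult_single)
  have look_J: "look (\<Sum>s\<in>J. mon s (b J s)) i = (if i \<in> J then b J i else 0)" if "finite J" for J i
    using that by (simp add: lookup_sum lookup_single when_def)
  have add1: "f_add \<in> span_of {m. supp m \<subseteq> {1..N} \<and> wt {1..N} q m = 1 \<and> card (supp m) \<ge> 2}"
    unfolding f_add term_eq
  proof (intro span_of_sum span_of_mon disjI2 CollectI)
    fix J assume J: "J \<in> A"
    have fin: "finite J" using JA(1)[OF J] finite_subset by blast
    have s: "supp (\<Sum>s\<in>J. mon s (b J s)) = J"
      using b_pos[OF J] by (auto simp: in_keys_iff look_J[OF fin] split: if_splits)
    have "wt {1..N} q (\<Sum>s\<in>J. mon s (b J s)) = (\<Sum>s\<in>J. of_nat (b J s) * q s)"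
      unfolding wt_def look_J[OF fin] by (rule sum.mono_neutral_cong_right) (use JA(1)[OF J] in auto)
    then show "supp (\<Sum>s\<in>J. mon s (b J s)) \<subseteq> {1..N} \<and> wt {1..N} q (\<Sum>s\<in>J. mon s (b J s)) = 1 \<and> card (supp (\<Sum>s\<in>J. mon s (b J s))) \<ge> 2"
      using s JA[OF J] b_weight[OF J] by simp
  qed
  \<comment> \<open>The other summands are even, hence so is the additional part.\<close>
  have f\<kappa>_even: "f\<^sub>\<kappa>\<^sub>0 \<in> span_of {m. even (look m 1 + look m (N + 1))}"
    unfolding f\<kappa>
  proof (intro span_of_add span_of_sum span_of_mon disjI2 CollectI)
    show "even (look (mon 1 (2 * a 1) + mon (\<kappa>\<^sub>0 1) 1 :: monom) 1 + look (mon 1 (2 * a 1) + mon (\<kappa>\<^sub>0 1) 1 :: monom) (N + 1))"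
      using \<kappa>j[OF one] N by (simp add: lookup_add lookup_single when_def)
    fix j assume j: "j \<in> {2..N}"
    then show "even (look (mon j (a j) + mon (\<kappa>\<^sub>0 j) 1 :: monom) 1 + look (mon j (a j) + mon (\<kappa>\<^sub>0 j) 1 :: monom) (N + 1))"
      using \<kappa>j[of j] by (simp add: lookup_add lookup_single when_def)
  qed
  have z_even: "var (N + 1) ^ 2 \<in> span_of {m. even (look m 1 + look m (N + 1))}"
    unfolding var_power by (rule span_of_mon) (use N in \<open>simp add: lookup_single when_def\<close>)
  have "cox.flip N f = f" using sym unfolding symmetry_group_def G' flip[symmetric] by simp
  then have "cox.flip N f_add = f_add"
    unfolding f flip_add flip_even[OF f\<kappa>_even] flip_even[OF z_even] by simp
  moreover have "f_add \<in> poly_ring {1..N+1}" unfolding poly_ring_eq by (rule span_of_mono[OF add1]) (auto simp: mons_def)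
  ultimately have "f_add \<in> span_of {m. supp m \<subseteq> {1..N+1} \<and> (even (0::int) \<longleftrightarrow> even (look m 1 + look m (N + 1)))}"
    by (intro cox.even_span[OF c0]) (simp_all add: single_one)
  moreover have "look m (N + 1) = 0" if "supp m \<subseteq> {1..N}" for m :: monom
    using that by (auto simp: in_keys_iff subset_iff)
  ultimately have "f_add \<in> span_of {m. supp m \<subseteq> {1..N} \<and> even (look m 1) \<and> wt {1..N} q m = 1 \<and> card (supp m) \<ge> 2}"
    using add1 by (fastforce simp: span_of_def)
  from halve[OF this] obtain fa where
    fa: "fa \<in> span_of {m. supp m \<subseteq> {1..N} \<and> wt {1..N} (q(1 := 2 * q 1)) m = 1 \<and> card (supp m) \<ge> 2}" "dbl fa = f_add" by blast
  define hp where "hp = ?M 1 (a 1) + (\<Sum>j\<in>{2..N}. ?M j (a j)) + fa"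
  have fa_ring: "fa \<in> poly_ring {1..N}" unfolding poly_ring_eq by (rule span_of_mono[OF fa(1)]) (auto simp: mons_def)
  have hp_ring: "hp \<in> poly_ring {1..N}"
    unfolding hp_def poly_ring_eq
  proof (intro span_of_add span_of_sum span_of_mon disjI2)
    show "fa \<in> span_of (mons {1..N})" using fa_ring by (simp add: poly_ring_eq)
    show "mon 1 (a 1) + mon (\<kappa>\<^sub>0 1) 1 \<in> mons {1..N}" using one funcset_mem[OF mapsto one] by (auto simp: mons_def keys_add_nat)
    fix j assume "j \<in> {2..N}"
    then have j: "j \<in> {1..N}" by simp
    then show "mon j (a j) + mon (\<kappa>\<^sub>0 j) 1 \<in> mons {1..N}" using funcset_mem[OF mapsto j] by (auto simp: mons_def keys_add_nat)
  qed
  interpret c: cox N hp by (rule cox.intro) (use N hp_ring in auto)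
  have dbl_hp: "dbl hp = f\<^sub>0"
  proof -
    have d1: "dbl (?M 1 (a 1)) = ?M 1 (2 * a 1)"
    proof -
      have "mon 1 (a 1) + mon (\<kappa>\<^sub>0 1) 1 + mon 1 (look (mon 1 (a 1) + mon (\<kappa>\<^sub>0 1) 1 :: monom) 1) = (mon 1 (2 * a 1) + mon (\<kappa>\<^sub>0 1) 1 :: monom)"
        by (rule poly_mapping_eqI) (use not1[OF one] in \<open>auto simp: lookup_add lookup_single when_def\<close>)
      then show ?thesis by simp
    qed
    have "dbl (?M j (a j)) = ?M j (a j)" if j: "j \<in> {2..N}" for j
    proof -
      have "look (mon j (a j) + mon (\<kappa>\<^sub>0 j) 1 :: monom) 1 = 0" using j \<kappa>j[of j] by (auto simp: lookup_add lookup_single when_def)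
      then show ?thesis by simp
    qed
    then have dj: "(\<Sum>j\<in>{2..N}. dbl (?M j (a j))) = (\<Sum>j\<in>{2..N}. ?M j (a j))" by (intro sum.cong refl)
    show ?thesis by (simp only: hp_def f\<^sub>0 f\<kappa> mono_op_add mono_op_sum fa(2) d1 dj)
  qed
  have ff: "c.ff = f" unfolding c.ff_def dbl_hp f f\<^sub>0 by (simp add: add_ac)
  define \<kappa>b where "\<kappa>b = \<kappa>\<^sub>0(N + 1 := 1)"
  define ab where "ab = a(N + 1 := 2)"
  have Vs: "{1..N+1} = insert (N + 1) (insert 1 {2..N})" using N by auto
  have fb: "c.fbar = (\<Sum>j\<in>{1..N+1}. var j ^ ab j * var (\<kappa>b j)) + fa"
  proof -
    have "(\<Sum>j\<in>{2..N}. var j ^ ab j * var (\<kappa>b j)) = (\<Sum>j\<in>{2..N}. ?M j (a j))"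
      by (rule sum.cong) (auto simp: ab_def \<kappa>b_def var_mult)
    moreover have "var 1 ^ ab 1 * var (\<kappa>b 1) = ?M 1 (a 1)" using N by (simp add: ab_def \<kappa>b_def var_mult)
    moreover have "N + 1 \<notin> insert 1 {2..N}" "1 \<notin> {2..N}" using N by auto
    ultimately show ?thesis
      unfolding Vs c.fbar_def unfolding hp_def by (simp add: ab_def \<kappa>b_def mult.commute add_ac)
  qed
  show ?thesis
  proof (intro exI conjI)
    show "c.fbar = (\<Sum>j\<in>{1..N+1}. var j ^ ab j * var (\<kappa>b j)) + fa" by (rule fb)
    show "fa \<in> poly_ring {1..N}" by (rule fa_ring)
    show "poly_subst (var(1 := var 1 ^ 2)) fa = f_add" unfolding poly_subst_square by (rule fa(2))
    show "\<forall>j\<in>{1..N+1}. ab j > 0"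
    proof
      fix j assume "j \<in> {1..N+1}"
      then consider "j = N + 1" | "j = 1" | "j \<in> {2..N}" unfolding Vs by blast
      then show "ab j > 0" using a_1 a_ge_2[of j] by cases (auto simp: ab_def)
    qed
    show "\<kappa>b \<in> {1..N+1} \<rightarrow> {1..N+1}"
    proof
      fix j assume "j \<in> {1..N+1}"
      then show "\<kappa>b j \<in> {1..N+1}" using funcset_mem[OF mapsto, of j] by (cases "j = N + 1") (auto simp: \<kappa>b_def)
    qed
    show "map_graph {1..N+1} \<kappa>b = add_arrow (map_graph {1..N+1} \<kappa>) (N + 1) 1"
      using N by (auto simp: map_graph_def add_arrow_def \<kappa>b_def \<kappa>)
    show "nondegenerate {1..N+1} c.fbar"
    proof (rule c.nondegenerate_fbar)
      show "nondegenerate {1..N} (dbl hp)" unfolding dbl_hp by (rule nondeg)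
      have nl: "mon j k + mon (\<kappa>\<^sub>0 j) 1 \<noteq> mon i 1" if "k \<ge> 1" "k \<ge> 2 \<or> \<kappa>\<^sub>0 j \<noteq> j" for i j and k :: nat
      proof
        assume eq: "mon j k + mon (\<kappa>\<^sub>0 j) 1 = mon i 1"
        show False
          using arg_cong[OF eq, of "\<lambda>m. look m j"] arg_cong[OF eq, of "\<lambda>m. look m (\<kappa>\<^sub>0 j)"] that
          by (auto simp: lookup_add lookup_single when_def split: if_splits)
      qed
      show "hp \<in> span_of {m. \<forall>i. m \<noteq> mon i 1}"
        unfolding hp_def
      proof (intro span_of_add span_of_sum span_of_mon disjI2 CollectI allI)
        show "fa \<in> span_of {m. \<forall>i. m \<noteq> mon i 1}" by (rule span_of_mono[OF fa(1)]) auto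
        show "mon 1 (a 1) + mon (\<kappa>\<^sub>0 1) 1 \<noteq> mon i 1" for i by (rule nl) (use a_1 not1[OF one] in auto)
        show "mon j (a j) + mon (\<kappa>\<^sub>0 j) 1 \<noteq> mon i 1" if "j \<in> {2..N}" for i j
          by (rule nl) (use a_ge_2[OF that] in auto)
      qed
    qed
    have "c.fbar \<in> span_of {m. supp m \<subseteq> {1..N+1} \<and> wt {1..N+1} ?Q m = 1}"
    proof -
      have Qj: "?Q j = q j" if "j \<in> {2..N}" for j using that by auto
      have Q1: "?Q 1 = 2 * q 1" using N by simp
      have "?M 1 (a 1) \<in> span_of {m. supp m \<subseteq> {1..N+1} \<and> wt {1..N+1} ?Q m = 1}"
      proof (intro span_of_mon disjI2 CollectI conjI)
        show "supp (mon 1 (a 1) + mon (\<kappa>\<^sub>0 1) 1 :: monom) \<subseteq> {1..N+1}" using \<kappa>j[OF one] by (auto simp: keys_add_nat)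
        have "\<kappa>\<^sub>0 1 \<in> {1..N+1}" using \<kappa>j[OF one] by auto
        then show "wt {1..N+1} ?Q (mon 1 (a 1) + mon (\<kappa>\<^sub>0 1) 1) = 1"
          using q_1 Qj[OF \<kappa>j[OF one]] by (simp only: wt_add wt_mon finite_atLeastAtMost Q1 \<kappa>\<^sub>0_1) (simp add: wt_mon Q1 mult_ac)
      qed
      moreover have "?M j (a j) \<in> span_of {m. supp m \<subseteq> {1..N+1} \<and> wt {1..N+1} ?Q m = 1}" if j: "j \<in> {2..N}" for j
      proof (intro span_of_mon disjI2 CollectI conjI)
        have j': "j \<in> {1..N+1}" "\<kappa>\<^sub>0 j \<in> {2..N}" using j \<kappa>j[of j] by auto
        then have j'': "\<kappa>\<^sub>0 j \<in> {1..N+1}" by auto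
        show "supp (mon j (a j) + mon (\<kappa>\<^sub>0 j) 1 :: monom) \<subseteq> {1..N+1}" using j' j'' by (auto simp: keys_add_nat)
        show "wt {1..N+1} ?Q (mon j (a j) + mon (\<kappa>\<^sub>0 j) 1) = 1"
          unfolding wt_add wt_mon[OF finite_atLeastAtMost j'(1)] wt_mon[OF finite_atLeastAtMost j''] Qj[OF j] Qj[OF j'(2)]
          using q_j[OF j] by simp
      qed
      moreover have "fa \<in> span_of {m. supp m \<subseteq> {1..N+1} \<and> wt {1..N+1} ?Q m = 1}"
      proof (rule span_of_mono[OF fa(1)], intro subsetI CollectI)
        fix m assume m: "m \<in> {m. supp m \<subseteq> {1..N} \<and> wt {1..N} (q(1 := 2 * q 1)) m = 1 \<and> card (supp m) \<ge> 2}"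
        have "wt {1..N+1} ?Q m = wt {1..N} (q(1 := 2 * q 1)) m"
          unfolding wt_def by (rule sum.mono_neutral_cong_right) (use m in \<open>auto simp: in_keys_iff subset_iff\<close>)
        then show "supp m \<subseteq> {1..N+1} \<and> wt {1..N+1} ?Q m = 1" using m by auto
      qed
      moreover have "var 1 * var (N + 1) ^ 2 \<in> span_of {m. supp m \<subseteq> {1..N+1} \<and> wt {1..N+1} ?Q m = 1}"
      proof -
        have in1: "1 \<in> {1..N+1}" "N + 1 \<in> {1..N+1}" by auto
        have "wt {1..N+1} ?Q (mon (N + 1) 2 + mon 1 1) = 1"
          unfolding wt_add wt_mon[OF finite_atLeastAtMost in1(1)] wt_mon[OF finite_atLeastAtMost in1(2)] Q1 by simp
        then show ?thesis
          unfolding mult.commute[of "var 1"] var_mult using in1 by (intro span_of_mon disjI2) (auto simp: keys_add_nat)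
      qed
      ultimately show ?thesis unfolding c.fbar_def unfolding hp_def by (intro span_of_add span_of_sum)
    qed
    then show "quasihomogeneous {1..N+1} ?Q c.fbar"
      unfolding quasihomogeneous_def by (auto simp: poly_ring_eq span_of_def mons_def wt_def)
    have "equivalent_categories (MF_equiv {1..N+1} {\<lambda>i. 1, \<lambda>i. 1} c.fbar) (MF_equiv {1..N+1} G f)"
      using c.charts_equivalent unfolding ff G' g .
    then show "orbifold_equivalent {1..N+1} f G c.fbar" unfolding orbifold_equivalent_def insert_absorb2 .
  qed
qed

end
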